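(* Fix $\theta>0$ and let $\ell=\ell(n)$ be even integers with $\ell(n)\sim 2\theta n$ as $n\to\infty$. Let $\boldsymbol\lambda\vdash n$ be a random partition distributed according to the positive half Plancherel--Hurwitz measure $\mathbb P^+_{n,\ell}$. Then, as $n\to\infty$: (i) $\boldsymbol\lambda_1\left(\frac{2\ell}{\log n}\right)^{-1}\to 1$ in probability; (ii) the partition $\tilde{\boldsymbol\lambda}=(\boldsymbol\lambda_2,\boldsymbol\lambda_3,\ldots)$ satisfies $\sup_{x\in\mathbb R}|\psi_{\tilde{\boldsymbol\lambda}}(x)-\Omega(x)|\to 0$ in probability, where $\Omega(x)=\frac{2}{\pi}\left(x\arcsin\frac{x}{2}+\sqrt{4-x^2}\right)$ for $|x|\le 2$ and $\Omega(x)=|x|$ for $|x|>2$; (iii) $\boldsymbol\lambda_2/\sqrt n\to 2$ and $\ell(\boldsymbol\lambda)/\sqrt n\to 2$ in probability.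
   Context: A partition $\lambda\vdash n$ is a weakly decreasing sequence $\lambda_1\ge\lambda_2\ge\dots\ge\lambda_{\ell(\lambda)}>0$ of integers summing to $n$ (with $\lambda_i=0$ for $i>\ell(\lambda)$); $\ell(\lambda)$ is its number of parts. Its Young diagram consists of boxes $(i,j)$ with $1\le j\le\lambda_i$. $f_\lambda$ denotes the number of standard Young tableaux of shape $\lambda$. The content-sum is $C_\lambda=\sum_{(i,j)\in\lambda}(j-i)=\sum_i \lambda_i(\lambda_i-2i+1)/2$. For $n\ge1$ and even $\ell\ge0$, $H_{n,\ell}$ is the number of tuples $(\tau_1,\dots,\tau_\ell)$ of transpositions in $\mathfrak S_n$ with $\tau_1\cdots\tau_\ell=\mathrm{id}$; by the Frobenius formula $H_{n,\ell}=\frac1{n!}\sum_{\lambda\vdash n}f_\lambda^2C_\lambda^\ell$. The Plancherel--Hurwitz measure on partitions of $n$ is $\mathbb P_{n,\ell}(\lambda)=\frac{f_\lambda^2C_\lambda^\ell}{n!H_{n,\ell}}$, and for $\ell>0$ its positive half is $\mathbb P^+_{n,\ell}(\lambda)=\mathbb P_{n,\ell}(\lambda\mid C_\lambda>0)=2\cdot\mathbf 1_{C_\lambda>0}\mathbb P_{n,\ell}(\lambda)$. Rescaled profile: for a partition $\mu$ of size $m$, $\psi_\mu:\mathbb R\to\mathbb R$ is the continuous piecewise linear function (slopes $\pm1$) such that the region $\{(x,y):|x|\le y\le\psi_\mu(x)\}$ is the union over boxes $(i,j)$ of $\mu$ of the squares $\{(a,b):|a-(j-i)|+|b-(j+i-1)|\le1\}$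 scaled by the factor $1/\sqrt m$ (the Young diagram drawn in "Russian" convention, rescaled by $1/\sqrt m$), and $\psi_\mu(x)=|x|$ outside this region's horizontal extent. *)

theory Defs
  imports
    "HOL-Probability.Probability"
    "HOL-Combinatorics.Transposition"
    "HOL-Library.Landau_Symbols"
    "HOL-Library.More_List"
begin

text \<open>
  An integer partition is the list of its (positive) parts, in weakly decreasing order.
\<close>

definition partitions :: "nat \<Rightarrow> nat list set" where
  "partitions n = {\<mu>. sorted_wrt (\<ge>) \<mu> \<and> (\<forall>p\<in>set \<mu>. 0 < p) \<and> sum_list \<mu> = n}"

text \<open>Parts are numbered from 1; \<open>nth_part \<mu> i = 0\<close> for \<open>i > length \<mu>\<close>.\<close>

definition nth_part :: "nat list \<Rightarrow> nat \<Rightarrow> nat" where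
  "nth_part \<mu> i = nth_default 0 \<mu> (i - 1)"

definition young_diagram :: "nat list \<Rightarrow> (nat \<times> nat) set" where
  "young_diagram \<mu> = {(i, j). 1 \<le> i \<and> i \<le> length \<mu> \<and> 1 \<le> j \<and> j \<le> nth_part \<mu> i}"

text \<open>Fillings are extensional functions on the diagram, so that they can be counted.\<close>

definition standard_young_tableaux :: "nat list \<Rightarrow> (nat \<times> nat \<Rightarrow> nat) set" where
  "standard_young_tableaux \<mu> =
     {T \<in> extensional (young_diagram \<mu>).
        bij_betw T (young_diagram \<mu>) {1..sum_list \<mu>} \<and>
        (\<forall>i j. (i, j) \<in> young_diagram \<mu> \<and> (i, j + 1) \<in> young_diagram \<mu> \<longrightarrow> T (i, j) < T (i, j + 1)) \<and>
        (\<forall>i j. (i, j) \<in> young_diagram \<mu> \<and> (i + 1, j) \<in> young_diagram \<mu> \<longrightarrow> T (i, j) < T (i + 1, j))}"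

definition num_syt :: "nat list \<Rightarrow> nat" where
  "num_syt \<mu> = card (standard_young_tableaux \<mu>)"

definition content_sum :: "nat list \<Rightarrow> int" where
  "content_sum \<mu> = (\<Sum>(i, j)\<in>young_diagram \<mu>. int j - int i)"

definition transpositions :: "nat \<Rightarrow> (nat \<Rightarrow> nat) set" where
  "transpositions n = {Transposition.transpose a b | a b. a \<in> {1..n} \<and> b \<in> {1..n} \<and> a \<noteq> b}"

definition hurwitz_number :: "nat \<Rightarrow> nat \<Rightarrow> nat" where
  "hurwitz_number n l =
     card {\<tau>s. length \<tau>s = l \<and> set \<tau>s \<subseteq> transpositions n \<and> foldr (\<circ>) \<tau>s id = id}"

definition plancherel_hurwitz :: "nat \<Rightarrow> nat \<Rightarrow> nat list measure" where
  "plancherel_hurwitz n l =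
     point_measure (partitions n)
       (\<lambda>\<mu>. ennreal (real (num_syt \<mu>) ^ 2 * real_of_int (content_sum \<mu>) ^ l
                      / (fact n * real (hurwitz_number n l))))"

text \<open>
  \<open>uniform_measure M A\<close> is \<open>M\<close> conditioned on the event \<open>A\<close>.
\<close>

definition plancherel_hurwitz_pos :: "nat \<Rightarrow> nat \<Rightarrow> nat list measure" where
  "plancherel_hurwitz_pos n l =
     uniform_measure (plancherel_hurwitz n l) {\<mu> \<in> partitions n. content_sum \<mu> > 0}"

text \<open>
  The Young diagram in Russian convention, scaled by \<open>1 / sqrt |\<mu>|\<close>.
\<close>

definition russian_region :: "nat list \<Rightarrow> (real \<times> real) set" where
  "russian_region \<mu> =
     (\<lambda>(a, b). (a / sqrt (real (sum_list \<mu>)), b / sqrt (real (sum_list \<mu>)))) `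
       (\<Union>(i, j)\<in>young_diagram \<mu>.
          {(a, b). \<bar>a - (real j - real i)\<bar> + \<bar>b - (real j + real i - 1)\<bar> \<le> 1})"

text \<open>
  The upper boundary of the region, extended by \<open>|x|\<close> where the vertical line at \<open>x\<close>
  misses the region (in particular everywhere if \<open>\<mu>\<close> is empty).
\<close>

definition profile :: "nat list \<Rightarrow> real \<Rightarrow> real" where
  "profile \<mu> x = Sup (insert \<bar>x\<bar> {y. (x, y) \<in> russian_region \<mu>})"

definition limit_shape :: "real \<Rightarrow> real" where
  "limit_shape x =
     (if \<bar>x\<bar> \<le> 2 then 2 / pi * (x * arcsin (x / 2) + sqrt (4 - x\<^sup>2)) else \<bar>x\<bar>)"

text \<open>Convergence in probability to a constant, where the probability space may vary with \<open>n\<close>.\<close>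

definition tendsto_in_prob ::
  "(nat \<Rightarrow> 'a measure) \<Rightarrow> (nat \<Rightarrow> 'a \<Rightarrow> real) \<Rightarrow> real \<Rightarrow> bool" where
  "tendsto_in_prob M X c \<longleftrightarrow>
     (\<forall>\<epsilon>>0. (\<lambda>n. measure (M n) {\<omega> \<in> space (M n). \<bar>X n \<omega> - c\<bar> > \<epsilon>}) \<longlonglongrightarrow> 0)"

end

theory Submission
  imports Defs "HOL-Real_Asymp.Real_Asymp" "HOL-Complex_Analysis.Great_Picard"
begin

text \<open>
  A partition of \<open>n\<close> is split into its first row \<open>k\<close> and the remaining rows \<open>\<mu>\<close>. Bounding \<open>f\<^sub>\<lambda>\<close> by
  the product over the rows longer than \<open>n / (log n)\<^sup>3\<close> and the content sum by half the sum of
  their squares shows that, with \<open>L = 2 \<ell> / log n\<close>, the weight \<open>f\<^sub>\<lambda>\<^sup>2 C\<^sub>\<lambda>\<^sup>\<ell>\<close> is exponentially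
  smaller than the total mass unless \<open>k\<close> is close to \<open>L\<close> and the second row is \<open>o(L)\<close>.

  For fixed \<open>k\<close> of order \<open>L\<close>, the law of \<open>\<mu>\<close> has a density with respect to the Plancherel measure
  of size \<open>m = n - k\<close> which is controlled by \<open>exp (\<beta> C\<^sub>\<mu>)\<close> with \<open>\<beta>\<close> of order \<open>(log n)\<^sup>2 / n\<close>.
  Truncated exponential moments of the content sum show that this density is subexponential in
  \<open>sqrt m\<close> on average, so everything that has Plancherel probability at most \<open>exp (- c sqrt m)\<close>
  remains negligible for \<open>\<mu>\<close>.

  The law of large numbers for the Plancherel measure with such a rate is obtained without
  determinantal processes. The expectation of \<open>\<Sum> exp (z c)\<close> over the contents \<open>c\<close> of the boxes is
  a Laguerre polynomial, computed exactly from the commutation relation of adding and removing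
  boxes; this bounds the first row and column. Since the logarithm of the Frobenius formula is
  strictly concave in the shifted parts, the measure concentrates near a maximiser of \<open>f\<close>, hence
  \<open>\<Sum> exp (z c)\<close> concentrates at its mean. Its limits are the exponential moments of \<open>\<Omega>\<close>, and these
  determine a Lipschitz profile uniformly.
\<close>

section \<open>Partial fractions and the Vandermonde product\<close>

definition vandermonde :: "nat \<Rightarrow> (nat \<Rightarrow> 'a::comm_ring_1) \<Rightarrow> 'a" where
  "vandermonde d x = (\<Prod>j<d. \<Prod>i<j. x i - x j)"

definition shift_factor :: "'a::field \<Rightarrow> ('b \<Rightarrow> 'a) \<Rightarrow> 'b set \<Rightarrow> 'b \<Rightarrow> 'a" where
  "shift_factor t x I i = (\<Prod>j\<in>I - {i}. 1 + t / (x i - x j))"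

lemma shift_factor_insert:
  assumes "finite I" "k \<notin> I" "i \<in> I"
  shows "shift_factor t x (insert k I) i = (1 + t / (x i - x k)) * shift_factor t x I i"
proof -
  have "insert k I - {i} = insert k (I - {i})" using assms by auto
  then show ?thesis using assms by (simp add: shift_factor_def)
qed

lemma shift_factor_insert_self:
  "k \<notin> I \<Longrightarrow> shift_factor t x (insert k I) k = (\<Prod>j\<in>I. 1 + t / (x k - x j))"
  by (simp add: shift_factor_def)

lemma vandermonde_Suc: "vandermonde (Suc d) x = vandermonde d x * (\<Prod>i<d. x i - x d)"
  by (simp add: vandermonde_def)

lemma vandermonde_shift:
  assumes "r < d" "inj_on x {..<d}"
  shows "vandermonde d (x(r := x r + t)) = vandermonde d x * shift_factor t x {..<d} r"
  using assms
proof (induction d)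
  case (Suc d)
  let ?x' = "x(r := x r + t)"
  show ?case
  proof (cases "r = d")
    case True
    have "vandermonde d ?x' = vandermonde d x"
      unfolding vandermonde_def using True by (intro prod.cong refl) auto
    moreover have "(\<Prod>i<d. ?x' i - ?x' d) = (\<Prod>i<d. (x i - x d) * (1 + t / (x d - x i)))"
    proof (intro prod.cong refl)
      fix i assume "i \<in> {..<d}"
      then have "x d - x i \<noteq> 0" "i \<noteq> d"
        using inj_onD[OF Suc.prems(2), of d i] by auto
      then show "?x' i - ?x' d = (x i - x d) * (1 + t / (x d - x i))"
        using True by (simp add: divide_simps) (simp add: algebra_simps)
    qed
    ultimately show ?thesis
      using True
      by (simp add: vandermonde_Suc lessThan_Suc shift_factor_insert_self prod.distrib
          del: fun_upd_apply)
  next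
    case False
    then have "r < d" using Suc.prems(1) by simp
    have split: "(\<Prod>i<d. g i) = g r * (\<Prod>i\<in>{..<d} - {r}. g i)" for g :: "nat \<Rightarrow> 'a"
      using \<open>r < d\<close> by (intro prod.remove) auto
    have "x r - x d \<noteq> 0" using inj_onD[OF Suc.prems(2), of r d] \<open>r < d\<close> by auto
    then have "x r + t - x d = (x r - x d) * (1 + t / (x r - x d))"
      by (simp add: divide_simps)
    moreover have "(\<Prod>i<d. ?x' i - ?x' d) = (x r + t - x d) * (\<Prod>i\<in>{..<d} - {r}. x i - x d)"
      unfolding split using \<open>r < d\<close> by (auto intro!: arg_cong2[where f="(*)"] prod.cong)
    ultimately have "(\<Prod>i<d. ?x' i - ?x' d) = (\<Prod>i<d. x i - x d) * (1 + t / (x r - x d))"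
      unfolding split[of "\<lambda>i. x i - x d"] by (simp add: mult_ac)
    moreover have "inj_on x {..<d}" using Suc.prems(2) by (rule inj_on_subset) auto
    ultimately show ?thesis
      using Suc.IH \<open>r < d\<close>
      by (simp add: vandermonde_Suc lessThan_Suc shift_factor_insert mult_ac del: fun_upd_apply)
  qed
qed simp

lemma partial_fraction_prod:
  assumes "finite I" "inj_on x I" "y \<notin> x ` I"
  shows "(\<Prod>j\<in>I. 1 + t / (y - x j)) = 1 + (\<Sum>i\<in>I. t / (y - x i) * shift_factor t x I i)"
  using assms
proof (induction I arbitrary: y rule: finite_induct)
  case (insert k I)
  let ?F = "shift_factor t x I" and ?c = "t / (y - x k)"
  have exchange: "(1 + ?c) * (t / (y - x i) * ?F i) =
      ?c * (t / (x k - x i) * ?F i) + t / (y - x i) * ((1 + t / (x i - x k)) * ?F i)" if "i \<in> I" for i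
  proof -
    have "y - x k \<noteq> 0" "y - x i \<noteq> 0" "x k - x i \<noteq> 0" "x i - x k \<noteq> 0"
      using that insert.prems insert.hyps by (auto simp: image_iff)
    then have "(1 + ?c) * (t / (y - x i)) =
        ?c * (t / (x k - x i)) + t / (y - x i) * (1 + t / (x i - x k))"
      by (simp add: divide_simps) (simp add: algebra_simps)
    then have "(1 + ?c) * (t / (y - x i)) * ?F i =
        (?c * (t / (x k - x i)) + t / (y - x i) * (1 + t / (x i - x k))) * ?F i" by simp
    then show ?thesis by (simp only: distrib_right mult.assoc)
  qed
  have "(\<Prod>j\<in>insert k I. 1 + t / (y - x j)) = (1 + ?c) * (1 + (\<Sum>i\<in>I. t / (y - x i) * ?F i))"
    using insert by simp
  also have "\<dots> = 1 + ?c + (\<Sum>i\<in>I. (1 + ?c) * (t / (y - x i) * ?F i))"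
    by (simp add: distrib_left sum_distrib_left)
  also have "\<dots> = 1 + ?c + (\<Sum>i\<in>I. ?c * (t / (x k - x i) * ?F i)
      + t / (y - x i) * ((1 + t / (x i - x k)) * ?F i))"
    using exchange by simp
  also have "\<dots> = 1 + ?c * (1 + (\<Sum>i\<in>I. t / (x k - x i) * ?F i))
      + (\<Sum>i\<in>I. t / (y - x i) * ((1 + t / (x i - x k)) * ?F i))"
    by (simp add: sum.distrib sum_distrib_left algebra_simps)
  also have "1 + (\<Sum>i\<in>I. t / (x k - x i) * ?F i) = (\<Prod>j\<in>I. 1 + t / (x k - x j))"
    using insert.IH[of "x k"] insert.prems insert.hyps by simp
  finally show ?case
    using insert.hyps by (simp add: shift_factor_insert_self shift_factor_insert)
qed simp

lemma shift_factor_insert_new: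
  assumes "finite I" "k \<notin> I" "inj_on x (insert k I)"
  shows "shift_factor t x (insert k I) k = 1 + (\<Sum>i\<in>I. t / (x k - x i) * shift_factor t x I i)"
  unfolding shift_factor_insert_self[OF assms(2)]
  by (rule partial_fraction_prod) (use assms in auto)

lemma sum_shift_factor:
  assumes "finite I" "inj_on x I"
  shows "(\<Sum>i\<in>I. shift_factor t x I i) = of_nat (card I)"
  using assms
proof (induction I rule: finite_induct)
  case (insert k I)
  let ?F = "shift_factor t x I"
  have "(\<Sum>i\<in>insert k I. shift_factor t x (insert k I) i) =
      1 + (\<Sum>i\<in>I. t / (x k - x i) * ?F i + (1 + t / (x i - x k)) * ?F i)"
    using insert by (simp add: shift_factor_insert_new shift_factor_insert sum.distrib)
  also have "(\<Sum>i\<in>I. t / (x k - x i) * ?F i + (1 + t / (x i - x k)) * ?F i) = (\<Sum>i\<in>I. ?F i)"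
  proof (intro sum.cong refl)
    fix i
    have "t / (x i - x k) = - (t / (x k - x i))" by (metis minus_diff_eq minus_divide_right)
    then show "t / (x k - x i) * ?F i + (1 + t / (x i - x k)) * ?F i = ?F i"
      by (simp add: algebra_simps)
  qed
  finally show ?case using insert by simp
qed simp

lemma sum_mult_shift_factor:
  assumes "finite I" "inj_on x I"
  shows "(\<Sum>i\<in>I. x i * shift_factor t x I i) = (\<Sum>i\<in>I. x i) + t * of_nat (card I choose 2)"
  using assms
proof (induction I rule: finite_induct)
  case (insert k I)
  let ?F = "shift_factor t x I"
  have "(\<Sum>i\<in>insert k I. x i * shift_factor t x (insert k I) i) =
      x k + (\<Sum>i\<in>I. x k * (t / (x k - x i) * ?F i) + x i * ((1 + t / (x i - x k)) * ?F i))"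
    using insert
    by (simp add: shift_factor_insert_new shift_factor_insert sum.distrib distrib_left
        sum_distrib_left)
  also have "(\<Sum>i\<in>I. x k * (t / (x k - x i) * ?F i) + x i * ((1 + t / (x i - x k)) * ?F i)) =
      (\<Sum>i\<in>I. t * ?F i + x i * ?F i)"
  proof (intro sum.cong refl)
    fix i assume "i \<in> I"
    define u where "u = t / (x k - x i)"
    have "x k - x i \<noteq> 0" using \<open>i \<in> I\<close> insert by (auto simp: inj_on_def)
    then have "(x k - x i) * u = t" by (simp add: u_def)
    moreover have "t / (x i - x k) = - u" unfolding u_def by (metis minus_diff_eq minus_divide_right)
    moreover have "x k * (u * ?F i) + x i * ((1 + - u) * ?F i) = ((x k - x i) * u) * ?F i + x i * ?F i"
      by (simp add: algebra_simps)
    ultimately show "x k * (t / (x k - x i) * ?F i) + x i * ((1 + t / (x i - x k)) * ?F i) =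
        t * ?F i + x i * ?F i"
      by (simp add: u_def)
  qed
  also have "\<dots> = t * of_nat (card I) + ((\<Sum>i\<in>I. x i) + t * of_nat (card I choose 2))"
    using insert by (simp add: sum.distrib sum_distrib_left[symmetric] sum_shift_factor)
  finally show ?case
    using insert by (simp add: numeral_2_eq_2 algebra_simps)
qed (simp add: numeral_2_eq_2)

section \<open>Partitions as sequences\<close>

text \<open>Rows are indexed from 0, so \<open>p i\<close> is the part usually called \<open>\<lambda>\<^sub>i\<^sub>+\<^sub>1\<close>.\<close>

definition partition_seqs :: "nat \<Rightarrow> (nat \<Rightarrow> nat) set" where
  "partition_seqs n = {p. (\<forall>i. p (Suc i) \<le> p i) \<and> (\<forall>i\<ge>n. p i = 0) \<and> (\<Sum>i<n. p i) = n}"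

lemma partition_seqs_antimono: "p \<in> partition_seqs n \<Longrightarrow> i \<le> j \<Longrightarrow> p j \<le> p i"
  by (rule lift_Suc_antimono_le[of p]) (auto simp: partition_seqs_def)

lemma partition_seqs_eq_0: "p \<in> partition_seqs n \<Longrightarrow> n \<le> i \<Longrightarrow> p i = 0"
  by (auto simp: partition_seqs_def)

lemma sum_lessThan_cong_support:
  fixes p :: "nat \<Rightarrow> 'a::comm_monoid_add"
  assumes "\<And>i. d \<le> i \<Longrightarrow> p i = 0" "\<And>i. e \<le> i \<Longrightarrow> p i = 0"
  shows "(\<Sum>i<d. p i) = (\<Sum>i<e. p i)"
  by (rule sum.mono_neutral_cong) (use assms in \<open>auto simp: not_less\<close>)

lemma sum_partition_seqs:
  assumes "p \<in> partition_seqs n" "\<And>i. d \<le> i \<Longrightarrow> p i = 0"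
  shows "(\<Sum>i<d. p i) = n"
  using assms sum_lessThan_cong_support[of d p n] by (auto simp: partition_seqs_def)

lemma partition_seqsI:
  assumes "\<And>i. p (Suc i) \<le> p i" "\<And>i. d \<le> i \<Longrightarrow> p i = 0" "(\<Sum>i<d. p i) = n"
  shows "p \<in> partition_seqs n"
proof -
  have "p i = 0" if "n \<le> i" for i
  proof (rule ccontr)
    assume "p i \<noteq> 0"
    then have "i < d" using assms(2)[of i] by (cases "i < d") auto
    have "p i \<le> p j" if "j \<le> i" for j
      by (rule lift_Suc_antimono_le[of p]) (use assms that in auto)
    then have "1 \<le> p j" if "j \<le> i" for j using \<open>p i \<noteq> 0\<close> that by fastforce
    then have "(\<Sum>j<Suc i. 1) \<le> (\<Sum>j<Suc i. p j)" by (intro sum_mono) auto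
    also have "\<dots> \<le> (\<Sum>j<d. p j)" using \<open>i < d\<close> by (intro sum_mono2) auto
    finally show False using assms(3) that by simp
  qed
  then show ?thesis
    using assms sum_lessThan_cong_support[of d p n] by (auto simp: partition_seqs_def)
qed

lemma partition_seqs_le:
  assumes "p \<in> partition_seqs n"
  shows "p i \<le> n"
proof (cases "i < n")
  case True
  then have "p i \<le> (\<Sum>i<n. p i)" by (intro member_le_sum) auto
  then show ?thesis using assms by (simp add: partition_seqs_def)
qed (use assms in \<open>simp add: partition_seqs_eq_0\<close>)

lemma partition_seqs_pos_imp_less: "p \<in> partition_seqs n \<Longrightarrow> 0 < p i \<Longrightarrow> i < n"
  using partition_seqs_eq_0[of p n i] by (cases "n \<le> i") auto

lemma finite_partition_seqs: "finite (partition_seqs n)"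
proof (rule finite_subset)
  show "partition_seqs n \<subseteq>
      {p. \<forall>i. (i \<in> {..<n} \<longrightarrow> p i \<in> {..n}) \<and> (i \<notin> {..<n} \<longrightarrow> p i = 0)}"
    using partition_seqs_le partition_seqs_eq_0 by auto
  show "finite {p::nat \<Rightarrow> nat. \<forall>i. (i \<in> {..<n} \<longrightarrow> p i \<in> {..n}) \<and> (i \<notin> {..<n} \<longrightarrow> p i = 0)}"
    by (rule finite_set_of_finite_funs) auto
qed

lemma partition_seqs_0: "partition_seqs 0 = {\<lambda>_. 0}"
  by (auto simp: partition_seqs_def)

definition addable :: "(nat \<Rightarrow> nat) \<Rightarrow> nat set" where
  "addable p = {i. i = 0 \<or> p i < p (i - 1)}"

definition removable :: "(nat \<Rightarrow> nat) \<Rightarrow> nat set" where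
  "removable p = {i. p (Suc i) < p i}"

definition add_box :: "(nat \<Rightarrow> nat) \<Rightarrow> nat \<Rightarrow> nat \<Rightarrow> nat" where
  "add_box p i = p(i := Suc (p i))"

definition remove_box :: "(nat \<Rightarrow> nat) \<Rightarrow> nat \<Rightarrow> nat \<Rightarrow> nat" where
  "remove_box p i = p(i := p i - 1)"

lemma addable_subset:
  assumes "\<And>i. d \<le> i \<Longrightarrow> p i = 0"
  shows "addable p \<subseteq> {..d}"
proof
  fix i assume "i \<in> addable p"
  then have "i = 0 \<or> p (i - 1) \<noteq> 0" by (auto simp: addable_def)
  then have "i = 0 \<or> i - 1 < d" using assms[of "i - 1"] by (cases "d \<le> i - 1") auto
  then show "i \<in> {..d}" by auto
qed

lemma removable_subset:
  assumes "\<And>i. d \<le> i \<Longrightarrow> p i = 0"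
  shows "removable p \<subseteq> {..<d}"
proof
  fix i assume "i \<in> removable p"
  then show "i \<in> {..<d}" using assms[of i] by (cases "d \<le> i") (auto simp: removable_def)
qed

lemma finite_addable: "p \<in> partition_seqs n \<Longrightarrow> finite (addable p)"
  using addable_subset[OF partition_seqs_eq_0] by (rule finite_subset) auto

lemma finite_removable: "p \<in> partition_seqs n \<Longrightarrow> finite (removable p)"
  using removable_subset[OF partition_seqs_eq_0] by (rule finite_subset) auto

lemma add_box_partition_seqs:
  assumes "p \<in> partition_seqs n" "i \<in> addable p"
  shows "add_box p i \<in> partition_seqs (Suc n)"
proof (rule partition_seqsI[where d = "Suc n"])
  have "i \<le> n" using assms addable_subset[of n p] partition_seqs_eq_0[OF assms(1)] by blast
  show "add_box p i (Suc j) \<le> add_box p i j" for j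
    using assms by (auto simp: add_box_def addable_def partition_seqs_def le_Suc_eq)
  show "add_box p i j = 0" if "Suc n \<le> j" for j
    using assms \<open>i \<le> n\<close> that by (auto simp: add_box_def partition_seqs_def)
  have "(\<Sum>j<Suc n. add_box p i j) = (\<Sum>j<Suc n. p j + (if j = i then 1 else 0))"
    by (intro sum.cong) (auto simp: add_box_def)
  also have "\<dots> = (\<Sum>j<Suc n. p j) + 1"
    using \<open>i \<le> n\<close> by (subst sum.distrib) (simp del: sum.lessThan_Suc)
  also have "(\<Sum>j<Suc n. p j) = n"
    using sum_partition_seqs[OF assms(1), of "Suc n"] partition_seqs_eq_0[OF assms(1)] by simp
  finally show "(\<Sum>j<Suc n. add_box p i j) = Suc n" by simp
qed

lemma remove_box_partition_seqs:
  assumes "p \<in> partition_seqs (Suc n)" "i \<in> removable p"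
  shows "remove_box p i \<in> partition_seqs n"
proof (rule partition_seqsI[where d = "Suc n"])
  have "i < Suc n" using assms removable_subset[of "Suc n" p] partition_seqs_eq_0[OF assms(1)] by blast
  have "0 < p i" using assms by (auto simp: removable_def)
  show "remove_box p i (Suc j) \<le> remove_box p i j" for j
    using assms
    by (auto simp: remove_box_def removable_def partition_seqs_def le_Suc_eq
        intro: le_trans[OF diff_le_self])
  show "remove_box p i j = 0" if "Suc n \<le> j" for j
    using assms \<open>i < Suc n\<close> that by (auto simp: remove_box_def partition_seqs_def)
  have "Suc n = (\<Sum>j<Suc n. p j)" using assms by (simp add: partition_seqs_def)
  also have "\<dots> = (\<Sum>j<Suc n. remove_box p i j + (if j = i then 1 else 0))"
    using \<open>0 < p i\<close> by (intro sum.cong) (auto simp: remove_box_def)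
  also have "\<dots> = (\<Sum>j<Suc n. remove_box p i j) + 1"
    using \<open>i < Suc n\<close> by (subst sum.distrib) (simp del: sum.lessThan_Suc)
  finally show "(\<Sum>j<Suc n. remove_box p i j) = n" by simp
qed

lemma remove_box_add_box [simp]: "remove_box (add_box p i) i = p"
  by (auto simp: remove_box_def add_box_def)

lemma add_box_remove_box: "i \<in> removable p \<Longrightarrow> add_box (remove_box p i) i = p"
  by (auto simp: remove_box_def add_box_def removable_def fun_eq_iff)

lemma remove_box_add_box_commute: "i \<noteq> j \<Longrightarrow> remove_box (add_box p i) j = add_box (remove_box p j) i"
  by (auto simp: remove_box_def add_box_def fun_eq_iff)

lemma removable_add_box: "p \<in> partition_seqs n \<Longrightarrow> i \<in> removable (add_box p i)"
  by (auto simp: removable_def add_box_def partition_seqs_def le_imp_less_Suc)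

lemma addable_remove_box:
  assumes "p \<in> partition_seqs n" "j \<in> removable p"
  shows "j \<in> addable (remove_box p j)"
proof -
  have "p j - 1 < p (j - 1)" if "j \<noteq> 0"
    using partition_seqs_antimono[OF assms(1), of "j - 1" j] assms(2) by (auto simp: removable_def)
  then show ?thesis by (auto simp: addable_def remove_box_def)
qed

lemma addable_removable_commute:
  assumes "p \<in> partition_seqs n" "i \<noteq> j"
  shows "i \<in> addable p \<and> j \<in> removable (add_box p i) \<longleftrightarrow>
    j \<in> removable p \<and> i \<in> addable (remove_box p j)"
  using assms
  by (cases i) (auto simp: removable_def addable_def add_box_def remove_box_def partition_seqs_def)

lemma partition_seqs_case_nat:
  assumes "q \<in> partition_seqs m" "q 0 \<le> k"
  shows "case_nat k q \<in> partition_seqs (k + m)"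
proof (rule partition_seqsI[where d = "Suc m"])
  show "case_nat k q (Suc i) \<le> case_nat k q i" for i
    using assms by (cases i) (auto simp: partition_seqs_def)
  show "case_nat k q i = 0" if "Suc m \<le> i" for i
    using assms that by (cases i) (auto simp: partition_seqs_def)
  show "(\<Sum>i<Suc m. case_nat k q i) = k + m"
    using assms by (simp add: sum.lessThan_Suc_shift partition_seqs_def del: sum.lessThan_Suc)
qed

lemma case_nat_comp_Suc: "case_nat (p 0) (p \<circ> Suc) = p"
  by (auto simp: fun_eq_iff split: nat.split)

lemma comp_Suc_partition_seqs:
  assumes "p \<in> partition_seqs n"
  shows "p \<circ> Suc \<in> partition_seqs (n - p 0)"
proof (rule partition_seqsI[where d = n])
  have "(\<Sum>i<Suc n. p i) = n"
    by (rule sum_partition_seqs[OF assms]) (use assms partition_seqs_eq_0 in auto)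
  then show "(\<Sum>i<n. (p \<circ> Suc) i) = n - p 0"
    by (simp add: sum.lessThan_Suc_shift del: sum.lessThan_Suc)
  show "(p \<circ> Suc) (Suc i) \<le> (p \<circ> Suc) i" for i using assms by (simp add: partition_seqs_def)
  show "(p \<circ> Suc) i = 0" if "n \<le> i" for i
    using partition_seqs_eq_0[OF assms, of "Suc i"] that by simp
qed

section \<open>The Frobenius formula\<close>

definition shifted_part :: "(nat \<Rightarrow> nat) \<Rightarrow> nat \<Rightarrow> int" where
  "shifted_part p i = int (p i) - int i"

lemma shifted_part_strict: "p \<in> partition_seqs n \<Longrightarrow> i < j \<Longrightarrow> shifted_part p j < shifted_part p i"
  using partition_seqs_antimono[of p n i j] by (auto simp: shifted_part_def)

lemma inj_on_shifted_part: "p \<in> partition_seqs n \<Longrightarrow> inj_on (shifted_part p) A"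
  by (rule inj_onI) (metis less_irrefl linorder_neqE_nat shifted_part_strict)

lemma vandermonde_shifted_part_pos:
  "p \<in> partition_seqs n \<Longrightarrow> 0 < vandermonde d (\<lambda>i. real_of_int (shifted_part p i))"
  unfolding vandermonde_def by (auto intro!: prod_pos simp: shifted_part_strict)

text \<open>The value is the same for every \<open>d\<close> beyond the last nonzero row, so \<open>fdim\<close> may use the least one.\<close>

definition frobenius_formula :: "nat \<Rightarrow> (nat \<Rightarrow> nat) \<Rightarrow> real" where
  "frobenius_formula d p =
     fact (\<Sum>i<d. p i) * vandermonde d (\<lambda>i. of_int (shifted_part p i)) / (\<Prod>i<d. fact (p i + (d - 1 - i)))"

definition fdim :: "(nat \<Rightarrow> nat) \<Rightarrow> real" where
  "fdim p = frobenius_formula (LEAST d. \<forall>i\<ge>d. p i = 0) p"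

lemma frobenius_formula_Suc_zero:
  assumes "p d = 0"
  shows "frobenius_formula (Suc d) p = frobenius_formula d p"
proof -
  have fact_row: "(fact (p i + (d - i)) :: real) = real (p i + (d - i)) * fact (p i + (d - 1 - i))"
    if "i < d" for i
  proof -
    have "p i + (d - i) = Suc (p i + (d - 1 - i))" using that by simp
    then show ?thesis by (metis fact_Suc of_nat_fact of_nat_mult)
  qed
  have "(\<Prod>i<Suc d. fact (p i + (Suc d - 1 - i)) :: real) =
      (\<Prod>i<d. real (p i + (d - i)) * fact (p i + (d - 1 - i)))"
    using fact_row assms by (auto intro!: prod.cong)
  also have "\<dots> = (\<Prod>i<d. of_int (shifted_part p i) - of_int (shifted_part p d)) *
      (\<Prod>i<d. fact (p i + (d - 1 - i)))"
    unfolding prod.distrib using assms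
    by (auto simp: shifted_part_def of_nat_diff intro!: arg_cong2[where f="(*)"] prod.cong)
  finally have denominator: "(\<Prod>i<Suc d. fact (p i + (Suc d - 1 - i)) :: real) = \<dots>" .
  have "(\<Prod>i<d. of_int (shifted_part p i) - of_int (shifted_part p d) :: real) \<noteq> 0"
    using assms by (auto simp: shifted_part_def)
  then show ?thesis
    unfolding frobenius_formula_def denominator vandermonde_Suc using assms by simp
qed

lemma frobenius_formula_extend:
  assumes "\<And>i. d \<le> i \<Longrightarrow> p i = 0" "d \<le> e"
  shows "frobenius_formula e p = frobenius_formula d p"
  using assms(2)
proof (induction e rule: dec_induct)
  case (step e)
  then show ?case using frobenius_formula_Suc_zero[of p e] assms(1)[of e] by simp
qed simp

lemma fdim_eq_frobenius_formula:
  assumes "\<And>i. d \<le> i \<Longrightarrow> p i = 0"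
  shows "fdim p = frobenius_formula d p"
proof -
  let ?P = "\<lambda>d. \<forall>i\<ge>d. p i = 0"
  have "?P d" using assms by auto
  then have "?P (Least ?P)" "Least ?P \<le> d" by (rule LeastI[of ?P], rule Least_le[of ?P])
  then show ?thesis unfolding fdim_def by (intro frobenius_formula_extend[symmetric]) blast+
qed

lemma fdim_pos: "p \<in> partition_seqs n \<Longrightarrow> 0 < fdim p"
  using fdim_eq_frobenius_formula[of n p] partition_seqs_eq_0[of p n]
    vandermonde_shifted_part_pos[of p n n]
  by (auto simp: frobenius_formula_def intro!: divide_pos_pos mult_pos_pos prod_pos)

lemma fdim_zero: "fdim (\<lambda>_. 0) = 1"
  by (subst fdim_eq_frobenius_formula[of 0]) (auto simp: frobenius_formula_def vandermonde_def)

lemma fdim_remove_box: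
  assumes p: "p \<in> partition_seqs (Suc n)" and i: "i \<in> removable p"
  shows "fdim (remove_box p i) * real (Suc n) =
    fdim p * (shift_factor (- 1) (\<lambda>j. real_of_int (shifted_part p j)) {..<Suc n} i *
        real (p i + (n - i)))"
proof -
  let ?q = "remove_box p i" and ?x = "\<lambda>j. real_of_int (shifted_part p j)"
  have "i < Suc n" using i removable_subset[of "Suc n" p] partition_seqs_eq_0[OF p] by blast
  have "0 < p i" using i by (auto simp: removable_def)
  have q: "?q \<in> partition_seqs n" by (rule remove_box_partition_seqs[OF p i])
  have fdims: "fdim p = frobenius_formula (Suc n) p" "fdim ?q = frobenius_formula (Suc n) ?q"
    by (rule fdim_eq_frobenius_formula; use p q partition_seqs_eq_0 in auto)+
  have sizes: "(\<Sum>j<Suc n. p j) = Suc n" "(\<Sum>j<Suc n. ?q j) = n"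
    by (rule sum_partition_seqs; use p q partition_seqs_eq_0 in auto)+
  have "(\<lambda>j. real_of_int (shifted_part ?q j)) = ?x(i := ?x i + - 1)"
    using \<open>0 < p i\<close> by (auto simp: fun_eq_iff shifted_part_def remove_box_def of_nat_diff)
  moreover have "inj_on ?x {..<Suc n}"
    using inj_on_shifted_part[OF p, of "{..<Suc n}"] by (auto simp: inj_on_def)
  ultimately have vandermonde:
    "vandermonde (Suc n) (\<lambda>j. real_of_int (shifted_part ?q j)) =
      vandermonde (Suc n) ?x * shift_factor (- 1) ?x {..<Suc n} i"
    using vandermonde_shift[OF \<open>i < Suc n\<close>, of ?x "- 1"] by (simp only:)
  have rows: "(\<Prod>j<Suc n. g j) = g i * (\<Prod>j\<in>{..<Suc n} - {i}. g j)" for g :: "nat \<Rightarrow> real"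
    using \<open>i < Suc n\<close> by (intro prod.remove) auto
  define h where "h = real (p i + (n - i))"
  have "p i + (n - i) = Suc (?q i + (n - i))" using \<open>0 < p i\<close> by (simp add: remove_box_def)
  then have row_i: "(fact (p i + (n - i)) :: real) = h * fact (?q i + (n - i))"
    unfolding h_def by (metis fact_Suc)
  have "(\<Prod>j\<in>{..<Suc n} - {i}. fact (p j + (n - j)) :: real) =
      (\<Prod>j\<in>{..<Suc n} - {i}. fact (?q j + (n - j)))"
    by (intro prod.cong) (auto simp: remove_box_def)
  then have denominator:
    "(\<Prod>j<Suc n. fact (p j + (n - j)) :: real) = h * (\<Prod>j<Suc n. fact (?q j + (n - j)))"
    by (simp only: rows row_i mult.assoc)
  have "h \<noteq> 0" using \<open>0 < p i\<close> by (simp add: h_def)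
  then show ?thesis
    unfolding fdims frobenius_formula_def sizes vandermonde diff_Suc_1 denominator h_def[symmetric]
    by (simp add: field_simps del: prod.lessThan_Suc)
qed

lemma shift_factor_not_removable:
  assumes p: "p \<in> partition_seqs (Suc n)" and i: "i < Suc n" "i \<notin> removable p"
  shows "shift_factor (- 1) (\<lambda>j. real_of_int (shifted_part p j)) {..<Suc n} i * real (p i + (n - i)) =
      0"
proof -
  have next_row: "p (Suc i) = p i"
    using i p by (auto simp: removable_def partition_seqs_def intro: antisym)
  show ?thesis
  proof (cases "i = n")
    case True
    then show ?thesis using next_row partition_seqs_eq_0[OF p, of "Suc n"] by simp
  next
    case False
    then show ?thesis
      using i(1) next_row unfolding shift_factor_def
      by (intro mult_eq_0_iff[THEN iffD2] disjI1 prod_zero) (auto simp: shifted_part_def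
          intro!: bexI[of _ "Suc i"])
  qed
qed

lemma fdim_branching:
  assumes p: "p \<in> partition_seqs (Suc n)"
  shows "(\<Sum>i\<in>removable p. fdim (remove_box p i)) = fdim p"
proof -
  let ?d = "Suc n" and ?x = "\<lambda>i. real_of_int (shifted_part p i)"
  let ?F = "shift_factor (- 1) ?x {..<?d}" and ?h = "\<lambda>i. real (p i + (n - i))"
  have inj: "inj_on ?x {..<?d}"
    using inj_on_shifted_part[OF p, of "{..<?d}"] by (auto simp: inj_on_def)
  have size: "real ?d = (\<Sum>i<?d. real (p i))"
    using p by (simp add: partition_seqs_def flip: of_nat_sum del: sum.lessThan_Suc)
  have "(\<Sum>i<?d. ?F i * ?h i) = (\<Sum>i<?d. ?x i * ?F i + real n * ?F i)"
    by (intro sum.cong refl) (auto simp: shifted_part_def of_nat_diff algebra_simps)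
  also have "\<dots> = (\<Sum>i<?d. ?x i) - real (?d choose 2) + real n * real ?d"
    using sum_shift_factor[OF _ inj, of "- 1"] sum_mult_shift_factor[OF _ inj, of "- 1"]
    by (simp add: sum.distrib sum_distrib_left[symmetric] del: sum.lessThan_Suc)
  also have "(\<Sum>i<?d. ?x i) = real ?d - (\<Sum>i<?d. real i)"
    unfolding size by (simp add: shifted_part_def sum_subtractf del: sum.lessThan_Suc)
  also have "(\<Sum>i<?d. real i) = real (?d choose 2)"
    by (induction n) (auto simp: numeral_2_eq_2)
  also have "real ?d - real (?d choose 2) - real (?d choose 2) + real n * real ?d = real ?d"
    by (simp add: choose_two real_of_nat_div algebra_simps)
  finally have total: "(\<Sum>i<?d. ?F i * ?h i) = real ?d" .
  have "(\<Sum>i\<in>removable p. fdim (remove_box p i)) * real ?d = fdim p * (\<Sum>i\<in>removable p. ?F i * ?h i)"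
    using fdim_remove_box[OF p] by (simp add: sum_distrib_left sum_distrib_right del: of_nat_Suc)
  also have "(\<Sum>i\<in>removable p. ?F i * ?h i) = (\<Sum>i<?d. ?F i * ?h i)"
    using shift_factor_not_removable[OF p] removable_subset[of ?d p] partition_seqs_eq_0[OF p]
    by (intro sum.mono_neutral_left) auto
  finally show ?thesis unfolding total by (simp del: of_nat_Suc)
qed

lemma fdim_case_nat:
  assumes q: "q \<in> partition_seqs m" and k: "q 0 \<le> k" and d: "\<And>i. d \<le> i \<Longrightarrow> q i = 0"
  shows "fdim (case_nat k q) =
      real ((k + m) choose k) * fdim q * (\<Prod>i<d. 1 - real (q i) / real (k + i + 1))"
proof -
  let ?p = "case_nat k q"
  have fdims: "fdim ?p = frobenius_formula (Suc d) ?p" "fdim q = frobenius_formula d q"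
    by (rule fdim_eq_frobenius_formula; use d in \<open>auto split: nat.split\<close>)+
  have size_q: "(\<Sum>i<d. q i) = m" by (rule sum_partition_seqs[OF q]) (use d in auto)
  then have size_p: "(\<Sum>i<Suc d. ?p i) = k + m"
    by (simp add: sum.lessThan_Suc_shift del: sum.lessThan_Suc)
  have denominator: "(\<Prod>i<Suc d. fact (?p i + (Suc d - 1 - i)) :: real) =
      fact (k + d) * (\<Prod>i<d. fact (q i + (d - 1 - i)))"
    by (simp add: prod.lessThan_Suc_shift del: prod.lessThan_Suc)
  have "vandermonde (Suc d) (\<lambda>i. real_of_int (shifted_part ?p i)) =
      (\<Prod>i<d. real (k + i + 1) - real (q i)) * vandermonde d (\<lambda>i. of_int (shifted_part q i))"
    unfolding vandermonde_def
    by (simp add: prod.lessThan_Suc_shift prod.distrib shifted_part_def add.commute add.left_commute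
        diff_diff_eq[symmetric] diff_diff_eq2 del: prod.lessThan_Suc)
  moreover have "(\<Prod>i<d. real (k + i + 1) - real (q i)) =
      (\<Prod>i<d. real (k + i + 1)) * (\<Prod>i<d. 1 - real (q i) / real (k + i + 1))"
    unfolding prod.distrib[symmetric] by (intro prod.cong) (auto simp: field_simps)
  ultimately have vandermonde: "vandermonde (Suc d) (\<lambda>i. real_of_int (shifted_part ?p i)) =
      (\<Prod>i<d. real (k + i + 1)) * (\<Prod>i<d. 1 - real (q i) / real (k + i + 1)) *
      vandermonde d (\<lambda>i. of_int (shifted_part q i))"
    by simp
  have fact_split: "fact (k + d) = fact k * (\<Prod>i<d. real (k + i + 1))"
    by (induction d) (auto simp: algebra_simps)
  have "(\<Prod>i<d. real (k + i + 1)) \<noteq> 0" by simp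
  moreover have "real ((k + m) choose k) = fact (k + m) / (fact k * fact m)"
    by (simp add: binomial_fact)
  ultimately show ?thesis
    unfolding fdims frobenius_formula_def size_p size_q denominator vandermonde fact_split
    by (simp add: field_simps)
qed

section \<open>Sums over contents and over corners\<close>

definition sum_contents :: "(int \<Rightarrow> real) \<Rightarrow> (nat \<Rightarrow> nat) \<Rightarrow> real" where
  "sum_contents \<phi> p = (\<Sum>i\<in>{i. p i \<noteq> 0}. \<Sum>j<p i. \<phi> (int j - int i))"

lemma sum_contents_eq:
  assumes "\<And>i. d \<le> i \<Longrightarrow> p i = 0"
  shows "sum_contents \<phi> p = (\<Sum>i<d. \<Sum>j<p i. \<phi> (int j - int i))"
  unfolding sum_contents_def
proof (rule sum.mono_neutral_left)
  show "{i. p i \<noteq> 0} \<subseteq> {..<d}"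
  proof
    fix i assume "i \<in> {i. p i \<noteq> 0}"
    then show "i \<in> {..<d}" using assms[of i] by (cases "d \<le> i") auto
  qed
qed auto

lemma sum_contents_cong:
  assumes "\<And>i j. j < p i \<Longrightarrow> \<phi> (int j - int i) = \<psi> (int j - int i)"
  shows "sum_contents \<phi> p = sum_contents \<psi> p"
  unfolding sum_contents_def using assms by (intro sum.cong refl) auto

lemma sum_contents_nonneg: "(\<And>c. 0 \<le> \<phi> c) \<Longrightarrow> 0 \<le> sum_contents \<phi> p"
  by (simp add: sum_contents_def sum_nonneg)

lemma sum_contents_cmult: "sum_contents (\<lambda>c. a * \<phi> c) p = a * sum_contents \<phi> p"
  by (simp add: sum_contents_def sum_distrib_left)

lemma sum_contents_const: "p \<in> partition_seqs n \<Longrightarrow> sum_contents (\<lambda>_. a) p = a * real n"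
  by (subst sum_contents_eq[of n])
    (auto simp: partition_seqs_def sum_distrib_left[symmetric] sum_distrib_right[symmetric]
        simp flip: of_nat_sum)

lemma sum_contents_zero [simp]: "sum_contents \<phi> (\<lambda>_. 0) = 0"
  by (simp add: sum_contents_def)

lemma sum_contents_add_box:
  assumes p: "p \<in> partition_seqs n" and i: "i \<in> addable p"
  shows "sum_contents \<phi> (add_box p i) = sum_contents \<phi> p + \<phi> (shifted_part p i)"
proof -
  have "i \<le> n" using addable_subset[of n p] partition_seqs_eq_0[OF p] i by auto
  have "sum_contents \<phi> (add_box p i) = (\<Sum>k<Suc n. \<Sum>j<add_box p i k. \<phi> (int j - int k))"
    by (rule sum_contents_eq) (use partition_seqs_eq_0[OF add_box_partition_seqs[OF p i]] in auto)
  also have "\<dots> = (\<Sum>k<Suc n. (\<Sum>j<p k. \<phi> (int j - int k)) + (if k = i then \<phi> (shifted_part p i) else 0))"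
    by (intro sum.cong refl) (auto simp: add_box_def shifted_part_def)
  also have "\<dots> = (\<Sum>k<Suc n. \<Sum>j<p k. \<phi> (int j - int k)) + \<phi> (shifted_part p i)"
    using \<open>i \<le> n\<close> by (subst sum.distrib) (simp del: sum.lessThan_Suc)
  also have "(\<Sum>k<Suc n. \<Sum>j<p k. \<phi> (int j - int k)) = sum_contents \<phi> p"
    by (rule sum_contents_eq[symmetric]) (use partition_seqs_eq_0[OF p] in auto)
  finally show ?thesis .
qed

definition corner_sum :: "(int \<Rightarrow> real) \<Rightarrow> (nat \<Rightarrow> nat) \<Rightarrow> real" where
  "corner_sum \<phi> p = (\<Sum>i\<in>addable p. \<phi> (shifted_part p i)) - (\<Sum>i\<in>removable p. \<phi> (shifted_part p i - 1))"

lemma corner_sum_linear: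
  "corner_sum (\<lambda>c. a * \<phi> c + b * \<psi> c) p = a * corner_sum \<phi> p + b * corner_sum \<psi> p"
  by (simp add: corner_sum_def sum.distrib sum_distrib_left algebra_simps)

text \<open>Rows that are neither addable nor removable cancel, so the interlacing corner contents may be
  replaced by all the shifted parts.\<close>

lemma corner_sum_eq_shifted_parts:
  assumes p: "p \<in> partition_seqs n" and d: "\<And>i. d \<le> i \<Longrightarrow> p i = 0"
  shows "corner_sum \<phi> p = \<phi> (- int d) + (\<Sum>i<d. \<phi> (shifted_part p i) - \<phi> (shifted_part p i - 1))"
proof -
  define a where "a i = (if i \<in> addable p then \<phi> (shifted_part p i) else 0)" for i
  define r where "r i = (if i \<in> removable p then \<phi> (shifted_part p i - 1) else 0)" for i
  have "(\<Sum>i\<in>addable p. \<phi> (shifted_part p i)) = (\<Sum>i\<le>d. a i)"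
    unfolding a_def using addable_subset[of d p] d by (subst sum.If_cases) (auto simp: Int_absorb1)
  also have "\<dots> = \<phi> (shifted_part p 0) + (\<Sum>i<d. a (Suc i))"
    by (simp add: sum.atMost_shift a_def addable_def)
  finally have addable: "(\<Sum>i\<in>addable p. \<phi> (shifted_part p i)) = \<dots>" .
  have removable: "(\<Sum>i\<in>removable p. \<phi> (shifted_part p i - 1)) = (\<Sum>i<d. r i)"
    unfolding r_def using removable_subset[of d p] d by (subst sum.If_cases) (auto simp: Int_absorb1)
  have cancel: "a (Suc i) - r i = \<phi> (shifted_part p (Suc i)) - \<phi> (shifted_part p i - 1)" for i
  proof (cases "i \<in> removable p")
    case False
    then have "p (Suc i) = p i" using p by (auto simp: removable_def partition_seqs_def intro: antisym)
    then have "shifted_part p (Suc i) = shifted_part p i - 1" by (simp add: shifted_part_def)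
    then show ?thesis using False \<open>p (Suc i) = p i\<close> by (simp add: a_def r_def addable_def)
  qed (simp add: a_def r_def addable_def removable_def)
  have "corner_sum \<phi> p = \<phi> (shifted_part p 0) + (\<Sum>i<d. a (Suc i) - r i)"
    unfolding corner_sum_def addable removable by (simp add: sum_subtractf)
  also have "\<dots> = \<phi> (shifted_part p 0) +
      (\<Sum>i<d. \<phi> (shifted_part p (Suc i))) - (\<Sum>i<d. \<phi> (shifted_part p i - 1))"
    by (simp add: cancel sum_subtractf)
  also have "\<phi> (shifted_part p 0) + (\<Sum>i<d. \<phi> (shifted_part p (Suc i))) =
      (\<Sum>i<d. \<phi> (shifted_part p i)) + \<phi> (shifted_part p d)"
    using sum.lessThan_Suc_shift[of "\<lambda>i. \<phi> (shifted_part p i)" d] by simp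
  also have "shifted_part p d = - int d" using d[of d] by (simp add: shifted_part_def)
  finally show ?thesis by (simp add: sum_subtractf)
qed

lemma corner_sum_eq_sum_contents:
  assumes p: "p \<in> partition_seqs n"
  shows "corner_sum \<phi> p = \<phi> 0 + sum_contents (\<lambda>c. \<phi> (c + 1) - 2 * \<phi> c + \<phi> (c - 1)) p"
proof -
  have row: "(\<Sum>j<k. \<phi> (int j - int i + 1) - 2 * \<phi> (int j - int i) + \<phi> (int j - int i - 1)) =
      \<phi> (int k - int i) - \<phi> (int k - int i - 1) - \<phi> (- int i) + \<phi> (- int i - 1)" for i k
    by (induction k) (auto simp: algebra_simps)
  have first_column: "(\<Sum>i<k. \<phi> (- int i - 1) - \<phi> (- int i)) = \<phi> (- int k) - \<phi> 0" for k
  proof (induction k)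
    case (Suc k)
    have neg_Suc: "- int (Suc k) = - int k - 1" by simp
    show ?case using Suc unfolding neg_Suc by simp
  qed simp
  have "sum_contents (\<lambda>c. \<phi> (c + 1) - 2 * \<phi> c + \<phi> (c - 1)) p =
      (\<Sum>i<n. \<phi> (shifted_part p i) - \<phi> (shifted_part p i - 1) + (\<phi> (- int i - 1) - \<phi> (- int i)))"
    by (subst sum_contents_eq[of n, OF partition_seqs_eq_0[OF p]], assumption, unfold row
        shifted_part_def)
      (simp add: algebra_simps)
  also have "\<dots> = (\<Sum>i<n. \<phi> (shifted_part p i) - \<phi> (shifted_part p i - 1)) + (\<phi> (- int n) - \<phi> 0)"
    by (simp only: sum.distrib first_column)
  finally show ?thesis using corner_sum_eq_shifted_parts[OF p partition_seqs_eq_0[OF p]] by simp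
qed

section \<open>Growing a diagram by one box\<close>

definition growth_sum :: "(int \<Rightarrow> real) \<Rightarrow> (nat \<Rightarrow> nat) \<Rightarrow> real" where
  "growth_sum \<phi> p = (\<Sum>i\<in>addable p. \<phi> (shifted_part p i) * fdim (add_box p i))"

definition add_remove_pairs :: "(nat \<Rightarrow> nat) \<Rightarrow> (nat \<times> nat) set" where
  "add_remove_pairs p = (SIGMA i:addable p. removable (add_box p i) - {i})"

lemma growth_sum_add_then_remove:
  assumes p: "p \<in> partition_seqs n"
  shows "growth_sum \<phi> p = (\<Sum>i\<in>addable p. \<phi> (shifted_part p i)) * fdim p +
    (\<Sum>(i, j)\<in>add_remove_pairs p. \<phi> (shifted_part p i) * fdim (remove_box (add_box p i) j))"
proof -
  have finite: "finite (removable (add_box p i))" if "i \<in> addable p" for i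
    using finite_removable add_box_partition_seqs p that by blast
  have "growth_sum \<phi> p =
      (\<Sum>i\<in>addable p. \<phi> (shifted_part p i) *
          (\<Sum>j\<in>removable (add_box p i). fdim (remove_box (add_box p i) j)))"
    unfolding growth_sum_def
    using fdim_branching[OF add_box_partition_seqs[OF p]] by (intro sum.cong) auto
  also have "\<dots> = (\<Sum>i\<in>addable p. \<phi> (shifted_part p i) * fdim p +
      (\<Sum>j\<in>removable (add_box p i) - {i}. \<phi> (shifted_part p i) * fdim (remove_box (add_box p i) j)))"
  proof (intro sum.cong refl)
    fix i assume i: "i \<in> addable p"
    show "\<phi> (shifted_part p i) * (\<Sum>j\<in>removable (add_box p i). fdim (remove_box (add_box p i) j)) =
        \<phi> (shifted_part p i) * fdim p +
        (\<Sum>j\<in>removable (add_box p i) - {i}. \<phi> (shifted_part p i) * fdim (remove_box (add_box p i) j))"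
      using sum.remove[OF finite[OF i] removable_add_box[OF p], of "\<lambda>j. fdim (remove_box (add_box p i) j)"]
      by (simp add: sum_distrib_left[symmetric] distrib_left)
  qed
  finally show ?thesis
    using finite_addable[OF p] finite
    by (simp add: add_remove_pairs_def sum.distrib sum_distrib_right sum.Sigma)
qed

lemma finite_addable_remove_box:
  assumes p: "p \<in> partition_seqs n" and j: "j \<in> removable p"
  shows "finite (addable (remove_box p j))"
proof (cases n)
  case 0
  then show ?thesis using removable_subset[of n p] partition_seqs_eq_0[OF p] j by auto
next
  case (Suc m)
  then show ?thesis using finite_addable remove_box_partition_seqs p j by blast
qed

lemma sum_add_remove_pairs:
  assumes p: "p \<in> partition_seqs n"
  shows "(\<Sum>(i, j)\<in>add_remove_pairs p. g i j) =
      (\<Sum>j\<in>removable p. \<Sum>i\<in>addable (remove_box p j) - {j}. g i j)"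
proof -
  have swap: "(i, j) \<in> add_remove_pairs p \<longleftrightarrow> j \<in> removable p \<and> i \<in> addable (remove_box p j) \<and> i \<noteq> j"
    for i j
    using addable_removable_commute[OF p, of i j] by (auto simp: add_remove_pairs_def)
  have "(\<Sum>(i, j)\<in>add_remove_pairs p. g i j) =
      (\<Sum>(j, i)\<in>(SIGMA j:removable p. addable (remove_box p j) - {j}). g i j)"
    by (rule sum.reindex_bij_witness[of _ prod.swap prod.swap]) (auto simp: swap)
  then show ?thesis
    using finite_removable[OF p] finite_addable_remove_box[OF p] by (simp add: sum.Sigma)
qed

lemma growth_sum_remove_then_add:
  assumes p: "p \<in> partition_seqs n"
  shows "(\<Sum>j\<in>removable p. growth_sum \<phi> (remove_box p j)) =
      (\<Sum>j\<in>removable p. \<phi> (shifted_part p j - 1)) * fdim p +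
    (\<Sum>(i, j)\<in>add_remove_pairs p. \<phi> (shifted_part p i) * fdim (remove_box (add_box p i) j))"
proof -
  let ?g = "\<lambda>j i. \<phi> (shifted_part (remove_box p j) i) * fdim (add_box (remove_box p j) i)"
  have other_row: "shifted_part (remove_box p j) i = shifted_part p i" if "i \<noteq> j" for i j
    using that by (simp add: shifted_part_def remove_box_def)
  have "(\<Sum>j\<in>removable p. growth_sum \<phi> (remove_box p j)) =
      (\<Sum>j\<in>removable p. \<phi> (shifted_part p j - 1) * fdim p + (\<Sum>i\<in>addable (remove_box p j) - {j}. ?g j i))"
  proof (intro sum.cong refl)
    fix j assume j: "j \<in> removable p"
    have "shifted_part (remove_box p j) j = shifted_part p j - 1"
      using j by (auto simp: shifted_part_def remove_box_def removable_def)
    then show "growth_sum \<phi> (remove_box p j) =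
        \<phi> (shifted_part p j - 1) * fdim p + (\<Sum>i\<in>addable (remove_box p j) - {j}. ?g j i)"
      unfolding growth_sum_def
        sum.remove[OF finite_addable_remove_box[OF p j] addable_remove_box[OF p j], of "?g j"]
      by (simp add: add_box_remove_box[OF j])
  qed
  also have "\<dots> = (\<Sum>j\<in>removable p. \<phi> (shifted_part p j - 1)) * fdim p +
      (\<Sum>(i, j)\<in>add_remove_pairs p. ?g j i)"
    unfolding sum_add_remove_pairs[OF p] by (simp add: sum.distrib sum_distrib_right)
  also have "(\<Sum>(i, j)\<in>add_remove_pairs p. ?g j i) =
      (\<Sum>(i, j)\<in>add_remove_pairs p. \<phi> (shifted_part p i) * fdim (remove_box (add_box p i) j))"
  proof (intro sum.cong refl)
    fix b assume "b \<in> add_remove_pairs p"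
    then obtain i j where "b = (i, j)" "i \<noteq> j" by (auto simp: add_remove_pairs_def)
    then show "(case b of (i, j) \<Rightarrow> ?g j i) =
        (case b of (i, j) \<Rightarrow> \<phi> (shifted_part p i) * fdim (remove_box (add_box p i) j))"
      by (simp add: other_row remove_box_add_box_commute)
  qed
  finally show ?thesis .
qed

lemma growth_sum_commute:
  assumes "p \<in> partition_seqs n"
  shows "growth_sum \<phi> p = corner_sum \<phi> p * fdim p + (\<Sum>j\<in>removable p. growth_sum \<phi> (remove_box p j))"
  unfolding growth_sum_add_then_remove[OF assms] growth_sum_remove_then_add[OF assms] corner_sum_def
  by (simp add: algebra_simps)

lemma growth_sum_eq:
  assumes "\<And>n p. p \<in> partition_seqs n \<Longrightarrow> corner_sum \<phi> p = c n" and "p \<in> partition_seqs n"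
  shows "growth_sum \<phi> p = (\<Sum>k\<le>n. c k) * fdim p"
  using assms(2)
proof (induction n arbitrary: p)
  case 0
  have "removable p = {}" using removable_subset[of 0 p] partition_seqs_eq_0[OF 0] by auto
  then show ?case using growth_sum_commute[OF 0, of \<phi>] assms(1)[OF 0] by simp
next
  case (Suc n)
  have "growth_sum \<phi> p = c (Suc n) * fdim p + (\<Sum>j\<in>removable p. (\<Sum>k\<le>n. c k) * fdim (remove_box p j))"
    using growth_sum_commute[OF Suc.prems, of \<phi>] assms(1)[OF Suc.prems]
      Suc.IH[OF remove_box_partition_seqs[OF Suc.prems]] by simp
  also have "\<dots> = c (Suc n) * fdim p + (\<Sum>k\<le>n. c k) * fdim p"
    by (simp only: sum_distrib_left[symmetric] fdim_branching[OF Suc.prems])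
  finally show ?case by (simp add: algebra_simps)
qed

lemma growth_sum_one: "p \<in> partition_seqs n \<Longrightarrow> growth_sum (\<lambda>_. 1) p = real (Suc n) * fdim p"
  by (subst growth_sum_eq[where c = "\<lambda>_. 1"]) (auto simp: corner_sum_eq_sum_contents
      sum_contents_const)

lemma growth_sum_content: "p \<in> partition_seqs n \<Longrightarrow> growth_sum of_int p = 0"
  by (subst growth_sum_eq[where c = "\<lambda>_. 0"]) (auto simp: corner_sum_eq_sum_contents
      sum_contents_const)

lemma growth_sum_content_sq:
  assumes "p \<in> partition_seqs n"
  shows "growth_sum (\<lambda>c. (of_int c)\<^sup>2) p = real n * real (Suc n) * fdim p"
proof -
  have "(of_int (c + 1))\<^sup>2 - 2 * (of_int c)\<^sup>2 + (of_int (c - 1))\<^sup>2 = (2::real)" for c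
    by (simp add: power2_eq_square algebra_simps)
  then have "growth_sum (\<lambda>c. (of_int c)\<^sup>2) p = (\<Sum>k\<le>n. 2 * real k) * fdim p"
    using growth_sum_eq[OF _ assms, of "\<lambda>c. (of_int c)\<^sup>2" "\<lambda>k. 2 * real k"]
    by (simp only: corner_sum_eq_sum_contents sum_contents_const) simp
  also have "(\<Sum>k\<le>n. 2 * real k) = real n * real (Suc n)"
    by (induction n) (auto simp: algebra_simps)
  finally show ?thesis .
qed

section \<open>Exact averages under the Plancherel measure\<close>

definition plancherel_mean :: "nat \<Rightarrow> ((nat \<Rightarrow> nat) \<Rightarrow> real) \<Rightarrow> real" where
  "plancherel_mean n H = (\<Sum>p\<in>partition_seqs n. (fdim p)\<^sup>2 * H p) / fact n"

definition plancherel_prob :: "nat \<Rightarrow> ((nat \<Rightarrow> nat) \<Rightarrow> bool) \<Rightarrow> real" where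
  "plancherel_prob n P = plancherel_mean n (\<lambda>p. of_bool (P p))"

lemma plancherel_mean_mono:
  "(\<And>p. p \<in> partition_seqs n \<Longrightarrow> H p \<le> H' p) \<Longrightarrow> plancherel_mean n H \<le> plancherel_mean n H'"
  unfolding plancherel_mean_def by (intro divide_right_mono sum_mono mult_left_mono) auto

lemma plancherel_mean_cong:
  "(\<And>p. p \<in> partition_seqs n \<Longrightarrow> H p = H' p) \<Longrightarrow> plancherel_mean n H = plancherel_mean n H'"
  unfolding plancherel_mean_def by (intro arg_cong2[where f = "(/)"] sum.cong) auto

lemma plancherel_mean_nonneg:
  "(\<And>p. p \<in> partition_seqs n \<Longrightarrow> 0 \<le> H p) \<Longrightarrow> 0 \<le> plancherel_mean n H"
  unfolding plancherel_mean_def by (intro divide_nonneg_nonneg sum_nonneg mult_nonneg_nonneg) auto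

lemma plancherel_mean_cmult: "plancherel_mean n (\<lambda>p. a * H p) = a * plancherel_mean n H"
  by (simp add: plancherel_mean_def sum_distrib_left mult.left_commute)

lemma plancherel_mean_add:
  "plancherel_mean n (\<lambda>p. H p + H' p) = plancherel_mean n H + plancherel_mean n H'"
  by (simp add: plancherel_mean_def sum.distrib distrib_left add_divide_distrib)

lemma abs_plancherel_mean_le: "\<bar>plancherel_mean n H\<bar> \<le> plancherel_mean n (\<lambda>p. \<bar>H p\<bar>)"
  unfolding plancherel_mean_def abs_divide
  by (intro divide_mono order_trans[OF sum_abs]) (simp_all add: abs_mult)

lemma plancherel_mean_Cauchy_Schwarz:
  "(plancherel_mean n (\<lambda>p. G p * H p))\<^sup>2 \<le>
      plancherel_mean n (\<lambda>p. (G p)\<^sup>2) * plancherel_mean n (\<lambda>p. (H p)\<^sup>2)"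
  using divide_right_mono[OF Cauchy_Schwarz_ineq_sum[of "\<lambda>p. fdim p * G p" "\<lambda>p. fdim p * H p" "partition_seqs n"],
      of "(fact n)\<^sup>2"]
  by (simp add: plancherel_mean_def power_mult_distrib power2_eq_square mult.assoc mult.left_commute)

lemma plancherel_mean_of_bool_mult_le:
  "plancherel_mean n (\<lambda>p. of_bool (B p) * H p) \<le>
      sqrt (plancherel_prob n B * plancherel_mean n (\<lambda>p. (H p)\<^sup>2))"
proof (rule real_le_rsqrt)
  have "(plancherel_mean n (\<lambda>p. of_bool (B p) * H p))\<^sup>2 \<le>
      plancherel_mean n (\<lambda>p. (of_bool (B p))\<^sup>2) * plancherel_mean n (\<lambda>p. (H p)\<^sup>2)"
    by (rule plancherel_mean_Cauchy_Schwarz)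
  also have "plancherel_mean n (\<lambda>p. (of_bool (B p))\<^sup>2) = plancherel_prob n B"
    unfolding plancherel_prob_def by (intro plancherel_mean_cong) auto
  finally show "(plancherel_mean n (\<lambda>p. of_bool (B p) * H p))\<^sup>2 \<le>
      plancherel_prob n B * plancherel_mean n (\<lambda>p. (H p)\<^sup>2)" .
qed

lemma sum_partition_seqs_Suc:
  "(\<Sum>p\<in>partition_seqs (Suc n). \<Sum>j\<in>removable p. g (remove_box p j) p) =
   (\<Sum>q\<in>partition_seqs n. \<Sum>i\<in>addable q. g q (add_box q i))"
proof -
  have "(\<Sum>p\<in>partition_seqs (Suc n). \<Sum>j\<in>removable p. g (remove_box p j) p) =
      (\<Sum>(p, j)\<in>(SIGMA p:partition_seqs (Suc n). removable p). g (remove_box p j) p)"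
    using finite_partition_seqs finite_removable by (subst sum.Sigma) auto
  also have "\<dots> = (\<Sum>(q, i)\<in>(SIGMA q:partition_seqs n. addable q). g q (add_box q i))"
    by (rule sum.reindex_bij_witness[of _ "\<lambda>(q, i). (add_box q i, i)" "\<lambda>(p, j). (remove_box p j, j)"])
      (auto simp: add_box_remove_box removable_add_box addable_remove_box
        remove_box_partition_seqs add_box_partition_seqs)
  also have "\<dots> = (\<Sum>q\<in>partition_seqs n. \<Sum>i\<in>addable q. g q (add_box q i))"
    using finite_partition_seqs finite_addable by (subst sum.Sigma) auto
  finally show ?thesis .
qed

lemma plancherel_mean_Suc:
  "plancherel_mean (Suc n) H =
   (\<Sum>q\<in>partition_seqs n. fdim q * (\<Sum>i\<in>addable q. fdim (add_box q i) * H (add_box q i))) / fact (Suc n)"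
proof -
  have "(\<Sum>p\<in>partition_seqs (Suc n). (fdim p)\<^sup>2 * H p) =
      (\<Sum>p\<in>partition_seqs (Suc n). \<Sum>j\<in>removable p. fdim (remove_box p j) * (fdim p * H p))"
    unfolding sum_distrib_right[symmetric]
    by (intro sum.cong refl) (simp add: fdim_branching power2_eq_square)
  also have "\<dots> = (\<Sum>q\<in>partition_seqs n. \<Sum>i\<in>addable q. fdim q * (fdim (add_box q i) * H (add_box q i)))"
    by (rule sum_partition_seqs_Suc)
  finally show ?thesis by (simp add: plancherel_mean_def sum_distrib_left)
qed

lemma plancherel_mean_Suc_le:
  assumes "\<And>q. q \<in> partition_seqs n \<Longrightarrow>
    (\<Sum>i\<in>addable q. fdim (add_box q i) * H (add_box q i)) \<le> real (Suc n) * fdim q * G q"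
  shows "plancherel_mean (Suc n) H \<le> plancherel_mean n G"
proof -
  have "plancherel_mean (Suc n) H \<le>
      (\<Sum>q\<in>partition_seqs n. fdim q * (real (Suc n) * fdim q * G q)) / fact (Suc n)"
    unfolding plancherel_mean_Suc using assms fdim_pos
    by (intro divide_right_mono sum_mono mult_left_mono) (auto intro: less_imp_le)
  also have "\<dots> = real (Suc n) * (\<Sum>q\<in>partition_seqs n. (fdim q)\<^sup>2 * G q) / fact (Suc n)"
    unfolding sum_distrib_left
    by (intro arg_cong2[where f = "(/)"] sum.cong refl) (simp add: power2_eq_square)
  also have "\<dots> = plancherel_mean n G" by (simp add: plancherel_mean_def)
  finally show ?thesis .
qed

lemma plancherel_mean_Suc_eq:
  assumes "\<And>q. q \<in> partition_seqs n \<Longrightarrow>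
    (\<Sum>i\<in>addable q. fdim (add_box q i) * H (add_box q i)) = real (Suc n) * fdim q * G q"
  shows "plancherel_mean (Suc n) H = plancherel_mean n G"
proof (rule antisym)
  show "plancherel_mean (Suc n) H \<le> plancherel_mean n G"
    by (rule plancherel_mean_Suc_le) (simp add: assms)
  have "plancherel_mean (Suc n) (\<lambda>p. (- 1) * H p) \<le> plancherel_mean n (\<lambda>q. (- 1) * G q)"
    by (rule plancherel_mean_Suc_le) (simp add: assms sum_negf)
  then show "plancherel_mean n G \<le> plancherel_mean (Suc n) H" unfolding plancherel_mean_cmult by simp
qed

lemma plancherel_mean_0: "plancherel_mean 0 H = H (\<lambda>_. 0)"
  by (simp add: plancherel_mean_def partition_seqs_0 fdim_zero)

lemma plancherel_mean_one: "plancherel_mean n (\<lambda>_. 1) = 1"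
proof (induction n)
  case (Suc n)
  have "plancherel_mean (Suc n) (\<lambda>_. 1) = plancherel_mean n (\<lambda>_. 1)"
    by (rule plancherel_mean_Suc_eq) (use growth_sum_one in \<open>simp add: growth_sum_def\<close>)
  then show ?case using Suc by simp
qed (simp add: plancherel_mean_0)

lemma plancherel_mean_const: "plancherel_mean n (\<lambda>_. a) = a"
  using plancherel_mean_cmult[of n a "\<lambda>_. 1"] by (simp add: plancherel_mean_one)

lemma fdim_sq_le_fact:
  assumes "p \<in> partition_seqs n"
  shows "(fdim p)\<^sup>2 \<le> fact n"
proof -
  have "(fdim p)\<^sup>2 \<le> (\<Sum>p\<in>partition_seqs n. (fdim p)\<^sup>2)"
    by (rule member_le_sum) (use assms finite_partition_seqs in auto)
  also have "\<dots> = fact n" using plancherel_mean_one[of n] by (simp add: plancherel_mean_def)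
  finally show ?thesis .
qed

lemma plancherel_prob_nonneg: "0 \<le> plancherel_prob n P"
  unfolding plancherel_prob_def by (rule plancherel_mean_nonneg) simp

lemma plancherel_prob_mono:
  "(\<And>p. p \<in> partition_seqs n \<Longrightarrow> P p \<Longrightarrow> Q p) \<Longrightarrow> plancherel_prob n P \<le> plancherel_prob n Q"
  unfolding plancherel_prob_def by (rule plancherel_mean_mono) auto

lemma plancherel_prob_disj_le:
  "plancherel_prob n (\<lambda>p. P p \<or> Q p) \<le> plancherel_prob n P + plancherel_prob n Q"
  unfolding plancherel_prob_def plancherel_mean_add[symmetric] by (rule plancherel_mean_mono) auto

lemma plancherel_prob_not: "plancherel_prob n (\<lambda>p. \<not> P p) = 1 - plancherel_prob n P"
proof -
  have "plancherel_prob n (\<lambda>p. \<not> P p) + plancherel_prob n P = plancherel_mean n (\<lambda>_. 1)"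
    unfolding plancherel_prob_def plancherel_mean_add[symmetric] by (rule plancherel_mean_cong) auto
  then show ?thesis by (simp add: plancherel_mean_one)
qed

lemma plancherel_Markov:
  assumes "\<And>p. p \<in> partition_seqs n \<Longrightarrow> 0 \<le> H p" "\<And>p. p \<in> partition_seqs n \<Longrightarrow> P p \<Longrightarrow> a \<le> H p"
  shows "a * plancherel_prob n P \<le> plancherel_mean n H"
  unfolding plancherel_prob_def plancherel_mean_cmult[symmetric]
  by (rule plancherel_mean_mono) (use assms in auto)

lemma plancherel_mean_growth_ratio:
  "plancherel_mean n (\<lambda>p. growth_sum \<phi> p / fdim p) = (\<Sum>m\<le>n. plancherel_mean m (corner_sum \<phi>))"
proof (induction n)
  case 0
  have zero: "(\<lambda>_. 0) \<in> partition_seqs 0" by (simp add: partition_seqs_0)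
  have "removable (\<lambda>_. 0) = {}" by (auto simp: removable_def)
  then show ?case using growth_sum_commute[OF zero, of \<phi>] by (simp add: plancherel_mean_0 fdim_zero)
next
  case (Suc n)
  have unnormalised: "plancherel_mean k (\<lambda>p. growth_sum \<phi> p / fdim p) =
      (\<Sum>p\<in>partition_seqs k. fdim p * growth_sum \<phi> p) / fact k" for k
    unfolding plancherel_mean_def using fdim_pos
    by (intro arg_cong2[where f = "(/)"] sum.cong refl) (simp add: power2_eq_square)
  have "(\<Sum>p\<in>partition_seqs (Suc n). fdim p * growth_sum \<phi> p) =
      (\<Sum>p\<in>partition_seqs (Suc n). (fdim p)\<^sup>2 * corner_sum \<phi> p +
        (\<Sum>j\<in>removable p. growth_sum \<phi> (remove_box p j) * fdim p))"
    by (intro sum.cong refl, subst growth_sum_commute, assumption)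
      (simp add: power2_eq_square algebra_simps sum_distrib_left)
  also have "\<dots> = (\<Sum>p\<in>partition_seqs (Suc n). (fdim p)\<^sup>2 * corner_sum \<phi> p) +
      (\<Sum>q\<in>partition_seqs n. \<Sum>i\<in>addable q. growth_sum \<phi> q * fdim (add_box q i))"
    unfolding sum.distrib sum_partition_seqs_Suc[of "\<lambda>q p. growth_sum \<phi> q * fdim p"] ..
  also have "(\<Sum>q\<in>partition_seqs n. \<Sum>i\<in>addable q. growth_sum \<phi> q * fdim (add_box q i)) =
      real (Suc n) * (\<Sum>q\<in>partition_seqs n. fdim q * growth_sum \<phi> q)"
    unfolding sum_distrib_left[of "real (Suc n)"]
    by (intro sum.cong refl)
      (use growth_sum_one in \<open>simp add: growth_sum_def[of "\<lambda>_. 1"] sum_distrib_left[symmetric]\<close>)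
  finally show ?case
    unfolding unnormalised using Suc.IH[unfolded unnormalised]
    by (simp add: plancherel_mean_def add_divide_distrib)
qed

theorem plancherel_mean_sum_contents_Suc:
  "plancherel_mean (Suc n) (sum_contents \<phi>) =
   plancherel_mean n (sum_contents \<phi>) + (\<Sum>m\<le>n. plancherel_mean m (corner_sum \<phi>)) / real (Suc n)"
proof -
  have "plancherel_mean (Suc n) (sum_contents \<phi>) =
      plancherel_mean n (\<lambda>q. sum_contents \<phi> q + 1 / real (Suc n) * (growth_sum \<phi> q / fdim q))"
  proof (rule plancherel_mean_Suc_eq)
    fix q assume q: "q \<in> partition_seqs n"
    have "(\<Sum>i\<in>addable q. fdim (add_box q i) * sum_contents \<phi> (add_box q i)) =
        growth_sum (\<lambda>_. 1) q * sum_contents \<phi> q + growth_sum \<phi> q"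
      unfolding growth_sum_def sum_distrib_right sum.distrib[symmetric]
      by (intro sum.cong refl) (simp add: sum_contents_add_box[OF q] algebra_simps)
    then show "(\<Sum>i\<in>addable q. fdim (add_box q i) * sum_contents \<phi> (add_box q i)) =
        real (Suc n) * fdim q * (sum_contents \<phi> q + 1 / real (Suc n) * (growth_sum \<phi> q / fdim q))"
      using fdim_pos[OF q] by (simp add: growth_sum_one[OF q] distrib_left del: of_nat_Suc)
  qed
  then show ?thesis
    unfolding plancherel_mean_add plancherel_mean_cmult plancherel_mean_growth_ratio by simp
qed

definition total_content :: "(nat \<Rightarrow> nat) \<Rightarrow> real" where
  "total_content p = sum_contents of_int p"

lemma total_content_add_box:
  "p \<in> partition_seqs n \<Longrightarrow> i \<in> addable p \<Longrightarrow>
      total_content (add_box p i) = total_content p + of_int (shifted_part p i)"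
  by (simp add: total_content_def sum_contents_add_box)

lemma plancherel_mean_total_content_sq:
  "plancherel_mean n (\<lambda>p. (total_content p)\<^sup>2) = real n * (real n - 1) / 2"
proof (induction n)
  case (Suc n)
  have "plancherel_mean (Suc n) (\<lambda>p. (total_content p)\<^sup>2) =
      plancherel_mean n (\<lambda>q. (total_content q)\<^sup>2 + real n)"
  proof (rule plancherel_mean_Suc_eq)
    fix q assume q: "q \<in> partition_seqs n"
    have "(\<Sum>i\<in>addable q. fdim (add_box q i) * (total_content (add_box q i))\<^sup>2) =
        (total_content q)\<^sup>2 * growth_sum (\<lambda>_. 1) q + 2 * total_content q * growth_sum of_int q
        + growth_sum (\<lambda>c. (of_int c)\<^sup>2) q"
      unfolding growth_sum_def sum_distrib_left sum.distrib[symmetric]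
      by (intro sum.cong refl) (simp add: total_content_add_box[OF q] power2_eq_square algebra_simps)
    then show "(\<Sum>i\<in>addable q. fdim (add_box q i) * (total_content (add_box q i))\<^sup>2) =
        real (Suc n) * fdim q * ((total_content q)\<^sup>2 + real n)"
      unfolding growth_sum_one[OF q] growth_sum_content[OF q] growth_sum_content_sq[OF q]
      by (simp add: algebra_simps)
  qed
  also have "\<dots> = real n * (real n - 1) / 2 + real n"
    unfolding plancherel_mean_add plancherel_mean_const Suc.IH ..
  finally show ?case by (simp add: field_simps)
qed (simp add: plancherel_mean_0 total_content_def)

section \<open>Exponential sums over contents and Laguerre polynomials\<close>

definition exp_content_sum :: "real \<Rightarrow> (nat \<Rightarrow> nat) \<Rightarrow> real" where
  "exp_content_sum z p = sum_contents (\<lambda>c. exp (z * of_int c)) p"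

text \<open>The eigenvalue of the second difference on \<open>c \<mapsto> exp (z c)\<close>.\<close>

definition laplacian_eigenvalue :: "real \<Rightarrow> real" where
  "laplacian_eigenvalue z = exp z - 2 + exp (- z)"

text \<open>The Laguerre polynomial of degree \<open>n\<close> at \<open>- s\<close>.\<close>

definition laguerre :: "nat \<Rightarrow> real \<Rightarrow> real" where
  "laguerre n s = (\<Sum>k\<le>n. real (n choose k) * s ^ k / fact k)"

lemma laplacian_eigenvalue_eq: "laplacian_eigenvalue z = (exp (z / 2) - exp (- z / 2))\<^sup>2"
  by (simp add: laplacian_eigenvalue_def power2_eq_square algebra_simps exp_add[symmetric])

lemma laplacian_eigenvalue_nonneg: "0 \<le> laplacian_eigenvalue z"
  by (simp add: laplacian_eigenvalue_eq)

lemma laplacian_eigenvalue_pos: "z \<noteq> 0 \<Longrightarrow> 0 < laplacian_eigenvalue z"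
  by (simp add: laplacian_eigenvalue_eq)

lemma laplacian_eigenvalue_minus: "laplacian_eigenvalue (- z) = laplacian_eigenvalue z"
  by (simp add: laplacian_eigenvalue_def)

lemma exp_content_sum_nonneg: "0 \<le> exp_content_sum z p"
  by (simp add: exp_content_sum_def sum_contents_nonneg)

lemma corner_sum_exp:
  assumes "p \<in> partition_seqs n"
  shows "corner_sum (\<lambda>c. exp (z * of_int c)) p = 1 + laplacian_eigenvalue z * exp_content_sum z p"
proof -
  have "(\<lambda>c::int. exp (z * of_int (c + 1)) - 2 * exp (z * of_int c) + exp (z * of_int (c - 1))) =
      (\<lambda>c. laplacian_eigenvalue z * exp (z * of_int c))"
    by (auto simp: laplacian_eigenvalue_def algebra_simps exp_add[symmetric])
  then show ?thesis
    using corner_sum_eq_sum_contents[OF assms, of "\<lambda>c. exp (z * of_int c)"]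
    by (simp add: exp_content_sum_def sum_contents_cmult)
qed

lemma sum_laguerre: "(\<Sum>m\<le>n. laguerre m s) = (\<Sum>k\<le>n. real (Suc n choose Suc k) * s ^ k / fact k)"
proof -
  have "(\<Sum>m\<le>n. laguerre m s) = (\<Sum>m\<le>n. \<Sum>k\<le>n. real (m choose k) * (s ^ k / fact k))"
    unfolding laguerre_def
    by (intro sum.cong refl sum.mono_neutral_cong_left) (auto simp: binomial_eq_0)
  also have "\<dots> = (\<Sum>k\<le>n. (\<Sum>m\<le>n. real (m choose k)) * (s ^ k / fact k))"
    by (subst sum.swap) (simp only: sum_distrib_right)
  also have "\<dots> = (\<Sum>k\<le>n. real (Suc n choose Suc k) * s ^ k / fact k)"
    by (simp only: of_nat_sum[symmetric] sum_choose_upper times_divide_eq_right)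
  finally show ?thesis .
qed

lemma laguerre_Suc: "laguerre (Suc n) s = laguerre n s + s * (\<Sum>m\<le>n. laguerre m s) / real (Suc n)"
proof -
  let ?t = "\<lambda>m k. real (m choose k) * s ^ k / fact k"
  let ?u = "\<lambda>k. real (n choose k) * s ^ Suc k / fact (Suc k)"
  have "laguerre (Suc n) s = 1 + (\<Sum>k\<le>n. ?t (Suc n) (Suc k))"
    unfolding laguerre_def by (subst sum.atMost_Suc_shift) simp
  also have "(\<Sum>k\<le>n. ?t (Suc n) (Suc k)) = (\<Sum>k\<le>n. ?t n (Suc k)) + (\<Sum>k\<le>n. ?u k)"
    unfolding sum.distrib[symmetric]
    by (intro sum.cong refl) (simp add: add_divide_distrib distrib_right)
  also have "1 + ((\<Sum>k\<le>n. ?t n (Suc k)) + (\<Sum>k\<le>n. ?u k)) = (\<Sum>k\<le>Suc n. ?t n k) + (\<Sum>k\<le>n. ?u k)"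
    by (subst sum.atMost_Suc_shift) simp
  also have "(\<Sum>k\<le>Suc n. ?t n k) = laguerre n s" by (simp add: laguerre_def binomial_eq_0)
  also have "(\<Sum>k\<le>n. ?u k) = s * (\<Sum>m\<le>n. laguerre m s) / real (Suc n)"
    unfolding sum_laguerre sum_distrib_left sum_divide_distrib
  proof (intro sum.cong refl)
    fix k
    have absorb: "real (Suc n choose Suc k) / real (Suc n) = real (n choose k) / real (Suc k)"
      using Suc_times_binomial_eq[of n k] by (simp add: field_simps flip: of_nat_mult)
    have "s * (real (Suc n choose Suc k) * s ^ k / fact k) / real (Suc n) =
        (real (Suc n choose Suc k) / real (Suc n)) * (s ^ Suc k / fact k)"
      by (simp add: mult.commute mult.left_commute del: binomial_Suc_Suc of_nat_Suc)
    also have "\<dots> = ?u k"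
      unfolding absorb by simp
    finally show "?u k = s * (real (Suc n choose Suc k) * s ^ k / fact k) / real (Suc n)" by simp
  qed
  finally show ?thesis .
qed

theorem plancherel_mean_exp_content_sum:
  "1 + laplacian_eigenvalue z * plancherel_mean n (exp_content_sum z) =
      laguerre n (laplacian_eigenvalue z)"
proof (induction n rule: less_induct)
  case (less n)
  let ?s = "laplacian_eigenvalue z" and ?\<phi> = "\<lambda>c::int. exp (z * of_int c)"
  have ecs: "sum_contents ?\<phi> = exp_content_sum z" by (simp add: exp_content_sum_def fun_eq_iff)
  show ?case
  proof (cases n)
    case 0
    then show ?thesis by (simp add: plancherel_mean_0 laguerre_def exp_content_sum_def)
  next
    case (Suc k)
    have corners: "plancherel_mean m (corner_sum ?\<phi>) = laguerre m ?s" if "m \<le> k" for m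
    proof -
      have "plancherel_mean m (corner_sum ?\<phi>) = plancherel_mean m (\<lambda>p. 1 + ?s * exp_content_sum z p)"
        by (rule plancherel_mean_cong) (rule corner_sum_exp)
      then show ?thesis
        using less.IH[of m] that Suc
        by (simp add: plancherel_mean_add plancherel_mean_const plancherel_mean_cmult)
    qed
    have "1 + ?s * plancherel_mean (Suc k) (exp_content_sum z) =
        (1 + ?s * plancherel_mean k (exp_content_sum z)) + ?s * (\<Sum>m\<le>k. laguerre m ?s) / real (Suc k)"
      using plancherel_mean_sum_contents_Suc[of k ?\<phi>, unfolded ecs] corners
      by (simp add: distrib_left del: of_nat_Suc)
    then show ?thesis using less.IH[of k] Suc by (simp add: laguerre_Suc del: of_nat_Suc)
  qed
qed

lemma sum_power_div_fact_le_exp: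
  assumes "(0::real) \<le> y" "finite A"
  shows "(\<Sum>k\<in>A. y ^ k / fact k) \<le> exp y"
proof -
  have "(\<lambda>k. y ^ k / fact k) sums exp y"
    using exp_converges[of y] by (simp add: divide_inverse mult.commute)
  then show ?thesis using sum_le_suminf[of "\<lambda>k. y ^ k / fact k" A] assms by (simp add: sums_iff)
qed

lemma binomial_times_fact_le_power: "real (n choose k) * fact k \<le> real n ^ k"
  using binomial_fact_pow[of n k] by (metis of_nat_fact of_nat_le_iff of_nat_mult of_nat_power)

lemma laguerre_le_exp_sqrt:
  assumes "0 \<le> s"
  shows "laguerre n s \<le> exp (2 * sqrt (real n * s))"
proof -
  define y where "y = sqrt (real n * s)"
  define a where "a k = y ^ k / fact k" for k
  have "0 \<le> y" using assms by (simp add: y_def)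
  then have a_nonneg: "0 \<le> a k" for k by (simp add: a_def)
  have "laguerre n s \<le> (\<Sum>k\<le>n. a k * a k)"
    unfolding laguerre_def
  proof (rule sum_mono)
    fix k
    have "y ^ k * y ^ k = (real n * s) ^ k"
      using assms by (simp add: y_def power_mult_distrib[symmetric])
    then have square: "a k * a k = real n ^ k * s ^ k / (fact k * fact k)"
      by (simp add: a_def power_mult_distrib)
    have "real (n choose k) * fact k * s ^ k / (fact k * fact k) \<le>
        real n ^ k * s ^ k / (fact k * fact k)"
      using assms by (intro divide_right_mono mult_right_mono binomial_times_fact_le_power) auto
    then show "real (n choose k) * s ^ k / fact k \<le> a k * a k" unfolding square by simp
  qed
  also have "\<dots> \<le> (\<Sum>k\<le>n. a k * (\<Sum>j\<le>n. a j))"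
    using a_nonneg by (intro sum_mono mult_left_mono member_le_sum) auto
  also have "\<dots> = (\<Sum>k\<le>n. a k)\<^sup>2" by (simp add: sum_distrib_right power2_eq_square)
  also have "\<dots> \<le> (exp y)\<^sup>2"
    unfolding a_def using \<open>0 \<le> y\<close> by (intro power_mono sum_power_div_fact_le_exp sum_nonneg) auto
  also have "\<dots> = exp (2 * y)" by (simp add: power2_eq_square exp_add[symmetric])
  finally show ?thesis by (simp add: y_def)
qed

lemma plancherel_mean_exp_content_sum_le:
  "laplacian_eigenvalue z * plancherel_mean n (exp_content_sum z) \<le>
      exp (2 * sqrt (real n * laplacian_eigenvalue z))"
  using plancherel_mean_exp_content_sum[of z n]
    laguerre_le_exp_sqrt[OF laplacian_eigenvalue_nonneg, of n z]
  by linarith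

lemma exp_le_quadratic:
  fixes x B :: real
  assumes "x \<le> B" "0 \<le> B"
  shows "exp x \<le> 1 + x + exp B * x\<^sup>2"
proof (cases "0 \<le> x")
  case True
  obtain t where t: "\<bar>t\<bar> \<le> \<bar>x\<bar>" and exp_x: "exp x = (\<Sum>m<2. x ^ m / fact m) + exp t / fact 2 * x ^ 2"
    using Maclaurin_exp_le[of x 2] by blast
  have "exp t \<le> exp B" using t assms True by simp
  then have "exp t / 2 \<le> exp B" using exp_gt_zero[of t] by linarith
  then have "exp t / 2 * x\<^sup>2 \<le> exp B * x\<^sup>2" by (rule mult_right_mono) simp
  then show ?thesis using exp_x by (simp add: numeral_2_eq_2)
next
  case False
  have "1 - x \<le> exp (- x)" using exp_ge_add_one_self[of "- x"] by simp
  then have "exp x \<le> 1 / (1 - x)" using False by (simp add: exp_minus field_simps)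
  also have "\<dots> \<le> 1 + x + 1 * x\<^sup>2"
  proof -
    have "x * (x * x) \<le> 0" using False by (intro mult_nonpos_nonneg) auto
    then show ?thesis using False by (simp add: field_simps power2_eq_square)
  qed
  also have "\<dots> \<le> 1 + x + exp B * x\<^sup>2" using assms by (intro add_left_mono mult_right_mono) auto
  finally show ?thesis .
qed

text \<open>The truncation to \<open>p 0 \<le> R\<close> makes the second-order Taylor remainder of the exponential
  uniform; the transition probabilities have mean \<open>0\<close> and variance \<open>n\<close> for every diagram.\<close>

lemma sum_addable_exp_total_content_le:
  assumes q: "q \<in> partition_seqs n" and g: "0 \<le> g" and R: "real (q 0) \<le> R"
  shows "(\<Sum>i\<in>addable q. fdim (add_box q i) * exp (g * total_content (add_box q i))) \<le>
    real (Suc n) * fdim q * ((1 + g\<^sup>2 * exp (g * R) * real n) * exp (g * total_content q))"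
proof -
  define b where "b = g\<^sup>2 * exp (g * R)"
  let ?E = "exp (g * total_content q)" and ?x = "\<lambda>i. real_of_int (shifted_part q i)"
  have "(\<Sum>i\<in>addable q. fdim (add_box q i) * exp (g * total_content (add_box q i))) \<le>
      (\<Sum>i\<in>addable q. fdim (add_box q i) * (?E * (1 + g * ?x i + b * (?x i)\<^sup>2)))"
  proof (intro sum_mono mult_left_mono)
    fix i assume i: "i \<in> addable q"
    have "?x i \<le> R" using R partition_seqs_antimono[OF q, of 0 i] by (simp add: shifted_part_def)
    moreover have "0 \<le> R" using R by (rule order_trans[rotated]) simp
    ultimately have "g * ?x i \<le> g * R" "0 \<le> g * R" using g by (auto intro: mult_left_mono)
    then have "exp (g * ?x i) \<le> 1 + g * ?x i + exp (g * R) * (g * ?x i)\<^sup>2" by (rule exp_le_quadratic)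
    then have "exp (g * ?x i) \<le> 1 + g * ?x i + b * (?x i)\<^sup>2"
      by (simp add: b_def power_mult_distrib mult.commute mult.left_commute)
    then have "?E * exp (g * ?x i) \<le> ?E * (1 + g * ?x i + b * (?x i)\<^sup>2)" by (intro mult_left_mono) auto
    then show "exp (g * total_content (add_box q i)) \<le> ?E * (1 + g * ?x i + b * (?x i)\<^sup>2)"
      by (simp add: total_content_add_box[OF q i] distrib_left exp_add)
    show "0 \<le> fdim (add_box q i)" using fdim_pos[OF add_box_partition_seqs[OF q i]] by simp
  qed
  also have "\<dots> = ?E * (growth_sum (\<lambda>_. 1) q + g * growth_sum of_int q +
      b * growth_sum (\<lambda>c. (of_int c)\<^sup>2) q)"
    unfolding growth_sum_def sum_distrib_left sum.distrib[symmetric]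
    by (intro sum.cong refl) (simp add: algebra_simps)
  also have "\<dots> = real (Suc n) * fdim q * ((1 + b * real n) * ?E)"
    unfolding growth_sum_one[OF q] growth_sum_content[OF q] growth_sum_content_sq[OF q]
    by (simp add: algebra_simps)
  finally show ?thesis by (simp add: b_def)
qed

lemma plancherel_mean_truncated_exp_total_content_le:
  assumes g: "0 \<le> g" and R: "0 \<le> R"
  shows "plancherel_mean n (\<lambda>p. of_bool (real (p 0) \<le> R) * exp (g * total_content p)) \<le>
    exp (g\<^sup>2 * exp (g * R) * (real n)\<^sup>2)"
proof -
  define b where "b = g\<^sup>2 * exp (g * R)"
  have b: "0 \<le> b" by (simp add: b_def)
  let ?H = "\<lambda>p. of_bool (real (p 0) \<le> R) * exp (g * total_content p)"
  have recurrence: "plancherel_mean (Suc n) ?H \<le> (1 + b * real n) * plancherel_mean n ?H" for n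
    unfolding plancherel_mean_cmult[symmetric]
  proof (rule plancherel_mean_Suc_le)
    fix q assume q: "q \<in> partition_seqs n"
    show "(\<Sum>i\<in>addable q. fdim (add_box q i) * ?H (add_box q i)) \<le>
        real (Suc n) * fdim q * ((1 + b * real n) * ?H q)"
    proof (cases "real (q 0) \<le> R")
      case True
      have "(\<Sum>i\<in>addable q. fdim (add_box q i) * ?H (add_box q i)) \<le>
          (\<Sum>i\<in>addable q. fdim (add_box q i) * exp (g * total_content (add_box q i)))"
        using fdim_pos[OF add_box_partition_seqs[OF q]]
        by (intro sum_mono mult_left_mono) (auto intro: less_imp_le)
      also have "\<dots> \<le> real (Suc n) * fdim q * ((1 + b * real n) * exp (g * total_content q))"
        unfolding b_def by (rule sum_addable_exp_total_content_le[OF q g True])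
      finally show ?thesis using True by simp
    next
      case False
      then have "\<not> real (add_box q i 0) \<le> R" for i by (auto simp: add_box_def)
      then show ?thesis using False by simp
    qed
  qed
  have "plancherel_mean n ?H \<le> (1 + b * real m) ^ n" if "n \<le> m" for m
    using that
  proof (induction n)
    case (Suc n)
    have "plancherel_mean (Suc n) ?H \<le> (1 + b * real n) * plancherel_mean n ?H" by (rule recurrence)
    also have "\<dots> \<le> (1 + b * real m) * (1 + b * real m) ^ n"
      using Suc b by (intro mult_mono plancherel_mean_nonneg) (auto intro!: mult_left_mono)
    finally show ?case by simp
  qed (use R in \<open>simp add: plancherel_mean_0 total_content_def\<close>)
  from this[of n] have "plancherel_mean n ?H \<le> (1 + b * real n) ^ n" by simp
  also have "\<dots> \<le> exp (b * real n) ^ n"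
    using b exp_ge_add_one_self[of "b * real n"] by (intro power_mono) auto
  also have "exp (b * real n) ^ n = exp (b * (real n)\<^sup>2)"
    by (simp add: exp_of_nat_mult[symmetric] power2_eq_square mult.commute)
  finally show ?thesis by (simp add: b_def)
qed

section \<open>Concentration of the Plancherel measure around a maximiser\<close>

lemma ln_add_le_ln_midpoint:
  fixes a b :: real
  assumes "0 < a" "0 < b"
  shows "ln a + ln b + (a - b)\<^sup>2 / (a + b)\<^sup>2 \<le> 2 * ln ((a + b) / 2)"
proof -
  have sum: "0 < a + b" "(a + b)\<^sup>2 \<noteq> 0" using assms by simp_all
  have "ln a + ln b - 2 * ln ((a + b) / 2) = ln (a * b / ((a + b) / 2)\<^sup>2)"
    using assms sum by (simp add: ln_div ln_mult ln_realpow)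
  also have "\<dots> \<le> a * b / ((a + b) / 2)\<^sup>2 - 1"
    using assms sum by (intro ln_le_minus_one) auto
  also have "\<dots> = (4 * (a * b) - (a + b)\<^sup>2) / (a + b)\<^sup>2"
    using sum by (simp add: power_divide diff_divide_distrib)
  also have "4 * (a * b) - (a + b)\<^sup>2 = - ((a - b)\<^sup>2)" by (simp add: power2_eq_square algebra_simps)
  finally show ?thesis by simp
qed

lemma ln_gap_midpoint:
  fixes a b e g d :: real
  assumes "1 \<le> g" "g \<le> a" "g \<le> b" "(a + b - 1) / 2 \<le> e" "a + b \<le> 4 * d"
  shows "ln a + ln b + (a - b)\<^sup>2 / (16 * d\<^sup>2) - 2 / g \<le> 2 * ln e"
proof -
  define s where "s = a + b"
  have s: "2 * g \<le> s" "0 < s - 1" "0 < a" "0 < b" using assms by (auto simp: s_def)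
  have "ln ((s - 1) / 2) \<le> ln e" using assms s by (subst ln_le_cancel_iff) (auto simp: s_def)
  then have "ln (s / 2) - ln e \<le> ln (s / 2) - ln ((s - 1) / 2)" by simp
  also have "\<dots> = ln (1 + 1 / (s - 1))"
  proof -
    have "1 + 1 / (s - 1) = (s / 2) / ((s - 1) / 2)" using s by (simp add: field_simps)
    then show ?thesis using s by (simp add: ln_div)
  qed
  also have "\<dots> \<le> 1 / (s - 1)" using s by (intro ln_add_one_self_le_self) auto
  also have "\<dots> \<le> 1 / g" using s assms by (intro divide_left_mono) auto
  finally have rounding: "ln (s / 2) \<le> ln e + 1 / g" by simp
  have "s\<^sup>2 \<le> (4 * d)\<^sup>2" using s assms by (intro power_mono) (auto simp: s_def)
  then have "(a - b)\<^sup>2 / (16 * d\<^sup>2) \<le> (a - b)\<^sup>2 / s\<^sup>2"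
    using s by (intro divide_left_mono) (auto simp: power_mult_distrib intro!: mult_pos_pos)
  then have "ln a + ln b + (a - b)\<^sup>2 / (16 * d\<^sup>2) \<le> 2 * ln (s / 2)"
    using ln_add_le_ln_midpoint[OF s(3,4)] by (simp add: s_def)
  then show ?thesis using rounding by simp
qed

lemma sum_inverse_diff_le:
  assumes "1 \<le> d" "j \<le> d"
  shows "(\<Sum>i<j. 1 / real (j - i)) \<le> 1 + ln (real d)"
proof (cases "j = 0")
  case False
  have "(\<Sum>i<j. 1 / real (j - i)) = (harm j :: real)"
    unfolding harm_def inverse_eq_divide
    by (rule sum.reindex_bij_witness[of _ "\<lambda>k. j - k" "\<lambda>i. j - i"]) auto
  also have "\<dots> \<le> 1 + ln (real j)"
    using euler_mascheroni_sequence_decreasing[of 1 j] False by (simp add: harm_def)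
  also have "\<dots> \<le> 1 + ln (real d)" using assms False by simp
  finally show ?thesis .
qed (use assms in simp)

lemma sum_pairs_sq_diff:
  fixes y :: "nat \<Rightarrow> 'a::comm_ring_1"
  shows "(\<Sum>j<d. \<Sum>i<j. (y i - y j)\<^sup>2) = of_nat d * (\<Sum>i<d. (y i)\<^sup>2) - (\<Sum>i<d. y i)\<^sup>2"
proof (induction d)
  case (Suc d)
  have "(\<Sum>i<d. (y i - y d)\<^sup>2) = (\<Sum>i<d. (y i)\<^sup>2 - 2 * y d * y i + (y d)\<^sup>2)"
    by (intro sum.cong refl) (simp add: power2_eq_square algebra_simps)
  also have "\<dots> = (\<Sum>i<d. (y i)\<^sup>2) - 2 * y d * (\<Sum>i<d. y i) + of_nat d * (y d)\<^sup>2"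
    by (simp add: sum.distrib sum_subtractf sum_distrib_left)
  finally have last_row: "(\<Sum>i<d. (y i - y d)\<^sup>2) = \<dots>" .
  show ?case
    unfolding sum.lessThan_Suc Suc.IH last_row by (simp add: power2_eq_square algebra_simps)
qed simp

lemma fact_midpoint_le: "fact ((a + b) div 2) * fact ((a + b) div 2) \<le> (fact a * fact b :: real)"
proof -
  define h where "h = (a + b) div 2"
  have "real ((a + b) choose a) \<le> real ((a + b) choose h)"
    unfolding h_def using binomial_maximum[of "a + b" a] by simp
  then have "fact (a + b) / (fact a * fact b) \<le> (fact (a + b) / (fact h * fact (a + b - h)) :: real)"
    by (simp add: binomial_fact h_def)
  then have "fact h * fact (a + b - h) \<le> (fact a * fact b :: real)"
    by (simp add: divide_simps split: if_splits)
  moreover have "fact h * fact h \<le> (fact h * fact (a + b - h) :: real)"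
    by (intro mult_left_mono fact_mono) (auto simp: h_def)
  ultimately show ?thesis unfolding h_def by (rule order_trans[rotated])
qed

lemma fact_add_le: "fact (a + b) \<le> (fact a * real (a + b) ^ b :: real)"
proof (induction b)
  case (Suc b)
  have "fact (a + Suc b) = real (a + Suc b) * fact (a + b)" by simp
  also have "\<dots> \<le> real (a + Suc b) * (fact a * real (a + b) ^ b)"
    using Suc by (intro mult_left_mono) auto
  also have "\<dots> \<le> real (a + Suc b) * (fact a * real (a + Suc b) ^ b)"
    by (intro mult_left_mono power_mono) auto
  finally show ?case by (simp add: mult.commute mult.left_commute)
qed simp

definition boxed_partitions :: "nat \<Rightarrow> nat \<Rightarrow> (nat \<Rightarrow> nat) set" where
  "boxed_partitions m d = {p \<in> partition_seqs m. p 0 \<le> d \<and> p d = 0}"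

lemma boxed_partitions_imp_partition_seqs: "p \<in> boxed_partitions m d \<Longrightarrow> p \<in> partition_seqs m"
  by (simp add: boxed_partitions_def)

lemma boxed_partitions_eq_0: "p \<in> boxed_partitions m d \<Longrightarrow> d \<le> i \<Longrightarrow> p i = 0"
  using partition_seqs_antimono[of p m d i] by (simp add: boxed_partitions_def)

lemma boxed_partitions_le: "p \<in> boxed_partitions m d \<Longrightarrow> p i \<le> d"
  using partition_seqs_antimono[of p m 0 i] by (simp add: boxed_partitions_def)

lemma sum_boxed_partitions: "p \<in> boxed_partitions m d \<Longrightarrow> (\<Sum>i<d. p i) = m"
  using sum_partition_seqs boxed_partitions_imp_partition_seqs boxed_partitions_eq_0 by blast

lemma finite_boxed_partitions: "finite (boxed_partitions m d)"
  using finite_partition_seqs by (simp add: boxed_partitions_def)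

definition row_distance :: "nat \<Rightarrow> (nat \<Rightarrow> nat) \<Rightarrow> (nat \<Rightarrow> nat) \<Rightarrow> real" where
  "row_distance d p q = (\<Sum>i<d. \<bar>real (p i) - real (q i)\<bar>)"

definition log_vandermonde :: "nat \<Rightarrow> (nat \<Rightarrow> nat) \<Rightarrow> real" where
  "log_vandermonde d p = (\<Sum>j<d. \<Sum>i<j. ln (of_int (shifted_part p i) - of_int (shifted_part p j)))"

definition log_fact_rows :: "nat \<Rightarrow> (nat \<Rightarrow> nat) \<Rightarrow> real" where
  "log_fact_rows d p = (\<Sum>i<d. ln (fact (p i + (d - 1 - i))))"

lemma ln_fdim:
  assumes p: "p \<in> partition_seqs m" and d: "\<And>i. d \<le> i \<Longrightarrow> p i = 0"
  shows "ln (fdim p) = ln (fact m) + log_vandermonde d p - log_fact_rows d p"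
proof -
  have "fdim p = frobenius_formula d p" by (rule fdim_eq_frobenius_formula) (use d in auto)
  moreover have "(\<Sum>i<d. p i) = m" by (rule sum_partition_seqs[OF p]) (use d in auto)
  moreover have "ln (vandermonde d (\<lambda>i. real_of_int (shifted_part p i))) = log_vandermonde d p"
  proof -
    have "ln (\<Prod>i<j. real_of_int (shifted_part p i) - real_of_int (shifted_part p j)) =
        (\<Sum>i<j. ln (real_of_int (shifted_part p i) - real_of_int (shifted_part p j)))" for j
      by (intro ln_prod) (auto dest!: shifted_part_strict[OF p])
    moreover have "ln (vandermonde d (\<lambda>i. real_of_int (shifted_part p i))) =
        (\<Sum>j<d. ln (\<Prod>i<j. real_of_int (shifted_part p i) - real_of_int (shifted_part p j)))"
      unfolding vandermonde_def by (intro ln_prod) (auto dest!: shifted_part_strict[OF p])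
    ultimately show ?thesis by (simp add: log_vandermonde_def)
  qed
  moreover have "ln (\<Prod>i<d. fact (p i + (d - 1 - i)) :: real) = log_fact_rows d p"
    unfolding log_fact_rows_def by (subst ln_prod) auto
  moreover have "0 < (\<Prod>i<d. fact (p i + (d - 1 - i)) :: real)" by (intro prod_pos) auto
  ultimately show ?thesis
    using vandermonde_shifted_part_pos[OF p, of d] by (simp add: frobenius_formula_def ln_div ln_mult)
qed

text \<open>The boxes lost by rounding down are put back into the first row.\<close>

definition rounded_midpoint :: "nat \<Rightarrow> nat \<Rightarrow> (nat \<Rightarrow> nat) \<Rightarrow> (nat \<Rightarrow> nat) \<Rightarrow> nat \<Rightarrow> nat" where
  "rounded_midpoint m d p q i =
     (p i + q i) div 2 + (if i = 0 then m - (\<Sum>k<d. (p k + q k) div 2) else 0)"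

context
  fixes p q :: "nat \<Rightarrow> nat" and m d :: nat
  assumes p: "p \<in> boxed_partitions m d" and q: "q \<in> boxed_partitions m d" and d: "1 \<le> d"
begin

lemma sum_half_rows: "(\<Sum>k<d. (p k + q k) div 2) \<le> m" "m \<le> (\<Sum>k<d. (p k + q k) div 2) + d"
proof -
  have total: "(\<Sum>k<d. p k + q k) = 2 * m"
    using sum_boxed_partitions[OF p] sum_boxed_partitions[OF q] by (simp add: sum.distrib)
  have "2 * (\<Sum>k<d. (p k + q k) div 2) \<le> (\<Sum>k<d. p k + q k)"
    unfolding sum_distrib_left by (intro sum_mono) auto
  then show "(\<Sum>k<d. (p k + q k) div 2) \<le> m" by (simp add: total)
  have "(\<Sum>k<d. p k + q k) \<le> (\<Sum>k<d. 2 * ((p k + q k) div 2) + 1)" by (intro sum_mono) auto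
  also have "\<dots> = 2 * (\<Sum>k<d. (p k + q k) div 2) + d"
    by (simp add: sum_distrib_left sum.distrib del: One_nat_def)
  finally show "m \<le> (\<Sum>k<d. (p k + q k) div 2) + d" by (simp add: total)
qed

lemma rounded_midpoint_eq_0: "d \<le> i \<Longrightarrow> rounded_midpoint m d p q i = 0"
  using boxed_partitions_eq_0[OF p] boxed_partitions_eq_0[OF q] d by (simp add: rounded_midpoint_def)

lemma rounded_midpoint_partition_seqs: "rounded_midpoint m d p q \<in> partition_seqs m"
proof (rule partition_seqsI[where d = d])
  have "(p (Suc i) + q (Suc i)) div 2 \<le> (p i + q i) div 2" for i
    using p q by (intro div_le_mono add_mono) (simp_all add: boxed_partitions_def partition_seqs_def)
  then show "rounded_midpoint m d p q (Suc i) \<le> rounded_midpoint m d p q i" for i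
    by (simp add: rounded_midpoint_def trans_le_add1)
  show "rounded_midpoint m d p q i = 0" if "d \<le> i" for i using that by (rule rounded_midpoint_eq_0)
  have "(\<Sum>i<d. rounded_midpoint m d p q i) =
      (\<Sum>k<d. (p k + q k) div 2) + (m - (\<Sum>k<d. (p k + q k) div 2))"
    unfolding rounded_midpoint_def sum.distrib using d by simp
  then show "(\<Sum>i<d. rounded_midpoint m d p q i) = m" using sum_half_rows(1) by simp
qed

lemma ln_row_gap_midpoint:
  fixes i j :: nat
  assumes "i < j" "j < d"
  defines "gap \<equiv> \<lambda>s. real_of_int (shifted_part s i) - real_of_int (shifted_part s j)"
    and "y \<equiv> \<lambda>i. real (p i) - real (q i)"
  shows "ln (gap p) + ln (gap q) + (y i - y j)\<^sup>2 / (16 * (real d)\<^sup>2) - 2 / real (j - i) \<le>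
    2 * ln (gap (rounded_midpoint m d p q))"
proof -
  have "real (j - i) \<le> gap p" "real (j - i) \<le> gap q"
    using assms(1) partition_seqs_antimono[OF boxed_partitions_imp_partition_seqs, OF p, of i j]
      partition_seqs_antimono[OF boxed_partitions_imp_partition_seqs, OF q, of i j]
    by (auto simp: gap_def shifted_part_def of_nat_diff)
  moreover have "(gap p + gap q - 1) / 2 \<le> gap (rounded_midpoint m d p q)"
  proof -
    have "2 * real (rounded_midpoint m d p q j) \<le> real (p j) + real (q j)"
      using assms(1) unfolding rounded_midpoint_def by simp
    moreover have "p i + q i \<le> 2 * ((p i + q i) div 2) + 1" by simp
    then have "p i + q i \<le> 2 * rounded_midpoint m d p q i + 1" by (simp add: rounded_midpoint_def)
    then have "real (p i) + real (q i) \<le> 2 * real (rounded_midpoint m d p q i) + 1" by linarith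
    ultimately show ?thesis by (simp add: gap_def shifted_part_def)
  qed
  moreover have "gap p + gap q \<le> 4 * real d"
    using boxed_partitions_le[OF p, of i] boxed_partitions_le[OF q, of i] assms(1,2)
    by (simp add: gap_def shifted_part_def)
  moreover have "1 \<le> real (j - i)" using assms(1) by simp
  moreover have "gap p - gap q = y i - y j" by (simp add: gap_def shifted_part_def y_def)
  ultimately show ?thesis using ln_gap_midpoint[of "real (j - i)" "gap p" "gap q"] by simp
qed

lemma row_distance_sq_le_sum_pairs:
  "(row_distance d p q)\<^sup>2 \<le> (\<Sum>j<d. \<Sum>i<j. ((real (p i) - real (q i)) - (real (p j) - real (q j)))\<^sup>2)"
proof -
  let ?y = "\<lambda>i. real (p i) - real (q i)"
  have "(\<Sum>i<d. ?y i) = real (\<Sum>i<d. p i) - real (\<Sum>i<d. q i)" by (simp add: sum_subtractf)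
  then have "(\<Sum>i<d. ?y i) = 0" by (simp only: sum_boxed_partitions[OF p] sum_boxed_partitions[OF q])
  then have "(\<Sum>j<d. \<Sum>i<j. (?y i - ?y j)\<^sup>2) = real d * (\<Sum>i<d. (?y i)\<^sup>2)"
    by (simp add: sum_pairs_sq_diff)
  moreover have "0 \<le> (\<Sum>j<d. \<Sum>i<j. (\<bar>?y i\<bar> - \<bar>?y j\<bar>)\<^sup>2)" by (intro sum_nonneg) auto
  then have "(row_distance d p q)\<^sup>2 \<le> real d * (\<Sum>i<d. (?y i)\<^sup>2)"
    unfolding sum_pairs_sq_diff[of "\<lambda>i. \<bar>?y i\<bar>"] by (simp add: row_distance_def)
  ultimately show ?thesis by simp
qed

lemma log_vandermonde_midpoint:
  "log_vandermonde d p + log_vandermonde d q + (row_distance d p q)\<^sup>2 / (16 * (real d)\<^sup>2)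
     - 2 * real d * (1 + ln (real d)) \<le> 2 * log_vandermonde d (rounded_midpoint m d p q)"
proof -
  let ?gap = "\<lambda>s i j. real_of_int (shifted_part s i) - real_of_int (shifted_part s j)"
  let ?y = "\<lambda>i. real (p i) - real (q i)"
  have "(\<Sum>j<d. \<Sum>i<j. 2 / real (j - i)) = (\<Sum>j<d. 2 * (\<Sum>i<j. 1 / real (j - i)))"
    by (simp add: sum_distrib_left)
  also have "\<dots> \<le> (\<Sum>j<d. 2 * (1 + ln (real d)))"
    using sum_inverse_diff_le[OF d] by (intro sum_mono mult_left_mono) auto
  finally have harmonic: "(\<Sum>j<d. \<Sum>i<j. 2 / real (j - i)) \<le> 2 * real d * (1 + ln (real d))"
    by (simp add: mult.commute mult.left_commute)
  have "(row_distance d p q)\<^sup>2 / (16 * (real d)\<^sup>2) \<le> (\<Sum>j<d. \<Sum>i<j. (?y i - ?y j)\<^sup>2) / (16 * (real d)\<^sup>2)"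
    by (intro divide_right_mono row_distance_sq_le_sum_pairs) simp
  then have "log_vandermonde d p + log_vandermonde d q + (row_distance d p q)\<^sup>2 / (16 * (real d)\<^sup>2)
      - 2 * real d * (1 + ln (real d)) \<le>
      (\<Sum>j<d. \<Sum>i<j. ln (?gap p i j) + ln (?gap q i j) +
          (?y i - ?y j)\<^sup>2 / (16 * (real d)\<^sup>2) - 2 / real (j - i))"
    using harmonic by (simp add: log_vandermonde_def sum.distrib sum_subtractf sum_divide_distrib)
  also have "\<dots> \<le> (\<Sum>j<d. \<Sum>i<j. 2 * ln (?gap (rounded_midpoint m d p q) i j))"
    using ln_row_gap_midpoint by (intro sum_mono) auto
  finally show ?thesis by (simp add: log_vandermonde_def sum_distrib_left)
qed

lemma ln_fact_first_row_midpoint: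
  "ln (fact (rounded_midpoint m d p q 0 + (d - 1)) :: real) \<le>
     ln (fact ((p 0 + q 0) div 2 + (d - 1))) + real d * ln (3 * real d)"
proof -
  define x where "x = m - (\<Sum>k<d. (p k + q k) div 2)"
  define h where "h = (p 0 + q 0) div 2"
  have x: "x \<le> d" using sum_half_rows by (simp add: x_def)
  have h: "h \<le> d"
    using boxed_partitions_le[OF p, of 0] boxed_partitions_le[OF q, of 0] by (simp add: h_def)
  have "fact (h + (d - 1) + x) \<le> (fact (h + (d - 1)) * real (h + (d - 1) + x) ^ x :: real)"
    by (rule fact_add_le)
  also have "\<dots> \<le> fact (h + (d - 1)) * (3 * real d) ^ x"
    using x h d by (intro mult_left_mono power_mono) auto
  also have "\<dots> \<le> fact (h + (d - 1)) * (3 * real d) ^ d"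
    using x d by (intro mult_left_mono power_increasing) auto
  finally have "ln (fact (h + (d - 1) + x) :: real) \<le> ln (fact (h + (d - 1)) * (3 * real d) ^ d)"
    using d by (subst ln_le_cancel_iff) auto
  also have "\<dots> = ln (fact (h + (d - 1))) + real d * ln (3 * real d)"
    using d by (simp add: ln_mult_pos ln_realpow distrib_left)
  finally show ?thesis by (simp add: rounded_midpoint_def x_def h_def add_ac)
qed

lemma log_fact_rows_midpoint:
  "2 * log_fact_rows d (rounded_midpoint m d p q) \<le>
     log_fact_rows d p + log_fact_rows d q + 2 * real d * ln (3 * real d)"
proof -
  let ?L = "\<lambda>s i. ln (fact (s i + (d - 1 - i)) :: real)"
  let ?k = "\<lambda>i. (p i + q i) div 2"
  have half: "2 * ?L ?k i \<le> ?L p i + ?L q i" for i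
  proof -
    let ?c = "d - 1 - i"
    have half_sum: "?k i + ?c = ((p i + ?c) + (q i + ?c)) div 2" by simp
    have "2 * ?L ?k i = ln (fact (?k i + ?c) * fact (?k i + ?c))" by (simp add: ln_mult)
    also have "\<dots> \<le> ln (fact (p i + ?c) * fact (q i + ?c))"
      unfolding half_sum by (subst ln_le_cancel_iff) (use fact_midpoint_le in auto)
    also have "\<dots> = ?L p i + ?L q i" by (simp add: ln_mult)
    finally show ?thesis .
  qed
  have "log_fact_rows d (rounded_midpoint m d p q) \<le>
      (\<Sum>i<d. ?L ?k i + (if i = 0 then real d * ln (3 * real d) else 0))"
    unfolding log_fact_rows_def using ln_fact_first_row_midpoint
    by (intro sum_mono) (auto simp: rounded_midpoint_def)
  also have "\<dots> = (\<Sum>i<d. ?L ?k i) + real d * ln (3 * real d)"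
    using d by (subst sum.distrib) auto
  finally have "2 * log_fact_rows d (rounded_midpoint m d p q) \<le>
      (\<Sum>i<d. 2 * ?L ?k i) + 2 * real d * ln (3 * real d)"
    by (simp add: sum_distrib_left[symmetric])
  also have "(\<Sum>i<d. 2 * ?L ?k i) \<le> (\<Sum>i<d. ?L p i + ?L q i)" by (intro sum_mono half)
  finally show ?thesis by (simp add: log_fact_rows_def sum.distrib)
qed

end

definition midpoint_error :: "nat \<Rightarrow> real" where
  "midpoint_error d = 2 * real d * (1 + ln (real d)) + 2 * real d * ln (3 * real d)"

text \<open>The logarithm of the Frobenius formula is concave in the shifted parts: the rounded midpoint
  loses only \<open>O (d ln d)\<close> and gains the square of the distance.\<close>

lemma fdim_mult_le:
  assumes p: "p \<in> boxed_partitions m d" and q: "q \<in> boxed_partitions m d" and d: "1 \<le> d"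
  shows "fdim p * fdim q \<le>
      fact m * exp (midpoint_error d - (row_distance d p q)\<^sup>2 / (16 * (real d)\<^sup>2))"
proof -
  let ?r = "rounded_midpoint m d p q"
  note seqs = boxed_partitions_imp_partition_seqs[OF p] boxed_partitions_imp_partition_seqs[OF q]
    rounded_midpoint_partition_seqs[OF p q d]
  have ln_fdims: "ln (fdim s) = ln (fact m) + log_vandermonde d s - log_fact_rows d s"
    if "s \<in> {p, q, ?r}" for s
    by (rule ln_fdim)
      (use that seqs boxed_partitions_eq_0[OF p] boxed_partitions_eq_0[OF q]
          rounded_midpoint_eq_0[OF p q d] in auto)
  have "2 * ln (fdim ?r) = ln ((fdim ?r)\<^sup>2)" using fdim_pos[OF seqs(3)] by (simp add: ln_realpow)
  also have "\<dots> \<le> ln (fact m)"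
    using fdim_sq_le_fact[OF seqs(3)] fdim_pos[OF seqs(3)] by (subst ln_le_cancel_iff) auto
  finally have "ln (fdim p) + ln (fdim q) \<le>
      ln (fact m) + (midpoint_error d - (row_distance d p q)\<^sup>2 / (16 * (real d)\<^sup>2))"
    using ln_fdims[of p] ln_fdims[of q] ln_fdims[of ?r]
      log_vandermonde_midpoint[OF p q d] log_fact_rows_midpoint[OF p q d]
    unfolding midpoint_error_def by simp
  then have "exp (ln (fdim p) + ln (fdim q)) \<le>
      exp (ln (fact m) + (midpoint_error d - (row_distance d p q)\<^sup>2 / (16 * (real d)\<^sup>2)))" by simp
  then show ?thesis using fdim_pos[OF seqs(1)] fdim_pos[OF seqs(2)] by (simp add: exp_add)
qed

lemma plancherel_prob_eq_sum:
  "plancherel_prob m P = (\<Sum>p\<in>{p \<in> partition_seqs m. P p}. (fdim p)\<^sup>2) / fact m"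
  unfolding plancherel_prob_def plancherel_mean_def using finite_partition_seqs
  by (intro arg_cong2[where f = "(/)"] sum.mono_neutral_cong_right) auto

lemma boxed_partitions_maximiser:
  assumes "1 / 2 \<le> plancherel_prob m (\<lambda>p. p \<in> boxed_partitions m d)"
  obtains p0 where "p0 \<in> boxed_partitions m d" "\<And>p. p \<in> boxed_partitions m d \<Longrightarrow> fdim p \<le> fdim p0"
    "fact m \<le> 2 * real (card (partition_seqs m)) * (fdim p0)\<^sup>2"
proof -
  let ?Y = "boxed_partitions m d"
  have "{p \<in> partition_seqs m. p \<in> ?Y} = ?Y" by (auto simp: boxed_partitions_def)
  then have mass: "fact m / 2 \<le> (\<Sum>p\<in>?Y. (fdim p)\<^sup>2)"
    using assms by (simp add: plancherel_prob_eq_sum field_simps)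
  then have "?Y \<noteq> {}" using fact_gt_zero[of m, where 'a = real] by (intro notI) simp
  then have "Max (fdim ` ?Y) \<in> fdim ` ?Y" using finite_boxed_partitions by (intro Max_in) auto
  then obtain p0 where p0: "p0 \<in> ?Y" "Max (fdim ` ?Y) = fdim p0" by auto
  then have maximal: "fdim p \<le> fdim p0" if "p \<in> ?Y" for p
    using Max_ge[of "fdim ` ?Y" "fdim p"] finite_boxed_partitions that by auto
  have "(\<Sum>p\<in>?Y. (fdim p)\<^sup>2) \<le> (\<Sum>p\<in>?Y. (fdim p0)\<^sup>2)"
    using maximal fdim_pos[OF boxed_partitions_imp_partition_seqs]
    by (intro sum_mono power_mono) (auto intro: less_imp_le)
  also have "\<dots> \<le> real (card (partition_seqs m)) * (fdim p0)\<^sup>2"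
    using card_mono[OF finite_partition_seqs[of m], of ?Y]
    by (auto simp: boxed_partitions_def intro!: mult_right_mono)
  finally show ?thesis using mass p0(1) maximal that[of p0] by simp
qed

lemma plancherel_prob_far_from_maximiser:
  assumes d: "1 \<le> d" and \<eta>: "0 \<le> \<eta>"
    and mass: "1 / 2 \<le> plancherel_prob m (\<lambda>p. p \<in> boxed_partitions m d)"
  obtains p0 where "p0 \<in> boxed_partitions m d"
    "plancherel_prob m (\<lambda>p. p \<in> boxed_partitions m d \<and> \<eta> * real m \<le> row_distance d p p0) \<le>
      2 * (real (card (partition_seqs m)))\<^sup>2 *
      exp (2 * midpoint_error d - 2 * ((\<eta> * real m)\<^sup>2 / (16 * (real d)\<^sup>2)))"
proof -
  define N where "N = real (card (partition_seqs m))"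
  obtain p0 where p0: "p0 \<in> boxed_partitions m d" and large: "fact m \<le> 2 * N * (fdim p0)\<^sup>2"
    using boxed_partitions_maximiser[OF mass] unfolding N_def by metis
  note p0_seq = boxed_partitions_imp_partition_seqs[OF p0]
  define E where "E = exp (midpoint_error d - (\<eta> * real m)\<^sup>2 / (16 * (real d)\<^sup>2))"
  have E_sq: "E\<^sup>2 = exp (2 * midpoint_error d - 2 * ((\<eta> * real m)\<^sup>2 / (16 * (real d)\<^sup>2)))"
    by (simp add: E_def power2_eq_square exp_add[symmetric])
  let ?far = "{p \<in> partition_seqs m. p \<in> boxed_partitions m d \<and> \<eta> * real m \<le> row_distance d p p0}"
  have far: "(fdim p)\<^sup>2 \<le> fact m * (2 * N * E\<^sup>2)" if "p \<in> ?far" for p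
  proof -
    have p: "p \<in> partition_seqs m" "p \<in> boxed_partitions m d" "\<eta> * real m \<le> row_distance d p p0"
      using that by auto
    have "fdim p * fdim p0 \<le>
        fact m * exp (midpoint_error d - (row_distance d p p0)\<^sup>2 / (16 * (real d)\<^sup>2))"
      by (rule fdim_mult_le[OF p(2) p0 d])
    also have "\<dots> \<le> fact m * E"
      unfolding E_def using p(3) \<eta>
      by (intro mult_left_mono exp_le_cancel_iff[THEN iffD2] diff_left_mono divide_right_mono
          power_mono) auto
    finally have "(fdim p * fdim p0)\<^sup>2 \<le> (fact m * E)\<^sup>2"
      using fdim_pos[OF p(1)] fdim_pos[OF p0_seq] by (intro power_mono) auto
    then have "(fdim p)\<^sup>2 * (fdim p0)\<^sup>2 \<le> fact m * (fact m * E\<^sup>2)"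
      by (simp add: power_mult_distrib power2_eq_square mult.assoc mult.left_commute)
    also have "\<dots> \<le> (2 * N * (fdim p0)\<^sup>2) * (fact m * E\<^sup>2)" using large by (intro mult_right_mono) auto
    finally have "(fdim p)\<^sup>2 * (fdim p0)\<^sup>2 \<le> (fact m * (2 * N * E\<^sup>2)) * (fdim p0)\<^sup>2"
      by (simp add: mult.assoc mult.left_commute mult.commute)
    then show ?thesis using fdim_pos[OF p0_seq] by (simp add: mult_le_cancel_right)
  qed
  have "card ?far \<le> card (partition_seqs m)" by (rule card_mono[OF finite_partition_seqs]) auto
  then have count: "real (card ?far) \<le> N" by (simp add: N_def)
  have "(\<Sum>p\<in>?far. (fdim p)\<^sup>2) \<le> real (card ?far) * (fact m * (2 * N * E\<^sup>2))"
    using far by (rule sum_bounded_above)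
  also have "\<dots> \<le> N * (fact m * (2 * N * E\<^sup>2))"
    using count by (intro mult_right_mono) (auto simp: N_def)
  finally have "plancherel_prob m (\<lambda>p. p \<in> boxed_partitions m d \<and> \<eta> * real m \<le> row_distance d p p0) \<le>
      2 * N\<^sup>2 * E\<^sup>2"
    by (simp add: plancherel_prob_eq_sum field_simps power2_eq_square)
  then show ?thesis using p0 that unfolding E_sq N_def by blast
qed

lemma less_card_downward_closed_iff:
  fixes P :: "nat \<Rightarrow> bool"
  assumes "finite {i. P i}" "\<And>i j. P j \<Longrightarrow> i \<le> j \<Longrightarrow> P i"
  shows "i < card {i. P i} \<longleftrightarrow> P i"
proof
  assume "P i"
  then have "card {..i} \<le> card {i. P i}" using assms by (intro card_mono) auto
  then show "i < card {i. P i}" by simp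
next
  assume "i < card {i. P i}"
  show "P i"
  proof (rule ccontr)
    assume "\<not> P i"
    then have "{k. P k} \<subseteq> {..<i}" using assms(2) by (force simp: not_less[symmetric])
    then have "card {k. P k} \<le> card {..<i}" by (intro card_mono) auto
    then show False using \<open>i < card {i. P i}\<close> by simp
  qed
qed

definition column_length :: "(nat \<Rightarrow> nat) \<Rightarrow> nat \<Rightarrow> nat" where
  "column_length p j = card {i. j < p i}"

lemma rows_longer_subset: "p \<in> partition_seqs n \<Longrightarrow> {i. j < p i} \<subseteq> {..<n}"
  using partition_seqs_pos_imp_less by force

lemma less_column_length_iff:
  assumes "p \<in> partition_seqs n"
  shows "i < column_length p j \<longleftrightarrow> j < p i"
  unfolding column_length_def
  using finite_subset[OF rows_longer_subset[OF assms]] partition_seqs_antimono[OF assms]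
  by (intro less_card_downward_closed_iff) (auto intro: less_le_trans)

lemma partition_seqs_le_of_square_bound:
  assumes p: "p \<in> partition_seqs n" and "n \<le> s * s" "s \<le> i"
  shows "p i \<le> s"
proof (rule ccontr)
  assume "\<not> p i \<le> s"
  then have big: "Suc s \<le> p k" if "k \<le> i" for k using partition_seqs_antimono[OF p that] by simp
  have "i < n" using big[of i] partition_seqs_pos_imp_less[OF p, of i] by simp
  have "Suc i * Suc s = (\<Sum>k<Suc i. Suc s)" by simp
  also have "\<dots> \<le> (\<Sum>k<Suc i. p k)" using big by (intro sum_mono) auto
  also have "\<dots> \<le> (\<Sum>k<n. p k)" using \<open>i < n\<close> by (intro sum_mono2) auto
  also have "\<dots> = n" using p by (simp add: partition_seqs_def)
  finally have "Suc i * Suc s \<le> s * s" using assms(2) by simp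
  moreover have "Suc s * Suc s \<le> Suc i * Suc s" using assms(3) by (intro mult_right_mono) auto
  ultimately show False by simp
qed

text \<open>A partition of \<open>n \<le> s\<^sup>2\<close> is determined by its first \<open>s\<close> rows and columns.\<close>

lemma card_partition_seqs_le_power:
  assumes "n \<le> s * s"
  shows "card (partition_seqs n) \<le> (n + 1) ^ (2 * s)"
proof -
  define h where "h p = (restrict p {..<s}, restrict (column_length p) {..<s})" for p
  let ?B = "PiE {..<s} (\<lambda>_. {..n})"
  have "inj_on h (partition_seqs n)"
  proof (rule inj_onI)
    fix p q assume p: "p \<in> partition_seqs n" and q: "q \<in> partition_seqs n" and same_code: "h p = h q"
    have rows: "p i = q i" if "i < s" for i
      using same_code that unfolding h_def by (metis fst_conv lessThan_iff restrict_apply')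
    have columns: "column_length p j = column_length q j" if "j < s" for j
      using same_code that unfolding h_def by (metis snd_conv lessThan_iff restrict_apply')
    have same_boxes: "j < p i \<longleftrightarrow> j < q i" for i j
      using rows columns less_column_length_iff[OF p, of i j] less_column_length_iff[OF q, of i j]
        partition_seqs_le_of_square_bound[OF p assms, of i] partition_seqs_le_of_square_bound[OF q assms, of i]
      by (cases "i < s"; cases "j < s") auto
    show "p = q"
    proof
      fix i show "p i = q i" using same_boxes[of "p i" i] same_boxes[of "q i" i] by simp
    qed
  qed
  moreover have "h ` partition_seqs n \<subseteq> ?B \<times> ?B"
  proof -
    have "column_length p j \<le> n" if "p \<in> partition_seqs n" for p j
      unfolding column_length_def using card_mono[OF _ rows_longer_subset[OF that, of j]] by simp
    then show ?thesis using partition_seqs_le by (auto simp: h_def PiE_def extensional_def)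
  qed
  moreover have "finite (?B \<times> ?B)" by (intro finite_cartesian_product finite_PiE) auto
  ultimately have "card (partition_seqs n) \<le> card (?B \<times> ?B)" by (metis card_inj_on_le)
  also have "\<dots> = (n + 1) ^ (2 * s)"
    by (simp add: card_cartesian_product card_PiE mult_2 power_add)
  finally show ?thesis .
qed

lemma card_partition_seqs_le_exp:
  "real (card (partition_seqs n)) \<le> exp (2 * (sqrt (real n) + 1) * ln (real n + 1))"
proof -
  define s where "s = nat \<lceil>sqrt (real n)\<rceil>"
  have s: "sqrt (real n) \<le> real s" "real s \<le> sqrt (real n) + 1"
    unfolding s_def by (auto simp: of_nat_nat ceiling_correct)
  have "real n = sqrt (real n) * sqrt (real n)" by simp
  also have "\<dots> \<le> real s * real s" using s by (intro mult_mono) auto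
  finally have "n \<le> s * s" by (simp flip: of_nat_mult)
  then have "real (card (partition_seqs n)) \<le> (real n + 1) ^ (2 * s)"
    using card_partition_seqs_le_power[of n s]
    by (metis of_nat_1 of_nat_add of_nat_le_iff of_nat_power)
  also have "\<dots> = exp (real (2 * s) * ln (real n + 1))" by (subst exp_of_nat_mult) simp
  also have "\<dots> \<le> exp (2 * (sqrt (real n) + 1) * ln (real n + 1))"
    using s by (auto intro!: mult_right_mono)
  finally show ?thesis .
qed

section \<open>Russian profiles\<close>

text \<open>The Russian profile before rescaling: its slopes change exactly at the corner contents.\<close>

definition russian_profile :: "(nat \<Rightarrow> nat) \<Rightarrow> real \<Rightarrow> real" where
  "russian_profile p u = corner_sum (\<lambda>c. \<bar>u - of_int c\<bar>) p"

definition russian_diagram :: "(nat \<Rightarrow> nat) \<Rightarrow> (real \<times> real) set" where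
  "russian_diagram p =
     {(a, b). \<exists>i j. j < p i \<and> \<bar>a - (real j - real i)\<bar> + \<bar>b - (real j + real i + 1)\<bar> \<le> 1}"

definition tent :: "real \<Rightarrow> real" where
  "tent v = max 0 (1 - \<bar>v\<bar>)"

lemma russian_profile_eq_tents:
  assumes "p \<in> partition_seqs n"
  shows "russian_profile p u = \<bar>u\<bar> + 2 * sum_contents (\<lambda>c. tent (u - of_int c)) p"
proof -
  have "\<bar>u - of_int (c + 1)\<bar> - 2 * \<bar>u - of_int c\<bar> + \<bar>u - of_int (c - 1)\<bar> = 2 * tent (u - of_int c)"
    for c
  proof -
    have "\<bar>y - 1\<bar> - 2 * \<bar>y\<bar> + \<bar>y + 1\<bar> = 2 * max 0 (1 - \<bar>y\<bar>)" for y :: real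
      by (auto simp: max_def abs_if)
    from this[of "u - of_int c"] show ?thesis by (simp add: tent_def algebra_simps)
  qed
  then show ?thesis
    using corner_sum_eq_sum_contents[OF assms, of "\<lambda>c. \<bar>u - of_int c\<bar>"]
    by (simp add: russian_profile_def sum_contents_cmult)
qed

lemma russian_profile_ge: "p \<in> partition_seqs n \<Longrightarrow> \<bar>u\<bar> \<le> russian_profile p u"
  by (auto simp: russian_profile_eq_tents tent_def intro!: sum_contents_nonneg)

lemma russian_profile_far:
  assumes p: "p \<in> partition_seqs n" and far: "\<And>i j. j < p i \<Longrightarrow> 1 \<le> \<bar>u - of_int (int j - int i)\<bar>"
  shows "russian_profile p u = \<bar>u\<bar>"
proof -
  have "sum_contents (\<lambda>c. tent (u - of_int c)) p = sum_contents (\<lambda>_. 0) p"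
  proof (rule sum_contents_cong)
    fix i j assume "j < p i"
    from far[OF this] show "tent (u - of_int (int j - int i)) = 0"
      unfolding tent_def by (intro max_absorb1) linarith
  qed
  then show ?thesis using russian_profile_eq_tents[OF p, of u] sum_contents_const[OF p, of 0] by simp
qed

lemma russian_profile_right:
  assumes p: "p \<in> partition_seqs n" and u: "real (p 0) \<le> u"
  shows "russian_profile p u = u"
proof -
  have "russian_profile p u = \<bar>u\<bar>"
  proof (rule russian_profile_far[OF p])
    fix i j assume "j < p i"
    then have "int j - int i + 1 \<le> int (p 0)" using partition_seqs_antimono[OF p, of 0 i] by simp
    then have "real_of_int (int j - int i) + 1 \<le> real (p 0)" by linarith
    then show "1 \<le> \<bar>u - real_of_int (int j - int i)\<bar>" using u by linarith
  qed
  then show ?thesis using u of_nat_0_le_iff[of "p 0", where 'a = real] by linarith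
qed

lemma russian_profile_left:
  assumes p: "p \<in> partition_seqs n" and u: "0 \<le> u" "\<And>i. u < real i + 1 \<Longrightarrow> p i = 0"
  shows "russian_profile p (- u) = u"
proof -
  have "russian_profile p (- u) = \<bar>- u\<bar>"
  proof (rule russian_profile_far[OF p])
    fix i j assume "j < p i"
    then have "real i + 1 \<le> u" using u(2)[of i] by (cases "u < real i + 1") auto
    then show "1 \<le> \<bar>- u - real_of_int (int j - int i)\<bar>" by simp
  qed
  then show ?thesis using u by simp
qed

lemma shifted_part_above_subset:
  assumes "p \<in> partition_seqs n"
  shows "{i. c < shifted_part p i} \<subseteq> {..<n + nat \<bar>c\<bar>}"
proof
  fix i assume "i \<in> {i. c < shifted_part p i}"
  then show "i \<in> {..<n + nat \<bar>c\<bar>}"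
    using partition_seqs_eq_0[OF assms, of i] by (cases "n \<le> i") (auto simp: shifted_part_def)
qed

lemma finite_shifted_part_above: "p \<in> partition_seqs n \<Longrightarrow> finite {i. c < shifted_part p i}"
  using shifted_part_above_subset by (rule finite_subset) auto

lemma less_card_shifted_part_above_iff:
  assumes "p \<in> partition_seqs n"
  shows "i < card {i. c < shifted_part p i} \<longleftrightarrow> c < shifted_part p i"
proof (rule less_card_downward_closed_iff[OF finite_shifted_part_above[OF assms]])
  fix i j assume "c < shifted_part p j" "i \<le> j"
  then show "c < shifted_part p i" using shifted_part_strict[OF assms, of i j] by (cases "i = j") auto
qed

lemma russian_profile_of_int:
  assumes p: "p \<in> partition_seqs n"
  shows "russian_profile p (of_int c) = of_int c + 2 * real (card {i. c < shifted_part p i})"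
proof -
  define d where "d = n + nat \<bar>c\<bar>"
  have zero: "p i = 0" if "d \<le> i" for i using partition_seqs_eq_0[OF p] that by (simp add: d_def)
  have above: "{i. c < shifted_part p i} \<subseteq> {..<d}"
    unfolding d_def by (rule shifted_part_above_subset[OF p])
  have "\<bar>real_of_int c - of_int x\<bar> - \<bar>of_int c - of_int (x - 1)\<bar> = 2 * of_bool (c < x) - 1" for x
  proof -
    have "\<bar>c - x\<bar> - \<bar>c - (x - 1)\<bar> = 2 * of_bool (c < x) - 1" by auto
    then have "real_of_int (\<bar>c - x\<bar> - \<bar>c - (x - 1)\<bar>) = of_int (2 * of_bool (c < x) - 1)"
      by (rule arg_cong)
    then show ?thesis by simp
  qed
  then have "russian_profile p (of_int c) =
      \<bar>of_int c + real d\<bar> + (\<Sum>i<d. 2 * of_bool (c < shifted_part p i) - 1)"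
    unfolding russian_profile_def
    using corner_sum_eq_shifted_parts[OF p zero, of d "\<lambda>x. \<bar>real_of_int c - of_int x\<bar>"] by simp
  also have "(\<Sum>i<d. 2 * of_bool (c < shifted_part p i) - 1 :: real) =
      2 * real (card {i \<in> {..<d}. c < shifted_part p i}) - real d"
    by (simp add: sum_subtractf sum_distrib_left[symmetric] sum.inter_filter[symmetric] of_bool_def)
  also have "{i \<in> {..<d}. c < shifted_part p i} = {i. c < shifted_part p i}" using above by auto
  also have "\<bar>of_int c + real d\<bar> = of_int c + real d" by (simp add: d_def)
  finally show ?thesis by simp
qed

lemma russian_profile_step:
  assumes p: "p \<in> partition_seqs n"
  shows "russian_profile p (of_int (c + 1)) - russian_profile p (of_int c) \<in> {- 1, 1}"
proof -
  let ?above = "\<lambda>c. {i. c < shifted_part p i}"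
  have "?above c = ?above (c + 1) \<union> {i. shifted_part p i = c + 1}" by auto
  moreover have "finite {i. shifted_part p i = c + 1}"
    by (rule finite_subset[OF _ finite_shifted_part_above[OF p, of c]]) auto
  ultimately have "card (?above c) = card (?above (c + 1)) + card {i. shifted_part p i = c + 1}"
    using finite_shifted_part_above[OF p] by (simp add: card_Un_disjoint disjoint_iff)
  moreover have "card {i. shifted_part p i = c + 1} \<le> 1"
    unfolding card_le_Suc0_iff_eq[OF \<open>finite {i. shifted_part p i = c + 1}\<close>, folded One_nat_def]
    using inj_on_shifted_part[OF p, of UNIV] by (auto simp: inj_on_def)
  then have "card {i. shifted_part p i = c + 1} = 0 \<or> card {i. shifted_part p i = c + 1} = 1"
    by linarith
  ultimately show ?thesis unfolding russian_profile_of_int[OF p] by auto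
qed

lemma russian_profile_affine_on_cells:
  assumes "0 \<le> t" "t \<le> 1"
  shows "russian_profile p (of_int k + t) =
    (1 - t) * russian_profile p (of_int k) + t * russian_profile p (of_int (k + 1))"
proof -
  have affine: "\<bar>of_int k + t - of_int c\<bar> =
      (1 - t) * \<bar>of_int k - of_int c\<bar> + t * \<bar>of_int (k + 1) - of_int c\<bar>"
    for c :: int
  proof (cases "k < c")
    case True
    then have "of_int k + t - of_int c \<le> 0" "of_int k - of_int c \<le> (0::real)"
      "of_int (k + 1) - of_int c \<le> (0::real)"
      using assms by linarith+
    then show ?thesis by (simp add: abs_of_nonpos algebra_simps)
  next
    case False
    then have "0 \<le> of_int k + t - of_int c" "0 \<le> of_int k - (of_int c :: real)"
      "0 \<le> of_int (k + 1) - (of_int c :: real)"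
      using assms by linarith+
    then show ?thesis by (simp add: abs_of_nonneg algebra_simps)
  qed
  show ?thesis unfolding russian_profile_def affine corner_sum_linear ..
qed

lemma lipschitz_on_UNIV_if_intervals:
  fixes f :: "real \<Rightarrow> 'a::metric_space"
  assumes "\<And>u v. C-lipschitz_on {u..v} f"
  shows "C-lipschitz_on UNIV f"
proof (rule lipschitz_onI)
  show "dist (f u) (f v) \<le> C * dist u v" for u v
    by (rule lipschitz_onD[OF assms[of "min u v" "max u v"]]) auto
  show "0 \<le> C" using assms by (rule lipschitz_on_nonneg)
qed

lemma russian_profile_lipschitz:
  assumes p: "p \<in> partition_seqs n"
  shows "1-lipschitz_on UNIV (russian_profile p)"
proof -
  have cell: "1-lipschitz_on {of_int k..of_int (k + 1)} (russian_profile p)" for k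
  proof (rule lipschitz_onI)
    let ?g = "russian_profile p (of_int k)" and ?g' = "russian_profile p (of_int (k + 1))"
    fix u v :: real assume uv: "u \<in> {of_int k..of_int (k + 1)}" "v \<in> {of_int k..of_int (k + 1)}"
    have affine: "russian_profile p w = ?g + (w - of_int k) * (?g' - ?g)"
      if "w \<in> {of_int k..of_int (k + 1)}" for w
      using russian_profile_affine_on_cells[of "w - of_int k" p k] that by (simp add: algebra_simps)
    have "russian_profile p u - russian_profile p v = (u - v) * (?g' - ?g)"
      unfolding affine[OF uv(1)] affine[OF uv(2)] by (simp add: algebra_simps)
    moreover have "\<bar>?g' - ?g\<bar> = 1" using russian_profile_step[OF p, of k] by auto
    ultimately show "dist (russian_profile p u) (russian_profile p v) \<le> 1 * dist u v"
      by (simp add: dist_real_def abs_mult)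
  qed simp
  have "1-lipschitz_on {u..v} (russian_profile p)" for u v :: real
  proof (rule lipschitz_on_closed_Union[where I = "{\<lfloor>u\<rfloor>..\<lfloor>v\<rfloor>}"
    and U = "\<lambda>k. {of_int k..of_int (k + 1)}"])
    show "{u..v} \<subseteq> (\<Union>k\<in>{\<lfloor>u\<rfloor>..\<lfloor>v\<rfloor>}. {of_int k..of_int (k + 1)})"
    proof
      fix w assume "w \<in> {u..v}"
      then have "\<lfloor>w\<rfloor> \<in> {\<lfloor>u\<rfloor>..\<lfloor>v\<rfloor>}" by (auto intro: floor_mono)
      moreover have "w \<in> {of_int \<lfloor>w\<rfloor>..of_int (\<lfloor>w\<rfloor> + 1)}" by (auto intro: less_imp_le)
      ultimately show "w \<in> (\<Union>k\<in>{\<lfloor>u\<rfloor>..\<lfloor>v\<rfloor>}. {of_int k..of_int (k + 1)})" by blast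
    qed
  qed (use cell in auto)
  then show ?thesis by (rule lipschitz_on_UNIV_if_intervals)
qed

lemma russian_diagram_le_profile:
  assumes p: "p \<in> partition_seqs n" and "(u, b) \<in> russian_diagram p"
  shows "b \<le> russian_profile p u"
proof -
  obtain i j where j: "j < p i" and box: "\<bar>u - (real j - real i)\<bar> + \<bar>b - (real j + real i + 1)\<bar> \<le> 1"
    using assms(2) by (auto simp: russian_diagram_def)
  define c where "c = int j - int i"
  have "c < shifted_part p i" using j by (simp add: c_def shifted_part_def)
  then have "i < card {i. c < shifted_part p i}" using less_card_shifted_part_above_iff[OF p] by blast
  then have "real j + real i + 2 \<le> russian_profile p (of_int c)"
    unfolding russian_profile_of_int[OF p] by (simp add: c_def)
  moreover have "\<bar>russian_profile p u - russian_profile p (of_int c)\<bar> \<le> \<bar>u - of_int c\<bar>"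
    using lipschitz_onD[OF russian_profile_lipschitz[OF p], of u "of_int c"]
    by (simp add: dist_real_def)
  ultimately show ?thesis using box by (simp add: c_def)
qed

text \<open>On a cell the profile is the upper edge of the unit square centred below its higher end.\<close>

lemma russian_profile_eq_peak:
  assumes p: "p \<in> partition_seqs n"
  obtains c where "\<bar>u - of_int c\<bar> \<le> 1"
    "russian_profile p u = russian_profile p (of_int c) - \<bar>u - of_int c\<bar>"
proof -
  define k where "k = \<lfloor>u\<rfloor>"
  define t where "t = u - of_int k"
  have t: "0 \<le> t" "t \<le> 1" unfolding t_def k_def by linarith+
  have u: "of_int k + t = u" by (simp add: t_def)
  let ?g = "russian_profile p (of_int k)" and ?g' = "russian_profile p (of_int (k + 1))"
  have affine: "russian_profile p u = (1 - t) * ?g + t * ?g'"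
    using russian_profile_affine_on_cells[OF t, of p k] by (simp only: u)
  from russian_profile_step[OF p, of k] consider (up) "?g' = ?g + 1" | (down) "?g' = ?g - 1" by force
  then show ?thesis
  proof cases
    case up
    have "russian_profile p u = ?g + t" using affine unfolding up by (simp add: algebra_simps)
    also have "\<dots> = ?g' - \<bar>u - of_int (k + 1)\<bar>" unfolding up using t by (simp add: t_def)
    finally have "russian_profile p u = ?g' - \<bar>u - of_int (k + 1)\<bar>" .
    moreover have "\<bar>u - of_int (k + 1)\<bar> \<le> 1" using t by (simp add: t_def)
    ultimately show ?thesis using that by blast
  next
    case down
    have "russian_profile p u = ?g - t" using affine unfolding down by (simp add: algebra_simps)
    then have "russian_profile p u = ?g - \<bar>u - of_int k\<bar>" using t by (simp add: t_def)
    moreover have "\<bar>u - of_int k\<bar> \<le> 1" using t by (simp add: t_def)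
    ultimately show ?thesis using that by blast
  qed
qed

lemma russian_profile_attained:
  assumes p: "p \<in> partition_seqs n"
  shows "russian_profile p u = \<bar>u\<bar> \<or> (u, russian_profile p u) \<in> russian_diagram p"
proof -
  obtain c where c: "\<bar>u - of_int c\<bar> \<le> 1"
    "russian_profile p u = russian_profile p (of_int c) - \<bar>u - of_int c\<bar>"
    by (rule russian_profile_eq_peak[OF p])
  define r where "r = card {i. c < shifted_part p i}"
  have height: "russian_profile p u = of_int c + 2 * real r - \<bar>u - of_int c\<bar>"
    unfolding c(2) russian_profile_of_int[OF p] by (simp add: r_def)
  note above = russian_profile_ge[OF p, of u]
  consider (outside) "r = 0" | (left) "0 < r" "c + int r \<le> 0" | (inside) "0 < r" "0 < c + int r"
    by linarith
  then show ?thesis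
  proof cases
    case outside
    then show ?thesis using height above by linarith
  next
    case left
    then have "real_of_int c + real r \<le> 0" by linarith
    then show ?thesis using height above by linarith
  next
    case inside
    define i where "i = r - 1"
    define j where "j = nat (c + int i)"
    have r: "r = Suc i" and j: "int j = c + int i" using inside by (auto simp: i_def j_def)
    have "c < shifted_part p i"
      using less_card_shifted_part_above_iff[OF p, of i c] r by (simp add: r_def)
    then have "j < p i" using j by (simp add: shifted_part_def)
    moreover have "real j = of_int c + real i" using j by linarith
    then have "\<bar>u - (real j - real i)\<bar> + \<bar>russian_profile p u - (real j + real i + 1)\<bar> \<le> 1"
      using c(1) unfolding height r by simp
    ultimately show ?thesis unfolding russian_diagram_def by blast
  qed
qed

section \<open>Partitions as lists and standard Young tableaux\<close>

definition part_seq :: "nat list \<Rightarrow> nat \<Rightarrow> nat" where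
  "part_seq \<mu> = nth_default 0 \<mu>"

lemma part_seq_nth: "part_seq \<mu> i = (if i < length \<mu> then \<mu> ! i else 0)"
  by (simp add: part_seq_def nth_default_def)

lemma part_seq_pos_iff: "\<mu> \<in> partitions n \<Longrightarrow> 0 < part_seq \<mu> i \<longleftrightarrow> i < length \<mu>"
  by (auto simp: part_seq_nth partitions_def)

lemma sum_part_seq: "(\<Sum>i<length \<mu>. part_seq \<mu> i) = sum_list \<mu>"
  by (simp add: sum_list_sum_nth part_seq_nth atLeast0LessThan)

lemma part_seq_partition_seqs:
  assumes \<mu>: "\<mu> \<in> partitions n"
  shows "part_seq \<mu> \<in> partition_seqs n"
proof (rule partition_seqsI[where d = "length \<mu>"])
  show "part_seq \<mu> (Suc i) \<le> part_seq \<mu> i" for i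
    using \<mu> by (auto simp: partitions_def part_seq_nth sorted_wrt_iff_nth_less)
  show "(\<Sum>i<length \<mu>. part_seq \<mu> i) = n" using \<mu> by (simp add: sum_part_seq partitions_def)
qed (simp add: part_seq_nth)

lemma inj_on_part_seq: "inj_on part_seq (partitions n)"
proof (rule inj_onI)
  fix \<mu> \<nu> assume \<mu>: "\<mu> \<in> partitions n" and \<nu>: "\<nu> \<in> partitions n"
    and same_seq: "part_seq \<mu> = part_seq \<nu>"
  have "i < length \<mu> \<longleftrightarrow> i < length \<nu>" for i
    using part_seq_pos_iff[OF \<mu>, of i] part_seq_pos_iff[OF \<nu>, of i] same_seq by simp
  then have length: "length \<mu> = length \<nu>" by (metis linorder_neq_iff)
  show "\<mu> = \<nu>"
  proof (rule nth_equalityI[OF length])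
    fix i assume "i < length \<mu>"
    then show "\<mu> ! i = \<nu> ! i" using fun_cong[OF same_seq, of i] length by (simp add: part_seq_nth)
  qed
qed

lemma part_seq_image: "part_seq ` partitions n = partition_seqs n"
proof
  show "part_seq ` partitions n \<subseteq> partition_seqs n" using part_seq_partition_seqs by auto
  show "partition_seqs n \<subseteq> part_seq ` partitions n"
  proof
    fix p assume p: "p \<in> partition_seqs n"
    define k where "k = card {i. 0 < p i}"
    have pos_iff: "i < k \<longleftrightarrow> 0 < p i" for i
      using less_column_length_iff[OF p, of i 0] by (simp add: k_def column_length_def)
    let ?\<mu> = "map p [0..<k]"
    have seq: "part_seq ?\<mu> = p" using pos_iff by (auto simp: part_seq_nth fun_eq_iff)
    have "sum_list ?\<mu> = n"
      using sum_part_seq[of ?\<mu>] sum_partition_seqs[OF p, of k] pos_iff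
      by (simp add: seq not_less[symmetric])
    moreover have "sorted_wrt (\<ge>) ?\<mu>"
      using partition_seqs_antimono[OF p] by (auto simp: sorted_wrt_iff_nth_less)
    ultimately have "?\<mu> \<in> partitions n" using pos_iff by (auto simp: partitions_def)
    then show "p \<in> part_seq ` partitions n" using seq by (metis imageI)
  qed
qed

lemma finite_partitions: "finite (partitions n)"
  using finite_imageD[OF _ inj_on_part_seq[of n]] part_seq_image finite_partition_seqs by metis

lemma part_seq_tl: "part_seq (tl \<mu>) = part_seq \<mu> \<circ> Suc"
  by (cases \<mu>) (auto simp: part_seq_nth fun_eq_iff)

lemma tl_partitions: "\<mu> \<in> partitions n \<Longrightarrow> tl \<mu> \<in> partitions (n - part_seq \<mu> 0)"
  by (cases \<mu>) (auto simp: partitions_def part_seq_nth)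

definition diagram_boxes :: "(nat \<Rightarrow> nat) \<Rightarrow> (nat \<times> nat) set" where
  "diagram_boxes p = {(i, j). 1 \<le> i \<and> 1 \<le> j \<and> j \<le> p (i - 1)}"

lemma young_diagram_eq: "young_diagram \<mu> = diagram_boxes (part_seq \<mu>)"
  unfolding young_diagram_def diagram_boxes_def nth_part_def part_seq_def[symmetric]
  by (auto simp: part_seq_nth split: if_splits)

lemma diagram_boxes_Suc_iff: "(Suc i, Suc j) \<in> diagram_boxes p \<longleftrightarrow> j < p i"
  by (auto simp: diagram_boxes_def)

lemma diagram_boxes_eq_image:
  assumes "p \<in> partition_seqs n"
  shows "diagram_boxes p = (\<lambda>(i, j). (Suc i, Suc j)) ` (SIGMA i:{..<n}. {..<p i})"
proof (intro equalityI subsetI)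
  fix b assume "b \<in> diagram_boxes p"
  then obtain i j where "b = (Suc i, Suc j)" "j < p i"
    by (cases b, cases "fst b", simp_all add: diagram_boxes_def) (metis Suc_le_D Suc_le_lessD)
  then show "b \<in> (\<lambda>(i, j). (Suc i, Suc j)) ` (SIGMA i:{..<n}. {..<p i})"
    using partition_seqs_pos_imp_less[OF assms, of i] by (auto intro!: image_eqI[of _ _ "(i, j)"])
qed (auto simp: diagram_boxes_Suc_iff)

lemma finite_diagram_boxes: "p \<in> partition_seqs n \<Longrightarrow> finite (diagram_boxes p)"
  by (simp add: diagram_boxes_eq_image)

lemma sum_contents_eq_sum_diagram_boxes:
  assumes p: "p \<in> partition_seqs n"
  shows "sum_contents \<phi> p = (\<Sum>(i, j)\<in>diagram_boxes p. \<phi> (int j - int i))"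
proof -
  have "sum_contents \<phi> p = (\<Sum>(i, j)\<in>(SIGMA i:{..<n}. {..<p i}). \<phi> (int j - int i))"
    using sum_contents_eq[of n p \<phi>] partition_seqs_eq_0[OF p] by (subst sum.Sigma[symmetric]) auto
  also have "\<dots> = (\<Sum>(i, j)\<in>diagram_boxes p. \<phi> (int j - int i))"
    unfolding diagram_boxes_eq_image[OF p]
    by (subst sum.reindex) (auto simp: inj_on_def case_prod_unfold)
  finally show ?thesis .
qed

definition standard_fillings :: "(nat \<times> nat) set \<Rightarrow> nat \<Rightarrow> (nat \<times> nat \<Rightarrow> nat) set" where
  "standard_fillings D n = {T \<in> extensional D. bij_betw T D {1..n} \<and>
     (\<forall>i j. (i, j) \<in> D \<and> (i, j + 1) \<in> D \<longrightarrow> T (i, j) < T (i, j + 1)) \<and>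
     (\<forall>i j. (i, j) \<in> D \<and> (i + 1, j) \<in> D \<longrightarrow> T (i, j) < T (i + 1, j))}"

lemma finite_standard_fillings: "finite D \<Longrightarrow> finite (standard_fillings D n)"
proof (rule finite_subset[of _ "PiE D (\<lambda>_. {1..n})"])
  show "standard_fillings D n \<subseteq> PiE D (\<lambda>_. {1..n})"
    by (auto simp: standard_fillings_def PiE_def bij_betw_def)
qed (auto intro: finite_PiE)

lemma standard_fillings_le: "T \<in> standard_fillings D n \<Longrightarrow> b \<in> D \<Longrightarrow> T b \<le> n"
  by (auto simp: standard_fillings_def bij_betw_def)

lemma standard_fillings_increasing:
  assumes "T \<in> standard_fillings D n" "(i, j) \<in> D"
  shows "(i, j + 1) \<in> D \<Longrightarrow> T (i, j) < T (i, j + 1)" "(i + 1, j) \<in> D \<Longrightarrow> T (i, j) < T (i + 1, j)"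
  using assms unfolding standard_fillings_def by blast+

lemma restrict_standard_filling:
  assumes b: "b \<in> D" and T: "T \<in> standard_fillings D (Suc n)" "T b = Suc n"
  shows "restrict T (D - {b}) \<in> standard_fillings (D - {b}) n"
proof -
  have "bij_betw T D {1..Suc n}" using T by (simp add: standard_fillings_def)
  then have "bij_betw T (D - {b}) ({1..Suc n} - {Suc n})"
    using inj_on_image_set_diff[of T D D "{b}"] b T(2) by (auto simp: bij_betw_def inj_on_diff)
  moreover have "{1..Suc n} - {Suc n} = {1..n}" by auto
  ultimately have "bij_betw T (D - {b}) {1..n}" by simp
  then have "bij_betw (restrict T (D - {b})) (D - {b}) {1..n}"
    by (subst bij_betw_cong[where g = T]) auto
  then show ?thesis using T(1) by (auto simp: standard_fillings_def)
qed

lemma extend_standard_filling: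
  assumes b: "(r, c) \<in> D" and out: "(r, c + 1) \<notin> D" "(r + 1, c) \<notin> D"
    and T: "T \<in> standard_fillings (D - {(r, c)}) n"
  shows "T((r, c) := Suc n) \<in> standard_fillings D (Suc n)"
proof -
  let ?b = "(r, c)" and ?E = "D - {(r, c)}" and ?S = "T((r, c) := Suc n)"
  have "bij_betw T ?E {1..n}" using T by (simp add: standard_fillings_def)
  then have "bij_betw ?S ?E {1..n}" by (subst bij_betw_cong[where g = T]) auto
  then have "bij_betw ?S (?E \<union> {?b}) ({1..n} \<union> {Suc n})"
    using notIn_Un_bij_betw[of ?b ?E ?S "{1..n}"] by simp
  moreover have "?E \<union> {?b} = D" "{1..n} \<union> {Suc n} = {1..Suc n}" using b by auto
  ultimately have "bij_betw ?S D {1..Suc n}" by simp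
  moreover have increasing: "?S x < ?S y"
    if "x \<in> D" "y \<in> D" "x \<noteq> ?b" "x \<in> ?E \<Longrightarrow> y \<in> ?E \<Longrightarrow> T x < T y" for x y
    using that standard_fillings_le[OF T, of x] by (cases "y = ?b") auto
  have "?S (i, j) < ?S (i, j + 1)" if "(i, j) \<in> D" "(i, j + 1) \<in> D" for i j
    by (rule increasing) (use that out standard_fillings_increasing(1)[OF T] in auto)
  moreover have "?S (i, j) < ?S (i + 1, j)" if "(i, j) \<in> D" "(i + 1, j) \<in> D" for i j
    by (rule increasing) (use that out standard_fillings_increasing(2)[OF T] in auto)
  moreover have "?S \<in> extensional D" using T b by (auto simp: standard_fillings_def extensional_def)
  ultimately show ?thesis by (simp add: standard_fillings_def del: fun_upd_apply)
qed

lemma card_standard_fillings_largest_at_corner: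
  assumes b: "(r, c) \<in> D" and out: "(r, c + 1) \<notin> D" "(r + 1, c) \<notin> D"
  shows "card {T \<in> standard_fillings D (Suc n). T (r, c) = Suc n} =
      card (standard_fillings (D - {(r, c)}) n)"
proof -
  let ?E = "D - {(r, c)}" and ?A = "{T \<in> standard_fillings D (Suc n). T (r, c) = Suc n}"
  let ?f = "\<lambda>T. restrict T ?E" and ?g = "\<lambda>T. T((r, c) := Suc n)"
  have "bij_betw ?f ?A (standard_fillings ?E n)"
  proof (rule bij_betw_byWitness[where f' = ?g])
    show "\<forall>T\<in>?A. ?g (?f T) = T"
      using b by (auto simp: standard_fillings_def fun_eq_iff extensional_def restrict_def)
    show "\<forall>T\<in>standard_fillings ?E n. ?f (?g T) = T"
      by (auto simp: standard_fillings_def fun_eq_iff extensional_def restrict_def)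
    show "?f ` ?A \<subseteq> standard_fillings ?E n" using restrict_standard_filling[OF b] by auto
    show "?g ` standard_fillings ?E n \<subseteq> ?A" using extend_standard_filling[OF b out] by auto
  qed
  then show ?thesis by (rule bij_betw_same_card)
qed

lemma largest_entry_at_removable_corner:
  assumes T: "T \<in> standard_fillings (diagram_boxes p) (Suc n)"
  shows "\<exists>r\<in>removable p. T (Suc r, p r) = Suc n"
proof -
  have "Suc n \<in> T ` diagram_boxes p" using T by (simp add: standard_fillings_def bij_betw_def)
  then obtain i j where ij: "(i, j) \<in> diagram_boxes p" "T (i, j) = Suc n" by auto
  then obtain r where r: "i = Suc r" by (cases i) (auto simp: diagram_boxes_def)
  have "(i, j + 1) \<notin> diagram_boxes p" "(i + 1, j) \<notin> diagram_boxes p"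
    using standard_fillings_increasing[OF T ij(1)] standard_fillings_le[OF T] ij(2)
    by (auto simp: not_less[symmetric])
  then have "j = p r" "r \<in> removable p" using ij r by (auto simp: diagram_boxes_def removable_def)
  then show ?thesis using ij r by auto
qed

lemma card_standard_fillings_branching:
  assumes p: "p \<in> partition_seqs (Suc n)"
  shows "card (standard_fillings (diagram_boxes p) (Suc n)) =
    (\<Sum>r\<in>removable p. card (standard_fillings (diagram_boxes (remove_box p r)) n))"
proof -
  let ?F = "standard_fillings (diagram_boxes p) (Suc n)"
  let ?A = "\<lambda>r. {T \<in> ?F. T (Suc r, p r) = Suc n}"
  have corner: "(Suc r, p r) \<in> diagram_boxes p" if "r \<in> removable p" for r
    using that by (auto simp: diagram_boxes_def removable_def)
  have cover: "?F = (\<Union>r\<in>removable p. ?A r)" using largest_entry_at_removable_corner by fast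
  have disjoint: "?A r \<inter> ?A s = {}" if "r \<in> removable p" "s \<in> removable p" "r \<noteq> s" for r s
  proof (rule equals0I)
    fix T assume "T \<in> ?A r \<inter> ?A s"
    moreover from this have "inj_on T (diagram_boxes p)"
      by (simp add: standard_fillings_def bij_betw_def)
    ultimately have "(Suc r, p r) = (Suc s, p s)"
      using corner[OF that(1)] corner[OF that(2)] by (intro inj_onD[of T "diagram_boxes p"]) auto
    then show False using that by simp
  qed
  have "card ?F = card (\<Union>r\<in>removable p. ?A r)" by (rule arg_cong[OF cover])
  also have "\<dots> = (\<Sum>r\<in>removable p. card (?A r))"
    using finite_removable[OF p] finite_standard_fillings[OF finite_diagram_boxes[OF p]] disjoint
    by (intro card_UN_disjoint) auto
  also have "\<dots> = (\<Sum>r\<in>removable p. card (standard_fillings (diagram_boxes (remove_box p r)) n))"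
  proof (rule sum.cong[OF refl])
    fix r assume r: "r \<in> removable p"
    have "diagram_boxes p - {(Suc r, p r)} = diagram_boxes (remove_box p r)"
      by (auto simp: diagram_boxes_def remove_box_def split: if_splits)
    moreover have "(Suc r, p r + 1) \<notin> diagram_boxes p" "(Suc r + 1, p r) \<notin> diagram_boxes p"
      using r by (auto simp: diagram_boxes_def removable_def)
    ultimately show "card (?A r) = card (standard_fillings (diagram_boxes (remove_box p r)) n)"
      using card_standard_fillings_largest_at_corner[OF corner[OF r], of n] by simp
  qed
  finally show ?thesis .
qed

lemma card_standard_fillings:
  "p \<in> partition_seqs n \<Longrightarrow> real (card (standard_fillings (diagram_boxes p) n)) = fdim p"
proof (induction n arbitrary: p)
  case 0
  then have p: "p = (\<lambda>_. 0)" by (simp add: partition_seqs_0)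
  then have "diagram_boxes p = {}" by (auto simp: diagram_boxes_def)
  then have "standard_fillings (diagram_boxes p) 0 = {\<lambda>_. undefined}"
    by (auto simp: standard_fillings_def bij_betw_def)
  then show ?case by (simp add: p fdim_zero)
next
  case (Suc n)
  then show ?case
    using card_standard_fillings_branching[OF Suc.prems] fdim_branching[OF Suc.prems]
      remove_box_partition_seqs[OF Suc.prems] by simp
qed

lemma num_syt_eq_fdim:
  assumes "\<mu> \<in> partitions n"
  shows "real (num_syt \<mu>) = fdim (part_seq \<mu>)"
proof -
  have "standard_young_tableaux \<mu> = standard_fillings (diagram_boxes (part_seq \<mu>)) n"
    unfolding standard_young_tableaux_def standard_fillings_def young_diagram_eq
    using assms by (simp add: partitions_def)
  then show ?thesis
    unfolding num_syt_def using card_standard_fillings[OF part_seq_partition_seqs[OF assms]] by simp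
qed

lemma content_sum_eq_total_content:
  assumes "\<mu> \<in> partitions n"
  shows "real_of_int (content_sum \<mu>) = total_content (part_seq \<mu>)"
  unfolding content_sum_def total_content_def young_diagram_eq
    sum_contents_eq_sum_diagram_boxes[OF part_seq_partition_seqs[OF assms]]
  by (simp add: case_prod_unfold)

section \<open>Integrals of exponentials over the sine\<close>

lemma has_integral_real_derivative:
  fixes F f :: "real \<Rightarrow> real"
  assumes "a \<le> b" "\<And>x. x \<in> {a..b} \<Longrightarrow> (F has_real_derivative f x) (at x within {a..b})"
  shows "(f has_integral (F b - F a)) {a..b}"
  by (rule fundamental_theorem_of_calculus)
    (use assms in \<open>simp_all add: has_real_derivative_iff_has_vector_derivative\<close>)

lemma minus_half_pi_le: "- pi / 2 \<le> pi / 2"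
  using pi_gt_zero by linarith

lemma has_integral_sin_power_Suc_Suc:
  assumes "((\<lambda>t. sin t ^ n) has_integral W) {- pi / 2..pi / 2}"
  shows "((\<lambda>t. sin t ^ (n + 2)) has_integral (real (n + 1) / real (n + 2) * W)) {- pi / 2..pi / 2}"
proof -
  have "((\<lambda>t. real (n + 2) * sin t ^ (n + 2) - real (n + 1) * sin t ^ n) has_integral
      (- cos (pi / 2) * sin (pi / 2) ^ (n + 1)) - (- cos (- pi / 2) * sin (- pi / 2) ^ (n + 1)))
      {- pi / 2..pi / 2}"
  proof (rule has_integral_real_derivative[OF minus_half_pi_le])
    fix t :: real
    have cos_sq: "cos t * cos t = 1 - sin t * sin t"
      using sin_cos_squared_add[of t] by (simp add: power2_eq_square)
    have "((\<lambda>t. - cos t * sin t ^ (n + 1)) has_real_derivative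
        sin t * sin t ^ (n + 1) - real (n + 1) *
            (sin t ^ n * (cos t * cos t))) (at t within {- pi / 2..pi / 2})"
      by (rule derivative_eq_intros refl)+ (simp add: algebra_simps)
    moreover have "sin t * sin t ^ (n + 1) - real (n + 1) * (sin t ^ n * (cos t * cos t)) =
        real (n + 2) * sin t ^ (n + 2) - real (n + 1) * sin t ^ n"
      unfolding cos_sq by (simp add: algebra_simps)
    ultimately show "((\<lambda>t. - cos t * sin t ^ (n + 1)) has_real_derivative
        real (n + 2) * sin t ^ (n + 2) - real (n + 1) * sin t ^ n) (at t within {- pi / 2..pi / 2})"
          by simp
  qed
  then have "((\<lambda>t. real (n + 2) * sin t ^ (n + 2) - real (n + 1) * sin t ^ n) has_integral
      0) {- pi / 2..pi / 2}"
    by simp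
  from has_integral_add[OF this has_integral_mult_right[OF assms, of "real (n + 1)"]]
  have "((\<lambda>t. real (n + 2) * sin t ^ (n + 2)) has_integral (real (n + 1) * W)) {- pi / 2..pi / 2}"
    by simp
  then show ?thesis
    using has_integral_cmul_iff[of "real (n + 2)" "\<lambda>t. sin t ^ (n + 2)" "real (n + 1) / real (n + 2) * W"]
    by (simp del: of_nat_add power_Suc)
qed

lemma has_integral_sin_power_even:
  "((\<lambda>t. sin t ^ (2 * k)) has_integral (pi * fact (2 * k) / (4 ^ k * (fact k)\<^sup>2))) {- pi / 2..pi / 2}"
proof (induction k)
  case 0
  show ?case using has_integral_const_real[of "1::real" "- pi / 2" "pi / 2"] pi_gt_zero by simp
next
  case (Suc k)
  have "real (2 * k + 1) / real (2 * k + 2) * (pi * fact (2 * k) / (4 ^ k * (fact k)\<^sup>2)) =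
      pi * fact (2 * Suc k) / (4 ^ Suc k * (fact (Suc k))\<^sup>2)"
    by (simp add: power2_eq_square divide_simps) (simp add: algebra_simps)
  then show ?case using has_integral_sin_power_Suc_Suc[OF Suc] by simp
qed

lemma has_integral_sin_power_odd: "((\<lambda>t. sin t ^ (2 * k + 1)) has_integral 0) {- pi / 2..pi / 2}"
proof (induction k)
  case 0
  have "(sin has_integral (- cos (pi / 2) - - cos (- pi / 2))) {- pi / 2..pi / 2}"
    by (rule has_integral_real_derivative[OF minus_half_pi_le]) (auto intro!: derivative_eq_intros)
  then show ?case by simp
next
  case (Suc k)
  then show ?case using has_integral_sin_power_Suc_Suc[OF Suc] by simp
qed

definition bessel_I0 :: "real \<Rightarrow> real" where
  "bessel_I0 x = (\<Sum>k. ((x / 2) ^ k / fact k)\<^sup>2)"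

lemma power_div_fact_sq: "(a ^ k / fact k)\<^sup>2 = (a\<^sup>2) ^ k / (fact k)\<^sup>2" for a :: real
  by (simp add: power_divide power_mult[symmetric] mult.commute)

lemma bessel_I0_sums: "(\<lambda>k. ((x / 2) ^ k / fact k)\<^sup>2) sums bessel_I0 x"
proof -
  have "summable (\<lambda>k. ((x / 2) ^ k / fact k)\<^sup>2)"
  proof (rule summable_comparison_test)
    show "summable (\<lambda>k. inverse (fact k) * ((x / 2)\<^sup>2) ^ k)" by (rule summable_exp)
    have "((x / 2) ^ k / fact k)\<^sup>2 \<le> inverse (fact k) * ((x / 2)\<^sup>2) ^ k" for k
    proof -
      have "inverse (fact k) * ((x / 2)\<^sup>2) ^ k * inverse (fact k) \<le> inverse (fact k) * ((x / 2)\<^sup>2) ^ k"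
        using fact_ge_1[of k, where 'a = real] by (intro mult_left_le) (simp_all add: inverse_le_1_iff)
      then show ?thesis
        unfolding power_div_fact_sq power2_eq_square[of "fact k"]
        by (simp only: divide_inverse inverse_mult_distrib mult_ac)
    qed
    then have "norm (((x / 2) ^ k / fact k)\<^sup>2) \<le> inverse (fact k) * ((x / 2)\<^sup>2) ^ k" for k
      unfolding real_norm_def abs_power2 .
    then show "\<exists>N. \<forall>n\<ge>N. norm (((x / 2) ^ n / fact n)\<^sup>2) \<le> inverse (fact n) * ((x / 2)\<^sup>2) ^ n" by blast
  qed
  then show ?thesis by (simp add: bessel_I0_def summable_sums)
qed

lemma has_integral_exp_sin_terms:
  "((\<lambda>t. (x * sin t) ^ (2 * k) /\<^sub>R fact (2 * k)) has_integral
      pi * ((x / 2) ^ k / fact k)\<^sup>2) {- pi / 2..pi / 2}"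
  "((\<lambda>t. (x * sin t) ^ (2 * k + 1) /\<^sub>R fact (2 * k + 1)) has_integral 0) {- pi / 2..pi / 2}"
proof -
  have term_eq: "(x * sin t) ^ n /\<^sub>R fact n = x ^ n / fact n * sin t ^ n" for t n
    by (simp add: power_mult_distrib divide_inverse)
  have "x ^ (2 * k) / fact (2 * k) * (pi * fact (2 * k) / (4 ^ k * (fact k)\<^sup>2)) =
      pi * ((x / 2) ^ k / fact k)\<^sup>2"
    unfolding power_div_fact_sq by (simp add: power_mult power_divide)
  then show "((\<lambda>t. (x * sin t) ^ (2 * k) /\<^sub>R fact (2 * k)) has_integral pi * ((x / 2) ^ k / fact k)\<^sup>2)
      {- pi / 2..pi / 2}"
    unfolding term_eq
    using has_integral_mult_right[OF has_integral_sin_power_even[of k], of "x ^ (2 * k) / fact (2 * k)"] by simp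
  show "((\<lambda>t. (x * sin t) ^ (2 * k + 1) /\<^sub>R fact (2 * k + 1)) has_integral 0) {- pi / 2..pi / 2}"
    unfolding term_eq
    using has_integral_mult_right[OF has_integral_sin_power_odd[of k], of "x ^ (2 * k + 1) / fact (2 * k + 1)"]
    by simp
qed

lemma has_integral_exp_sin: "((\<lambda>t. exp (x * sin t)) has_integral (pi * bessel_I0 x)) {- pi / 2..pi / 2}"
proof -
  define f where "f n t = (x * sin t) ^ n /\<^sub>R fact n" for n t
  have "uniform_limit {- pi / 2..pi / 2} (\<lambda>n t. \<Sum>i<n. f i t) (\<lambda>t. \<Sum>i. f i t) sequentially"
  proof (rule Weierstrass_m_test)
    show "summable (\<lambda>n. inverse (fact n) * \<bar>x\<bar> ^ n)" by (rule summable_exp)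
    fix n t
    have "\<bar>x * sin t\<bar> ^ n \<le> \<bar>x\<bar> ^ n" by (intro power_mono) (auto simp: abs_mult mult_left_le)
    then show "norm (f n t) \<le> inverse (fact n) * \<bar>x\<bar> ^ n" by (simp add: f_def power_abs abs_mult)
  qed
  moreover have "(\<lambda>t. \<Sum>i. f i t) = (\<lambda>t. exp (x * sin t))" by (simp add: exp_def f_def)
  ultimately have "uniform_limit {- pi / 2..pi / 2} (\<lambda>n t. \<Sum>i<n. f i t) (\<lambda>t. exp (x *
      sin t)) sequentially" by simp
  then obtain I J where I: "\<And>n. ((\<lambda>t. \<Sum>i<n. f i t) has_integral I n) {- pi / 2..pi / 2}"
    and J: "((\<lambda>t. exp (x * sin t)) has_integral J) {- pi / 2..pi / 2}" and lim: "I \<longlonglongrightarrow> J"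
    by (rule uniform_limit_integral) (auto intro!: continuous_intros simp: f_def)
  have even_partial_sums: "I (2 * N) = pi * (\<Sum>k<N. ((x / 2) ^ k / fact k)\<^sup>2)" for N
  proof (rule has_integral_unique[OF I])
    show "((\<lambda>t. \<Sum>i<2 * N. f i t) has_integral pi * (\<Sum>k<N. ((x / 2) ^ k / fact k)\<^sup>2)) {- pi / 2..pi / 2}"
    proof (induction N)
      case (Suc N)
      from has_integral_add[OF has_integral_add[OF Suc has_integral_exp_sin_terms(1)] has_integral_exp_sin_terms(2)]
      show ?case by (simp add: f_def distrib_left)
    qed simp
  qed
  have "(\<lambda>N. I (2 * N)) \<longlonglongrightarrow> J"
    using LIMSEQ_subseq_LIMSEQ[OF lim, of "\<lambda>N. 2 * N"] by (simp add: o_def strict_mono_def)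
  moreover have "(\<lambda>N. I (2 * N)) \<longlonglongrightarrow> pi * bessel_I0 x"
    unfolding even_partial_sums
    using bessel_I0_sums[of x] by (intro tendsto_intros) (simp add: sums_def)
  ultimately show ?thesis using J LIMSEQ_unique by blast
qed

section \<open>The limit shape and its exponential moments\<close>

lemma limit_shape_sin:
  assumes "t \<in> {- pi / 2..pi / 2}"
  shows "limit_shape (2 * sin t) = 4 / pi * (t * sin t + cos t)"
proof -
  have "0 \<le> cos t" using assms by (intro cos_ge_zero) auto
  have "4 - (2 * sin t)\<^sup>2 = (2 * cos t)\<^sup>2" by (simp add: power_mult_distrib cos_squared_eq)
  then have "sqrt (4 - (2 * sin t)\<^sup>2) = \<bar>2 * cos t\<bar>" by (simp only: real_sqrt_abs)
  moreover have "arcsin (sin t) = t" using assms by (intro arcsin_sin) auto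
  moreover have "\<bar>2 * sin t\<bar> \<le> 2" using abs_sin_le_one[of t] by (simp add: abs_mult)
  ultimately show ?thesis using \<open>0 \<le> cos t\<close> by (simp add: limit_shape_def field_simps)
qed

lemma limit_shape_outer: "2 \<le> \<bar>x\<bar> \<Longrightarrow> limit_shape x = \<bar>x\<bar>"
proof (cases "\<bar>x\<bar> = 2")
  case True
  then have "x = 2 \<or> x = -2" by linarith
  then show ?thesis by (auto simp: limit_shape_def)
qed (simp add: limit_shape_def)

lemma limit_shape_minus: "limit_shape (- x) = limit_shape x"
proof (cases "\<bar>x\<bar> \<le> 2")
  case True
  then have "arcsin (- (x / 2)) = - arcsin (x / 2)" by (intro arcsin_minus) auto
  then show ?thesis by (simp add: limit_shape_def)
qed (simp add: limit_shape_def)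

lemma limit_shape_greater:
  assumes "0 \<le> x" "x < 2"
  shows "x < limit_shape x"
proof -
  define t where "t = arcsin (x / 2)"
  have t: "0 \<le> t" "t < pi / 2"
    using assms arcsin_lt_bounded[of "x / 2"] arcsin_le_arcsin[of 0 "x / 2"] by (auto simp: t_def)
  have x: "x = 2 * sin t" using assms by (simp add: t_def)
  define s where "s = pi / 2 - t"
  have s: "0 < s" "s \<le> pi / 2" using t by (auto simp: s_def)
  have "sin 0 - 0 * cos 0 < sin s - s * cos s"
  proof (rule DERIV_pos_imp_increasing_open[OF s(1)])
    fix y assume y: "0 < y" "y < s"
    have "((\<lambda>y. sin y - y * cos y) has_real_derivative y * sin y) (at y)"
      by (auto intro!: derivative_eq_intros)
    moreover have "0 < y * sin y" using y s by (intro mult_pos_pos sin_gt_zero) auto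
    ultimately show "\<exists>z. ((\<lambda>y. sin y - y * cos y) has_real_derivative z) (at y) \<and> 0 < z" by blast
  qed (auto intro!: continuous_intros)
  then have "(pi / 2 - t) * sin t < cos t" by (simp add: s_def sin_diff cos_diff)
  then have "4 / pi * (pi / 2 * sin t) < 4 / pi * (t * sin t + cos t)"
    by (intro mult_strict_left_mono) (auto simp: algebra_simps)
  moreover have "t \<in> {- pi / 2..pi / 2}" using t by auto
  ultimately show ?thesis unfolding x using limit_shape_sin[of t] by simp
qed

lemma continuous_on_limit_shape_inner: "continuous_on {-2..2} limit_shape"
proof -
  have "continuous_on {-2..2} (\<lambda>x. 2 / pi * (x * arcsin (x / 2) + sqrt (4 - x\<^sup>2)))"
    by (intro continuous_intros) auto
  then show ?thesis
    by (rule continuous_on_eq) (auto simp: limit_shape_def)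
qed

lemma limit_shape_has_derivative_inner:
  assumes z: "- 2 < z" "z < 2"
  shows "(limit_shape has_real_derivative (2 / pi * arcsin (z / 2))) (at z)"
proof -
  have "z\<^sup>2 < 2\<^sup>2" using z by (intro power2_strict_mono) auto
  then have pos: "0 < 4 - z\<^sup>2" by simp
  have circle: "1 - (z / 2)\<^sup>2 = (4 - z\<^sup>2) / 2\<^sup>2" by (simp add: power_divide diff_divide_distrib)
  have root: "sqrt (1 - (z / 2)\<^sup>2) = sqrt (4 - z\<^sup>2) / 2" unfolding circle real_sqrt_divide by simp
  have arcsin: "((\<lambda>z. arcsin (z / 2)) has_real_derivative
      (inverse (sqrt (1 - (z / 2)\<^sup>2)) * (1 / 2))) (at z)"
    by (rule DERIV_chain2[OF DERIV_arcsin]) (use z in \<open>auto intro!: derivative_eq_intros\<close>)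
  have sqrt: "((\<lambda>z. sqrt (4 - z\<^sup>2)) has_real_derivative
      (inverse (sqrt (4 - z\<^sup>2)) / 2 * (- (2 * z)))) (at z)"
    by (rule DERIV_chain2[where f = sqrt and g = "\<lambda>z. 4 - z\<^sup>2", OF DERIV_real_sqrt[OF pos]])
      (auto intro!: derivative_eq_intros)
  have "inverse (sqrt (1 - (z / 2)\<^sup>2)) * (1 / 2) * z + inverse (sqrt (4 - z\<^sup>2)) / 2 * (- (2 * z)) = 0"
    unfolding root using pos by (simp add: field_simps)
  then have "((\<lambda>z. 2 / pi * (z * arcsin (z / 2) + sqrt (4 - z\<^sup>2))) has_real_derivative
      2 / pi * arcsin (z / 2)) (at z)"
    using DERIV_cmult[OF DERIV_add[OF DERIV_mult[OF DERIV_ident arcsin] sqrt], of "2 / pi"]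
    by (simp only: add.assoc add_0_right mult_1_left)
  moreover have "eventually (\<lambda>x. x \<in> {- 2<..<2}) (nhds z)"
    using z by (intro eventually_nhds_in_open) auto
  then have "eventually (\<lambda>x. limit_shape x = 2 / pi * (x * arcsin (x / 2) + sqrt (4 - x\<^sup>2))) (nhds z)"
    by eventually_elim (auto simp: limit_shape_def)
  ultimately show ?thesis by (subst DERIV_cong_ev) auto
qed

lemma limit_shape_lipschitz: "1-lipschitz_on UNIV limit_shape"
proof -
  have "1-lipschitz_on {- 2<..<2} limit_shape"
  proof (rule bounded_derivative_imp_lipschitz)
    fix z :: real assume z: "z \<in> {- 2<..<2}"
    have bounds: "- pi / 2 \<le> arcsin (z / 2)" "arcsin (z / 2) \<le> pi / 2"
      using arcsin_bounded[of "z / 2"] z by auto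
    show "(limit_shape has_derivative (*) (2 / pi * arcsin (z / 2))) (at z within {- 2<..<2})"
      using limit_shape_has_derivative_inner[of z] z
      by (auto simp: has_field_derivative_def intro: has_derivative_at_withinI)
    show "onorm ((*) (2 / pi * arcsin (z / 2))) \<le> 1"
    proof (rule onorm_le)
      fix y :: real
      have "\<bar>2 / pi * arcsin (z / 2)\<bar> \<le> 1" using bounds by (auto simp: abs_le_iff field_simps)
      then have "\<bar>2 / pi * arcsin (z / 2)\<bar> * \<bar>y\<bar> \<le> 1 * \<bar>y\<bar>" by (rule mult_right_mono) simp
      then show "norm (2 / pi * arcsin (z / 2) * y) \<le> 1 * norm y" unfolding real_norm_def abs_mult .
    qed
  qed auto
  then have inner: "1-lipschitz_on {- 2..2} limit_shape"
    using lipschitz_on_closure[of 1 "{- 2<..<2::real}" limit_shape] continuous_on_limit_shape_inner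
    by simp
  have "1-lipschitz_on {u..v} limit_shape" for u v :: real
  proof (rule lipschitz_on_closed_Union[where I = "{- 1, 0, 1 :: int}" and
        U = "\<lambda>i. if i = - 1 then {..- 2} else if i = 0 then {- 2..2} else {2..}"])
    fix i :: int assume "i \<in> {- 1, 0, 1}"
    then show "1-lipschitz_on (if i = - 1 then {..- 2} else if i =
        0 then {- 2..2} else {2..}) limit_shape"
      using inner by (auto intro!: lipschitz_onI simp: dist_real_def limit_shape_outer)
  qed auto
  then show ?thesis by (rule lipschitz_on_UNIV_if_intervals)
qed

lemma has_integral_limit_shape_exp:
  assumes "a \<noteq> 0"
  shows "((\<lambda>x. limit_shape x * exp (a * x)) has_integral
    (2 * (exp (2 * a) - exp (- 2 * a)) / a - (exp (2 * a) + exp (- 2 * a)) / a\<^sup>2 +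
        2 * bessel_I0 (2 * a) / a\<^sup>2)) {-2..2}"
proof -
  let ?T = "{- pi / 2..pi / 2}" and ?w = "\<lambda>t. exp (2 * a * sin t)"
  define F where "F t = 4 / pi * (t * sin t + cos t) * ?w t / a - 2 / (pi * a\<^sup>2) * (t * ?w t)" for t
  have parts: "((\<lambda>t. (2 * cos t) * (4 / pi * (t * sin t + cos t)) * ?w t - 2 / (pi * a\<^sup>2) *
      ?w t) has_integral
      F (pi / 2) - F (- pi / 2)) ?T"
  proof (rule has_integral_real_derivative[OF minus_half_pi_le])
    fix t :: real
    show "(F has_real_derivative
        (2 * cos t) * (4 / pi * (t * sin t + cos t)) * ?w t - 2 / (pi * a\<^sup>2) * ?w t) (at t within ?T)"
      unfolding F_def
      using assms by (auto intro!: derivative_eq_intros) (simp add: field_simps power2_eq_square)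
  qed
  have "((\<lambda>t. (2 * cos t) * (4 / pi * (t * sin t + cos t)) * ?w t) has_integral
      F (pi / 2) - F (- pi / 2) + 2 / (pi * a\<^sup>2) * (pi * bessel_I0 (2 * a))) ?T"
    using has_integral_add[OF parts has_integral_mult_right[OF has_integral_exp_sin[of "2 * a"], of "2 / (pi * a\<^sup>2)"]]
    by simp
  then have substituted: "((\<lambda>t. (2 * cos t) *\<^sub>R (limit_shape (2 * sin t) *
      exp (a * (2 * sin t)))) has_integral
      F (pi / 2) - F (- pi / 2) + 2 / (pi * a\<^sup>2) * (pi * bessel_I0 (2 * a))) ?T"
    by (rule has_integral_eq[rotated]) (subst limit_shape_sin, assumption, simp add: mult.commute
        mult.left_commute)
  have "((\<lambda>t. (2 * cos t) *\<^sub>R (limit_shape (2 * sin t) * exp (a * (2 * sin t)))) has_integral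
      integral {2 * sin (- pi / 2)..2 * sin (pi / 2)} (\<lambda>x. limit_shape x * exp (a * x))) ?T"
    by (rule has_integral_substitution[where c = "-2" and d = 2])
      (use minus_half_pi_le in
        \<open>auto intro!: derivative_eq_intros continuous_intros continuous_on_limit_shape_inner\<close>)
  from has_integral_unique[OF this substituted]
  have "integral {-2..2} (\<lambda>x. limit_shape x * exp (a * x)) =
      F (pi / 2) - F (- pi / 2) + 2 / (pi * a\<^sup>2) * (pi * bessel_I0 (2 * a))" by simp
  also have "\<dots> = 2 * (exp (2 * a) - exp (- 2 * a)) / a - (exp (2 * a) + exp (- 2 * a)) / a\<^sup>2
      + 2 * bessel_I0 (2 * a) / a\<^sup>2"
    unfolding F_def using assms by (simp add: field_simps power2_eq_square)
  finally have "integral {-2..2} (\<lambda>x. limit_shape x * exp (a * x)) = \<dots>" .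
  moreover have "(\<lambda>x. limit_shape x * exp (a * x)) integrable_on {-2..2}"
    by (intro integrable_continuous_real continuous_intros continuous_on_limit_shape_inner)
  ultimately show ?thesis using integrable_integral by fastforce
qed

lemma has_integral_abs_exp:
  fixes a b :: real
  assumes "a \<noteq> 0" "0 \<le> b"
  shows "((\<lambda>x. \<bar>x\<bar> * exp (a * x)) has_integral
    (b * (exp (b * a) - exp (- b * a)) / a - (exp (b * a) + exp (- b * a)) / a\<^sup>2 + 2 / a\<^sup>2)) {- b..b}"
proof -
  define F where "F x = x * exp (a * x) / a - exp (a * x) / a\<^sup>2" for x :: real
  have deriv: "(F has_real_derivative x * exp (a * x)) (at x within S)" for x S
    unfolding F_def
    using assms by (auto intro!: derivative_eq_intros simp: field_simps power2_eq_square)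
  have "((\<lambda>x. x * exp (a * x)) has_integral (F b - F 0)) {0..b}"
    by (rule has_integral_real_derivative[OF assms(2)]) (rule deriv)
  then have right: "((\<lambda>x. \<bar>x\<bar> * exp (a * x)) has_integral (F b - F 0)) {0..b}"
    by (rule has_integral_eq[rotated]) auto
  have "((\<lambda>x. x * exp (a * x)) has_integral (F 0 - F (- b))) {- b..0}"
    by (rule has_integral_real_derivative) (use assms deriv in auto)
  then have "((\<lambda>x. - (x * exp (a * x))) has_integral - (F 0 - F (- b))) {- b..0}"
    by (rule has_integral_neg)
  then have left: "((\<lambda>x. \<bar>x\<bar> * exp (a * x)) has_integral - (F 0 - F (- b))) {- b..0}"
    by (rule has_integral_eq[rotated]) auto
  have "- (F 0 - F (- b)) + (F b - F 0) =
      b * (exp (b * a) - exp (- b * a)) / a - (exp (b * a) + exp (- b * a)) / a\<^sup>2 + 2 / a\<^sup>2"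
    using assms by (simp add: F_def field_simps power2_eq_square)
  then show ?thesis using has_integral_combine[OF _ _ left right] assms by simp
qed

lemma has_integral_limit_shape_excess:
  assumes "a \<noteq> 0" "2 \<le> b"
  shows "((\<lambda>x. (limit_shape x - \<bar>x\<bar>) * exp (a * x)) has_integral
      (2 * (bessel_I0 (2 * a) - 1) / a\<^sup>2)) {- b..b}"
proof (rule has_integral_on_superset)
  show "((\<lambda>x. (limit_shape x - \<bar>x\<bar>) * exp (a * x)) has_integral
      (2 * (bessel_I0 (2 * a) - 1) / a\<^sup>2)) {- 2..2}"
    using has_integral_diff[OF has_integral_limit_shape_exp[OF assms(1)] has_integral_abs_exp[OF assms(1), of 2]]
    by (simp add: left_diff_distrib right_diff_distrib diff_divide_distrib)
qed (use assms in \<open>auto simp: limit_shape_outer\<close>)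

lemma has_integral_tent_exp:
  assumes "b \<noteq> 0"
  shows "((\<lambda>y. tent y * exp (b * y)) has_integral (laplacian_eigenvalue b / b\<^sup>2)) {- 1..1}"
proof -
  define F where "F s y = (1 + s * y) * exp (b * y) / b - s * exp (b * y) / b\<^sup>2" for s y
  have deriv: "(F s has_real_derivative (1 + s * y) * exp (b * y)) (at y within S)" for s y S
    unfolding F_def
    using assms by (auto intro!: derivative_eq_intros simp: field_simps power2_eq_square)
  have "((\<lambda>y. (1 + 1 * y) * exp (b * y)) has_integral (F 1 0 - F 1 (- 1))) {- 1..0}"
    by (rule has_integral_real_derivative) (simp, rule deriv)
  then have left: "((\<lambda>y. tent y * exp (b * y)) has_integral (F 1 0 - F 1 (- 1))) {- 1..0}"
    by (rule has_integral_eq[rotated]) (auto simp: tent_def)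
  have "((\<lambda>y. (1 + - 1 * y) * exp (b * y)) has_integral (F (- 1) 1 - F (- 1) 0)) {0..1}"
    by (rule has_integral_real_derivative) (simp, rule deriv)
  then have right: "((\<lambda>y. tent y * exp (b * y)) has_integral (F (- 1) 1 - F (- 1) 0)) {0..1}"
    by (rule has_integral_eq[rotated]) (auto simp: tent_def)
  have "F 1 0 - F 1 (- 1) + (F (- 1) 1 - F (- 1) 0) = laplacian_eigenvalue b / b\<^sup>2"
    using assms by (simp add: F_def laplacian_eigenvalue_def field_simps)
  then show ?thesis using has_integral_combine[OF _ _ left right] by simp
qed

lemma has_integral_scaled_tent_exp:
  assumes r: "0 < r" and a: "a \<noteq> 0" and c: "\<bar>c\<bar> + 1 \<le> b * r"
  shows "((\<lambda>x. tent (x * r - c) * exp (a * x)) has_integral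
    (r / a\<^sup>2 * (exp (a / r * c) * laplacian_eigenvalue (a / r)))) {- b..b}"
proof (rule has_integral_on_superset)
  have "((\<lambda>x. tent (r *\<^sub>R x + - c) * exp (a / r * (r *\<^sub>R x + - c))) has_integral
      (laplacian_eigenvalue (a / r) / (a / r)\<^sup>2) /\<^sub>R r ^ DIM(real)) (cbox ((- 1 - - c) /\<^sub>R r) ((1 - - c) /\<^sub>R r))"
    by (rule has_integral_affinity') (use has_integral_tent_exp[of "a / r"] r a in auto)
  from has_integral_mult_right[OF this, of "exp (a / r * c)"]
  have "((\<lambda>x. exp (a / r * c) * (tent (r *\<^sub>R x + - c) * exp (a / r * (r *\<^sub>R x + - c)))) has_integral
      exp (a / r * c) * ((laplacian_eigenvalue (a / r) / (a / r)\<^sup>2) /\<^sub>R r ^ DIM(real)))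
      (cbox ((- 1 - - c) /\<^sub>R r) ((1 - - c) /\<^sub>R r))" .
  moreover have "exp (a / r * c) * (tent (r *\<^sub>R x + - c) * exp (a / r * (r *\<^sub>R x + - c))) =
      tent (x * r - c) * exp (a * x)" for x
  proof -
    have "exp (a / r * c) * exp (a / r * (r *\<^sub>R x + - c)) = exp (a * x)"
      using r by (simp add: exp_add[symmetric] right_diff_distrib)
    then show ?thesis by (simp add: mult_ac)
  qed
  moreover have "exp (a / r * c) * ((laplacian_eigenvalue (a / r) / (a / r)\<^sup>2) /\<^sub>R r ^ DIM(real)) =
      r / a\<^sup>2 * (exp (a / r * c) * laplacian_eigenvalue (a / r))"
    using r a by (simp add: field_simps power2_eq_square)
  ultimately show "((\<lambda>x. tent (x * r - c) * exp (a * x)) has_integral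
      (r / a\<^sup>2 * (exp (a / r * c) * laplacian_eigenvalue (a / r)))) (cbox ((- 1 - - c) /\<^sub>R r) ((1 - - c) /\<^sub>R r))"
    by (simp only:)
  show "tent (x * r - c) * exp (a * x) = 0" if "x \<notin> cbox ((- 1 - - c) /\<^sub>R r) ((1 - - c) /\<^sub>R r)" for x
    using that r by (auto simp: tent_def field_simps)
  show "cbox ((- 1 - - c) /\<^sub>R r) ((1 - - c) /\<^sub>R r) \<subseteq> {- b..b}"
    using r c by (auto simp: field_simps)
qed

lemma has_integral_tents_exp:
  assumes p: "p \<in> partition_seqs m" and r: "0 < r" and a: "a \<noteq> 0"
    and c: "\<And>i j. j < p i \<Longrightarrow> \<bar>real_of_int (int j - int i)\<bar> + 1 \<le> b * r"
  shows "((\<lambda>x. sum_contents (\<lambda>c. tent (x * r - of_int c)) p * exp (a * x)) has_integral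
    (r / a\<^sup>2 * laplacian_eigenvalue (a / r) * exp_content_sum (a / r) p)) {- b..b}"
proof -
  have rows: "sum_contents \<phi> p = (\<Sum>i<m. \<Sum>j<p i. \<phi> (int j - int i))" for \<phi>
    by (rule sum_contents_eq) (rule partition_seqs_eq_0[OF p])
  have "((\<lambda>x. \<Sum>i<m. \<Sum>j<p i. tent (x * r - of_int (int j - int i)) * exp (a * x)) has_integral
      (\<Sum>i<m. \<Sum>j<p i. r / a\<^sup>2 * (exp (a / r * of_int (int j - int i)) *
          laplacian_eigenvalue (a / r)))) {- b..b}"
    by (intro has_integral_sum has_integral_scaled_tent_exp r a) (use c in auto)
  moreover have "(\<Sum>i<m. \<Sum>j<p i. r / a\<^sup>2 *
      (exp (a / r * of_int (int j - int i)) * laplacian_eigenvalue (a / r))) =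
      r / a\<^sup>2 * laplacian_eigenvalue (a / r) * exp_content_sum (a / r) p"
    unfolding exp_content_sum_def rows by (simp add: sum_distrib_left mult_ac)
  ultimately show ?thesis unfolding rows by (simp add: sum_distrib_right)
qed

section \<open>Exponential moments determine a function\<close>

lemma exp_polynomial_approximation:
  fixes g :: "real \<Rightarrow> real"
  assumes g: "continuous_on {a..b} g" and \<epsilon>: "0 < \<epsilon>"
  obtains c n where "\<And>x. x \<in> {a..b} \<Longrightarrow> \<bar>g x - (\<Sum>i\<le>n. c i * exp (real (Suc i) * x))\<bar> \<le> \<epsilon>"
proof -
  have "continuous_on {exp a..exp b} (\<lambda>y. g (ln y) / y)"
  proof (intro continuous_intros continuous_on_compose2[OF g])
    have pos: "0 < y" if "y \<in> {exp a..exp b}" for y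
      using that exp_gt_zero[of a] by (metis atLeastAtMost_iff less_le_trans)
    then show "\<forall>y\<in>{exp a..exp b}. y \<noteq> 0" by force
    then show "\<forall>y\<in>{exp a..exp b}. y \<noteq> 0" .
    show "ln ` {exp a..exp b} \<subseteq> {a..b}"
    proof (rule image_subsetI)
      fix y assume "y \<in> {exp a..exp b}"
      then show "ln y \<in> {a..b}"
        using pos[of y] by (simp add: ln_ge_iff) (metis exp_gt_zero ln_exp ln_le_cancel_iff)
    qed
  qed
  then obtain P where "real_polynomial_function P"
    and P: "\<And>y. y \<in> {exp a..exp b} \<Longrightarrow> \<bar>g (ln y) / y - P y\<bar> < \<epsilon> / exp b"
    using Stone_Weierstrass_real_polynomial_function[of "{exp a..exp b}" "\<lambda>y. g (ln y) / y" "\<epsilon> / exp b"] \<epsilon>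
    by auto
  then obtain c n where poly: "P = (\<lambda>x. \<Sum>i\<le>n. c i * x ^ i)"
    by (auto simp: real_polynomial_function_iff_sum)
  show ?thesis
  proof (rule that)
    fix x assume x: "x \<in> {a..b}"
    have exp_poly: "exp x * P (exp x) = (\<Sum>i\<le>n. c i * exp (real (Suc i) * x))"
      unfolding poly sum_distrib_left
      by (intro sum.cong refl) (simp add: exp_of_nat_mult[symmetric] exp_add[symmetric] algebra_simps)
    have "\<bar>g x / exp x - P (exp x)\<bar> < \<epsilon> / exp b" using P[of "exp x"] x by simp
    then have "exp x * \<bar>g x / exp x - P (exp x)\<bar> \<le> exp b * (\<epsilon> / exp b)"
      using x by (intro mult_mono) auto
    moreover have "exp x * \<bar>g x / exp x - P (exp x)\<bar> = \<bar>exp x * (g x / exp x - P (exp x))\<bar>"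
      by (simp add: abs_mult)
    moreover have "exp x * (g x / exp x - P (exp x)) = g x - exp x * P (exp x)"
      by (simp add: right_diff_distrib)
    ultimately show "\<bar>g x - (\<Sum>i\<le>n. c i * exp (real (Suc i) * x))\<bar> \<le> \<epsilon>" by (simp add: exp_poly)
  qed
qed

lemma integral_sq_le_if_exp_moments_eq_0:
  fixes g :: "real \<Rightarrow> real"
  assumes g: "continuous_on {a..b} g"
    and moments: "\<And>i. integral {a..b} (\<lambda>x. g x * exp (real (Suc i) * x)) = 0"
    and \<epsilon>: "0 < \<epsilon>"
  shows "integral {a..b} (\<lambda>x. (g x)\<^sup>2) \<le> \<epsilon> * integral {a..b} (\<lambda>x. \<bar>g x\<bar>)"
proof -
  obtain c n where approx: "\<And>x. x \<in> {a..b} \<Longrightarrow> \<bar>g x - (\<Sum>i\<le>n. c i * exp (real (Suc i) * x))\<bar> \<le> \<epsilon>"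
    using exp_polynomial_approximation[OF g \<epsilon>] by metis
  define q where "q x = (\<Sum>i\<le>n. c i * exp (real (Suc i) * x))" for x
  have q: "continuous_on {a..b} q" unfolding q_def by (intro continuous_intros)
  have moment_integrable: "(\<lambda>x. c i * (g x * exp (real (Suc i) * x))) integrable_on {a..b}" for i
    by (intro integrable_continuous_real continuous_intros g)
  have "integral {a..b} (\<lambda>x. g x * q x) =
      integral {a..b} (\<lambda>x. \<Sum>i\<le>n. c i * (g x * exp (real (Suc i) * x)))"
    unfolding q_def sum_distrib_left by (simp only: mult.left_commute)
  also have "\<dots> = (\<Sum>i\<le>n. integral {a..b} (\<lambda>x. c i * (g x * exp (real (Suc i) * x))))"
    by (rule integral_sum) (use moment_integrable in simp_all)
  also have "\<dots> = 0" unfolding integral_mult_right moments by simp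
  finally have orthogonal: "integral {a..b} (\<lambda>x. g x * q x) = 0" .
  have integrable: "(\<lambda>x. (g x)\<^sup>2) integrable_on {a..b}" "(\<lambda>x. g x * q x) integrable_on {a..b}"
    "(\<lambda>x. \<epsilon> * \<bar>g x\<bar>) integrable_on {a..b}"
    by (intro integrable_continuous_real continuous_intros g q)+
  have "integral {a..b} (\<lambda>x. (g x)\<^sup>2) = integral {a..b} (\<lambda>x. (g x)\<^sup>2 - g x * q x)"
    unfolding integral_diff[OF integrable(1,2)] orthogonal by simp
  also have "\<dots> \<le> integral {a..b} (\<lambda>x. \<epsilon> * \<bar>g x\<bar>)"
  proof (rule integral_le[OF integrable_diff[OF integrable(1,2)] integrable(3)])
    fix x assume x: "x \<in> {a..b}"
    have "(g x)\<^sup>2 - g x * q x = g x * (g x - q x)" by (simp add: power2_eq_square right_diff_distrib)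
    also have "\<dots> \<le> \<bar>g x\<bar> * \<bar>g x - q x\<bar>" by (metis abs_ge_self abs_mult)
    also have "\<dots> \<le> \<bar>g x\<bar> * \<epsilon>" using approx[OF x] unfolding q_def by (intro mult_left_mono) auto
    finally show "(g x)\<^sup>2 - g x * q x \<le> \<epsilon> * \<bar>g x\<bar>" by (simp add: mult.commute)
  qed
  finally show ?thesis by simp
qed

lemma eq_0_if_exp_moments_eq_0:
  fixes g :: "real \<Rightarrow> real"
  assumes g: "continuous_on {a..b} g" and "a < b"
    and moments: "\<And>i. integral {a..b} (\<lambda>x. g x * exp (real (Suc i) * x)) = 0" and x: "x \<in> {a..b}"
  shows "g x = 0"
proof -
  let ?G = "integral {a..b} (\<lambda>x. \<bar>g x\<bar>)"
  have G: "0 \<le> ?G" and sq: "0 \<le> integral {a..b} (\<lambda>x. (g x)\<^sup>2)"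
    by (intro integral_nonneg integrable_continuous_real continuous_intros g; simp)+
  have "integral {a..b} (\<lambda>x. (g x)\<^sup>2) \<le> 0"
  proof (rule field_le_epsilon)
    fix \<epsilon> :: real assume "0 < \<epsilon>"
    then have "integral {a..b} (\<lambda>x. (g x)\<^sup>2) \<le> \<epsilon> / (?G + 1) * ?G"
      using G by (intro integral_sq_le_if_exp_moments_eq_0 g moments) auto
    also have "\<dots> \<le> \<epsilon>" using G \<open>0 < \<epsilon>\<close> by (simp add: field_simps)
    finally show "integral {a..b} (\<lambda>x. (g x)\<^sup>2) \<le> 0 + \<epsilon>" by simp
  qed
  with sq have "integral {a..b} (\<lambda>x. (g x)\<^sup>2) = 0" by simp
  then have "\<forall>x\<in>{a..b}. (g x)\<^sup>2 = 0"
    using integral_eq_0_iff[of a b "\<lambda>x. (g x)\<^sup>2"] \<open>a < b\<close> by (auto intro!: continuous_on_power g)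
  then show ?thesis using x by auto
qed

definition small_exp_moments :: "real \<Rightarrow> real \<Rightarrow> nat \<Rightarrow> real \<Rightarrow> (real \<Rightarrow> real) \<Rightarrow> bool" where
  "small_exp_moments C b J \<delta> g \<longleftrightarrow> C-lipschitz_on UNIV g \<and> (\<forall>x. b \<le> \<bar>x\<bar> \<longrightarrow> g x = 0) \<and>
     (\<forall>j\<in>{1..J}. \<bar>integral {- b..b} (\<lambda>x. g x * exp (real j * x))\<bar> \<le> \<delta>)"

lemma lipschitz_uniformly_convergent_subsequence:
  fixes G :: "nat \<Rightarrow> real \<Rightarrow> real"
  assumes b: "0 \<le> b" and C: "0 \<le> C" and lipschitz: "\<And>n. C-lipschitz_on UNIV (G n)"
    and end_point: "\<And>n. G n b = 0"
  obtains g and k :: "nat \<Rightarrow> nat" where "continuous_on {- b..b} g" "strict_mono k"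
    "uniform_limit {- b..b} (\<lambda>n. G (k n)) g sequentially"
proof -
  obtain g k where g: "continuous_on {- b..b} g" and k: "strict_mono (k :: nat \<Rightarrow> nat)"
    and close: "\<And>e. 0 < e \<Longrightarrow> \<exists>N. \<forall>n x. n \<ge> N \<and> x \<in> {- b..b} \<longrightarrow> norm (G (k n) x - g x) < e"
  proof (rule Arzela_Ascoli[of "{- b..b}" G "C * (2 * b)"])
    fix n x assume "x \<in> {- b..b}"
    then have "dist x b \<le> 2 * b" by (auto simp: dist_real_def)
    then have "C * dist x b \<le> C * (2 * b)" using C by (rule mult_left_mono)
    then show "norm (G n x) \<le> C * (2 * b)"
      using lipschitz_onD[OF lipschitz, of x b n] end_point[of n] by (simp add: dist_real_def)
  next
    fix x e :: real assume "0 < e"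
    have "norm (G n x - G n y) < e" if "norm (x - y) < e / (C + 1)" for n y
    proof -
      have "norm (G n x - G n y) \<le> C * norm (x - y)"
        using lipschitz_onD[OF lipschitz, of x y n] by (simp add: dist_norm)
      also have "\<dots> \<le> (C + 1) * norm (x - y)" by (intro mult_right_mono) auto
      also have "\<dots> < e" using that C by (simp add: field_simps)
      finally show ?thesis .
    qed
    then show "\<exists>d>0. \<forall>n y. y \<in> {- b..b} \<and> norm (x - y) < d \<longrightarrow> norm (G n x - G n y) < e"
      using \<open>0 < e\<close> C by (intro exI[of _ "e / (C + 1)"]) auto
  qed auto
  have "uniform_limit {- b..b} (\<lambda>n. G (k n)) g sequentially"
    unfolding uniform_limit_iff eventually_sequentially dist_norm using close by blast
  with g k show ?thesis by (rule that)
qed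

lemma uniform_limit_exp_moment:
  fixes G :: "nat \<Rightarrow> real \<Rightarrow> real"
  assumes limit: "uniform_limit {a..b} G g sequentially" and G: "\<And>n. continuous_on {a..b} (G n)"
    and g: "continuous_on {a..b} g"
  shows "(\<lambda>n. integral {a..b} (\<lambda>x. G n x * exp (c * x))) \<longlonglongrightarrow> integral {a..b} (\<lambda>x. g x * exp (c * x))"
proof -
  have "uniform_limit {a..b} (\<lambda>n x. G n x * exp (c * x)) (\<lambda>x. g x * exp (c * x)) sequentially"
    by (intro uniform_lim_mult limit uniform_limit_const compact_imp_bounded compact_continuous_image
        continuous_intros g) auto
  then obtain I L
    where I: "\<And>n. ((\<lambda>x. G n x * exp (c * x)) has_integral I n) {a..b}"
      and L: "((\<lambda>x. g x * exp (c * x)) has_integral L) {a..b}" and "I \<longlonglongrightarrow> L"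
    by (rule uniform_limit_integral) (auto intro!: continuous_intros G)
  then show ?thesis by (simp only: integral_unique[OF I] integral_unique[OF L])
qed

lemma small_exp_moments_limit:
  assumes b: "0 < b" and C: "0 \<le> C" and G: "\<And>n. small_exp_moments C b n (inverse (real (Suc n))) (G n)"
  obtains k :: "nat \<Rightarrow> nat" where "uniform_limit {- b..b} (\<lambda>n. G (k n)) (\<lambda>_. 0) sequentially"
proof -
  let ?moment = "\<lambda>g j. integral {- b..b} (\<lambda>x. g x * exp (real j * x))"
  have lipschitz: "C-lipschitz_on UNIV (G n)" and support: "b \<le> \<bar>x\<bar> \<Longrightarrow> G n x = 0"
    and moments: "j \<in> {1..n} \<Longrightarrow> \<bar>?moment (G n) j\<bar> \<le> inverse (real (Suc n))" for n x j
    using G[of n] unfolding small_exp_moments_def by blast+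
  obtain g k where g: "continuous_on {- b..b} g" and k: "strict_mono (k :: nat \<Rightarrow> nat)"
    and limit: "uniform_limit {- b..b} (\<lambda>n. G (k n)) g sequentially"
    by (rule lipschitz_uniformly_convergent_subsequence[of b C G]) (use b C lipschitz support in auto)
  have "?moment g (Suc i) = 0" for i
  proof -
    have "(\<lambda>n. ?moment (G (k n)) (Suc i)) \<longlonglongrightarrow> ?moment g (Suc i)"
      by (intro uniform_limit_exp_moment limit g
          lipschitz_on_continuous_on[OF lipschitz_on_subset[OF lipschitz]]) simp
    moreover have "(\<lambda>n. ?moment (G (k n)) (Suc i)) \<longlonglongrightarrow> 0"
    proof (rule Lim_null_comparison)
      show "eventually (\<lambda>n. norm (?moment (G (k n)) (Suc i)) \<le> inverse (real (Suc n))) sequentially"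
        using eventually_ge_at_top[of "Suc i"]
      proof eventually_elim
        case (elim n)
        have "n \<le> k n" using k by (rule strict_mono_imp_increasing)
        then have "\<bar>?moment (G (k n)) (Suc i)\<bar> \<le> inverse (real (Suc (k n)))"
          using elim by (intro moments) auto
        also have "\<dots> \<le> inverse (real (Suc n))" using \<open>n \<le> k n\<close> by (simp add: field_simps)
        finally show ?case by simp
      qed
    qed (rule LIMSEQ_inverse_real_of_nat)
    ultimately show ?thesis by (rule LIMSEQ_unique)
  qed
  then have "g x = 0" if "x \<in> {- b..b}" for x using eq_0_if_exp_moments_eq_0[OF g _ _ that] b by auto
  then have "uniform_limit {- b..b} (\<lambda>n. G (k n)) (\<lambda>_. 0) sequentially"
    using limit by (subst uniform_limit_cong') auto
  then show ?thesis by (rule that)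
qed

theorem exp_moments_determine_uniformly:
  assumes b: "0 < b" and C: "0 \<le> C" and \<epsilon>: "0 < \<epsilon>"
  shows "\<exists>J \<delta>. 0 < \<delta> \<and> (\<forall>g. small_exp_moments C b J \<delta> g \<longrightarrow> (\<forall>x. \<bar>g x\<bar> \<le> \<epsilon>))"
proof (rule ccontr)
  assume "\<not> ?thesis"
  then have "\<exists>g. small_exp_moments C b n (inverse (real (Suc n))) g \<and> \<not> (\<forall>x. \<bar>g x\<bar> \<le> \<epsilon>)" for n
    using inverse_Suc by blast
  then obtain G where G: "\<And>n. small_exp_moments C b n (inverse (real (Suc n))) (G n)"
    and "\<And>n. \<not> (\<forall>x. \<bar>G n x\<bar> \<le> \<epsilon>)" by metis
  then have "\<exists>x. \<epsilon> < \<bar>G n x\<bar>" for n by (simp add: not_le)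
  then obtain y where large: "\<And>n. \<epsilon> < \<bar>G n (y n)\<bar>" by metis
  have y: "y n \<in> {- b..b}" for n
    using large[of n] \<epsilon> G[of n] unfolding small_exp_moments_def by (cases "b \<le> \<bar>y n\<bar>") auto
  obtain k where "uniform_limit {- b..b} (\<lambda>n. G (k n)) (\<lambda>_. 0) sequentially"
    by (rule small_exp_moments_limit[OF b C G]) blast
  then have "eventually (\<lambda>n. \<forall>x\<in>{- b..b}. dist (G (k n) x) 0 < \<epsilon>) sequentially"
    using \<epsilon> by (simp add: uniform_limit_iff)
  then obtain n where "\<forall>x\<in>{- b..b}. dist (G (k n) x) 0 < \<epsilon>"
    using eventually_happens'[OF sequentially_bot] by blast
  then have "\<bar>G (k n) (y (k n))\<bar> < \<epsilon>" using y by simp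
  then show False using large[of "k n"] by simp
qed

section \<open>Rare events and extreme contents\<close>

definition plancherel_rare :: "(nat \<Rightarrow> (nat \<Rightarrow> nat) \<Rightarrow> bool) \<Rightarrow> bool" where
  "plancherel_rare B \<longleftrightarrow>
     (\<exists>c>0. eventually (\<lambda>m. plancherel_prob m (B m) \<le> exp (- c * sqrt (real m))) sequentially)"

lemma plancherel_rareI:
  assumes c: "0 < c"
    and bound: "eventually (\<lambda>m. plancherel_prob m (B m) \<le> K * exp (- c * sqrt (real m))) sequentially"
  shows "plancherel_rare B"
proof -
  have "eventually (\<lambda>m. K * exp (- c * sqrt (real m)) \<le> exp (- (c / 2) * sqrt (real m))) sequentially"
    using c by real_asymp
  with bound have "eventually (\<lambda>m. plancherel_prob m (B m) \<le> exp (- (c / 2) *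
      sqrt (real m))) sequentially"
    by eventually_elim (rule order_trans)
  then show ?thesis unfolding plancherel_rare_def using c by (intro exI[of _ "c / 2"]) simp
qed

lemma plancherel_rare_mono:
  assumes "plancherel_rare B" "eventually (\<lambda>m. \<forall>p\<in>partition_seqs m. A m p \<longrightarrow> B m p) sequentially"
  shows "plancherel_rare A"
proof -
  obtain c where c: "0 < c"
    "eventually (\<lambda>m. plancherel_prob m (B m) \<le> exp (- c * sqrt (real m))) sequentially"
    using assms(1) by (auto simp: plancherel_rare_def)
  from assms(2) c(2) have "eventually (\<lambda>m. plancherel_prob m (A m) \<le> exp (- c *
      sqrt (real m))) sequentially"
  proof eventually_elim
    case (elim m)
    have "plancherel_prob m (A m) \<le> plancherel_prob m (B m)"
      using elim(1) by (intro plancherel_prob_mono) auto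
    then show ?case using elim(2) by (rule order_trans)
  qed
  then show ?thesis using c(1) by (auto simp: plancherel_rare_def)
qed

lemma plancherel_rare_disj:
  assumes "plancherel_rare A" "plancherel_rare B"
  shows "plancherel_rare (\<lambda>m p. A m p \<or> B m p)"
proof -
  obtain a where a: "0 < a"
    "eventually (\<lambda>m. plancherel_prob m (A m) \<le> exp (- a * sqrt (real m))) sequentially"
    using assms(1) by (auto simp: plancherel_rare_def)
  obtain b where b: "0 < b"
    "eventually (\<lambda>m. plancherel_prob m (B m) \<le> exp (- b * sqrt (real m))) sequentially"
    using assms(2) by (auto simp: plancherel_rare_def)
  have "eventually (\<lambda>m. plancherel_prob m (\<lambda>p. A m p \<or> B m p) \<le> 2 *
      exp (- min a b * sqrt (real m))) sequentially"
    using a(2) b(2)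
  proof eventually_elim
    case (elim m)
    have "exp (- a * sqrt (real m)) \<le> exp (- min a b * sqrt (real m))"
      "exp (- b * sqrt (real m)) \<le> exp (- min a b * sqrt (real m))"
      by (auto intro!: mult_right_mono)
    then show ?case using elim plancherel_prob_disj_le[of m "A m" "B m"] by linarith
  qed
  then show ?thesis using a(1) b(1) by (intro plancherel_rareI[of "min a b"]) auto
qed

lemma plancherel_rare_bex:
  assumes "finite I" "\<And>j. j \<in> I \<Longrightarrow> plancherel_rare (B j)"
  shows "plancherel_rare (\<lambda>m p. \<exists>j\<in>I. B j m p)"
  using assms
proof (induction I rule: finite_induct)
  case empty
  have "plancherel_prob m (\<lambda>_. False) = 0" for m
    by (simp add: plancherel_prob_def plancherel_mean_const)
  then show ?case by (auto simp: plancherel_rare_def intro: exI[of _ 1])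
next
  case (insert j I)
  have "plancherel_rare (\<lambda>m p. B j m p \<or> (\<exists>j\<in>I. B j m p))"
    by (rule plancherel_rare_disj) (use insert in auto)
  then show ?case by simp
qed

lemma plancherel_rare_tendsto_0:
  assumes "plancherel_rare B"
  shows "(\<lambda>m. plancherel_prob m (B m)) \<longlonglongrightarrow> 0"
proof -
  obtain c where c: "0 < c"
    "eventually (\<lambda>m. plancherel_prob m (B m) \<le> exp (- c * sqrt (real m))) sequentially"
    using assms by (auto simp: plancherel_rare_def)
  show ?thesis
  proof (rule tendsto_sandwich[OF _ c(2) tendsto_const])
    show "(\<lambda>m. exp (- c * sqrt (real m))) \<longlonglongrightarrow> 0" using c(1) by real_asymp
  qed (simp add: plancherel_prob_nonneg)
qed

definition far_content :: "real \<Rightarrow> (nat \<Rightarrow> nat) \<Rightarrow> bool" where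
  "far_content y p \<longleftrightarrow> (\<exists>i j. j < p i \<and> y \<le> \<bar>real j - real i\<bar>)"

lemma not_far_content_first_row:
  assumes "\<not> far_content y p" "0 \<le> y"
  shows "real (p 0) < y + 1"
proof (cases "p 0")
  case (Suc k)
  then have "k < p 0" by simp
  then have "\<not> y \<le> \<bar>real k - real 0\<bar>" using assms(1) unfolding far_content_def by blast
  then show ?thesis using Suc by simp
qed (use assms in simp)

lemma not_far_content_row_eq_0:
  assumes "\<not> far_content y p" "y \<le> real i"
  shows "p i = 0"
proof (rule ccontr)
  assume "p i \<noteq> 0"
  then have "0 < p i" by simp
  then have "\<not> y \<le> \<bar>real 0 - real i\<bar>" using assms(1) unfolding far_content_def by blast
  then show False using assms(2) by simp
qed

lemma not_far_content_boxed:
  assumes "p \<in> partition_seqs m" "\<not> far_content y p" "0 \<le> y" "y \<le> real d"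
  shows "p \<in> boxed_partitions m d"
  using assms not_far_content_first_row[of y p] not_far_content_row_eq_0[of y p d]
  by (simp add: boxed_partitions_def)

lemma exp_content_le_exp_content_sum:
  assumes p: "p \<in> partition_seqs m" and j: "j < p i"
  shows "exp (z * (real j - real i)) \<le> exp_content_sum z p"
proof -
  have i: "i < m" using j partition_seqs_pos_imp_less[OF p, of i] by simp
  have "exp (z * (real j - real i)) \<le> (\<Sum>j<p i. exp (z * of_int (int j - int i)))"
    using member_le_sum[of j "{..<p i}" "\<lambda>j. exp (z * of_int (int j - int i))"] j by simp
  also have "\<dots> \<le> (\<Sum>i<m. \<Sum>j<p i. exp (z * of_int (int j - int i)))"
    using i by (intro member_le_sum[of i "{..<m}"]) (auto intro: sum_nonneg)
  also have "\<dots> = exp_content_sum z p"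
    unfolding exp_content_sum_def
    using partition_seqs_eq_0[OF p] by (intro sum_contents_eq[symmetric]) auto
  finally show ?thesis .
qed

lemma plancherel_prob_content_ge:
  "laplacian_eigenvalue z * plancherel_prob m (\<lambda>p. \<exists>i j. j < p i \<and> y \<le> z * (real j - real i)) \<le>
   exp (2 * sqrt (real m * laplacian_eigenvalue z) - y)" (is "_ * ?P \<le> _")
proof -
  have "exp y * ?P \<le> plancherel_mean m (exp_content_sum z)"
    by (rule plancherel_Markov)
      (auto simp: exp_content_sum_nonneg intro: order_trans[OF _ exp_content_le_exp_content_sum])
  then have "laplacian_eigenvalue z * (exp y * ?P) \<le>
      laplacian_eigenvalue z * plancherel_mean m (exp_content_sum z)"
    by (rule mult_left_mono) (rule laplacian_eigenvalue_nonneg)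
  also have "\<dots> \<le> exp (2 * sqrt (real m * laplacian_eigenvalue z))"
    by (rule plancherel_mean_exp_content_sum_le)
  finally show ?thesis by (simp add: exp_diff field_simps)
qed

lemma plancherel_prob_far_content_le:
  assumes "0 < z"
  shows "laplacian_eigenvalue z * plancherel_prob m (far_content y) \<le>
    2 * exp (2 * sqrt (real m * laplacian_eigenvalue z) - z * y)"
proof -
  let ?P = "\<lambda>z'. plancherel_prob m (\<lambda>p. \<exists>i j. j < p i \<and> z * y \<le> z' * (real j - real i))"
  have "plancherel_prob m (far_content y) \<le>
      plancherel_prob m (\<lambda>p. (\<exists>i j. j < p i \<and> z * y \<le> z * (real j - real i)) \<or>
        (\<exists>i j. j < p i \<and> z * y \<le> - z * (real j - real i)))"
  proof (rule plancherel_prob_mono)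
    fix p assume "far_content y p"
    then obtain i j where "j < p i" "y \<le> \<bar>real j - real i\<bar>" unfolding far_content_def by blast
    then have "z * y \<le> z * (real j - real i) \<or> z * y \<le> z * - (real j - real i)"
      using assms by (simp only: mult_le_cancel_left_pos) linarith
    then show "(\<exists>i j. j < p i \<and> z * y \<le> z * (real j - real i)) \<or>
        (\<exists>i j. j < p i \<and> z * y \<le> - z * (real j - real i))"
      using \<open>j < p i\<close> by (metis minus_mult_commute)
  qed
  also have "\<dots> \<le> ?P z + ?P (- z)" by (rule plancherel_prob_disj_le)
  finally have "laplacian_eigenvalue z * plancherel_prob m (far_content y) \<le>
      laplacian_eigenvalue z * ?P z + laplacian_eigenvalue (- z) * ?P (- z)"
    using mult_left_mono[OF _ laplacian_eigenvalue_nonneg[of z]]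
    by (simp add: laplacian_eigenvalue_minus distrib_left[symmetric])
  then show ?thesis
    using plancherel_prob_content_ge[of z m "z * y"] plancherel_prob_content_ge[of "- z" m "z * y"]
    by (simp add: laplacian_eigenvalue_minus)
qed

lemma plancherel_rare_far_content:
  assumes "0 < \<epsilon>"
  shows "plancherel_rare (\<lambda>m. far_content ((2 + \<epsilon>) * sqrt (real m)))"
proof -
  have "((\<lambda>z::real. 2 * (exp (z / 2) - exp (- z / 2)) / z) \<longlongrightarrow> 2) (at_right 0)" by real_asymp
  then have "eventually (\<lambda>z::real. 2 * (exp (z / 2) - exp (- z / 2)) / z < 2 + \<epsilon> / 2) (at_right 0)"
    using assms by (intro order_tendstoD(2)) auto
  then have "eventually (\<lambda>z::real. 0 <
      z \<and> 2 * (exp (z / 2) - exp (- z / 2)) \<le> (2 + \<epsilon> / 2) * z) (at_right 0)"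
    using eventually_at_right_less[of "0::real"] by eventually_elim (simp add: field_simps)
  then obtain z :: real where z: "0 < z"
    and sinh_le: "2 * (exp (z / 2) - exp (- z / 2)) \<le> (2 + \<epsilon> / 2) * z"
    using eventually_happens'[OF trivial_limit_at_right_real] by blast
  have "plancherel_prob m (far_content ((2 + \<epsilon>) * sqrt (real m))) \<le>
      2 / laplacian_eigenvalue z * exp (- (\<epsilon> * z / 2) * sqrt (real m))" for m
  proof -
    have "2 * sqrt (real m * laplacian_eigenvalue z) =
        sqrt (real m) * (2 * (exp (z / 2) - exp (- z / 2)))"
      using z by (simp add: laplacian_eigenvalue_eq real_sqrt_mult)
    also have "\<dots> \<le> sqrt (real m) * ((2 + \<epsilon> / 2) * z)" using sinh_le by (rule mult_left_mono) simp
    finally have "2 * sqrt (real m * laplacian_eigenvalue z) - z * ((2 + \<epsilon>) * sqrt (real m)) \<le>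
        - (\<epsilon> * z / 2) * sqrt (real m)"
      by (simp add: algebra_simps)
    then have "laplacian_eigenvalue z * plancherel_prob m (far_content ((2 + \<epsilon>) * sqrt (real m))) \<le>
        2 * exp (- (\<epsilon> * z / 2) * sqrt (real m))"
      using plancherel_prob_far_content_le[OF z, of m "(2 + \<epsilon>) * sqrt (real m)"]
      by (smt (verit) exp_le_cancel_iff)
    then show ?thesis using laplacian_eigenvalue_pos[of z] z by (simp add: field_simps)
  qed
  then show ?thesis
    using assms z
    by (intro plancherel_rareI[of "\<epsilon> * z / 2" _ "2 / laplacian_eigenvalue z"] always_eventually) auto
qed

section \<open>Concentration of the exponential moments\<close>

lemma binomial_div_power_tendsto: "(\<lambda>n. real (n choose k) / real n ^ k) \<longlonglongrightarrow> 1 / fact k"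
proof -
  have "real (n choose k) / real n ^ k = (\<Prod>i=0..<k. (real n - real i) / real n) / fact k" for n
    by (simp add: binomial_gbinomial gbinomial_prod_rev prod_dividef)
  moreover have "(\<lambda>n. (\<Prod>i=0..<k. (real n - real i) / real n) / fact k) \<longlonglongrightarrow> (\<Prod>i=0..<k. 1) / fact k"
    by (intro tendsto_intros) (simp, real_asymp, simp)
  ultimately show ?thesis by simp
qed

lemma laguerre_tendsto_bessel_I0:
  assumes s: "\<And>m. 0 \<le> s m" and lim: "(\<lambda>m. real m * s m) \<longlonglongrightarrow> a\<^sup>2"
  shows "(\<lambda>m. laguerre m (s m)) \<longlonglongrightarrow> bessel_I0 (2 * a)"
proof -
  define t where "t k m = real (m choose k) * s m ^ k / fact k" for k m
  have "t k m = (real (m choose k) / real m ^ k) * (real m * s m) ^ k / fact k" for k m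
    by (cases "m = 0"; cases k) (simp_all add: t_def power_mult_distrib)
  moreover have "(\<lambda>m. (real (m choose k) / real m ^ k) * (real m * s m) ^ k / fact k)
      \<longlonglongrightarrow> (1 / fact k) * (a\<^sup>2) ^ k / fact k" for k
    by (intro tendsto_intros binomial_div_power_tendsto lim) simp
  ultimately have termwise: "(\<lambda>m. t k m) \<longlonglongrightarrow> (a ^ k / fact k)\<^sup>2" for k
    by (simp add: power_div_fact_sq power2_eq_square[of "fact k"])
  have dominated: "norm (t k m) \<le> inverse (fact k) * (a\<^sup>2 + 1) ^ k" if "real m * s m \<le> a\<^sup>2 + 1" for k m
  proof -
    have "real (m choose k) * 1 \<le> real (m choose k) * fact k"
      by (intro mult_left_mono) (auto simp: fact_ge_1)
    also have "\<dots> \<le> real m ^ k" by (rule binomial_times_fact_le_power)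
    finally have "real (m choose k) * s m ^ k \<le> (real m * s m) ^ k"
      unfolding power_mult_distrib using s by (intro mult_right_mono) auto
    also have "\<dots> \<le> (a\<^sup>2 + 1) ^ k" using that s by (intro power_mono) auto
    finally show ?thesis using s by (simp add: t_def divide_inverse mult.commute)
  qed
  have "eventually (\<lambda>m. real m * s m \<le> a\<^sup>2 + 1) sequentially"
    using order_tendstoD(2)[OF lim, of "a\<^sup>2 + 1"] by (auto elim: eventually_mono)
  then have "eventually (\<lambda>(k, m). norm (t k m) \<le> inverse (fact k) *
      (a\<^sup>2 + 1) ^ k) (at_top \<times>\<^sub>F sequentially)"
    unfolding eventually_prod_filter
    by (intro exI[of _ "\<lambda>_. True"] exI[of _ "\<lambda>m. real m * s m \<le> a\<^sup>2 + 1"]) (use dominated in auto)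
  then have "(\<lambda>m. \<Sum>k. t k m) \<longlonglongrightarrow> (\<Sum>k. (a ^ k / fact k)\<^sup>2)"
    using tannerys_theorem[OF termwise _ summable_exp] by simp
  moreover have "(\<Sum>k. t k m) = laguerre m (s m)" for m
    unfolding laguerre_def t_def by (rule suminf_finite) (auto simp: binomial_eq_0)
  ultimately show ?thesis by (simp add: bessel_I0_def)
qed

definition profile_exp_moment :: "real \<Rightarrow> nat \<Rightarrow> (nat \<Rightarrow> nat) \<Rightarrow> real" where
  "profile_exp_moment a m p =
     laplacian_eigenvalue (a / sqrt (real m)) * exp_content_sum (a / sqrt (real m)) p / a\<^sup>2"

definition shape_exp_moment :: "real \<Rightarrow> real" where
  "shape_exp_moment a = (bessel_I0 (2 * a) - 1) / a\<^sup>2"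

lemma profile_exp_moment_nonneg: "0 \<le> profile_exp_moment a m p"
  by (simp add: profile_exp_moment_def laplacian_eigenvalue_nonneg exp_content_sum_nonneg)

lemma laplacian_eigenvalue_double: "laplacian_eigenvalue (2 * z) =
    laplacian_eigenvalue z * (laplacian_eigenvalue z + 4)"
  by (simp add: laplacian_eigenvalue_def algebra_simps exp_add[symmetric])

lemma laplacian_eigenvalue_scaled_tendsto:
  "0 < a \<Longrightarrow> (\<lambda>m. real m * laplacian_eigenvalue (a / sqrt (real m))) \<longlonglongrightarrow> a\<^sup>2"
  unfolding laplacian_eigenvalue_def power2_eq_square by real_asymp

lemma laplacian_eigenvalue_scaled_le:
  assumes "0 < a"
  shows "eventually (\<lambda>m. real m * laplacian_eigenvalue (a / sqrt (real m)) \<le> 2 * a\<^sup>2) sequentially"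
  using order_tendstoD(2)[OF laplacian_eigenvalue_scaled_tendsto[OF assms], of "2 * a\<^sup>2"] assms
  by (auto elim: eventually_mono)

lemma plancherel_mean_profile_exp_moment_tendsto:
  assumes a: "0 < a"
  shows "(\<lambda>m. plancherel_mean m (profile_exp_moment a m)) \<longlonglongrightarrow> shape_exp_moment a"
proof -
  let ?s = "\<lambda>m. laplacian_eigenvalue (a / sqrt (real m))"
  have "plancherel_mean m (profile_exp_moment a m) = (laguerre m (?s m) - 1) / a\<^sup>2" for m
  proof -
    have "plancherel_mean m (profile_exp_moment a m) =
        plancherel_mean m (\<lambda>p. (?s m / a\<^sup>2) * exp_content_sum (a / sqrt (real m)) p)"
      by (intro plancherel_mean_cong) (simp add: profile_exp_moment_def)
    also have "\<dots> = ?s m * plancherel_mean m (exp_content_sum (a / sqrt (real m))) / a\<^sup>2"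
      unfolding plancherel_mean_cmult by simp
    finally show ?thesis using plancherel_mean_exp_content_sum[of "a / sqrt (real m)" m] by simp
  qed
  moreover have "(\<lambda>m. (laguerre m (?s m) - 1) / a\<^sup>2) \<longlonglongrightarrow> (bessel_I0 (2 * a) - 1) / a\<^sup>2"
    using a
    by (intro tendsto_intros laguerre_tendsto_bessel_I0 laplacian_eigenvalue_nonneg
        laplacian_eigenvalue_scaled_tendsto) auto
  ultimately show ?thesis by (simp add: shape_exp_moment_def)
qed

lemma sum_contents_sq_le:
  assumes p: "p \<in> partition_seqs m"
  shows "(sum_contents \<phi> p)\<^sup>2 \<le> real m * sum_contents (\<lambda>c. (\<phi> c)\<^sup>2) p"
proof -
  have "real (card (diagram_boxes p)) = real m"
    using sum_contents_eq_sum_diagram_boxes[OF p, of "\<lambda>_. 1"] sum_contents_const[OF p, of 1] by simp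
  then show ?thesis
    unfolding sum_contents_eq_sum_diagram_boxes[OF p]
    using sum_squared_le_sum_of_squares[of "\<lambda>(i, j). \<phi> (int j - int i)" "diagram_boxes p"]
    by (simp add: case_prod_unfold mult.commute)
qed

lemma profile_exp_moment_sq_le:
  assumes p: "p \<in> partition_seqs m" and a: "0 < a"
  shows "(profile_exp_moment a m p)\<^sup>2 \<le>
    real m * laplacian_eigenvalue (a / sqrt (real m)) / a\<^sup>2 * profile_exp_moment (2 * a) m p"
proof -
  define z where "z = a / sqrt (real m)"
  let ?s = "laplacian_eigenvalue z"
  have s: "0 \<le> ?s" "4 * ?s \<le> laplacian_eigenvalue (2 * z)"
    using laplacian_eigenvalue_nonneg[of z]
    unfolding laplacian_eigenvalue_double distrib_left by simp_all
  have "(exp_content_sum z p)\<^sup>2 \<le> real m * exp_content_sum (2 * z) p"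
    using sum_contents_sq_le[OF p, of "\<lambda>c. exp (z * of_int c)"]
    by (simp add: exp_content_sum_def exp_double[symmetric] mult.assoc)
  then have "(profile_exp_moment a m p)\<^sup>2 \<le> (?s / a\<^sup>2)\<^sup>2 * (real m * exp_content_sum (2 * z) p)"
    by (simp add: profile_exp_moment_def z_def[symmetric] power_mult_distrib power_divide
        divide_right_mono mult_left_mono)
  also have "\<dots> = real m * ?s / a\<^sup>2 * (4 * ?s * exp_content_sum (2 * z) p / (2 * a)\<^sup>2)"
    by (simp add: power2_eq_square)
  also have "\<dots> \<le> real m * ?s / a\<^sup>2 * (laplacian_eigenvalue (2 * z) *
      exp_content_sum (2 * z) p / (2 * a)\<^sup>2)"
    using s exp_content_sum_nonneg by (intro mult_left_mono divide_right_mono mult_right_mono) auto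
  finally show ?thesis by (simp add: profile_exp_moment_def z_def)
qed

lemma plancherel_mean_profile_exp_moment_sq_le:
  assumes a: "0 < a"
  shows "eventually (\<lambda>m. plancherel_mean m (\<lambda>p. (profile_exp_moment a m p)\<^sup>2) \<le> 2 *
      (shape_exp_moment (2 * a) + 1)) sequentially"
proof -
  have "eventually (\<lambda>m. plancherel_mean m (profile_exp_moment (2 * a) m) <
      shape_exp_moment (2 * a) + 1) sequentially"
    using plancherel_mean_profile_exp_moment_tendsto[of "2 * a"] a by (intro order_tendstoD(2)) auto
  then show ?thesis using laplacian_eigenvalue_scaled_le[OF a]
  proof eventually_elim
    case (elim m)
    have "plancherel_mean m (\<lambda>p. (profile_exp_moment a m p)\<^sup>2) \<le>
        plancherel_mean m (\<lambda>p. 2 * profile_exp_moment (2 * a) m p)"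
    proof (rule plancherel_mean_mono)
      fix p assume p: "p \<in> partition_seqs m"
      have "real m * laplacian_eigenvalue (a / sqrt (real m)) / a\<^sup>2 \<le> 2"
        using elim(2) a by (simp add: field_simps)
      then show "(profile_exp_moment a m p)\<^sup>2 \<le> 2 * profile_exp_moment (2 * a) m p"
        by (rule order_trans[OF profile_exp_moment_sq_le[OF p a] mult_right_mono])
          (rule profile_exp_moment_nonneg)
    qed
    then show ?case using elim(1) by (simp add: plancherel_mean_cmult)
  qed
qed

lemma abs_diff_sum_lessThan_le:
  fixes f :: "nat \<Rightarrow> real"
  assumes "\<And>j. j < max a b \<Longrightarrow> \<bar>f j\<bar> \<le> K"
  shows "\<bar>sum f {..<a} - sum f {..<b}\<bar> \<le> \<bar>real a - real b\<bar> * K"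
proof -
  have ordered: "\<bar>sum f {..<a} - sum f {..<b}\<bar> \<le> \<bar>real a - real b\<bar> * K"
    if "b \<le> a" "\<And>j. j < a \<Longrightarrow> \<bar>f j\<bar> \<le> K" for a b :: nat
  proof -
    have "sum f {..<a} - sum f {..<b} = sum f {b..<a}"
      using sum_diff_nat_ivl[of 0 b a f] that(1) by (simp add: atLeast0LessThan)
    also have "\<bar>\<dots>\<bar> \<le> (\<Sum>j\<in>{b..<a}. K)" using that(2) by (intro order_trans[OF sum_abs] sum_mono) auto
    finally show ?thesis using that(1) by (simp add: of_nat_diff)
  qed
  show ?thesis
    using ordered[of b a] ordered[of a b] assms by (cases "b \<le> a") (auto simp: abs_minus_commute)
qed

lemma exp_content_sum_diff_le:
  assumes p: "p \<in> boxed_partitions m d" and q: "q \<in> boxed_partitions m d" and z: "0 \<le> z"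
  shows "\<bar>exp_content_sum z p - exp_content_sum z q\<bar> \<le> row_distance d p q * exp (z * real d)"
proof -
  have "\<bar>exp_content_sum z p - exp_content_sum z q\<bar> =
      \<bar>\<Sum>i<d. (\<Sum>j<p i. exp (z * of_int (int j - int i))) - (\<Sum>j<q i. exp (z * of_int (int j - int i)))\<bar>"
    unfolding exp_content_sum_def
    by (simp add: sum_contents_eq[of d] boxed_partitions_eq_0[OF p] boxed_partitions_eq_0[OF q]
        sum_subtractf)
  also have "\<dots> \<le> (\<Sum>i<d. \<bar>real (p i) - real (q i)\<bar> * exp (z * real d))"
  proof (rule order_trans[OF sum_abs], intro sum_mono abs_diff_sum_lessThan_le)
    fix i j assume "j < max (p i) (q i)"
    then have "real_of_int (int j - int i) \<le> real d"
      using boxed_partitions_le[OF p, of i] boxed_partitions_le[OF q, of i] by simp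
    then show "\<bar>exp (z * of_int (int j - int i))\<bar> \<le> exp (z * real d)"
      using z by (simp add: mult_left_mono)
  qed
  finally show ?thesis by (simp add: row_distance_def sum_distrib_right)
qed

lemma exp_content_sum_boxed_le:
  assumes p: "p \<in> boxed_partitions m d" and z: "0 \<le> z"
  shows "exp_content_sum z p \<le> real m * exp (z * real d)"
proof -
  have "exp_content_sum z p = (\<Sum>i<d. \<Sum>j<p i. exp (z * of_int (int j - int i)))"
    unfolding exp_content_sum_def using boxed_partitions_eq_0[OF p] by (intro sum_contents_eq) auto
  also have "\<dots> \<le> (\<Sum>i<d. \<Sum>j<p i. exp (z * real d))"
  proof (intro sum_mono)
    fix i j assume "j \<in> {..<p i}"
    then have "real_of_int (int j - int i) \<le> real d" using boxed_partitions_le[OF p, of i] by simp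
    then show "exp (z * of_int (int j - int i)) \<le> exp (z * real d)"
      using z by (simp add: mult_left_mono)
  qed
  also have "\<dots> = real (\<Sum>i<d. p i) * exp (z * real d)" by (simp add: sum_distrib_right)
  finally show ?thesis unfolding sum_boxed_partitions[OF p] .
qed

text \<open>Any constant above \<open>2\<close> would do in place of \<open>3\<close>.\<close>

definition typical_box_size :: "nat \<Rightarrow> nat" where
  "typical_box_size m = nat \<lceil>3 * sqrt (real m)\<rceil>"

lemma typical_box_size_ge: "3 * sqrt (real m) \<le> real (typical_box_size m)"
  unfolding typical_box_size_def by (simp add: of_nat_nat ceiling_correct)

lemma typical_box_size_le: "1 \<le> m \<Longrightarrow> real (typical_box_size m) \<le> 4 * sqrt (real m)"
  unfolding typical_box_size_def using real_sqrt_ge_1_iff[of "real m"] by linarith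

lemma deviation_bound_le_exp:
  assumes \<eta>: "0 < \<eta>"
  defines "d \<equiv> \<lambda>m. typical_box_size m"
  shows "eventually (\<lambda>m. 2 * (real (card (partition_seqs m)))\<^sup>2 *
    exp (2 * midpoint_error (d m) - 2 * ((\<eta> * real m)\<^sup>2 / (16 *
        (real (d m))\<^sup>2))) \<le> exp (- sqrt (real m))) sequentially"
proof -
  define err where "err r = 2 * (4 * r) * (1 + ln (4 * r)) + 2 * (4 * r) * ln (3 * (4 * r))"
    for r :: real
  have "eventually (\<lambda>m. ln 2 + 4 * (sqrt (real m) + 1) * ln (real m + 1) +
      (2 * err (sqrt (real m)) - \<eta>\<^sup>2 / 128 * real m)
      \<le> - sqrt (real m)) sequentially"
    unfolding err_def using \<eta> by real_asymp
  then show ?thesis using eventually_ge_at_top[of 1]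
  proof eventually_elim
    case (elim m)
    let ?r = "sqrt (real m)" and ?d = "real (d m)"
    have r: "1 \<le> ?r" and d_le: "?d \<le> 4 * ?r" and d_ge: "3 * ?r \<le> ?d"
      using elim(2) typical_box_size_le[of m] typical_box_size_ge[of m] by (auto simp: d_def)
    have d: "1 \<le> ?d" using r d_ge by linarith
    have card: "(real (card (partition_seqs m)))\<^sup>2 \<le> exp (4 * (?r + 1) * ln (real m + 1))"
      using power_mono[OF card_partition_seqs_le_exp[of m], of 2]
      by (simp add: exp_double[symmetric] algebra_simps)
    have midpoint: "midpoint_error (d m) \<le> err ?r"
      unfolding midpoint_error_def err_def using d d_le r
      by (intro add_mono mult_mono) (auto intro!: add_nonneg_nonneg)
    have "?d\<^sup>2 \<le> 16 * real m" using power_mono[OF d_le, of 2] by (simp add: power_mult_distrib)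
    then have "(\<eta> * real m)\<^sup>2 / (16 * (16 * real m)) \<le> (\<eta> * real m)\<^sup>2 / (16 * ?d\<^sup>2)"
      using d elim(2) by (intro divide_left_mono mult_pos_pos) auto
    then have quadratic: "\<eta>\<^sup>2 / 128 * real m \<le> 2 * ((\<eta> * real m)\<^sup>2 / (16 * ?d\<^sup>2))"
      using elim(2) by (simp add: power_mult_distrib power2_eq_square)
    have "2 * (real (card (partition_seqs m)))\<^sup>2 *
        exp (2 * midpoint_error (d m) - 2 * ((\<eta> * real m)\<^sup>2 / (16 * ?d\<^sup>2)))
      \<le> exp (ln 2) * exp (4 * (?r + 1) * ln (real m + 1)) * exp (2 * err ?r - \<eta>\<^sup>2 / 128 * real m)"
      using card midpoint quadratic by (intro mult_mono) auto
    also have "\<dots> \<le> exp (- ?r)" unfolding exp_add[symmetric] using elim(1) by simp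
    finally show ?case .
  qed
qed

lemma plancherel_rare_far_from_maximiser:
  assumes \<eta>: "0 < \<eta>"
  defines "d \<equiv> \<lambda>m. typical_box_size m"
  obtains p0 where "eventually (\<lambda>m. p0 m \<in> boxed_partitions m (d m)) sequentially"
    "plancherel_rare (\<lambda>m p. p \<in> boxed_partitions m (d m) \<and> \<eta> * real m \<le> row_distance (d m) p (p0 m))"
proof -
  have "plancherel_rare (\<lambda>m. far_content (3 * sqrt (real m)))"
    using plancherel_rare_far_content[of 1] by simp
  then have "eventually (\<lambda>m. plancherel_prob m (far_content (3 * sqrt (real m))) < 1 / 2) sequentially"
    by (intro order_tendstoD(2)[OF plancherel_rare_tendsto_0]) auto
  then have "eventually (\<lambda>m. \<exists>p0. p0 \<in> boxed_partitions m (d m) \<and>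
      plancherel_prob m (\<lambda>p. p \<in> boxed_partitions m (d m) \<and> \<eta> * real m \<le> row_distance (d m) p p0) \<le>
        exp (- sqrt (real m))) sequentially"
    using deviation_bound_le_exp[OF \<eta>] eventually_ge_at_top[of 1]
  proof eventually_elim
    case (elim m)
    have "1 \<le> sqrt (real m)" using elim(3) by simp
    then have "1 \<le> d m" using typical_box_size_ge[of m] unfolding d_def by linarith
    have "1 / 2 \<le> plancherel_prob m (\<lambda>p. \<not> far_content (3 * sqrt (real m)) p)"
      using elim(1) by (simp add: plancherel_prob_not)
    also have "\<dots> \<le> plancherel_prob m (\<lambda>p. p \<in> boxed_partitions m (d m))"
      using typical_box_size_ge[of m]
      unfolding d_def by (intro plancherel_prob_mono not_far_content_boxed) auto
    finally obtain p0 where p0: "p0 \<in> boxed_partitions m (d m)"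
      and far: "plancherel_prob m (\<lambda>p. p \<in> boxed_partitions m (d m) \<and> \<eta> *
          real m \<le> row_distance (d m) p p0) \<le>
        2 * (real (card (partition_seqs m)))\<^sup>2 *
        exp (2 * midpoint_error (d m) - 2 * ((\<eta> * real m)\<^sup>2 / (16 * (real (d m))\<^sup>2)))"
      using plancherel_prob_far_from_maximiser[of "d m" \<eta> m] \<eta> \<open>1 \<le> d m\<close> by auto
    show ?case using p0 order_trans[OF far elim(2)[folded d_def]] by blast
  qed
  then obtain p0 where p0: "eventually (\<lambda>m. p0 m \<in> boxed_partitions m (d m) \<and>
      plancherel_prob m (\<lambda>p. p \<in> boxed_partitions m (d m) \<and> \<eta> * real m \<le> row_distance (d m) p (p0 m)) \<le>
        exp (- sqrt (real m))) sequentially"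
    unfolding eventually_ex by blast
  show ?thesis
    using p0
    by (intro that[of p0])
      (auto simp: eventually_conj_iff intro!: plancherel_rareI[of 1 _ 1] elim: eventually_mono)
qed

lemma plancherel_mean_close:
  assumes close: "\<And>p. p \<in> partition_seqs m \<Longrightarrow> \<not> B p \<Longrightarrow> \<bar>H p - v\<bar> \<le> \<epsilon>" and "0 \<le> \<epsilon>"
  shows "\<bar>plancherel_mean m H - v\<bar> \<le>
    \<epsilon> + (sqrt (plancherel_prob m B * plancherel_mean m (\<lambda>p. (H p)\<^sup>2)) + \<bar>v\<bar> * plancherel_prob m B)"
proof -
  let ?b = "\<lambda>p. of_bool (B p) :: real"
  have "plancherel_mean m H - v = plancherel_mean m (\<lambda>p. H p + - v)"
    by (simp only: plancherel_mean_add plancherel_mean_const)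
  then have "\<bar>plancherel_mean m H - v\<bar> \<le> plancherel_mean m (\<lambda>p. \<bar>H p + - v\<bar>)"
    using abs_plancherel_mean_le[of m "\<lambda>p. H p + - v"] by simp
  also have "\<dots> \<le> plancherel_mean m (\<lambda>p. \<epsilon> + (?b p * \<bar>H p\<bar> + \<bar>v\<bar> * ?b p))"
  proof (rule plancherel_mean_mono)
    fix p assume "p \<in> partition_seqs m"
    then show "\<bar>H p + - v\<bar> \<le> \<epsilon> + (?b p * \<bar>H p\<bar> + \<bar>v\<bar> * ?b p)"
      using close[of p] \<open>0 \<le> \<epsilon>\<close> by (cases "B p") auto
  qed
  also have "\<dots> = \<epsilon> + (plancherel_mean m (\<lambda>p. ?b p * \<bar>H p\<bar>) + \<bar>v\<bar> * plancherel_prob m B)"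
    by (simp add: plancherel_mean_add plancherel_mean_const plancherel_mean_cmult plancherel_prob_def)
  also have "plancherel_mean m (\<lambda>p. ?b p * \<bar>H p\<bar>) \<le>
      sqrt (plancherel_prob m B * plancherel_mean m (\<lambda>p. (H p)\<^sup>2))"
    using plancherel_mean_of_bool_mult_le[of m B "\<lambda>p. \<bar>H p\<bar>"] by simp
  finally show ?thesis by simp
qed

lemma plancherel_rare_deviation_from_mean:
  assumes \<eta>: "0 < \<eta>" and rare: "plancherel_rare (\<lambda>m p. \<eta> < \<bar>H m p - v m\<bar>)"
    and v: "eventually (\<lambda>m. \<bar>v m\<bar> \<le> K) sequentially"
    and sq: "eventually (\<lambda>m. plancherel_mean m (\<lambda>p. (H m p)\<^sup>2) \<le> M) sequentially"
    and mean: "(\<lambda>m. plancherel_mean m (H m)) \<longlonglongrightarrow> L"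
  shows "plancherel_rare (\<lambda>m p. 4 * \<eta> < \<bar>H m p - L\<bar>)"
proof (rule plancherel_rare_mono[OF rare])
  let ?P = "\<lambda>m. plancherel_prob m (\<lambda>p. \<eta> < \<bar>H m p - v m\<bar>)"
  have "(\<lambda>m. sqrt (?P m * M) + K * ?P m) \<longlonglongrightarrow> sqrt (0 * M) + K * 0"
    by (intro tendsto_intros plancherel_rare_tendsto_0 rare)
  then have "eventually (\<lambda>m. sqrt (?P m * M) + K * ?P m < \<eta>) sequentially"
    using \<eta> by (intro order_tendstoD(2)) auto
  moreover have "eventually (\<lambda>m. \<bar>plancherel_mean m (H m) - L\<bar> < \<eta>) sequentially"
    using tendstoD[OF mean \<eta>] by (simp add: dist_real_def)
  ultimately show "eventually (\<lambda>m. \<forall>p\<in>partition_seqs m. 4 * \<eta> < \<bar>H m p - L\<bar> \<longrightarrow> \<eta> <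
      \<bar>H m p - v m\<bar>) sequentially"
    using v sq
  proof eventually_elim
    case (elim m)
    have "\<bar>plancherel_mean m (H m) - v m\<bar> \<le>
        \<eta> + (sqrt (?P m * plancherel_mean m (\<lambda>p. (H m p)\<^sup>2)) + \<bar>v m\<bar> * ?P m)"
      using \<eta> by (intro plancherel_mean_close) (auto simp: not_less)
    also have "\<dots> \<le> \<eta> + (sqrt (?P m * M) + K * ?P m)"
      using elim plancherel_prob_nonneg
      by (intro add_mono real_sqrt_le_mono mult_left_mono mult_right_mono) auto
    finally show ?case using elim(1,2) by auto
  qed
qed

lemma box_weight_le:
  assumes a: "0 < a"
  shows "eventually (\<lambda>m. real m * laplacian_eigenvalue (a / sqrt (real m)) *
    exp (a / sqrt (real m) * real (typical_box_size m)) / a\<^sup>2 \<le> 2 * exp (4 * a)) sequentially"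
  using laplacian_eigenvalue_scaled_le[OF a] eventually_ge_at_top[of 1]
proof eventually_elim
  case (elim m)
  have "a / sqrt (real m) * real (typical_box_size m) \<le> a / sqrt (real m) * (4 * sqrt (real m))"
    using a elim(2) typical_box_size_le[of m] by (intro mult_left_mono) auto
  then have "a / sqrt (real m) * real (typical_box_size m) \<le> 4 * a" using elim(2) by simp
  then have "real m * laplacian_eigenvalue (a / sqrt (real m)) *
      exp (a / sqrt (real m) * real (typical_box_size m)) \<le>
      2 * a\<^sup>2 * exp (4 * a)"
    by (intro mult_mono[OF elim(1)]) simp_all
  then show ?case using a by (simp add: field_simps)
qed

lemma profile_exp_moment_boxed_le:
  assumes a: "0 < a"
  shows "eventually (\<lambda>m. \<forall>p\<in>boxed_partitions m (typical_box_size m). profile_exp_moment a m p \<le> 2 *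
      exp (4 * a)) sequentially"
  using box_weight_le[OF a]
proof eventually_elim
  case (elim m)
  let ?z = "a / sqrt (real m)"
  have "profile_exp_moment a m p \<le>
      laplacian_eigenvalue ?z * (real m * exp (?z * real (typical_box_size m))) / a\<^sup>2"
    if "p \<in> boxed_partitions m (typical_box_size m)" for p
    unfolding profile_exp_moment_def using a that
    by (intro divide_right_mono mult_left_mono exp_content_sum_boxed_le laplacian_eigenvalue_nonneg)
        auto
  then show ?case using elim by (force simp: mult_ac)
qed

lemma profile_exp_moment_diff_le:
  assumes a: "0 < a"
  shows "eventually (\<lambda>m. \<forall>p\<in>boxed_partitions m (typical_box_size m). \<forall>q\<in>boxed_partitions m (typical_box_size m).
    real m * \<bar>profile_exp_moment a m p - profile_exp_moment a m q\<bar> \<le>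
      2 * exp (4 * a) * row_distance (typical_box_size m) p q) sequentially"
  using box_weight_le[OF a]
proof eventually_elim
  case (elim m)
  let ?z = "a / sqrt (real m)" and ?d = "typical_box_size m"
  show ?case
  proof (intro ballI)
    fix p q assume p: "p \<in> boxed_partitions m ?d" and q: "q \<in> boxed_partitions m ?d"
    have "real m * \<bar>profile_exp_moment a m p - profile_exp_moment a m q\<bar> =
        real m * laplacian_eigenvalue ?z / a\<^sup>2 * \<bar>exp_content_sum ?z p - exp_content_sum ?z q\<bar>"
      by (simp add: profile_exp_moment_def diff_divide_distrib[symmetric] right_diff_distrib[symmetric]
          abs_mult laplacian_eigenvalue_nonneg)
    also have "\<dots> \<le> real m * laplacian_eigenvalue ?z / a\<^sup>2 * (row_distance ?d p q * exp (?z * real ?d))"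
      using a
      by (intro mult_left_mono exp_content_sum_diff_le[OF p q])
          (auto simp: laplacian_eigenvalue_nonneg)
    also have "\<dots> = real m * laplacian_eigenvalue ?z * exp (?z * real ?d) / a\<^sup>2 * row_distance ?d p q"
      by simp
    also have "\<dots> \<le> 2 * exp (4 * a) * row_distance ?d p q"
      using elim by (rule mult_right_mono) (simp add: row_distance_def sum_nonneg)
    finally show "real m * \<bar>profile_exp_moment a m p - profile_exp_moment a m q\<bar> \<le>
        2 * exp (4 * a) * row_distance ?d p q" .
  qed
qed

text \<open>Since every typical diagram is close to one maximiser of \<open>fdim\<close>, its exponential moments are
  nearly constant, hence close to their explicitly known means.\<close>

lemma plancherel_rare_profile_exp_moment_not_near_constant:
  assumes a: "0 < a" and \<eta>: "0 < \<eta>"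
  obtains v where "eventually (\<lambda>m. \<bar>v m\<bar> \<le> 2 * exp (4 * a)) sequentially"
    "plancherel_rare (\<lambda>m p. \<eta> < \<bar>profile_exp_moment a m p - v m\<bar>)"
proof -
  let ?box = "\<lambda>m. boxed_partitions m (typical_box_size m)"
    and ?dist = "\<lambda>m. row_distance (typical_box_size m)"
  define \<delta> where "\<delta> = \<eta> / (2 * exp (4 * a))"
  have "0 < \<delta>" using \<eta> by (simp add: \<delta>_def)
  then obtain p0 where p0: "eventually (\<lambda>m. p0 m \<in> ?box m) sequentially"
    and far: "plancherel_rare (\<lambda>m p. p \<in> ?box m \<and> \<delta> * real m \<le> ?dist m p (p0 m))"
    by (rule plancherel_rare_far_from_maximiser)
  show ?thesis
  proof (rule that[of "\<lambda>m. profile_exp_moment a m (p0 m)"])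
    show "eventually (\<lambda>m. \<bar>profile_exp_moment a m (p0 m)\<bar> \<le> 2 * exp (4 * a)) sequentially"
      using p0 profile_exp_moment_boxed_le[OF a]
      by eventually_elim (simp add: profile_exp_moment_nonneg)
    have "plancherel_rare (\<lambda>m. far_content (3 * sqrt (real m)))"
      using plancherel_rare_far_content[of 1] by simp
    from plancherel_rare_disj[OF this far]
    show "plancherel_rare (\<lambda>m p. \<eta> < \<bar>profile_exp_moment a m p - profile_exp_moment a m (p0 m)\<bar>)"
    proof (rule plancherel_rare_mono)
      show "eventually (\<lambda>m. \<forall>p\<in>partition_seqs m. \<eta> <
          \<bar>profile_exp_moment a m p - profile_exp_moment a m (p0 m)\<bar> \<longrightarrow>
          far_content (3 * sqrt (real m)) p \<or> p \<in> ?box m \<and> \<delta> * real m \<le> ?dist m p (p0 m)) sequentially"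
        using p0 profile_exp_moment_diff_le[OF a]
      proof (eventually_elim, intro ballI impI disjCI)
        fix m p
        assume p0: "p0 m \<in> ?box m"
          and diff: "\<forall>p\<in>?box m. \<forall>q\<in>?box m. real m *
              \<bar>profile_exp_moment a m p - profile_exp_moment a m q\<bar> \<le>
            2 * exp (4 * a) * ?dist m p q"
          and p: "p \<in> partition_seqs m"
            and large: "\<eta> < \<bar>profile_exp_moment a m p - profile_exp_moment a m (p0 m)\<bar>"
          and "\<not> (p \<in> ?box m \<and> \<delta> * real m \<le> ?dist m p (p0 m))"
        show "far_content (3 * sqrt (real m)) p"
        proof (rule ccontr)
          assume "\<not> ?thesis"
          then have box: "p \<in> ?box m"
            using typical_box_size_ge by (intro not_far_content_boxed[OF p]) auto
          have "\<eta> * real m \<le> 2 * exp (4 * a) * ?dist m p (p0 m)"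
            using mult_left_mono[OF less_imp_le[OF large], of "real m"] diff box p0
            by (force simp: mult.commute)
          then have "\<delta> * real m \<le> ?dist m p (p0 m)" by (simp add: \<delta>_def field_simps)
          then show False using box \<open>\<not> (p \<in> ?box m \<and> \<delta> * real m \<le> ?dist m p (p0 m))\<close> by blast
        qed
      qed
    qed
  qed
qed

theorem plancherel_rare_profile_exp_moment:
  assumes a: "0 < a" and \<eta>: "0 < \<eta>"
  shows "plancherel_rare (\<lambda>m p. \<eta> < \<bar>profile_exp_moment a m p - shape_exp_moment a\<bar>)"
proof -
  obtain v where "eventually (\<lambda>m. \<bar>v m\<bar> \<le> 2 * exp (4 * a)) sequentially"
    "plancherel_rare (\<lambda>m p. \<eta> / 4 < \<bar>profile_exp_moment a m p - v m\<bar>)"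
    using plancherel_rare_profile_exp_moment_not_near_constant[of a "\<eta> / 4"] a \<eta> by auto
  then have "plancherel_rare (\<lambda>m p. 4 * (\<eta> / 4) < \<bar>profile_exp_moment a m p - shape_exp_moment a\<bar>)"
    using plancherel_mean_profile_exp_moment_sq_le[OF a]
      plancherel_mean_profile_exp_moment_tendsto[OF a] \<eta>
    by (intro plancherel_rare_deviation_from_mean) auto
  then show ?thesis by simp
qed

section \<open>Law of large numbers for the Plancherel measure\<close>

definition scaled_profile :: "nat \<Rightarrow> (nat \<Rightarrow> nat) \<Rightarrow> real \<Rightarrow> real" where
  "scaled_profile m p x = russian_profile p (x * sqrt (real m)) / sqrt (real m)"

lemma scaled_profile_lipschitz:
  assumes p: "p \<in> partition_seqs m"
  shows "1-lipschitz_on UNIV (scaled_profile m p)"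
proof (rule lipschitz_onI)
  fix x y
  let ?r = "sqrt (real m)"
  have "dist (scaled_profile m p x) (scaled_profile m p y) =
      dist (russian_profile p (x * ?r)) (russian_profile p (y * ?r)) / ?r"
    by (simp add: scaled_profile_def dist_real_def diff_divide_distrib[symmetric])
  also have "\<dots> \<le> dist (x * ?r) (y * ?r) / ?r"
    using lipschitz_onD[OF russian_profile_lipschitz[OF p], of "x * ?r" "y * ?r"]
    by (intro divide_right_mono) auto
  also have "\<dots> \<le> 1 * dist x y"
    by (cases "m = 0") (simp_all add: dist_real_def left_diff_distrib[symmetric] abs_mult)
  finally show "dist (scaled_profile m p x) (scaled_profile m p y) \<le> 1 * dist x y" .
qed simp

lemma integral_scaled_profile_minus_limit_shape:
  assumes p: "p \<in> partition_seqs m" and m: "0 < m" and a: "0 < a" and b: "2 \<le> b"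
    and contents: "\<And>i j. j < p i \<Longrightarrow> \<bar>real_of_int (int j - int i)\<bar> + 1 \<le> b * sqrt (real m)"
  shows "integral {- b..b} (\<lambda>x. (scaled_profile m p x - limit_shape x) * exp (a * x)) =
    2 * (profile_exp_moment a m p - shape_exp_moment a)"
proof -
  let ?r = "sqrt (real m)" and ?T = "\<lambda>x. sum_contents (\<lambda>c. tent (x * sqrt (real m) - of_int c)) p"
  have "((\<lambda>x. 2 / ?r * (?T x * exp (a * x))) has_integral
      (2 / ?r * (?r / a\<^sup>2 * laplacian_eigenvalue (a / ?r) * exp_content_sum (a / ?r) p))) {- b..b}"
    by (intro has_integral_mult_right has_integral_tents_exp[OF p]) (use contents m a in auto)
  from has_integral_diff[OF this has_integral_limit_shape_excess]
  have "((\<lambda>x. 2 / ?r * (?T x * exp (a * x)) - (limit_shape x - \<bar>x\<bar>) * exp (a * x)) has_integral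
      2 * (profile_exp_moment a m p - shape_exp_moment a)) {- b..b}"
    using a b m by (simp add: profile_exp_moment_def shape_exp_moment_def right_diff_distrib)
  moreover have "2 / ?r * (?T x * exp (a * x)) - (limit_shape x - \<bar>x\<bar>) * exp (a * x) =
      (scaled_profile m p x - limit_shape x) * exp (a * x)" for x
    using m
    by (simp add: scaled_profile_def russian_profile_eq_tents[OF p] add_divide_distrib abs_mult
        algebra_simps)
  ultimately show ?thesis by (simp add: integral_unique)
qed

lemma small_exp_moments_scaled_profile:
  assumes p: "p \<in> partition_seqs m" and m: "0 < m" and near: "\<not> far_content (3 * sqrt (real m)) p"
    and moments: "\<And>j. j \<in> {1..J} \<Longrightarrow>
        \<bar>profile_exp_moment (real j) m p - shape_exp_moment (real j)\<bar> \<le> \<delta> / 2"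
  shows "small_exp_moments 2 4 J \<delta> (\<lambda>x. scaled_profile m p x - limit_shape x)"
proof -
  let ?r = "sqrt (real m)"
  have r: "1 \<le> ?r" using m by simp
  have contents: "\<bar>real_of_int (int j - int i)\<bar> + 1 \<le> 4 * ?r" if "j < p i" for i j
  proof -
    have "\<bar>real_of_int (int j - int i)\<bar> < 3 * ?r" using near that unfolding far_content_def by force
    then show ?thesis using r by linarith
  qed
  have lipschitz: "2-lipschitz_on UNIV (\<lambda>x. scaled_profile m p x - limit_shape x)"
    using lipschitz_on_diff[OF scaled_profile_lipschitz[OF p] limit_shape_lipschitz] by simp
  have support: "scaled_profile m p x - limit_shape x = 0" if x: "4 \<le> \<bar>x\<bar>" for x
  proof -
    have "4 * ?r \<le> \<bar>x\<bar> * ?r" using x r by (intro mult_right_mono) auto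
    then have "4 * ?r \<le> \<bar>x * ?r\<bar>" by (simp add: abs_mult)
    have "russian_profile p (x * ?r) = \<bar>x * ?r\<bar>"
    proof (intro russian_profile_far[OF p])
      fix i j assume "j < p i"
      from contents[OF this] show "1 \<le> \<bar>x * ?r - of_int (int j - int i)\<bar>"
        using \<open>4 * ?r \<le> \<bar>x * ?r\<bar>\<close> by linarith
    qed
    then show ?thesis using x limit_shape_outer[of x] m by (simp add: scaled_profile_def abs_mult)
  qed
  have "\<bar>integral {- 4..4} (\<lambda>x. (scaled_profile m p x - limit_shape x) * exp (real j * x))\<bar> \<le> \<delta>"
    if j: "j \<in> {1..J}" for j
  proof -
    have moment: "integral {- 4..4} (\<lambda>x. (scaled_profile m p x - limit_shape x) * exp (real j * x)) =
        2 * (profile_exp_moment (real j) m p - shape_exp_moment (real j))"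
      using j contents m by (intro integral_scaled_profile_minus_limit_shape[OF p]) auto
    show ?thesis unfolding moment abs_mult using moments[OF j] by simp
  qed
  then show ?thesis unfolding small_exp_moments_def using lipschitz support by blast
qed

theorem plancherel_rare_profile_far_from_limit_shape:
  assumes \<epsilon>: "0 < \<epsilon>"
  shows "plancherel_rare (\<lambda>m p. \<exists>x. \<epsilon> < \<bar>scaled_profile m p x - limit_shape x\<bar>)"
proof -
  obtain J \<delta> where \<delta>: "0 < \<delta>" and determined: "\<And>g x. small_exp_moments 2 4 J \<delta> g \<Longrightarrow> \<bar>g x\<bar> \<le> \<epsilon>"
    using exp_moments_determine_uniformly[of 4 2 \<epsilon>] \<epsilon> by auto
  have "plancherel_rare (\<lambda>m p. far_content ((2 + 1) * sqrt (real m)) p \<or>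
      (\<exists>j\<in>{1..J}. \<delta> / 2 < \<bar>profile_exp_moment (real j) m p - shape_exp_moment (real j)\<bar>))"
    by (intro plancherel_rare_disj plancherel_rare_bex plancherel_rare_far_content
        plancherel_rare_profile_exp_moment)
      (use \<delta> in auto)
  then show ?thesis
  proof (rule plancherel_rare_mono)
    show "eventually (\<lambda>m. \<forall>p\<in>partition_seqs m. (\<exists>x. \<epsilon> < \<bar>scaled_profile m p x - limit_shape x\<bar>) \<longrightarrow>
        far_content ((2 + 1) * sqrt (real m)) p \<or>
        (\<exists>j\<in>{1..J}. \<delta> / 2 < \<bar>profile_exp_moment (real j) m p - shape_exp_moment (real j)\<bar>)) sequentially"
      using eventually_gt_at_top[of 0]
    proof eventually_elim
      case (elim m)
      have "\<bar>scaled_profile m p x - limit_shape x\<bar> \<le> \<epsilon>"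
        if "p \<in> partition_seqs m" "\<not> far_content ((2 + 1) * sqrt (real m)) p"
          "\<not> (\<exists>j\<in>{1..J}. \<delta> / 2 < \<bar>profile_exp_moment (real j) m p - shape_exp_moment (real j)\<bar>)"
            for p x
        using that by (intro determined small_exp_moments_scaled_profile elim) (auto simp: not_less)
      then show ?case by (meson not_le)
    qed
  qed
qed

definition near_limit_shape :: "real \<Rightarrow> nat \<Rightarrow> (nat \<Rightarrow> nat) \<Rightarrow> bool" where
  "near_limit_shape \<epsilon> m p \<longleftrightarrow> (\<forall>x. \<bar>scaled_profile m p x - limit_shape x\<bar> \<le> \<epsilon>) \<and>
     \<bar>real (p 0) / sqrt (real m) - 2\<bar> \<le> \<epsilon> \<and> \<bar>real (column_length p 0) / sqrt (real m) - 2\<bar> \<le> \<epsilon>"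

lemma near_limit_shapeI:
  assumes p: "p \<in> partition_seqs m" and \<epsilon>: "0 < \<epsilon>" "\<epsilon> \<le> 2" and large: "1 \<le> \<epsilon> / 2 * sqrt (real m)"
    and shape: "\<And>x. \<bar>scaled_profile m p x - limit_shape x\<bar> \<le> \<kappa>"
    and \<kappa>: "\<kappa> \<le> \<epsilon>" "\<kappa> < limit_shape (2 - \<epsilon>) - (2 - \<epsilon>)"
    and near: "\<not> far_content ((2 + \<epsilon> / 2) * sqrt (real m)) p"
  shows "near_limit_shape \<epsilon> m p"
proof -
  let ?r = "sqrt (real m)"
  have r: "0 < ?r" using large \<epsilon> by (cases "m = 0") auto
  have "real (p 0) < (2 + \<epsilon> / 2) * ?r + 1"
    using \<epsilon> by (intro not_far_content_first_row[OF near]) auto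
  then have row_le: "real (p 0) \<le> (2 + \<epsilon>) * ?r" using large by (simp add: algebra_simps)
  have row_ge: "(2 - \<epsilon>) * ?r \<le> real (p 0)"
  proof (rule ccontr)
    assume "\<not> ?thesis"
    then have "scaled_profile m p (2 - \<epsilon>) = 2 - \<epsilon>"
      unfolding scaled_profile_def using r by (subst russian_profile_right[OF p]) auto
    then show False using shape[of "2 - \<epsilon>"] \<kappa>(2) by simp
  qed
  have column_le: "real (column_length p 0) \<le> (2 + \<epsilon>) * ?r"
  proof (cases "column_length p 0")
    case (Suc k)
    then have "p k \<noteq> 0" using less_column_length_iff[OF p, of k 0] by simp
    then have "real k < (2 + \<epsilon> / 2) * ?r" using not_far_content_row_eq_0[OF near, of k] by force
    then show ?thesis using Suc large by (simp add: algebra_simps)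
  qed (use \<epsilon> in simp)
  have column_ge: "(2 - \<epsilon>) * ?r \<le> real (column_length p 0)"
  proof (rule ccontr)
    assume short: "\<not> ?thesis"
    have "p i = 0" if "(2 - \<epsilon>) * ?r < real i + 1" for i
      using that short less_column_length_iff[OF p, of i 0] by (cases "p i = 0") auto
    then have "scaled_profile m p (- (2 - \<epsilon>)) = 2 - \<epsilon>"
      unfolding scaled_profile_def mult_minus_left using \<epsilon> r by (subst russian_profile_left[OF p]) auto
    then show False using shape[of "- (2 - \<epsilon>)"] \<kappa>(2) unfolding limit_shape_minus by simp
  qed
  have "\<bar>scaled_profile m p x - limit_shape x\<bar> \<le> \<epsilon>" for x using shape[of x] \<kappa>(1) by simp
  then show ?thesis
    using row_le row_ge column_le column_ge r
    by (simp add: near_limit_shape_def abs_le_iff field_simps)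
qed

theorem plancherel_rare_not_near_limit_shape:
  assumes \<epsilon>: "0 < \<epsilon>" "\<epsilon> \<le> 2"
  shows "plancherel_rare (\<lambda>m p. \<not> near_limit_shape \<epsilon> m p)"
proof -
  define \<kappa> where "\<kappa> = min \<epsilon> ((limit_shape (2 - \<epsilon>) - (2 - \<epsilon>)) / 2)"
  have "2 - \<epsilon> < limit_shape (2 - \<epsilon>)" using limit_shape_greater[of "2 - \<epsilon>"] \<epsilon> by simp
  then have \<kappa>: "0 < \<kappa>" "\<kappa> \<le> \<epsilon>" "\<kappa> < limit_shape (2 - \<epsilon>) - (2 - \<epsilon>)"
    using \<epsilon> by (auto simp: \<kappa>_def min_def)
  have "plancherel_rare (\<lambda>m p. (\<exists>x. \<kappa> < \<bar>scaled_profile m p x - limit_shape x\<bar>) \<or>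
      far_content ((2 + \<epsilon> / 2) * sqrt (real m)) p)"
    using \<epsilon> \<kappa>(1)
    by (intro plancherel_rare_disj plancherel_rare_profile_far_from_limit_shape
        plancherel_rare_far_content) auto
  moreover have "eventually (\<lambda>m. 1 \<le> \<epsilon> / 2 * sqrt (real m)) sequentially" using \<epsilon> by real_asymp
  then have "eventually (\<lambda>m. \<forall>p\<in>partition_seqs m. \<not> near_limit_shape \<epsilon> m p \<longrightarrow>
      (\<exists>x. \<kappa> < \<bar>scaled_profile m p x - limit_shape x\<bar>) \<or> far_content ((2 + \<epsilon> / 2) *
          sqrt (real m)) p) sequentially"
    by eventually_elim (use near_limit_shapeI[OF _ \<epsilon> _ _ \<kappa>(2,3)] in \<open>auto simp: not_less[symmetric]\<close>)
  ultimately show ?thesis by (rule plancherel_rare_mono)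
qed

section \<open>Splitting off the first row\<close>

lemma exp_minus_double_le:
  fixes x :: real
  assumes "0 \<le> x" "x \<le> 1 / 2"
  shows "exp (- 2 * x) \<le> 1 - x"
proof -
  have "- 2 * x \<le> - x - 2 * x\<^sup>2"
    using mult_left_mono[OF assms(2,1)] by (simp add: power2_eq_square)
  also have "\<dots> \<le> ln (1 - x)" using assms by (rule ln_one_minus_pos_lower_bound)
  finally have "exp (- 2 * x) \<le> exp (ln (1 - x))" by (simp only: exp_le_cancel_iff)
  then show ?thesis using assms by simp
qed

lemma power_mult_exp_le_power:
  fixes x a b :: real
  assumes "0 \<le> x" "x \<le> 1 / 2" "0 \<le> a" "a * (1 - x) \<le> b"
  shows "a ^ l * exp (- 2 * x * real l) \<le> b ^ l"
proof -
  have "a * exp (- 2 * x) \<le> a * (1 - x)"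
    using exp_minus_double_le[OF assms(1,2)] assms(3) by (rule mult_left_mono)
  then have "(a * exp (- 2 * x)) ^ l \<le> b ^ l" using assms(3,4) by (intro power_mono) auto
  moreover have "exp (- 2 * x) ^ l = exp (- 2 * x * real l)"
    by (simp add: exp_of_nat_mult[symmetric] mult.commute)
  ultimately show ?thesis unfolding power_mult_distrib by simp
qed

lemma sum_real_lessThan: "(\<Sum>j<k. real j) = real k * (real k - 1) / 2"
  by (induction k) (auto simp: field_simps)

text \<open>The term \<open>- m\<close> is there because the contents of the other rows drop by one.\<close>

definition first_row_content :: "nat \<Rightarrow> nat \<Rightarrow> real" where
  "first_row_content k m = real k * (real k - 1) / 2 - real m"

lemma total_content_case_nat:
  assumes q: "q \<in> partition_seqs m"
  shows "total_content (case_nat k q) = first_row_content k m + total_content q"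
proof -
  have "total_content (case_nat k q) = (\<Sum>i<Suc m. \<Sum>j<case_nat k q i. real_of_int (int j - int i))"
    unfolding total_content_def
    using partition_seqs_eq_0[OF q] by (intro sum_contents_eq) (auto split: nat.split)
  also have "\<dots> = (\<Sum>j<k. real j) + (\<Sum>i<m. (\<Sum>j<q i. real_of_int (int j - int i)) - real (q i))"
    by (simp add: sum.lessThan_Suc_shift sum_subtractf algebra_simps del: sum.lessThan_Suc)
  also have "\<dots> = (\<Sum>j<k. real j) + ((\<Sum>i<m. \<Sum>j<q i. real_of_int (int j - int i)) - real (\<Sum>i<m. q i))"
    by (simp add: sum_subtractf)
  also have "(\<Sum>i<m. \<Sum>j<q i. real_of_int (int j - int i)) = total_content q"
    unfolding total_content_def
    using partition_seqs_eq_0[OF q] by (intro sum_contents_eq[symmetric]) auto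
  also have "(\<Sum>i<m. q i) = m" using q by (simp add: partition_seqs_def)
  finally show ?thesis by (simp add: sum_real_lessThan first_row_content_def)
qed

lemma fdim_case_nat_le:
  assumes q: "q \<in> partition_seqs m" and k: "q 0 \<le> k"
  shows "fdim (case_nat k q) \<le> real ((k + m) choose k) * fdim q"
proof -
  have "(\<Prod>i<m. 1 - real (q i) / real (k + i + 1)) \<le> 1"
  proof (rule prod_le_1)
    fix i
    have "q i \<le> k" using partition_seqs_antimono[OF q, of 0 i] k by simp
    then show "0 \<le> 1 - real (q i) / real (k + i + 1) \<and> 1 - real (q i) / real (k + i + 1) \<le> 1"
      by (simp add: field_simps)
  qed
  then have "real ((k + m) choose k) * fdim q * (\<Prod>i<m. 1 - real (q i) / real (k + i + 1)) \<le>
      real ((k + m) choose k) * fdim q * 1"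
    using fdim_pos[OF q] by (intro mult_left_mono) auto
  then show ?thesis using fdim_case_nat[OF q k partition_seqs_eq_0[OF q]] by simp
qed

lemma fdim_case_nat_ge:
  assumes q: "q \<in> partition_seqs m" and k: "2 * q 0 \<le> k" "1 \<le> k"
  shows "real ((k + m) choose k) * fdim q * exp (- 2 * real m / real k) \<le> fdim (case_nat k q)"
proof -
  have "(\<Sum>i<m. - 2 * (real (q i) / real k)) = - 2 * (real (\<Sum>i<m. q i) / real k)"
    by (simp only: sum_distrib_left[symmetric] sum_divide_distrib[symmetric] of_nat_sum)
  also have "(\<Sum>i<m. q i) = m" using q by (simp add: partition_seqs_def)
  finally have "- 2 * real m / real k = (\<Sum>i<m. - 2 * (real (q i) / real k))" by simp
  then have "exp (- 2 * real m / real k) = (\<Prod>i<m. exp (- 2 * (real (q i) / real k)))"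
    by (simp add: exp_sum)
  also have "\<dots> \<le> (\<Prod>i<m. 1 - real (q i) / real (k + i + 1))"
  proof (intro prod_mono conjI)
    fix i
    let ?x = "real (q i) / real (k + i + 1)"
    have x_le: "?x \<le> real (q i) / real k" using k by (intro divide_left_mono) auto
    have "2 * real (q i) \<le> real k" using partition_seqs_antimono[OF q, of 0 i] k by linarith
    then have "?x \<le> 1 / 2" by (intro order_trans[OF x_le]) (use k in \<open>simp add: field_simps\<close>)
    then have "exp (- 2 * ?x) \<le> 1 - ?x" by (intro exp_minus_double_le) auto
    moreover have "exp (- 2 * (real (q i) / real k)) \<le> exp (- 2 * ?x)" using x_le by simp
    ultimately show "exp (- 2 * (real (q i) / real k)) \<le> 1 - ?x" by (rule order_trans[rotated])
  qed simp
  finally have "real ((k + m) choose k) * fdim q * exp (- 2 * real m / real k) \<le>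
      real ((k + m) choose k) * fdim q * (\<Prod>i<m. 1 - real (q i) / real (k + i + 1))"
    using fdim_pos[OF q] by (intro mult_left_mono) auto
  then show ?thesis using fdim_case_nat[OF q _ partition_seqs_eq_0[OF q], of k] k by simp
qed

text \<open>The unnormalised density of the positive half measure. The Hurwitz number cancels on
  conditioning, so the Frobenius character formula for it plays no role.\<close>

definition hurwitz_weight :: "nat \<Rightarrow> (nat \<Rightarrow> nat) \<Rightarrow> real" where
  "hurwitz_weight l p = (if 0 < total_content p then (fdim p)\<^sup>2 * total_content p ^ l else 0)"

definition event_weight :: "nat \<Rightarrow> nat \<Rightarrow> ((nat \<Rightarrow> nat) \<Rightarrow> bool) \<Rightarrow> real" where
  "event_weight n l P = (\<Sum>p\<in>partition_seqs n. of_bool (P p) * hurwitz_weight l p)"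

lemma hurwitz_weight_nonneg: "0 \<le> hurwitz_weight l p"
  by (simp add: hurwitz_weight_def)

lemma event_weight_nonneg: "0 \<le> event_weight n l P"
  by (simp add: event_weight_def sum_nonneg hurwitz_weight_nonneg)

lemma event_weight_mono:
  "(\<And>p. p \<in> partition_seqs n \<Longrightarrow> P p \<Longrightarrow> Q p) \<Longrightarrow> event_weight n l P \<le> event_weight n l Q"
  unfolding event_weight_def by (intro sum_mono mult_right_mono hurwitz_weight_nonneg) auto

lemma event_weight_disj_le: "event_weight n l (\<lambda>p. P p \<or> Q p) \<le>
    event_weight n l P + event_weight n l Q"
  unfolding event_weight_def sum.distrib[symmetric]
  by (intro sum_mono) (auto simp: hurwitz_weight_nonneg)

lemma event_weight_sum_first_row: "event_weight n l P = (\<Sum>k\<le>n. event_weight n l (\<lambda>p. p 0 = k \<and> P p))"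
proof -
  have "(\<Sum>k\<le>n. of_bool (p 0 = k \<and> P p) * hurwitz_weight l p) = of_bool (P p) * hurwitz_weight l p"
    if p: "p \<in> partition_seqs n" for p
  proof -
    have "(\<Sum>k\<le>n. of_bool (p 0 = k \<and> P p) * hurwitz_weight l p) =
        (\<Sum>k\<le>n. if p 0 = k then of_bool (P p) * hurwitz_weight l p else 0)"
      by (intro sum.cong) auto
    then show ?thesis using partition_seqs_le[OF p, of 0] by simp
  qed
  then show ?thesis unfolding event_weight_def by (subst sum.swap) (simp only: cong: sum.cong)
qed

lemma event_weight_first_row:
  assumes "k \<le> n"
  shows "event_weight n l (\<lambda>p. p 0 = k \<and> P p) =
    (\<Sum>q\<in>{q \<in> partition_seqs (n - k). q 0 \<le> k}. of_bool (P (case_nat k q)) *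
        hurwitz_weight l (case_nat k q))"
proof -
  have "event_weight n l (\<lambda>p. p 0 = k \<and> P p) =
      (\<Sum>p\<in>{p \<in> partition_seqs n. p 0 = k}. of_bool (P p) * hurwitz_weight l p)"
    unfolding event_weight_def using finite_partition_seqs by (intro sum.mono_neutral_cong_right) auto
  also have "\<dots> = (\<Sum>q\<in>{q \<in> partition_seqs (n - k). q 0 \<le> k}.
      of_bool (P (case_nat k q)) * hurwitz_weight l (case_nat k q))"
  proof (rule sum.reindex_bij_witness[of _ "\<lambda>q. case_nat k q" "\<lambda>p. p \<circ> Suc"])
    fix p assume p: "p \<in> {p \<in> partition_seqs n. p 0 = k}"
    then show case_nat: "case_nat k (p \<circ> Suc) = p" using case_nat_comp_Suc[of p] by auto
    show "p \<circ> Suc \<in> {q \<in> partition_seqs (n - k). q 0 \<le> k}"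
      using p comp_Suc_partition_seqs[of p n] partition_seqs_antimono[of p n 0 1] by auto
    show "of_bool (P (case_nat k (p \<circ> Suc))) * hurwitz_weight l (case_nat k (p \<circ> Suc)) =
        of_bool (P p) * hurwitz_weight l p"
      unfolding case_nat ..
  next
    fix q assume q: "q \<in> {q \<in> partition_seqs (n - k). q 0 \<le> k}"
    show "case_nat k q \<circ> Suc = q" by auto
    show "case_nat k q \<in> {p \<in> partition_seqs n. p 0 = k}"
      using q partition_seqs_case_nat[of q "n - k" k] assms by auto
  qed
  finally show ?thesis .
qed

lemma hurwitz_weight_case_nat_le:
  fixes k m l :: nat
  assumes q: "q \<in> partition_seqs m" and q0: "q 0 \<le> k"
  defines "K \<equiv> first_row_content k m"
  assumes K: "0 < K"
  shows "hurwitz_weight l (case_nat k q) \<le>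
    (real ((k + m) choose k))\<^sup>2 * K ^ l * ((fdim q)\<^sup>2 * exp (real l / K * total_content q))"
proof (cases "0 < total_content (case_nat k q)")
  case True
  have content: "total_content (case_nat k q) = K * (1 + total_content q / K)"
    using total_content_case_nat[OF q, of k] K by (simp add: K_def distrib_left)
  have "total_content (case_nat k q) ^ l = K ^ l * (1 + total_content q / K) ^ l"
    unfolding content power_mult_distrib ..
  also have "\<dots> \<le> K ^ l * exp (total_content q / K) ^ l"
  proof (intro mult_left_mono power_mono)
    show "1 + total_content q / K \<le> exp (total_content q / K)" by (rule exp_ge_add_one_self)
    show "0 \<le> 1 + total_content q / K" using True K unfolding content by (simp add: zero_less_mult_iff)
  qed (use K in simp)
  also have "exp (total_content q / K) ^ l = exp (real l / K * total_content q)"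
    by (simp add: exp_of_nat_mult[symmetric])
  finally have "(fdim (case_nat k q))\<^sup>2 * total_content (case_nat k q) ^ l \<le>
      (real ((k + m) choose k) * fdim q)\<^sup>2 * (K ^ l * exp (real l / K * total_content q))"
    using fdim_case_nat_le[OF q q0] fdim_pos[OF partition_seqs_case_nat[OF q q0]] True
    by (intro mult_mono power_mono) auto
  then show ?thesis using True by (simp add: hurwitz_weight_def power_mult_distrib mult_ac)
qed (use K in \<open>simp add: hurwitz_weight_def\<close>)

lemma hurwitz_weight_case_nat_ge:
  fixes k m l :: nat
  assumes q: "q \<in> partition_seqs m" and k: "2 * q 0 \<le> k" "1 \<le> k"
    and content: "- 2 * real m \<le> total_content q"
  defines "K \<equiv> first_row_content k m"
  assumes K: "0 < K" "4 * real m \<le> K"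
  shows "(real ((k + m) choose k))\<^sup>2 * K ^ l * exp (- 4 * real m / real k - 4 * real m * real l / K) *
      (fdim q)\<^sup>2 \<le>
    hurwitz_weight l (case_nat k q)"
proof -
  let ?C = "real ((k + m) choose k)"
  have total: "total_content (case_nat k q) = K + total_content q"
    using total_content_case_nat[OF q, of k] by (simp add: K_def)
  have pos: "0 < total_content (case_nat k q)"
    unfolding total using content K by (cases "m = 0") auto
  have "K ^ l * exp (- 2 * (2 * real m / K) * real l) \<le> total_content (case_nat k q) ^ l"
  proof (rule power_mult_exp_le_power)
    show "2 * real m / K \<le> 1 / 2" using K by (simp add: field_simps)
    show "K * (1 - 2 * real m / K) \<le> total_content (case_nat k q)"
      unfolding total using content K by (simp add: right_diff_distrib)
  qed (use K in auto)
  moreover have "(?C * fdim q * exp (- 2 * real m / real k))\<^sup>2 \<le> (fdim (case_nat k q))\<^sup>2"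
    using fdim_case_nat_ge[OF q k] fdim_pos[OF q] by (intro power_mono) auto
  ultimately have "(?C * fdim q * exp (- 2 * real m / real k))\<^sup>2 *
      (K ^ l * exp (- 2 * (2 * real m / K) * real l)) \<le>
      (fdim (case_nat k q))\<^sup>2 * total_content (case_nat k q) ^ l"
    using K by (intro mult_mono) auto
  also have "\<dots> = hurwitz_weight l (case_nat k q)" using pos by (simp add: hurwitz_weight_def)
  finally have "(?C * fdim q * exp (- 2 * real m / real k))\<^sup>2 *
      (K ^ l * exp (- 2 * (2 * real m / K) * real l)) \<le>
      hurwitz_weight l (case_nat k q)" .
  moreover have "exp (- 4 * real m / real k - 4 * real m * real l / K) =
      (exp (- 2 * real m / real k))\<^sup>2 * exp (- 2 * (2 * real m / K) * real l)"
    by (simp add: exp_double[symmetric] exp_add[symmetric])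
  ultimately show ?thesis by (simp only: power_mult_distrib mult_ac)
qed

definition first_row_weight :: "nat \<Rightarrow> nat \<Rightarrow> nat \<Rightarrow> real" where
  "first_row_weight n l k = (real (n choose k))\<^sup>2 * fact (n - k) * first_row_content k (n - k) ^ l"

lemma event_weight_first_row_ge:
  fixes n k l :: nat
  defines "m \<equiv> n - k"
  defines "K \<equiv> first_row_content k m"
  assumes k: "1 \<le> k" "k \<le> n" and K: "0 < K" "4 * real m \<le> K"
    and mass: "1 / 2 \<le> plancherel_prob m (\<lambda>q. 2 * q 0 \<le> k \<and> - 2 * real m \<le> total_content q)"
  shows "first_row_weight n l k * exp (- 1 - 4 * real m / real k - 4 * real m * real l / K) \<le>
    event_weight n l (\<lambda>p. p 0 = k)"
proof -
  let ?G = "\<lambda>q. 2 * q 0 \<le> k \<and> - 2 * real m \<le> total_content q"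
  define c where "c = (real (n choose k))\<^sup>2 * K ^ l *
      exp (- 4 * real m / real k - 4 * real m * real l / K)"
  have c: "0 \<le> c" using K by (simp add: c_def)
  have n: "k + m = n" using k by (simp add: m_def)
  have "c * (fact m / 2) \<le> c * (fact m * plancherel_prob m ?G)"
    using mass c by (intro mult_left_mono) auto
  also have "\<dots> = (\<Sum>q\<in>{q \<in> partition_seqs m. ?G q}. c * (fdim q)\<^sup>2)"
    unfolding plancherel_prob_eq_sum sum_distrib_left[symmetric] by simp
  also have "\<dots> \<le> (\<Sum>q\<in>{q \<in> partition_seqs m. ?G q}. hurwitz_weight l (case_nat k q))"
    unfolding c_def K_def n[symmetric]
    by (intro sum_mono hurwitz_weight_case_nat_ge) (use k K in \<open>auto simp: K_def\<close>)
  also have "\<dots> \<le> (\<Sum>q\<in>{q \<in> partition_seqs m. q 0 \<le> k}. hurwitz_weight l (case_nat k q))"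
    using finite_partition_seqs by (intro sum_mono2 hurwitz_weight_nonneg) auto
  also have "\<dots> = event_weight n l (\<lambda>p. p 0 = k)"
    using event_weight_first_row[OF k(2), of l "\<lambda>_. True"] by (simp add: m_def)
  finally have "c * (fact m / 2) \<le> event_weight n l (\<lambda>p. p 0 = k)" .
  moreover have "exp (- 1) * (c * fact m) \<le> 1 / 2 * (c * fact m)"
    using exp_ge_add_one_self[of "1::real"] c
    by (intro mult_right_mono) (auto simp: exp_minus field_simps)
  moreover have "exp (- 1 - 4 * real m / real k - 4 * real m * real l / K) =
      exp (- 1) * exp (- 4 * real m / real k - 4 * real m * real l / K)"
    by (simp add: exp_add[symmetric])
  then have "first_row_weight n l k * exp (- 1 - 4 * real m / real k - 4 * real m * real l / K) =
      exp (- 1) * (c * fact m)"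
    by (simp add: first_row_weight_def c_def m_def K_def)
  ultimately show ?thesis by linarith
qed

lemma event_weight_first_row_le:
  fixes n k l :: nat and R :: real
  defines "m \<equiv> n - k"
  defines "K \<equiv> first_row_content k m"
  assumes k: "k \<le> n" and K: "0 < K" and R: "0 \<le> R"
  shows "event_weight n l (\<lambda>p. p 0 = k \<and> real (p 1) \<le> R \<and> B (p \<circ> Suc)) \<le>
    first_row_weight n l k *
      sqrt (plancherel_prob m B * exp ((2 * real l / K)\<^sup>2 * exp (2 * real l / K * R) * (real m)\<^sup>2))"
proof -
  define b where "b = real l / K"
  define c where "c = (real (n choose k))\<^sup>2 * K ^ l"
  have c: "0 \<le> c" and b: "0 \<le> b" using K by (simp_all add: c_def b_def)
  have n: "k + m = n" using k by (simp add: m_def)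
  let ?E = "\<lambda>q. of_bool (real (q 0) \<le> R) * exp (b * total_content q)"
  have E_sq: "(\<lambda>q. (?E q)\<^sup>2) = (\<lambda>q. of_bool (real (q 0) \<le> R) * exp (2 * b * total_content q))"
    by (auto simp: power2_eq_square exp_add[symmetric])
  have "event_weight n l (\<lambda>p. p 0 = k \<and> real (p 1) \<le> R \<and> B (p \<circ> Suc)) =
      (\<Sum>q\<in>{q \<in> partition_seqs m. q 0 \<le> k}. of_bool (real (q 0) \<le> R \<and> B q) *
          hurwitz_weight l (case_nat k q))"
    unfolding event_weight_first_row[OF k] by (simp add: m_def comp_def)
  also have "\<dots> \<le> (\<Sum>q\<in>{q \<in> partition_seqs m. q 0 \<le> k}. c * ((fdim q)\<^sup>2 * (of_bool (B q) * ?E q)))"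
  proof (rule sum_mono)
    fix q assume "q \<in> {q \<in> partition_seqs m. q 0 \<le> k}"
    then have "hurwitz_weight l (case_nat k q) \<le> c * ((fdim q)\<^sup>2 * exp (b * total_content q))"
      unfolding c_def b_def K_def n[symmetric]
      using K by (intro hurwitz_weight_case_nat_le) (auto simp: K_def)
    then show "of_bool (real (q 0) \<le> R \<and> B q) * hurwitz_weight l (case_nat k q) \<le>
        c * ((fdim q)\<^sup>2 * (of_bool (B q) * ?E q))"
      by auto
  qed
  also have "\<dots> \<le> (\<Sum>q\<in>partition_seqs m. c * ((fdim q)\<^sup>2 * (of_bool (B q) * ?E q)))"
    using c finite_partition_seqs by (intro sum_mono2) auto
  also have "\<dots> = c * fact m * plancherel_mean m (\<lambda>q. of_bool (B q) * ?E q)"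
    unfolding plancherel_mean_def sum_distrib_left[symmetric] by simp
  also have "\<dots> \<le> c * fact m * sqrt (plancherel_prob m B *
      plancherel_mean m (\<lambda>q. of_bool (real (q 0) \<le> R) * exp (2 * b * total_content q)))"
    unfolding E_sq[symmetric] using c by (intro mult_left_mono plancherel_mean_of_bool_mult_le) simp
  also have "\<dots> \<le> c * fact m * sqrt (plancherel_prob m B * exp ((2 * b)\<^sup>2 * exp (2 * b * R) * (real m)\<^sup>2))"
    using b c R plancherel_mean_truncated_exp_total_content_le[of "2 * b" R m]
    by (intro mult_left_mono real_sqrt_le_mono plancherel_prob_nonneg) auto
  finally show ?thesis by (simp add: first_row_weight_def c_def b_def m_def K_def mult_ac)
qed

section \<open>The linear regime\<close>

definition linear_regime :: "real \<Rightarrow> nat \<Rightarrow> nat \<Rightarrow> bool" where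
  "linear_regime \<theta> n l \<longleftrightarrow> \<theta> * real n \<le> real l \<and> real l \<le> 3 * \<theta> * real n"

definition first_row_scale :: "nat \<Rightarrow> nat \<Rightarrow> real" where
  "first_row_scale n l = 2 * real l / ln (real n)"

definition regime_unit :: "real \<Rightarrow> nat \<Rightarrow> real" where
  "regime_unit \<theta> n = \<theta> * real n / ln (real n)"

definition first_row_window :: "nat \<Rightarrow> nat \<Rightarrow> nat \<Rightarrow> bool" where
  "first_row_window n l k \<longleftrightarrow> first_row_scale n l / 2 \<le> real k \<and> real k \<le> 2 * first_row_scale n l"

definition large_size :: "real \<Rightarrow> nat \<Rightarrow> bool" where
  "large_size \<theta> n \<longleftrightarrow> 1 \<le> ln (real n) \<and> 4 \<le> regime_unit \<theta> n \<and> 24 * regime_unit \<theta> n \<le> real n \<and>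
     6 * sqrt (real n) \<le> regime_unit \<theta> n \<and> 16 * real n \<le> (regime_unit \<theta> n)\<^sup>2"

lemma eventually_large_size: "0 < \<theta> \<Longrightarrow> eventually (large_size \<theta>) sequentially"
  unfolding large_size_def regime_unit_def by (intro eventually_conj; real_asymp)

lemma large_size_pos: "large_size \<theta> n \<Longrightarrow> 0 < n"
  by (cases n) (auto simp: large_size_def)

lemma first_row_scale_bounds:
  assumes "large_size \<theta> n" "linear_regime \<theta> n l"
  shows "2 * regime_unit \<theta> n \<le> first_row_scale n l" "first_row_scale n l \<le> 6 * regime_unit \<theta> n"
  using assms
  by (simp_all add: large_size_def linear_regime_def regime_unit_def first_row_scale_def
      divide_right_mono)

lemma first_row_scale_ge_8: "large_size \<theta> n \<Longrightarrow> linear_regime \<theta> n l \<Longrightarrow> 8 \<le> first_row_scale n l"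
  using first_row_scale_bounds(1)[of \<theta> n l] by (simp add: large_size_def)

lemma first_row_scale_mult_ln: "large_size \<theta> n \<Longrightarrow> first_row_scale n l * ln (real n) = 2 * real l"
  by (simp add: large_size_def first_row_scale_def)

context
  fixes \<theta> :: real and n l k :: nat
  assumes \<theta>: "0 < \<theta>" and large: "large_size \<theta> n" and regime: "linear_regime \<theta> n l"
    and window: "first_row_window n l k"
begin

lemma window_regime_unit_le: "regime_unit \<theta> n \<le> real k" "real k \<le> 12 * regime_unit \<theta> n"
  using first_row_scale_bounds[OF large regime] window by (auto simp: first_row_window_def)

lemma window_bounds: "4 \<le> k" "2 * k \<le> n" "6 * sqrt (real n) \<le> real k"
  using window_regime_unit_le large by (auto simp: large_size_def)

lemma window_first_row_content_ge:
  "(real k)\<^sup>2 / 4 \<le> first_row_content k (n - k)" "4 * real (n - k) \<le> first_row_content k (n - k)"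
  "0 < first_row_content k (n - k)"
proof -
  have content: "first_row_content k (n - k) = (real k)\<^sup>2 / 2 - real k / 2 - real (n - k)"
    by (simp add: first_row_content_def power2_eq_square right_diff_distrib diff_divide_distrib)
  have "(regime_unit \<theta> n)\<^sup>2 \<le> (real k)\<^sup>2"
    using large window_regime_unit_le(1) by (intro power_mono) (auto simp: large_size_def)
  then have unit_sq: "16 * real n \<le> (real k)\<^sup>2" using large unfolding large_size_def by linarith
  have k_sq: "4 * real k \<le> (real k)\<^sup>2"
    using mult_right_mono[of 4 "real k" "real k"] window_bounds(1) by (simp add: power2_eq_square)
  show "(real k)\<^sup>2 / 4 \<le> first_row_content k (n - k)" "4 * real (n - k) \<le> first_row_content k (n - k)"
    using unit_sq k_sq window_bounds(2) unfolding content by (auto simp: of_nat_diff)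
  have "0 < (real k)\<^sup>2 / 4" using window_bounds(1) by simp
  also have "\<dots> \<le> first_row_content k (n - k)" by fact
  finally show "0 < first_row_content k (n - k)" .
qed

lemma theta_mult_eq: "\<theta> * real n = regime_unit \<theta> n * ln (real n)"
  using large by (simp add: large_size_def regime_unit_def)

lemma window_tail_ratio_le: "real (n - k) / real k \<le> ln (real n) / \<theta>"
proof -
  have "real (n - k) / real k \<le> real n / regime_unit \<theta> n"
    using window_regime_unit_le large by (intro frac_le) (auto simp: large_size_def)
  also have "\<dots> = ln (real n) / \<theta>" using theta_mult_eq \<theta> large by (simp add: large_size_def field_simps)
  finally show ?thesis .
qed

lemma window_tail_content_ratio_le:
  "real (n - k) * real l / first_row_content k (n - k) \<le> 12 * (ln (real n))\<^sup>2 / \<theta>"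
proof -
  let ?u = "regime_unit \<theta> n"
  have u: "4 \<le> ?u" using large by (simp add: large_size_def)
  have "?u\<^sup>2 \<le> (real k)\<^sup>2" using window_regime_unit_le(1) u by (intro power_mono) auto
  then have "?u\<^sup>2 / 4 \<le> first_row_content k (n - k)" using window_first_row_content_ge(1) by linarith
  then have "real (n - k) * real l / first_row_content k (n - k) \<le>
      real n * (3 * \<theta> * real n) / (?u\<^sup>2 / 4)"
    using regime u \<theta> by (intro frac_le mult_mono) (auto simp: linear_regime_def)
  also have "\<dots> = 12 * (\<theta> * real n)\<^sup>2 / \<theta> / ?u\<^sup>2" using \<theta> by (simp add: power2_eq_square)
  also have "\<dots> = 12 * (ln (real n))\<^sup>2 / \<theta>"
    unfolding theta_mult_eq using u by (simp add: power_mult_distrib)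
  finally show ?thesis .
qed

lemma window_tilt_le:
  "2 * real l / first_row_content k (n - k) * (first_row_scale n l / 64) \<le> ln (real n) / 4"
proof -
  let ?L = "first_row_scale n l" and ?y = "ln (real n)"
  have L: "8 \<le> ?L" by (rule first_row_scale_ge_8[OF large regime])
  have "(?L / 2)\<^sup>2 \<le> (real k)\<^sup>2" using window L by (intro power_mono) (auto simp: first_row_window_def)
  then have L_sq: "?L\<^sup>2 / 16 \<le> first_row_content k (n - k)"
    using window_first_row_content_ge(1) by (simp add: power_divide)
  have "2 * real l / first_row_content k (n - k) * (?L / 64) =
      ?L\<^sup>2 * ?y / 64 / first_row_content k (n - k)"
    unfolding first_row_scale_mult_ln[OF large, symmetric] by (simp add: power2_eq_square mult_ac)
  also have "\<dots> \<le> ?L\<^sup>2 * ?y / 64 / (?L\<^sup>2 / 16)"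
    using L_sq L large window_first_row_content_ge(3)
    by (intro divide_left_mono) (auto simp: large_size_def)
  also have "\<dots> = ?y / 4" using L by simp
  finally show ?thesis .
qed

end

lemma plancherel_prob_moderate:
  "eventually (\<lambda>m. \<forall>k. 6 * sqrt (real m) \<le> real k \<longrightarrow>
     1 / 2 \<le> plancherel_prob m (\<lambda>q. 2 * q 0 \<le> k \<and> - 2 * real m \<le> total_content q)) sequentially"
proof -
  have "eventually (\<lambda>m. plancherel_prob m (far_content ((2 + 1 / 2) * sqrt (real m))) <
      1 / 4) sequentially"
    by (intro order_tendstoD(2)[OF plancherel_rare_tendsto_0] plancherel_rare_far_content) auto
  moreover have "eventually (\<lambda>m. 2 \<le> sqrt (real m)) sequentially" by real_asymp
  ultimately show ?thesis
  proof eventually_elim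
    case (elim m)
    let ?F = "far_content ((2 + 1 / 2) * sqrt (real m))"
    have "(2 * real m)\<^sup>2 * plancherel_prob m (\<lambda>q. total_content q < - 2 * real m) \<le>
        plancherel_mean m (\<lambda>q. (total_content q)\<^sup>2)"
    proof (rule plancherel_Markov)
      fix q assume "total_content q < - 2 * real m"
      then show "(2 * real m)\<^sup>2 \<le> (total_content q)\<^sup>2" by (intro abs_le_square_iff[THEN iffD1]) auto
    qed simp
    also have "\<dots> \<le> (real m)\<^sup>2"
      unfolding plancherel_mean_total_content_sq
      using mult_left_mono[of "real m - 1" "2 * real m" "real m"] by (simp add: power2_eq_square)
    finally have "(real m)\<^sup>2 * (4 * plancherel_prob m (\<lambda>q. total_content q < - 2 * real m)) \<le>
        (real m)\<^sup>2 * 1"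
      by (simp add: power_mult_distrib mult.left_commute)
    moreover have "0 < (real m)\<^sup>2" using elim(2) by (cases "m = 0") auto
    ultimately have content: "plancherel_prob m (\<lambda>q. total_content q < - 2 * real m) \<le> 1 / 4"
      unfolding mult_le_cancel_left_pos[OF \<open>0 < (real m)\<^sup>2\<close>] by simp
    have "1 / 2 \<le> plancherel_prob m (\<lambda>q. \<not> (?F q \<or> total_content q < - 2 * real m))"
      unfolding plancherel_prob_not
      using plancherel_prob_disj_le[of m ?F "\<lambda>q. total_content q < - 2 * real m"] content elim(1)
      by linarith
    also have "\<dots> \<le> plancherel_prob m (\<lambda>q. 2 * q 0 \<le> k \<and> - 2 * real m \<le> total_content q)"
      if "6 * sqrt (real m) \<le> real k" for k
    proof (rule plancherel_prob_mono)
      fix q assume q: "\<not> (?F q \<or> total_content q < - 2 * real m)"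
      then have "real (q 0) < (2 + 1 / 2) * sqrt (real m) + 1"
        by (intro not_far_content_first_row) auto
      then have "2 * real (q 0) < 5 * sqrt (real m) + 2" by simp
      then have "2 * real (q 0) \<le> real k" using that elim(2) by linarith
      then show "2 * q 0 \<le> k \<and> - 2 * real m \<le> total_content q" using q by auto
    qed
    finally show ?case by blast
  qed
qed

lemma eventually_sequentially_half:
  assumes "eventually P sequentially"
  shows "eventually (\<lambda>n. \<forall>m. n \<le> 2 * m \<longrightarrow> P m) sequentially"
proof -
  obtain N where "\<And>m. N \<le> m \<Longrightarrow> P m" using assms by (auto simp: eventually_sequentially)
  then show ?thesis unfolding eventually_sequentially by (intro exI[of _ "2 * N"]) auto
qed

definition first_row_loss :: "real \<Rightarrow> nat \<Rightarrow> real" where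
  "first_row_loss \<theta> n = 1 + 4 * (ln (real n) / \<theta>) + 4 * (12 * (ln (real n))\<^sup>2 / \<theta>)"

lemma event_weight_first_row_window_ge:
  assumes \<theta>: "0 < \<theta>"
  shows "eventually (\<lambda>n. \<forall>l k. linear_regime \<theta> n l \<longrightarrow> first_row_window n l k \<longrightarrow>
    first_row_weight n l k * exp (- first_row_loss \<theta> n) \<le> event_weight n l (\<lambda>p. p 0 = k)) sequentially"
  using eventually_large_size[OF \<theta>] eventually_sequentially_half[OF plancherel_prob_moderate]
proof eventually_elim
  case (elim n)
  show ?case
  proof (intro allI impI)
    fix l k assume "linear_regime \<theta> n l" "first_row_window n l k"
    note window = \<theta> elim(1) this
    note bounds = window_bounds[OF window] window_first_row_content_ge[OF window]
    have "6 * sqrt (real (n - k)) \<le> real k" using bounds(3) by (rule order_trans[rotated]) simp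
    then have mass: "1 / 2 \<le>
        plancherel_prob (n - k) (\<lambda>q. 2 * q 0 \<le> k \<and> - 2 * real (n - k) \<le> total_content q)"
      using elim(2)[rule_format, of "n - k" k] bounds(2) by simp
    have "first_row_weight n l k * exp (- first_row_loss \<theta> n) \<le> first_row_weight n l k *
        exp (- 1 - 4 * real (n - k) / real k - 4 * real (n - k) * real l / first_row_content k (n - k))"
    proof (rule mult_left_mono)
      show "exp (- first_row_loss \<theta> n) \<le>
          exp (- 1 - 4 * real (n - k) / real k - 4 * real (n - k) * real l / first_row_content k (n - k))"
        using window_tail_ratio_le[OF window] window_tail_content_ratio_le[OF window]
        by (simp add: first_row_loss_def del: of_nat_diff)
      show "0 \<le> first_row_weight n l k" using bounds(6) by (simp add: first_row_weight_def)
    qed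
    also have "\<dots> \<le> event_weight n l (\<lambda>p. p 0 = k)"
      using bounds mass by (intro event_weight_first_row_ge) auto
    finally show "first_row_weight n l k * exp (- first_row_loss \<theta> n) \<le>
        event_weight n l (\<lambda>p. p 0 = k)" .
  qed
qed

definition tilt_exponent :: "real \<Rightarrow> nat \<Rightarrow> real" where
  "tilt_exponent \<theta> n = 4 * (12 * (ln (real n))\<^sup>2 / \<theta>)\<^sup>2 * exp (ln (real n) / 4)"

lemma event_weight_first_row_window_le:
  assumes window: "0 < \<theta>" "large_size \<theta> n" "linear_regime \<theta> n l" "first_row_window n l k"
    and c: "0 \<le> c" and rare: "plancherel_prob (n - k) B \<le> exp (- c * sqrt (real (n - k)))"
  shows "event_weight n l (\<lambda>p. p 0 = k \<and> real (p 1) \<le> first_row_scale n l / 64 \<and> B (p \<circ> Suc)) \<le>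
    first_row_weight n l k * exp (tilt_exponent \<theta> n / 2 - c / 4 * sqrt (real n))"
proof -
  let ?m = "n - k" and ?K = "first_row_content k (n - k)" and ?R = "first_row_scale n l / 64"
  note bounds = window_bounds[OF window] window_first_row_content_ge[OF window]
  define E where "E = (2 * real l / ?K)\<^sup>2 * exp (2 * real l / ?K * ?R) * (real ?m)\<^sup>2"
  have "E = 4 * (real ?m * real l / ?K)\<^sup>2 * exp (2 * real l / ?K * ?R)"
    by (simp add: E_def power_mult_distrib power_divide)
  also have "\<dots> \<le> tilt_exponent \<theta> n"
    unfolding tilt_exponent_def
    using window_tail_content_ratio_le[OF window] window_tilt_le[OF window] bounds
    by (intro mult_mono power_mono) auto
  finally have E: "E \<le> tilt_exponent \<theta> n" .
  have "sqrt (real n / 4) \<le> sqrt (real ?m)"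
    using bounds by (intro real_sqrt_le_mono) (simp add: of_nat_diff)
  then have "c * (sqrt (real n) / 2) \<le> c * sqrt (real ?m)"
    using c by (intro mult_left_mono) (auto simp: real_sqrt_divide)
  then have exponent: "(E - c * sqrt (real ?m)) / 2 \<le> tilt_exponent \<theta> n / 2 - c / 4 * sqrt (real n)"
    using E by (simp add: field_simps)
  have "plancherel_prob ?m B * exp E \<le> exp (- c * sqrt (real ?m)) * exp E"
    using rare by (intro mult_right_mono) auto
  also have "\<dots> = (exp ((E - c * sqrt (real ?m)) / 2))\<^sup>2"
    by (simp add: exp_double[symmetric] exp_add[symmetric])
  finally have "sqrt (plancherel_prob ?m B * exp E) \<le> exp ((E - c * sqrt (real ?m)) / 2)"
    by (intro real_le_lsqrt) simp_all
  also have "\<dots> \<le> exp (tilt_exponent \<theta> n / 2 - c / 4 * sqrt (real n))" using exponent by simp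
  finally have "first_row_weight n l k * sqrt (plancherel_prob ?m B * exp E) \<le>
      first_row_weight n l k * exp (tilt_exponent \<theta> n / 2 - c / 4 * sqrt (real n))"
    using bounds by (intro mult_left_mono) (auto simp: first_row_weight_def)
  moreover have "event_weight n l (\<lambda>p. p 0 = k \<and> real (p 1) \<le> ?R \<and> B (p \<circ> Suc)) \<le>
      first_row_weight n l k * sqrt (plancherel_prob ?m B * exp E)"
    unfolding E_def
    using bounds first_row_scale_ge_8[OF window(2,3)] by (intro event_weight_first_row_le) auto
  ultimately show ?thesis by (rule order_trans[rotated])
qed

lemma event_weight_first_row_window_rare_le:
  assumes window: "0 < \<theta>" "large_size \<theta> n" "linear_regime \<theta> n l" "first_row_window n l k"
    and c: "0 \<le> c" and rare: "plancherel_prob (n - k) B \<le> exp (- c * sqrt (real (n - k)))"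
    and loss: "tilt_exponent \<theta> n / 2 + first_row_loss \<theta> n \<le> c / 8 * sqrt (real n)"
    and lower: "first_row_weight n l k * exp (- first_row_loss \<theta> n) \<le> event_weight n l (\<lambda>p. p 0 = k)"
  shows "event_weight n l (\<lambda>p. p 0 = k \<and> real (p 1) \<le> first_row_scale n l / 64 \<and> B (p \<circ> Suc)) \<le>
    exp (- (c / 8) * sqrt (real n)) * event_weight n l (\<lambda>p. p 0 = k)"
proof -
  have "event_weight n l (\<lambda>p. p 0 = k \<and> real (p 1) \<le> first_row_scale n l / 64 \<and> B (p \<circ> Suc)) \<le>
      first_row_weight n l k * exp (tilt_exponent \<theta> n / 2 - c / 4 * sqrt (real n))"
    by (rule event_weight_first_row_window_le[OF window c rare])
  also have "\<dots> \<le> first_row_weight n l k * exp (- (c / 8) * sqrt (real n) - first_row_loss \<theta> n)"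
    using loss window_first_row_content_ge(3)[OF window]
    by (intro mult_left_mono) (simp_all add: first_row_weight_def)
  also have "\<dots> = exp (- (c / 8) * sqrt (real n)) * (first_row_weight n l k * exp (- first_row_loss \<theta> n))"
    unfolding diff_conv_add_uminus exp_add by (simp only: mult_ac)
  also have "\<dots> \<le> exp (- (c / 8) * sqrt (real n)) * event_weight n l (\<lambda>p. p 0 = k)"
    using lower by (rule mult_left_mono) simp
  finally show ?thesis .
qed

text \<open>For every fixed first row of the right order, the law of the remaining rows and the
  Plancherel measure differ by a factor that is subexponential in \<open>sqrt n\<close>.\<close>

theorem event_weight_rare_tail_le:
  assumes \<theta>: "0 < \<theta>" and "plancherel_rare B"
  obtains c where "0 < c" "eventually (\<lambda>n. \<forall>l. linear_regime \<theta> n l \<longrightarrow>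
    event_weight n l (\<lambda>p. first_row_window n l (p 0) \<and> real (p 1) \<le> first_row_scale n l / 64 \<and>
        B (n - p 0) (p \<circ> Suc))
     \<le> exp (- c * sqrt (real n)) * event_weight n l (\<lambda>_. True)) sequentially"
proof -
  obtain c where c: "0 < c"
    and rare: "eventually (\<lambda>m. plancherel_prob m (B m) \<le> exp (- c * sqrt (real m))) sequentially"
    using assms(2) by (auto simp: plancherel_rare_def)
  have "eventually (\<lambda>n. tilt_exponent \<theta> n / 2 + first_row_loss \<theta> n \<le> c / 8 * sqrt (real n)) sequentially"
    unfolding tilt_exponent_def first_row_loss_def using \<theta> c by real_asymp
  then have "eventually (\<lambda>n. \<forall>l. linear_regime \<theta> n l \<longrightarrow>
    event_weight n l (\<lambda>p. first_row_window n l (p 0) \<and> real (p 1) \<le> first_row_scale n l / 64 \<and>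
        B (n - p 0) (p \<circ> Suc))
     \<le> exp (- (c / 8) * sqrt (real n)) * event_weight n l (\<lambda>_. True)) sequentially"
    using eventually_large_size[OF \<theta>] event_weight_first_row_window_ge[OF \<theta>]
      eventually_sequentially_half[OF rare]
  proof eventually_elim
    case (elim n)
    show ?case
    proof (intro allI impI)
      fix l assume l: "linear_regime \<theta> n l"
      let ?P = "\<lambda>p. first_row_window n l (p 0) \<and> real (p 1) \<le> first_row_scale n l / 64 \<and>
          B (n - p 0) (p \<circ> Suc)"
      have row: "event_weight n l (\<lambda>p. p 0 = k \<and> ?P p) \<le>
          exp (- (c / 8) * sqrt (real n)) * event_weight n l (\<lambda>p. p 0 = k)" for k
      proof (cases "first_row_window n l k")
        case True
        note window = \<theta> elim(2) l True
        have "event_weight n l (\<lambda>p. p 0 = k \<and> ?P p) \<le>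
            event_weight n l (\<lambda>p. p 0 = k \<and> real (p 1) \<le> first_row_scale n l / 64 \<and> B (n - k) (p \<circ> Suc))"
          by (rule event_weight_mono) auto
        also have "\<dots> \<le> exp (- (c / 8) * sqrt (real n)) * event_weight n l (\<lambda>p. p 0 = k)"
          using c l True elim(1,3) elim(4)[rule_format, of "n - k"] window_bounds(2)[OF window]
          by (intro event_weight_first_row_window_rare_le[OF window]) simp_all
        finally show ?thesis .
      next
        case False
        then have "event_weight n l (\<lambda>p. p 0 = k \<and> ?P p) = 0"
          unfolding event_weight_def by (intro sum.neutral) auto
        then show ?thesis by (simp add: event_weight_nonneg)
      qed
      have "event_weight n l ?P = (\<Sum>k\<le>n. event_weight n l (\<lambda>p. p 0 = k \<and> ?P p))"
        by (rule event_weight_sum_first_row)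
      also have "\<dots> \<le> (\<Sum>k\<le>n. exp (- (c / 8) * sqrt (real n)) * event_weight n l (\<lambda>p. p 0 = k))"
        by (intro sum_mono row)
      also have "\<dots> = exp (- (c / 8) * sqrt (real n)) * event_weight n l (\<lambda>_. True)"
        unfolding event_weight_sum_first_row[of n l "\<lambda>_. True"] sum_distrib_left by simp
      finally show "event_weight n l ?P \<le>
          exp (- (c / 8) * sqrt (real n)) * event_weight n l (\<lambda>_. True)" .
    qed
  qed
  then show ?thesis using c by (intro that[of "c / 8"]) auto
qed

section \<open>Concentration of the first row\<close>

lemma sqrt_minus_one_sq_le:
  fixes v :: real
  assumes "0 < v"
  shows "(sqrt v - 1)\<^sup>2 \<le> v - 1 - ln v"
proof -
  have "ln v = 2 * ln (sqrt v)" using assms by (simp add: ln_sqrt)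
  also have "\<dots> \<le> 2 * (sqrt v - 1)" using assms by (intro mult_left_mono ln_le_minus_one) auto
  finally show ?thesis using assms by (simp add: power2_diff)
qed

lemma near_one_if_log_deficit_le:
  fixes v t :: real
  assumes "0 < v" "0 \<le> t" "t \<le> 1 / 4" "v - 1 - ln v \<le> (2 * t)\<^sup>2"
  shows "1 - 4 * t \<le> v" "v \<le> 1 + 5 * t"
proof -
  have "\<bar>sqrt v - 1\<bar> \<le> \<bar>2 * t\<bar>"
    by (rule abs_le_square_iff[THEN iffD2]) (use sqrt_minus_one_sq_le[OF assms(1)] assms(4)
        in linarith)
  then have sqrt_v: "1 - 2 * t \<le> sqrt v" "sqrt v \<le> 1 + 2 * t" using assms(2) by auto
  have "(1 - 2 * t)\<^sup>2 \<le> (sqrt v)\<^sup>2" using sqrt_v assms by (intro power_mono) auto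
  then show "1 - 4 * t \<le> v" using assms(1)
    by (simp add: power2_diff power_mult_distrib) (use zero_le_power2[of t] in linarith)
  have "(sqrt v)\<^sup>2 \<le> (1 + 2 * t)\<^sup>2" using sqrt_v assms(1) by (intro power_mono) auto
  moreover have "4 * t\<^sup>2 \<le> t" using mult_right_mono[OF assms(3,2)] by (simp add: power2_eq_square)
  ultimately show "v \<le> 1 + 5 * t" using assms(1) by (simp add: power2_sum power_mult_distrib)
qed

text \<open>If the large rows are \<open>a\<^sub>i L\<close>, the weight is \<open>exp (l (- 2 \<Sum> a\<^sub>i + ln \<Sum> a\<^sub>i\<^sup>2))\<close> up to a
  common factor. As \<open>\<Sum> a\<^sub>i\<^sup>2 \<le> a\<^sub>1 \<Sum> a\<^sub>i\<close>, the exponent stays below \<open>- 2\<close> times \<open>l\<close>, with equality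
  only for a single row \<open>a\<^sub>1 = 1\<close>. Here \<open>b = \<Sum> a\<^sub>i\<close>, \<open>b1 = a\<^sub>1\<close> and \<open>\<delta>\<close> accounts for the small
  rows.\<close>

lemma entropy_maximiser_stable:
  fixes t \<delta> b b1 r :: real
  assumes t: "0 < t" "t \<le> 1 / 100" and \<delta>: "\<delta> \<le> (t\<^sup>2)\<^sup>2"
    and b1: "0 \<le> b1" "b1 \<le> b" and r: "0 < r" "r \<le> b1 * b + \<delta>"
    and near_max: "- 2 - 5 * t\<^sup>2 < - 2 * b + ln r"
  shows "1 - 15 * t \<le> b1" "b \<le> 1 + 6 * t"
proof -
  have s: "0 < t\<^sup>2" "t\<^sup>2 \<le> t / 100"
    using t mult_left_mono[OF t(2), of t] by (auto simp: power2_eq_square)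
  define u where "u = sqrt r"
  have u: "0 < u" "u\<^sup>2 = r" using r by (auto simp: u_def)
  have "b1 * b \<le> b\<^sup>2" using b1 by (simp add: power2_eq_square mult_right_mono)
  moreover have "b\<^sup>2 + (t\<^sup>2)\<^sup>2 \<le> (b + t\<^sup>2)\<^sup>2" using b1 by (simp add: power2_sum)
  ultimately have "u\<^sup>2 \<le> (b + t\<^sup>2)\<^sup>2" using r(2) \<delta> unfolding u(2) by linarith
  then have u_le: "u \<le> b + t\<^sup>2" by (rule power2_le_imp_le) (use b1 in simp)
  have "ln r = 2 * ln u" using u by (simp flip: u(2) add: ln_realpow)
  then have b_le: "b \<le> 1 + 5 / 2 * t\<^sup>2 + ln u" using near_max by simp
  then have "u - 1 - ln u \<le> 4 * t\<^sup>2" using u_le s(1) by linarith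
  then have "u - 1 - ln u \<le> (2 * t)\<^sup>2" by (simp add: power_mult_distrib)
  then have u_near: "1 - 4 * t \<le> u" "u \<le> 1 + 5 * t"
    using near_one_if_log_deficit_le[of u t] u(1) t by auto
  show b_upper: "b \<le> 1 + 6 * t" using b_le ln_le_minus_one[OF u(1)] u_near(2) s t by linarith
  have "(1 - 4 * t)\<^sup>2 \<le> u\<^sup>2" using u_near(1) t by (intro power_mono) auto
  then have "1 + 16 * t\<^sup>2 - 8 * t \<le> r" unfolding u(2) by (simp add: power2_diff power_mult_distrib)
  then have "1 - 8 * t \<le> r" using s(1) by linarith
  moreover have "(t\<^sup>2)\<^sup>2 \<le> t"
    using mult_mono[of "t\<^sup>2" 1 "t\<^sup>2" t] s t by (simp add: power2_eq_square[of "t\<^sup>2"])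
  moreover have "b1 * b \<le> b1 * (1 + 6 * t)" using b_upper b1 by (intro mult_left_mono) auto
  moreover have "(1 - 15 * t) * (1 + 6 * t) \<le> 1 - 9 * t" by (simp add: algebra_simps)
  ultimately have "(1 - 15 * t) * (1 + 6 * t) \<le> b1 * (1 + 6 * t)" using r(2) \<delta> by linarith
  then show "1 - 15 * t \<le> b1" using t by (simp add: mult_le_cancel_right)
qed

lemma damped_entropy_maximiser_stable:
  fixes t \<eta> \<delta> a a1 q :: real
  assumes t: "0 < t" "t \<le> 1 / 100" and \<eta>: "0 \<le> \<eta>" "\<eta> \<le> t\<^sup>2" and \<delta>: "0 < \<delta>" "\<delta> \<le> t ^ 4"
    and a1: "0 \<le> a1" "a1 \<le> a" and q: "0 \<le> q" "q \<le> a1 * a"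
    and near_max: "- 2 - t\<^sup>2 < - 2 * (1 - \<eta>) * a + ln (q + \<delta>)"
  shows "\<bar>a1 - 1\<bar> \<le> 15 * t" "a \<le> 1 + 8 * t"
proof -
  define e where "e = 1 - \<eta>"
  have s: "0 < t\<^sup>2" "t\<^sup>2 \<le> t / 100" "t\<^sup>2 \<le> 1 / 10000"
    using t mult_left_mono[OF t(2), of t] mult_mono[OF t(2,2)] by (auto simp: power2_eq_square)
  have e: "1 / 2 \<le> e" "e \<le> 1" "1 - t\<^sup>2 \<le> e" using \<eta> s by (auto simp: e_def)
  have ln_e: "- 2 * t\<^sup>2 \<le> ln e"
  proof -
    have "exp (- 2 * t\<^sup>2) \<le> 1 - t\<^sup>2" using s by (intro exp_minus_double_le) auto
    then have "exp (- 2 * t\<^sup>2) \<le> e" using e(3) by simp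
    then show ?thesis using e(1) by (simp add: ln_ge_iff)
  qed
  have r: "0 < e\<^sup>2 * (q + \<delta>)" "e\<^sup>2 * (q + \<delta>) \<le> (e * a1) * (e * a) + (t\<^sup>2)\<^sup>2"
  proof -
    have "e\<^sup>2 * \<delta> \<le> 1 * t ^ 4" using e \<delta> by (intro mult_mono) (auto simp: power_le_one)
    moreover have "e\<^sup>2 * q \<le> e\<^sup>2 * (a1 * a)" using q by (intro mult_left_mono) auto
    ultimately show "e\<^sup>2 * (q + \<delta>) \<le> (e * a1) * (e * a) + (t\<^sup>2)\<^sup>2"
      by (simp add: power2_eq_square power4_eq_xxxx algebra_simps)
    show "0 < e\<^sup>2 * (q + \<delta>)" using e q \<delta> by (intro mult_pos_pos) auto
  qed
  have "ln (e\<^sup>2 * (q + \<delta>)) = 2 * ln e + ln (q + \<delta>)" using e q \<delta> by (simp add: ln_mult ln_realpow)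
  then have "- 2 - 5 * t\<^sup>2 < - 2 * (e * a) + ln (e\<^sup>2 * (q + \<delta>))"
    using near_max ln_e by (simp add: e_def algebra_simps)
  note stable = entropy_maximiser_stable[OF t order_refl _ _ r this]
  have ea1: "1 - 15 * t \<le> e * a1" and ea: "e * a \<le> 1 + 6 * t"
    using stable a1 e by (auto intro: mult_left_mono)
  have "(1 - t\<^sup>2) * (1 + 8 * t) = 1 + 8 * t - t\<^sup>2 - 8 * (t\<^sup>2 * t)" by (simp add: algebra_simps)
  moreover have "t\<^sup>2 * t \<le> 1 / 10000 * t" using s t by (intro mult_right_mono) auto
  ultimately have "1 + 6 * t \<le> (1 - t\<^sup>2) * (1 + 8 * t)" using s t by linarith
  also have "\<dots> \<le> e * (1 + 8 * t)" using e t by (intro mult_right_mono) auto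
  finally have "e * a \<le> e * (1 + 8 * t)" using ea by simp
  then show a: "a \<le> 1 + 8 * t" using e by (simp add: mult_le_cancel_left)
  have "e * a1 \<le> a1" using a1 e mult_right_mono[of e 1 a1] by simp
  then show "\<bar>a1 - 1\<bar> \<le> 15 * t" using ea1 a a1 t by (simp add: abs_le_iff)
qed

lemma power_mult_fact_le: "real m ^ k * fact m \<le> fact (m + k)"
proof (induction k)
  case (Suc k)
  have "real m ^ Suc k * fact m = real m * (real m ^ k * fact m)" by simp
  also have "\<dots> \<le> real (Suc (m + k)) * fact (m + k)" using Suc by (intro mult_mono) auto
  finally show ?case by simp
qed simp

lemma binomial_sq_mult_fact_ge:
  assumes k: "1 \<le> k" "2 * k \<le> n"
  shows "fact n * exp (- real k * ln (real n) - 2 * (real k)\<^sup>2 / real n) \<le>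
      (real (n choose k))\<^sup>2 * fact (n - k)"
proof -
  define m where "m = n - k"
  have n: "0 < real n" and m: "real m = real n * (1 - real k / real n)"
    using k by (auto simp: m_def field_simps)
  have "real n ^ k * exp (- 2 * (real k / real n) * real k) \<le> real m ^ k"
    using k n m by (intro power_mult_exp_le_power) (auto simp: field_simps)
  then have "real n ^ k * exp (- 2 * (real k)\<^sup>2 / real n) * fact m \<le> real m ^ k * fact m"
    by (intro mult_right_mono) (simp_all add: power2_eq_square mult.assoc)
  also have "\<dots> \<le> fact n" using power_mult_fact_le[of m k] k by (simp add: m_def)
  finally have falling: "real n ^ k * exp (- 2 * (real k)\<^sup>2 / real n) * fact m \<le> fact n" .
  have "fact k \<le> real (k ^ k)" using fact_le_power[of k, where 'a = real] by simp
  also have "\<dots> \<le> real n ^ k" using k by (simp add: power_mono)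
  finally have fact_k: "fact k \<le> real n ^ k" .
  have "exp (- real k * ln (real n) - 2 * (real k)\<^sup>2 / real n) =
      exp (- real k * ln (real n)) * exp (- 2 * (real k)\<^sup>2 / real n)"
    by (simp add: exp_add[symmetric])
  also have "exp (- real k * ln (real n)) = 1 / real n ^ k"
    using n by (simp add: exp_minus exp_of_nat_mult divide_inverse)
  finally have "fact n * exp (- real k * ln (real n) - 2 * (real k)\<^sup>2 / real n) =
      fact n * (real n ^ k * exp (- 2 * (real k)\<^sup>2 / real n) * fact m) / (real n ^ k * real n ^ k *
          fact m)"
    using n by simp
  also have "\<dots> \<le> fact n * fact n / (real n ^ k * real n ^ k * fact m)"
    using falling by (intro divide_right_mono mult_left_mono) auto
  also have "\<dots> \<le> fact n * fact n / (fact k * fact k * fact m)"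
    by (intro divide_left_mono mult_right_mono mult_mono mult_pos_pos fact_k) (use n in auto)
  also have "\<dots> = (real (n choose k))\<^sup>2 * fact m"
    using k by (simp add: binomial_fact m_def power2_eq_square)
  finally show ?thesis by (simp add: m_def)
qed

lemma first_row_content_power_ge:
  fixes L :: real and n k l :: nat
  assumes L: "8 \<le> L" "64 * real n \<le> L\<^sup>2" and k: "real k \<le> L" "L - 1 \<le> real k"
  shows "(L\<^sup>2 / 2) ^ l * exp (- 2 * ((3 * L + 2 * real n) / L\<^sup>2) * real l) \<le>
      first_row_content k (n - k) ^ l"
proof -
  define w where "w = (3 * L + 2 * real n) / L\<^sup>2"
  have L_sq: "0 < L\<^sup>2" "8 * L \<le> L\<^sup>2"
    using L mult_right_mono[OF L(1), of L] by (simp_all add: power2_eq_square)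
  show ?thesis
    unfolding w_def[symmetric]
  proof (rule power_mult_exp_le_power)
    show "0 \<le> w" using L by (simp add: w_def)
    have "3 * L + 2 * real n \<le> L\<^sup>2 / 2" using L_sq L by linarith
    then show "w \<le> 1 / 2" using L_sq by (simp add: w_def field_simps)
    have "L\<^sup>2 / 2 * (1 - w) = L\<^sup>2 / 2 - (3 * L + 2 * real n) / 2"
      using L_sq(1) by (simp add: w_def right_diff_distrib)
    also have "\<dots> \<le> (L - 1)\<^sup>2 / 2 - L / 2 - real n" by (simp add: power2_diff field_simps)
    also have "\<dots> \<le> (real k)\<^sup>2 / 2 - real k / 2 - real (n - k)"
      using power_mono[OF k(2), of 2] k(1) L(1) by (intro diff_mono divide_right_mono) auto
    also have "\<dots> = first_row_content k (n - k)"
      by (simp add: first_row_content_def power2_eq_square right_diff_distrib diff_divide_distrib)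
    finally show "L\<^sup>2 / 2 * (1 - w) \<le> first_row_content k (n - k)" .
  qed simp
qed

lemma first_row_weight_at_scale_ge:
  fixes n l :: nat and \<theta> :: real
  defines "L \<equiv> first_row_scale n l" and "y \<equiv> ln (real n)"
  assumes \<theta>: "0 < \<theta>" and large: "large_size \<theta> n" and regime: "linear_regime \<theta> n l"
  shows "fact n * (L\<^sup>2 / 2) ^ l * exp (- 2 * real l - (72 * \<theta>\<^sup>2 * real n / y\<^sup>2 + (3 * y + y\<^sup>2 / \<theta>))) \<le>
    first_row_weight n l (nat \<lfloor>L\<rfloor>)"
proof -
  let ?u = "regime_unit \<theta> n"
  define k where "k = nat \<lfloor>L\<rfloor>"
  have y: "1 \<le> y" and u: "4 \<le> ?u" "16 * real n \<le> ?u\<^sup>2" "24 * ?u \<le> real n" and n: "0 < real n"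
    using large large_size_pos[OF large] by (auto simp: large_size_def y_def)
  have L: "2 * ?u \<le> L" "L \<le> 6 * ?u" "8 \<le> L" and Ly: "L * y = 2 * real l"
    using first_row_scale_bounds[OF large regime] first_row_scale_ge_8[OF large regime]
      first_row_scale_mult_ln[OF large]
    by (simp_all add: L_def y_def)
  have k: "real k \<le> L" "L - 1 \<le> real k" "1 \<le> k" using L(3) unfolding k_def by linarith+
  have k2: "2 * k \<le> n" using k(1) L(2) u(3) by linarith
  define w where "w = (3 * L + 2 * real n) / L\<^sup>2"
  have "64 * real n \<le> L\<^sup>2" using power_mono[OF L(1), of 2] u by (simp add: power_mult_distrib)
  then have content: "(L\<^sup>2 / 2) ^ l * exp (- 2 * w * real l) \<le> first_row_content k (n - k) ^ l"
    unfolding w_def using L(3) k by (intro first_row_content_power_ge) auto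
  have "2 * w * real l = w * (L * y)" by (simp add: Ly)
  also have "\<dots> = 3 * y + 2 * real n * y / L"
    using L(3) by (simp add: w_def power2_eq_square field_simps)
  also have "\<dots> \<le> 3 * y + 2 * real n * y / (2 * ?u)"
    using L u y by (intro add_left_mono divide_left_mono mult_pos_pos) auto
  also have "\<dots> = 3 * y + y\<^sup>2 / \<theta>" using n y \<theta> by (simp add: regime_unit_def y_def power2_eq_square)
  finally have loss: "2 * w * real l \<le> 3 * y + y\<^sup>2 / \<theta>" .
  have "(real k)\<^sup>2 \<le> (6 * ?u)\<^sup>2" using k(1) L(2) by (intro power_mono) auto
  then have "2 * (real k)\<^sup>2 / real n \<le> 2 * (6 * ?u)\<^sup>2 / real n"
    using n by (intro divide_right_mono) auto
  also have "\<dots> = 72 * \<theta>\<^sup>2 * real n / y\<^sup>2"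
    using n by (simp add: regime_unit_def y_def power_mult_distrib power_divide power2_eq_square)
  finally have quadratic: "2 * (real k)\<^sup>2 / real n \<le> 72 * \<theta>\<^sup>2 * real n / y\<^sup>2" .
  have linear: "real k * y \<le> 2 * real l" using mult_right_mono[OF k(1), of y] y Ly by simp
  have "fact n * (L\<^sup>2 / 2) ^ l * exp (- 2 * real l - (72 * \<theta>\<^sup>2 * real n / y\<^sup>2 + (3 * y + y\<^sup>2 / \<theta>))) \<le>
      fact n * (L\<^sup>2 / 2) ^ l * exp ((- real k * y - 2 * (real k)\<^sup>2 / real n) + - 2 * w * real l)"
  proof (rule mult_left_mono)
    show "exp (- 2 * real l - (72 * \<theta>\<^sup>2 * real n / y\<^sup>2 + (3 * y + y\<^sup>2 / \<theta>))) \<le>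
        exp ((- real k * y - 2 * (real k)\<^sup>2 / real n) + - 2 * w * real l)"
      using loss quadratic linear unfolding exp_le_cancel_iff by linarith
  qed simp
  also have "\<dots> = (fact n * exp (- real k * y - 2 * (real k)\<^sup>2 / real n)) *
      ((L\<^sup>2 / 2) ^ l * exp (- 2 * w * real l))"
    unfolding exp_add by (simp only: mult_ac)
  also have "\<dots> \<le> ((real (n choose k))\<^sup>2 * fact (n - k)) * first_row_content k (n - k) ^ l"
    using binomial_sq_mult_fact_ge[OF k(3) k2] content
    by (intro mult_mono[of "fact n * _"]) (auto simp: y_def)
  finally show ?thesis by (simp add: first_row_weight_def k_def)
qed

lemma event_weight_True_ge:
  assumes \<theta>: "0 < \<theta>" and s: "0 < s"
  shows "eventually (\<lambda>n. \<forall>l. linear_regime \<theta> n l \<longrightarrow>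
    fact n * ((first_row_scale n l)\<^sup>2 / 2) ^ l *
        exp (- 2 * real l - s * real l) \<le> event_weight n l (\<lambda>_. True)) sequentially"
proof -
  define loss where "loss y x = 72 * \<theta>\<^sup>2 * x / y\<^sup>2 + (3 * y + y\<^sup>2 / \<theta>)" for y x :: real
  have "eventually (\<lambda>n. loss (ln (real n)) (real n) + first_row_loss \<theta> n \<le> s * \<theta> * real n) sequentially"
    unfolding loss_def first_row_loss_def using \<theta> s by real_asymp
  then show ?thesis using eventually_large_size[OF \<theta>] event_weight_first_row_window_ge[OF \<theta>]
  proof eventually_elim
    case (elim n)
    show ?case
    proof (intro allI impI)
      fix l assume l: "linear_regime \<theta> n l"
      let ?L = "first_row_scale n l" and ?y = "ln (real n)"
      define k where "k = nat \<lfloor>?L\<rfloor>"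
      have "8 \<le> ?L" by (rule first_row_scale_ge_8[OF elim(2) l])
      then have "real k \<le> ?L" "?L - 1 \<le> real k" unfolding k_def by linarith+
      then have window: "first_row_window n l k" using \<open>8 \<le> ?L\<close> by (simp add: first_row_window_def)
      have "s * (\<theta> * real n) \<le> s * real l"
        using l s by (intro mult_left_mono) (auto simp: linear_regime_def)
      then have "- 2 * real l - s * real l \<le> (- 2 * real l - loss ?y (real n)) + - first_row_loss \<theta> n"
        using elim(1) by (simp add: mult.assoc)
      then have "fact n * (?L\<^sup>2 / 2) ^ l * exp (- 2 * real l - s * real l) \<le>
          fact n * (?L\<^sup>2 / 2) ^ l * exp ((- 2 * real l - loss ?y (real n)) + - first_row_loss \<theta> n)"
        by (intro mult_left_mono) auto
      also have "\<dots> = fact n * (?L\<^sup>2 / 2) ^ l * exp (- 2 * real l - loss ?y (real n)) *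
          exp (- first_row_loss \<theta> n)"
        unfolding exp_add by simp
      also have "\<dots> \<le> first_row_weight n l k * exp (- first_row_loss \<theta> n)"
        unfolding loss_def k_def by (intro mult_right_mono first_row_weight_at_scale_ge \<theta> elim l) auto
      also have "\<dots> \<le> event_weight n l (\<lambda>p. p 0 = k)" using elim(3) l window by blast
      also have "\<dots> \<le> event_weight n l (\<lambda>_. True)" by (rule event_weight_mono) simp
      finally show "fact n * (?L\<^sup>2 / 2) ^ l * exp (- 2 * real l - s * real l) \<le>
          event_weight n l (\<lambda>_. True)" .
    qed
  qed
qed

lemma fact_le_power_mult_fact: "k \<le> n \<Longrightarrow> fact n \<le> (real n ^ k * fact (n - k) :: real)"
proof -
  assume k: "k \<le> n"
  have "fact n div fact (n - k) \<le> n ^ k" by (rule fact_div_fact_le_pow[OF k])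
  moreover have "fact (n - k) dvd (fact n :: nat)" by (rule fact_dvd) simp
  ultimately have "(fact n :: nat) \<le> n ^ k * fact (n - k)" by (metis dvd_div_mult_self mult_le_mono1)
  then have "real (fact n) \<le> real (n ^ k * fact (n - k))" by (simp only: of_nat_le_iff)
  then show ?thesis by simp
qed

lemma fdim_sq_le_prod_rows:
  assumes "p \<in> partition_seqs n"
  shows "(fdim p)\<^sup>2 \<le> fact n * (\<Prod>i<r. real n ^ p i / (fact (p i))\<^sup>2)"
  using assms
proof (induction r arbitrary: p n)
  case 0
  then show ?case using fdim_sq_le_fact by simp
next
  case (Suc r)
  let ?k = "p 0" and ?q = "p \<circ> Suc" and ?row = "\<lambda>v. real n ^ v / (fact v)\<^sup>2"
  define m where "m = n - ?k"
  have q: "?q \<in> partition_seqs m" using comp_Suc_partition_seqs[OF Suc.prems] by (simp add: m_def)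
  have k: "?k \<le> n" and n: "?k + m = n"
    using partition_seqs_le[OF Suc.prems, of 0] by (simp_all add: m_def)
  have "fdim p \<le> real (n choose ?k) * fdim ?q"
    using fdim_case_nat_le[OF q, of ?k] partition_seqs_antimono[OF Suc.prems, of 0 1]
    by (simp add: case_nat_comp_Suc n)
  then have "(fdim p)\<^sup>2 \<le> (real (n choose ?k))\<^sup>2 * (fdim ?q)\<^sup>2"
    using fdim_pos[OF Suc.prems] unfolding power_mult_distrib[symmetric] by (intro power_mono) auto
  also have "\<dots> \<le> (real (n choose ?k))\<^sup>2 * (fact m * (\<Prod>i<r. real m ^ ?q i / (fact (?q i))\<^sup>2))"
    by (intro mult_left_mono Suc.IH[OF q]) auto
  also have "\<dots> \<le> (real (n choose ?k))\<^sup>2 * (fact m * (\<Prod>i<r. ?row (?q i)))"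
    by (intro mult_left_mono prod_mono conjI divide_right_mono power_mono) (auto simp: m_def)
  also have "\<dots> = (real (n choose ?k))\<^sup>2 * fact m * (\<Prod>i<r. ?row (?q i))" by simp
  also have "\<dots> \<le> fact n * ?row ?k * (\<Prod>i<r. ?row (?q i))"
  proof (intro mult_right_mono prod_nonneg)
    have "fact n * fact n / ((fact ?k)\<^sup>2 * fact m) \<le>
        fact n * (real n ^ ?k * fact m) / ((fact ?k)\<^sup>2 * fact m)"
      using fact_le_power_mult_fact[OF k]
      by (intro divide_right_mono mult_left_mono) (auto simp: m_def)
    then show "(real (n choose ?k))\<^sup>2 * fact m \<le> fact n * ?row ?k"
      using binomial_fact[OF k, where 'a = real]
      by (simp add: m_def power_divide power_mult_distrib power2_eq_square)
  qed auto
  also have "\<dots> = fact n * (\<Prod>i<Suc r. ?row (p i))"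
    by (simp add: prod.lessThan_Suc_shift del: prod.lessThan_Suc)
  finally show ?case .
qed

definition large_row_count :: "real \<Rightarrow> (nat \<Rightarrow> nat) \<Rightarrow> nat" where
  "large_row_count T p = card {i. T < real (p i)}"

definition large_row_sum :: "real \<Rightarrow> (nat \<Rightarrow> nat) \<Rightarrow> real" where
  "large_row_sum T p = (\<Sum>i<large_row_count T p. real (p i))"

definition large_row_sq_sum :: "real \<Rightarrow> (nat \<Rightarrow> nat) \<Rightarrow> real" where
  "large_row_sq_sum T p = (\<Sum>i<large_row_count T p. (real (p i))\<^sup>2)"

lemma less_large_row_count_iff:
  assumes p: "p \<in> partition_seqs n" and "0 \<le> T"
  shows "i < large_row_count T p \<longleftrightarrow> T < real (p i)"
  unfolding large_row_count_def
proof (rule less_card_downward_closed_iff)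
  show "finite {i. T < real (p i)}"
    by (rule finite_subset[of _ "{..<n}"]) (use partition_seqs_pos_imp_less[OF p] \<open>0 \<le> T\<close> in force)+
  show "T < real (p i)" if "T < real (p j)" "i \<le> j" for i j
    using that partition_seqs_antimono[OF p that(2)] by simp
qed

lemma power_div_fact_sq_le_exp:
  assumes n: "0 < n" and T: "1 \<le> T" "T \<le> real v"
  shows "real n ^ v / (fact v)\<^sup>2 \<le> exp (real v * (ln (real n) + 2 - 2 * ln T))"
proof -
  have v: "0 < real v" using T by linarith
  have "real v ^ v / fact v \<le> exp (real v)"
    using sum_power_div_fact_le_exp[of "real v" "{v}"] by simp
  then have "1 / fact v \<le> exp (real v) / real v ^ v" using v by (simp add: field_simps)
  then have "real n ^ v * (1 / fact v)\<^sup>2 \<le> real n ^ v * (exp (real v) / real v ^ v)\<^sup>2"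
    by (intro mult_left_mono power_mono) auto
  also have "\<dots> = exp (real v * ln (real n)) * (exp (real v) / exp (real v * ln (real v)))\<^sup>2"
    using n v by (simp add: exp_of_nat_mult)
  also have "\<dots> = exp (real v * (ln (real n) + 2 - 2 * ln (real v)))"
    by (simp add: exp_diff[symmetric] exp_double[symmetric] exp_add[symmetric] algebra_simps)
  also have "\<dots> \<le> exp (real v * (ln (real n) + 2 - 2 * ln T))" using T v by simp
  finally show ?thesis by (simp add: power_divide)
qed

lemma fdim_sq_le_exp_large_rows:
  assumes p: "p \<in> partition_seqs n" and n: "0 < n" and T: "1 \<le> T"
  shows "(fdim p)\<^sup>2 \<le> fact n * exp (large_row_sum T p * (ln (real n) + 2 - 2 * ln T))"
proof -
  let ?r = "large_row_count T p"
  have "(fdim p)\<^sup>2 \<le> fact n * (\<Prod>i<?r. real n ^ p i / (fact (p i))\<^sup>2)"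
    by (rule fdim_sq_le_prod_rows[OF p])
  also have "\<dots> \<le> fact n * (\<Prod>i<?r. exp (real (p i) * (ln (real n) + 2 - 2 * ln T)))"
    using less_large_row_count_iff[OF p, of T] n T
    by (intro mult_left_mono prod_mono conjI power_div_fact_sq_le_exp) auto
  also have "(\<Prod>i<?r. exp (real (p i) * (ln (real n) + 2 - 2 * ln T))) =
      exp (large_row_sum T p * (ln (real n) + 2 - 2 * ln T))"
    by (simp add: exp_sum[symmetric] large_row_sum_def sum_distrib_right)
  finally show ?thesis .
qed

lemma total_content_le_large_rows:
  assumes p: "p \<in> partition_seqs n" and T: "0 \<le> T"
  shows "total_content p \<le> (large_row_sq_sum T p + real n * T) / 2"
proof -
  let ?r = "large_row_count T p"
  have "total_content p = (\<Sum>i<n. \<Sum>j<p i. real_of_int (int j - int i))"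
    unfolding total_content_def by (rule sum_contents_eq) (use partition_seqs_eq_0[OF p] in auto)
  also have "\<dots> \<le> (\<Sum>i<n. (real (p i))\<^sup>2 / 2)"
  proof (rule sum_mono)
    fix i
    have "(\<Sum>j<p i. real_of_int (int j - int i)) \<le> (\<Sum>j<p i. real j)" by (intro sum_mono) auto
    then show "(\<Sum>j<p i. real_of_int (int j - int i)) \<le> (real (p i))\<^sup>2 / 2"
      by (simp add: sum_real_lessThan power2_eq_square right_diff_distrib)
  qed
  also have "\<dots> = (\<Sum>i<n. (real (p i))\<^sup>2) / 2" by (simp add: sum_divide_distrib)
  also have "(\<Sum>i<n. (real (p i))\<^sup>2) \<le> (\<Sum>i<n. (if i < ?r then (real (p i))\<^sup>2 else 0) + real (p i) * T)"
  proof (rule sum_mono)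
    fix i
    show "(real (p i))\<^sup>2 \<le> (if i < ?r then (real (p i))\<^sup>2 else 0) + real (p i) * T"
      using less_large_row_count_iff[OF p T, of i] T mult_left_mono[of "real (p i)" T "real (p i)"]
      by (auto simp: power2_eq_square)
  qed
  also have "\<dots> \<le> large_row_sq_sum T p + real n * T"
  proof -
    have "(\<Sum>i<n. if i < ?r then (real (p i))\<^sup>2 else 0) = (\<Sum>i\<in>{..<n} \<inter> {..<?r}. (real (p i))\<^sup>2)"
      by (simp add: sum.inter_restrict)
    also have "\<dots> \<le> large_row_sq_sum T p" unfolding large_row_sq_sum_def by (intro sum_mono2) auto
    finally have "(\<Sum>i<n. if i < ?r then (real (p i))\<^sup>2 else 0) \<le> large_row_sq_sum T p" .
    moreover have "(\<Sum>i<n. p i) = n" using p by (simp add: partition_seqs_def)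
    then have "(\<Sum>i<n. real (p i) * T) = real n * T"
      by (simp only: sum_distrib_right[symmetric] of_nat_sum[symmetric])
    ultimately show ?thesis by (simp add: sum.distrib)
  qed
  finally show ?thesis by (simp add: divide_right_mono)
qed

lemma hurwitz_weight_le:
  fixes n l :: nat
  defines "y \<equiv> ln (real n)" and "L \<equiv> first_row_scale n l"
  defines "T \<equiv> real n / y ^ 3"
  assumes p: "p \<in> partition_seqs n" and y: "1 \<le> y" and T: "1 \<le> T" and L: "0 < L"
  shows "hurwitz_weight l p \<le> fact n * (L\<^sup>2 / 2) ^ l * exp (real l *
    (- 2 * (1 - (6 * ln y + 2) / y) * (large_row_sum T p / L) +
        ln (large_row_sq_sum T p / L\<^sup>2 + real n * T / L\<^sup>2)))"
proof (cases "0 < total_content p")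
  case True
  let ?A = "large_row_sum T p" and ?Q = "large_row_sq_sum T p"
  have n: "0 < n" using T by (cases n) (auto simp: T_def)
  define z where "z = ?Q / L\<^sup>2 + real n * T / L\<^sup>2"
  have "0 \<le> ?Q" by (simp add: large_row_sq_sum_def sum_nonneg)
  then have z: "0 < z" using n T L by (auto simp: z_def intro!: add_nonneg_pos divide_pos_pos)
  have ln_n: "ln (real n) = y" by (simp add: y_def)
  have ln_T: "ln T = y - 3 * ln y" unfolding T_def using y n by (simp add: ln_div ln_realpow ln_n)
  define e where "e = 1 - (6 * ln y + 2) / y"
  have "ln (real n) + 2 - 2 * ln T = - (y * e)"
    unfolding ln_n ln_T e_def using y by (simp add: field_simps)
  then have "?A * (ln (real n) + 2 - 2 * ln T) = - e * (?A * y)" by simp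
  also have "?A * y = ?A / L * (L * y)" using L by simp
  also have "L * y = 2 * real l" using y by (simp add: L_def first_row_scale_def y_def)
  finally have exponent: "?A * (ln (real n) + 2 - 2 * ln T) = real l * (- 2 * e * (?A / L))" by simp
  have "L\<^sup>2 / 2 * z = (?Q + real n * T) / 2" using L by (simp add: z_def distrib_left)
  then have "total_content p \<le> L\<^sup>2 / 2 * z" using total_content_le_large_rows[OF p, of T] T by simp
  then have "total_content p ^ l \<le> (L\<^sup>2 / 2 * z) ^ l" using True by (intro power_mono) auto
  also have "\<dots> = (L\<^sup>2 / 2) ^ l * exp (real l * ln z)"
    unfolding power_mult_distrib[of "L\<^sup>2 / 2"] using z by (simp add: exp_of_nat_mult)
  finally have content: "total_content p ^ l \<le> (L\<^sup>2 / 2) ^ l * exp (real l * ln z)" .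
  have "hurwitz_weight l p = (fdim p)\<^sup>2 * total_content p ^ l"
    using True by (simp add: hurwitz_weight_def)
  also have "\<dots> \<le> (fact n * exp (?A * (ln (real n) + 2 - 2 * ln T))) *
      ((L\<^sup>2 / 2) ^ l * exp (real l * ln z))"
    using fdim_sq_le_exp_large_rows[OF p n T] content True by (intro mult_mono) auto
  also have "\<dots> = fact n * (L\<^sup>2 / 2) ^ l * exp (?A * (ln (real n) + 2 - 2 * ln T) + real l * ln z)"
    unfolding exp_add by (simp only: mult_ac)
  finally show ?thesis unfolding exponent distrib_left[symmetric] z_def e_def .
qed (simp add: hurwitz_weight_def)

lemma weight_exponent_le_if_first_row_atypical:
  fixes L T t \<epsilon> \<eta> \<delta> :: real
  defines "a \<equiv> \<lambda>p. large_row_sum T p / L" and "q \<equiv> \<lambda>p. large_row_sq_sum T p / L\<^sup>2"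
  assumes p: "p \<in> partition_seqs n" and T: "0 \<le> T" "T \<le> \<epsilon> * L" and L: "0 < L"
    and t: "0 < t" "t \<le> 1 / 100" "25 * t \<le> \<epsilon>" and \<eta>: "0 \<le> \<eta>" "\<eta> \<le> t\<^sup>2" and \<delta>: "0 < \<delta>" "\<delta> \<le> t ^ 4"
    and atypical: "\<epsilon> < \<bar>real (p 0) / L - 1\<bar> \<or> \<epsilon> * L < real (p 1)"
  shows "- 2 * (1 - \<eta>) * a p + ln (q p + \<delta>) \<le> - 2 - t\<^sup>2"
proof (rule ccontr)
  let ?r = "large_row_count T p"
  assume "\<not> ?thesis"
  then have near_max: "- 2 - t\<^sup>2 < - 2 * (1 - \<eta>) * a p + ln (q p + \<delta>)" by simp
  note stable = damped_entropy_maximiser_stable[OF t(1,2) \<eta> \<delta> _ _ _ _ near_max]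
  have "0 \<le> q p" by (simp add: q_def large_row_sq_sum_def sum_nonneg)
  have "0 < ?r"
  proof (rule ccontr)
    assume "\<not> 0 < ?r"
    then have "a p = 0" "q p = 0" by (simp_all add: a_def q_def large_row_sum_def large_row_sq_sum_def)
    then show False using stable(1)[of 0] t(2) by simp
  qed
  then have "real (p 0) \<le> large_row_sum T p"
    unfolding large_row_sum_def by (intro member_le_sum[of 0 "{..<?r}" "\<lambda>i. real (p i)"]) auto
  then have first_le: "real (p 0) / L \<le> a p" using L by (simp add: a_def divide_right_mono)
  have "large_row_sq_sum T p \<le> real (p 0) * large_row_sum T p"
    unfolding large_row_sq_sum_def large_row_sum_def sum_distrib_left power2_eq_square
    using partition_seqs_antimono[OF p, of 0] by (intro sum_mono mult_right_mono) auto
  then have "q p \<le> real (p 0) / L * a p"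
    using L by (simp add: q_def a_def power2_eq_square divide_right_mono)
  note near = stable[OF _ first_le \<open>0 \<le> q p\<close> this]
  then have "\<bar>real (p 0) / L - 1\<bar> \<le> \<epsilon>" using t L by auto
  then have second: "\<epsilon> * L < real (p 1)" using atypical by auto
  then have "T < real (p 1)" using T(2) by simp
  then have "1 < ?r" using less_large_row_count_iff[OF p T(1), of 1] by simp
  then have "{0, 1} \<subseteq> {..<?r}" by auto
  then have "(\<Sum>i\<in>{0, 1}. real (p i)) \<le> large_row_sum T p"
    unfolding large_row_sum_def by (intro sum_mono2) auto
  then have "real (p 0) / L + real (p 1) / L \<le> a p"
    using L by (simp add: a_def add_divide_distrib[symmetric] divide_right_mono)
  moreover have "\<epsilon> < real (p 1) / L" using second L by (simp add: field_simps)
  moreover have "1 - 15 * t \<le> real (p 0) / L" "a p \<le> 1 + 8 * t" using near L by (auto simp: abs_le_iff)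
  ultimately show False using t(1,3) by linarith
qed

lemma hurwitz_weight_le_if_first_row_atypical:
  fixes n l :: nat and t \<epsilon> \<theta> :: real
  defines "L \<equiv> first_row_scale n l" and "y \<equiv> ln (real n)"
  assumes p: "p \<in> partition_seqs n" and \<theta>: "0 < \<theta>" and large: "large_size \<theta> n"
    and regime: "linear_regime \<theta> n l"
    and t: "0 < t" "t \<le> 1 / 100" "25 * t \<le> \<epsilon>"
    and n: "1 \<le> real n / y ^ 3" "(6 * ln y + 2) / y \<le> t\<^sup>2" "1 / (4 * \<theta>\<^sup>2 * y) \<le> t ^ 4"
      "1 / (2 * \<theta> * y\<^sup>2) \<le> \<epsilon>"
    and atypical: "\<epsilon> < \<bar>real (p 0) / L - 1\<bar> \<or> \<epsilon> * L < real (p 1)"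
  shows "hurwitz_weight l p \<le> fact n * (L\<^sup>2 / 2) ^ l * exp (real l * (- 2 - t\<^sup>2))"
proof -
  define T where "T = real n / y ^ 3"
  define unit where "unit = 2 * \<theta> * real n / y"
  have y: "1 \<le> y" and n0: "0 < real n"
    using large large_size_pos[OF large] by (auto simp: large_size_def y_def)
  have "0 < 2 * \<theta> * real n" using \<theta> n0 by simp
  then have "0 < unit" unfolding unit_def using y by (intro divide_pos_pos) auto
  moreover have "unit \<le> L"
    using first_row_scale_bounds(1)[OF large regime]
    by (simp add: unit_def regime_unit_def L_def y_def)
  ultimately have unit: "0 < unit" "unit \<le> L" and L: "0 < L" by auto
  have T: "1 \<le> T" using n(1) by (simp add: T_def)
  have "T / L \<le> T / unit" using unit T L by (intro divide_left_mono) auto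
  also have "\<dots> = 1 / (2 * \<theta> * y\<^sup>2)"
    using n0 y \<theta> by (simp add: T_def unit_def power2_eq_square power3_eq_cube field_simps)
  also have "\<dots> \<le> \<epsilon>" by (rule n(4))
  finally have T_le: "T \<le> \<epsilon> * L" using L by (simp add: field_simps)
  have "unit\<^sup>2 \<le> L\<^sup>2" using unit by (intro power_mono) auto
  then have "real n * T / L\<^sup>2 \<le> real n * T / unit\<^sup>2" using T n0 unit L by (intro divide_left_mono) auto
  also have "\<dots> = 1 / (4 * \<theta>\<^sup>2 * y)"
    using n0 y \<theta>
    by (simp add: T_def unit_def power_divide power_mult_distrib power2_eq_square power3_eq_cube
        field_simps)
  also have "\<dots> \<le> t ^ 4" by (rule n(3))
  finally have \<delta>: "real n * T / L\<^sup>2 \<le> t ^ 4" .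
  have "hurwitz_weight l p \<le> fact n * (L\<^sup>2 / 2) ^ l * exp (real l *
      (- 2 * (1 - (6 * ln y + 2) / y) * (large_row_sum T p / L) +
          ln (large_row_sq_sum T p / L\<^sup>2 + real n * T / L\<^sup>2)))"
    unfolding y_def L_def T_def
    using p y T L by (intro hurwitz_weight_le) (auto simp: y_def L_def T_def)
  also have "\<dots> \<le> fact n * (L\<^sup>2 / 2) ^ l * exp (real l * (- 2 - t\<^sup>2))"
    using weight_exponent_le_if_first_row_atypical[OF p _ T_le L t _ n(2) _ \<delta> atypical] T y n0 L
    by (intro mult_left_mono) (auto intro!: mult_left_mono)
  finally show ?thesis .
qed

lemma event_weight_le_exp_mult:
  assumes "0 \<le> U" "\<And>p. p \<in> partition_seqs n \<Longrightarrow> P p \<Longrightarrow> hurwitz_weight l p \<le> U"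
  shows "event_weight n l P \<le> exp (2 * (sqrt (real n) + 1) * ln (real n + 1)) * U"
proof -
  have "event_weight n l P \<le> (\<Sum>p\<in>partition_seqs n. U)"
    unfolding event_weight_def using assms by (intro sum_mono) auto
  also have "\<dots> = real (card (partition_seqs n)) * U" by simp
  also have "\<dots> \<le> exp (2 * (sqrt (real n) + 1) * ln (real n + 1)) * U"
    using card_partition_seqs_le_exp assms(1) by (rule mult_right_mono)
  finally show ?thesis .
qed

theorem event_weight_first_row_atypical_le:
  assumes \<theta>: "0 < \<theta>" and \<epsilon>: "0 < \<epsilon>"
  shows "eventually (\<lambda>n. \<forall>l. linear_regime \<theta> n l \<longrightarrow>
    event_weight n l (\<lambda>p. \<epsilon> < \<bar>real (p 0) / first_row_scale n l - 1\<bar> \<or>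
        \<epsilon> * first_row_scale n l < real (p 1))
      \<le> exp (- sqrt (real n)) * event_weight n l (\<lambda>_. True)) sequentially"
proof -
  define t where "t = min (1 / 100) (\<epsilon> / 25)"
  have t: "0 < t" "t \<le> 1 / 100" "25 * t \<le> \<epsilon>" using \<epsilon> by (auto simp: t_def)
  have pos: "0 < t\<^sup>2" "0 < t ^ 4" using t by auto
  have "eventually (\<lambda>n. 1 \<le> real n / ln (real n) ^ 3) sequentially" by real_asymp
  moreover have "eventually (\<lambda>n. (6 * ln (ln (real n)) + 2) / ln (real n) \<le> t\<^sup>2) sequentially"
    using pos by real_asymp
  moreover have "eventually (\<lambda>n. 1 / (4 * \<theta>\<^sup>2 * ln (real n)) \<le> t ^ 4) sequentially"
    using pos \<theta> by real_asymp
  moreover have "eventually (\<lambda>n. 1 / (2 * \<theta> * (ln (real n))\<^sup>2) \<le> \<epsilon>) sequentially"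
    using \<epsilon> \<theta> by real_asymp
  moreover have "eventually (\<lambda>n. 2 * (sqrt (real n) + 1) * ln (real n + 1) - t\<^sup>2 / 2 *
      (\<theta> * real n) \<le> - sqrt (real n)) sequentially"
    using pos \<theta> by real_asymp
  ultimately show ?thesis
    using eventually_large_size[OF \<theta>] event_weight_True_ge[OF \<theta> half_gt_zero[OF pos(1)]]
  proof eventually_elim
    case (elim n)
    show ?case
    proof (intro allI impI)
      fix l assume l: "linear_regime \<theta> n l"
      let ?L = "first_row_scale n l" and ?N = "2 * (sqrt (real n) + 1) * ln (real n + 1)"
      let ?P = "\<lambda>p. \<epsilon> < \<bar>real (p 0) / ?L - 1\<bar> \<or> \<epsilon> * ?L < real (p 1)"
      define U where "U = fact n * (?L\<^sup>2 / 2) ^ l * exp (real l * (- 2 - t\<^sup>2))"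
      have "event_weight n l ?P \<le> exp ?N * U"
        unfolding U_def
        by (intro event_weight_le_exp_mult
            hurwitz_weight_le_if_first_row_atypical[OF _ \<theta> elim(6) l t elim(1-4)]) auto
      also have "\<dots> = exp (?N - t\<^sup>2 / 2 * real l) *
          (fact n * (?L\<^sup>2 / 2) ^ l * exp (- 2 * real l - t\<^sup>2 / 2 * real l))"
        unfolding U_def by (simp add: exp_add[symmetric] algebra_simps)
      also have "\<dots> \<le> exp (- sqrt (real n)) * event_weight n l (\<lambda>_. True)"
      proof (rule mult_mono)
        have "t\<^sup>2 / 2 * (\<theta> * real n) \<le> t\<^sup>2 / 2 * real l"
          using l by (intro mult_left_mono) (auto simp: linear_regime_def)
        then show "exp (?N - t\<^sup>2 / 2 * real l) \<le> exp (- sqrt (real n))"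
          using elim(5) unfolding exp_le_cancel_iff by linarith
        show "fact n * (?L\<^sup>2 / 2) ^ l * exp (- 2 * real l - t\<^sup>2 / 2 * real l) \<le>
            event_weight n l (\<lambda>_. True)"
          using elim(7) l by simp
      qed auto
      finally show "event_weight n l ?P \<le> exp (- sqrt (real n)) * event_weight n l (\<lambda>_. True)" .
    qed
  qed
qed

section \<open>Transfer to the probability measure\<close>

lemma russian_diagram_part_seq:
  "(\<Union>(i, j)\<in>young_diagram \<mu>. {(a, b). \<bar>a - (real j - real i)\<bar> + \<bar>b - (real j + real i - 1)\<bar> \<le> 1}) =
   russian_diagram (part_seq \<mu>)" (is "?U = _")
proof (intro set_eqI iffI; clarify)
  fix a b i j
  assume "(i, j) \<in> young_diagram \<mu>"
    and cell: "\<bar>a - (real j - real i)\<bar> + \<bar>b - (real j + real i - 1)\<bar> \<le> 1"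
  then obtain i' j' where "i = Suc i'" "j = Suc j'" "j' < part_seq \<mu> i'"
    unfolding young_diagram_eq diagram_boxes_def by (cases i; cases j) auto
  moreover from this have "\<bar>a - (real j' - real i')\<bar> + \<bar>b - (real j' + real i' + 1)\<bar> \<le> 1"
    using cell by (simp add: algebra_simps)
  ultimately show "(a, b) \<in> russian_diagram (part_seq \<mu>)" unfolding russian_diagram_def by blast
next
  fix a b assume "(a, b) \<in> russian_diagram (part_seq \<mu>)"
  then obtain i j where "j < part_seq \<mu> i" "\<bar>a - (real j - real i)\<bar> + \<bar>b - (real j + real i + 1)\<bar> \<le> 1"
    unfolding russian_diagram_def by blast
  then show "(a, b) \<in> ?U"
    unfolding young_diagram_eq
    by (intro UN_I[of "(Suc i, Suc j)"]) (auto simp: diagram_boxes_Suc_iff algebra_simps)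
qed

lemma russian_region_iff:
  assumes \<mu>: "\<mu> \<in> partitions m" and m: "0 < m"
  shows "(x, y) \<in> russian_region \<mu> \<longleftrightarrow>
      (x * sqrt (real m), y * sqrt (real m)) \<in> russian_diagram (part_seq \<mu>)"
proof -
  have "sum_list \<mu> = m" using \<mu> by (simp add: partitions_def)
  then have "(x, y) \<in> russian_region \<mu> \<longleftrightarrow>
      (\<exists>a b. (a, b) \<in> russian_diagram (part_seq \<mu>) \<and> x = a / sqrt (real m) \<and> y = b / sqrt (real m))"
    unfolding russian_region_def russian_diagram_part_seq by (force simp: image_iff)
  also have "\<dots> \<longleftrightarrow> (x * sqrt (real m), y * sqrt (real m)) \<in> russian_diagram (part_seq \<mu>)"
  proof
    assume "(x * sqrt (real m), y * sqrt (real m)) \<in> russian_diagram (part_seq \<mu>)"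
    then show "\<exists>a b. (a, b) \<in> russian_diagram (part_seq \<mu>) \<and> x = a / sqrt (real m) \<and>
        y = b / sqrt (real m)"
      using m by (intro exI[of _ "x * sqrt (real m)"] exI[of _ "y * sqrt (real m)"]) auto
  qed (use m in auto)
  finally show ?thesis .
qed

lemma profile_eq_scaled_profile:
  assumes \<mu>: "\<mu> \<in> partitions m" and m: "0 < m"
  shows "profile \<mu> x = scaled_profile m (part_seq \<mu>) x"
proof -
  let ?r = "sqrt (real m)" and ?p = "part_seq \<mu>"
  note p = part_seq_partition_seqs[OF \<mu>]
  have r: "0 < ?r" using m by simp
  have abs_x: "\<bar>x * ?r\<bar> / ?r = \<bar>x\<bar>" using r by (simp add: abs_mult)
  show ?thesis
    unfolding profile_def
  proof (rule cSup_eq_maximum)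
    have "russian_profile ?p (x * ?r) = \<bar>x * ?r\<bar> \<or>
        (x * ?r, scaled_profile m ?p x * ?r) \<in> russian_diagram ?p"
      using russian_profile_attained[OF p, of "x * ?r"] r by (simp add: scaled_profile_def)
    then show "scaled_profile m ?p x \<in> insert \<bar>x\<bar> {y. (x, y) \<in> russian_region \<mu>}"
      unfolding russian_region_iff[OF \<mu> m] scaled_profile_def[of m] using abs_x by auto
    fix y assume "y \<in> insert \<bar>x\<bar> {y. (x, y) \<in> russian_region \<mu>}"
    then consider (outside) "y = \<bar>x\<bar>" | (inside) "(x * ?r, y * ?r) \<in> russian_diagram ?p"
      using russian_region_iff[OF \<mu> m] by auto
    then show "y \<le> scaled_profile m ?p x"
    proof cases
      case outside
      then show ?thesis
        using divide_right_mono[OF russian_profile_ge[OF p, of "x * ?r"], of ?r] r abs_x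
        by (simp add: scaled_profile_def)
    next
      case inside
      then show ?thesis
        using russian_diagram_le_profile[OF p inside] r by (simp add: scaled_profile_def field_simps)
    qed
  qed
qed

text \<open>If \<open>A\<close> is a null set, then both sides are \<open>0\<close>.\<close>

lemma measure_uniform_measure_eq:
  assumes sets: "A \<in> sets M" "B \<in> sets M" and "emeasure M A \<noteq> \<infinity>"
  shows "measure (uniform_measure M A) B = measure M (A \<inter> B) / measure M A"
proof (cases "emeasure M A = 0")
  case True
  then have "emeasure M (A \<inter> B) = 0" using emeasure_mono[of "A \<inter> B" A M] sets by auto
  then show ?thesis using True emeasure_uniform_measure[OF sets] by (simp add: measure_def)
qed (use measure_uniform_measure[of M A B] assms in simp)

lemma measure_plancherel_hurwitz:
  fixes l n :: nat
  assumes X: "X \<subseteq> {\<mu> \<in> partitions n. 0 < content_sum \<mu>}"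
  shows "emeasure (plancherel_hurwitz n l) X \<noteq> \<infinity>"
    "measure (plancherel_hurwitz n l) X =
      (\<Sum>\<mu>\<in>X. hurwitz_weight l (part_seq \<mu>)) / (fact n * real (hurwitz_number n l))"
proof -
  let ?h = "fact n * real (hurwitz_number n l)"
  let ?f = "\<lambda>\<mu>. real (num_syt \<mu>) ^ 2 * real_of_int (content_sum \<mu>) ^ l / ?h"
  have f: "?f \<mu> = hurwitz_weight l (part_seq \<mu>) / ?h" if "\<mu> \<in> X" for \<mu>
    using that X content_sum_eq_total_content[of \<mu> n] num_syt_eq_fdim[of \<mu> n]
    by (auto simp: hurwitz_weight_def simp flip: content_sum_eq_total_content)
  have "emeasure (plancherel_hurwitz n l) X = (\<Sum>\<mu>\<in>X. ennreal (?f \<mu>))"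
    unfolding plancherel_hurwitz_def
    using X finite_partitions by (intro emeasure_point_measure_finite) auto
  also have "\<dots> = (\<Sum>\<mu>\<in>X. ennreal (hurwitz_weight l (part_seq \<mu>) / ?h))"
    using f by (intro sum.cong refl arg_cong[where f = ennreal])
  also have "\<dots> = ennreal (\<Sum>\<mu>\<in>X. hurwitz_weight l (part_seq \<mu>) / ?h)"
    by (rule sum_ennreal) (simp add: hurwitz_weight_nonneg)
  finally have "emeasure (plancherel_hurwitz n l) X =
      ennreal ((\<Sum>\<mu>\<in>X. hurwitz_weight l (part_seq \<mu>)) / ?h)"
    by (simp add: sum_divide_distrib)
  then show "emeasure (plancherel_hurwitz n l) X \<noteq> \<infinity>"
    "measure (plancherel_hurwitz n l) X = (\<Sum>\<mu>\<in>X. hurwitz_weight l (part_seq \<mu>)) / ?h"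
    by (simp_all add: measure_def sum_nonneg hurwitz_weight_nonneg)
qed

lemma sum_positive_content:
  "(\<Sum>\<mu>\<in>{\<mu> \<in> partitions n. 0 < content_sum \<mu> \<and> P (part_seq \<mu>)}. hurwitz_weight l (part_seq \<mu>)) =
      event_weight n l P"
proof -
  have "event_weight n l P =
      (\<Sum>\<mu>\<in>partitions n. of_bool (P (part_seq \<mu>)) * hurwitz_weight l (part_seq \<mu>))"
    unfolding event_weight_def part_seq_image[symmetric] by (simp add: sum.reindex[OF inj_on_part_seq])
  also have "\<dots> = (\<Sum>\<mu>\<in>{\<mu> \<in> partitions n. 0 <
      content_sum \<mu> \<and> P (part_seq \<mu>)}. hurwitz_weight l (part_seq \<mu>))"
    by (rule sum.mono_neutral_cong_right[OF finite_partitions])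
      (auto simp: hurwitz_weight_def simp flip: content_sum_eq_total_content)
  finally show ?thesis ..
qed

lemma measure_plancherel_hurwitz_pos_le:
  assumes "\<And>\<mu>. \<mu> \<in> partitions n \<Longrightarrow> P \<mu> \<Longrightarrow> Q (part_seq \<mu>)"
  shows "measure (plancherel_hurwitz_pos n l) {\<mu> \<in> space (plancherel_hurwitz_pos n l). P \<mu>} \<le>
    event_weight n l Q / event_weight n l (\<lambda>_. True)"
proof -
  let ?M = "plancherel_hurwitz n l" and ?w = "\<lambda>\<mu>. hurwitz_weight l (part_seq \<mu>)"
  let ?A = "{\<mu> \<in> partitions n. 0 < content_sum \<mu>}" and ?B = "{\<mu> \<in> partitions n. P \<mu>}"
  let ?h = "fact n * real (hurwitz_number n l)"
  have space: "space (plancherel_hurwitz_pos n l) = partitions n"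
    by (simp add: plancherel_hurwitz_pos_def plancherel_hurwitz_def space_point_measure)
  have "?A \<in> sets ?M" "?B \<in> sets ?M" by (auto simp: plancherel_hurwitz_def sets_point_measure)
  then have "measure (plancherel_hurwitz_pos n l) ?B = (sum ?w (?A \<inter> ?B) / ?h) / (sum ?w ?A / ?h)"
    unfolding plancherel_hurwitz_pos_def
    using measure_plancherel_hurwitz[of ?A n l] measure_plancherel_hurwitz[of "?A \<inter> ?B" n l]
    by (subst measure_uniform_measure_eq) auto
  also have "\<dots> \<le> sum ?w (?A \<inter> ?B) / sum ?w ?A"
    by (cases "?h = 0") (auto simp: hurwitz_weight_nonneg intro!: divide_nonneg_nonneg sum_nonneg)
  also have "sum ?w ?A = event_weight n l (\<lambda>_. True)"
    using sum_positive_content[where P = "\<lambda>_. True"] by simp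
  also have "sum ?w (?A \<inter> ?B) \<le> event_weight n l Q"
    unfolding sum_positive_content[symmetric] using assms finite_partitions
    by (intro sum_mono2 hurwitz_weight_nonneg) auto
  finally show ?thesis by (simp add: space divide_right_mono event_weight_nonneg)
qed

definition hurwitz_typical :: "real \<Rightarrow> nat \<Rightarrow> nat \<Rightarrow> (nat \<Rightarrow> nat) \<Rightarrow> bool" where
  "hurwitz_typical \<epsilon> n l p \<longleftrightarrow>
      \<bar>real (p 0) / first_row_scale n l - 1\<bar> \<le> \<epsilon> \<and> real (p 1) \<le> \<epsilon> * first_row_scale n l \<and>
     near_limit_shape \<epsilon> (n - p 0) (p \<circ> Suc)"

lemma not_hurwitz_typical_cases:
  assumes L: "0 < first_row_scale n l" and \<epsilon>: "\<epsilon> \<le> 1 / 64" and "\<not> hurwitz_typical \<epsilon> n l p"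
  shows "(\<epsilon> < \<bar>real (p 0) / first_row_scale n l - 1\<bar> \<or> \<epsilon> * first_row_scale n l < real (p 1)) \<or>
    (first_row_window n l (p 0) \<and> real (p 1) \<le> first_row_scale n l / 64 \<and>
      \<not> near_limit_shape \<epsilon> (n - p 0) (p \<circ> Suc))"
proof -
  let ?L = "first_row_scale n l"
  have "first_row_window n l (p 0)" if "\<bar>real (p 0) / ?L - 1\<bar> \<le> \<epsilon>"
  proof -
    have "1 / 2 \<le> real (p 0) / ?L" "real (p 0) / ?L \<le> 2" using that \<epsilon> by linarith+
    then show ?thesis using L by (simp add: first_row_window_def field_simps)
  qed
  moreover have "\<epsilon> * ?L \<le> 1 / 64 * ?L" using \<epsilon> L by (intro mult_right_mono) auto
  ultimately show ?thesis using assms(3) unfolding hurwitz_typical_def by force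
qed

lemma event_weight_not_hurwitz_typical_le:
  assumes \<theta>: "0 < \<theta>" and \<epsilon>: "0 < \<epsilon>" "\<epsilon> \<le> 1 / 64"
  obtains c where "0 < c" "eventually (\<lambda>n. \<forall>l. linear_regime \<theta> n l \<longrightarrow>
    event_weight n l (\<lambda>p. \<not> hurwitz_typical \<epsilon> n l p) \<le>
      (exp (- sqrt (real n)) + exp (- c * sqrt (real n))) * event_weight n l (\<lambda>_. True)) sequentially"
proof -
  have "plancherel_rare (\<lambda>m p. \<not> near_limit_shape \<epsilon> m p)"
    using \<epsilon> by (intro plancherel_rare_not_near_limit_shape) auto
  then obtain c where c: "0 < c" and tail: "eventually (\<lambda>n. \<forall>l. linear_regime \<theta> n l \<longrightarrow>
    event_weight n l (\<lambda>p. first_row_window n l (p 0) \<and> real (p 1) \<le> first_row_scale n l / 64 \<and>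
      \<not> near_limit_shape \<epsilon> (n - p 0) (p \<circ> Suc))
     \<le> exp (- c * sqrt (real n)) * event_weight n l (\<lambda>_. True)) sequentially"
    by (rule event_weight_rare_tail_le[OF \<theta>])
  have "eventually (\<lambda>n. \<forall>l. linear_regime \<theta> n l \<longrightarrow> event_weight n l (\<lambda>p. \<not> hurwitz_typical \<epsilon> n l p) \<le>
      (exp (- sqrt (real n)) + exp (- c * sqrt (real n))) * event_weight n l (\<lambda>_. True)) sequentially"
    using tail event_weight_first_row_atypical_le[OF \<theta> \<epsilon>(1)] eventually_large_size[OF \<theta>]
  proof eventually_elim
    case (elim n)
    show ?case
    proof (intro allI impI)
      fix l assume l: "linear_regime \<theta> n l"
      let ?L = "first_row_scale n l"
      let ?far = "\<lambda>p. \<epsilon> < \<bar>real (p 0) / ?L - 1\<bar> \<or> \<epsilon> * ?L < real (p 1)"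
      let ?tail = "\<lambda>p. first_row_window n l (p 0) \<and> real (p 1) \<le> ?L / 64 \<and>
          \<not> near_limit_shape \<epsilon> (n - p 0) (p \<circ> Suc)"
      have L: "0 < ?L" using first_row_scale_ge_8[OF elim(3) l] by simp
      have "event_weight n l (\<lambda>p. \<not> hurwitz_typical \<epsilon> n l p) \<le> event_weight n l (\<lambda>p. ?far p \<or> ?tail p)"
        by (intro event_weight_mono not_hurwitz_typical_cases[OF L \<epsilon>(2)])
      also have "\<dots> \<le> event_weight n l ?far + event_weight n l ?tail" by (rule event_weight_disj_le)
      also have "\<dots> \<le> exp (- sqrt (real n)) * event_weight n l (\<lambda>_. True) +
          exp (- c * sqrt (real n)) * event_weight n l (\<lambda>_. True)"
        using elim(1,2) l by (intro add_mono) blast+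
      finally show "event_weight n l (\<lambda>p. \<not> hurwitz_typical \<epsilon> n l p) \<le>
          (exp (- sqrt (real n)) + exp (- c * sqrt (real n))) * event_weight n l (\<lambda>_. True)"
        by (simp only: distrib_right)
    qed
  qed
  then show ?thesis using c by (rule that[rotated])
qed

lemma rescale_div_sqrt:
  assumes m: "0 < m" "m \<le> n" "(1 - h) * real n \<le> real m" and h: "0 \<le> h" "h \<le> 1"
    and z: "\<bar>z / sqrt (real m) - 2\<bar> \<le> e"
  shows "\<bar>z / sqrt (real n) - 2\<bar> \<le> e + 2 * h"
proof -
  define \<rho> where "\<rho> = sqrt (real m) / sqrt (real n)"
  have \<rho>: "0 \<le> \<rho>" "\<rho> \<le> 1" using m by (auto simp: \<rho>_def)
  have "1 - h \<le> real m / real n" using m by (simp add: pos_le_divide_eq)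
  also have "\<dots> = \<rho>\<^sup>2" by (simp add: \<rho>_def power_divide)
  also have "\<dots> \<le> \<rho>" using mult_left_mono[OF \<rho>(2,1)] by (simp add: power2_eq_square)
  finally have "\<bar>2 * (\<rho> - 1)\<bar> \<le> 2 * h" using \<rho> by (simp add: abs_le_iff)
  moreover have "\<bar>\<rho> * (z / sqrt (real m) - 2)\<bar> \<le> 1 * e"
    unfolding abs_mult using \<rho> z by (intro mult_mono) auto
  moreover have "z / sqrt (real n) - 2 = \<rho> * (z / sqrt (real m) - 2) + 2 * (\<rho> - 1)"
    using m by (simp add: \<rho>_def right_diff_distrib)
  ultimately show ?thesis
    using abs_triangle_ineq[of "\<rho> * (z / sqrt (real m) - 2)" "2 * (\<rho> - 1)"] by linarith
qed

lemma column_length_part_seq: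
  assumes "\<mu> \<in> partitions n"
  shows "column_length (part_seq \<mu>) 0 = length \<mu>"
proof -
  have "{i. 0 < part_seq \<mu> i} = {..<length \<mu>}" using part_seq_pos_iff[OF assms] by auto
  then show ?thesis by (simp add: column_length_def)
qed

context
  fixes \<theta> :: real and l :: "nat \<Rightarrow> nat"
  assumes \<theta>: "0 < \<theta>" and regime: "eventually (\<lambda>n. linear_regime \<theta> n (l n)) sequentially"
begin

lemma not_hurwitz_typical_tendsto_0:
  assumes \<epsilon>: "0 < \<epsilon>" "\<epsilon> \<le> 1 / 64"
  shows "(\<lambda>n. event_weight n (l n) (\<lambda>p. \<not> hurwitz_typical \<epsilon> n (l n) p) / event_weight n (l n) (\<lambda>_. True)) \<longlonglongrightarrow> 0"
proof -
  let ?E = "\<lambda>n. event_weight n (l n)"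
  obtain c where c: "0 < c" and bound: "eventually (\<lambda>n. \<forall>l. linear_regime \<theta> n l \<longrightarrow>
    event_weight n l (\<lambda>p. \<not> hurwitz_typical \<epsilon> n l p) \<le>
      (exp (- sqrt (real n)) + exp (- c * sqrt (real n))) * event_weight n l (\<lambda>_. True)) sequentially"
    by (rule event_weight_not_hurwitz_typical_le[OF \<theta> \<epsilon>])
  have lim: "(\<lambda>n. exp (- sqrt (real n)) + exp (- c * sqrt (real n))) \<longlonglongrightarrow> 0"
    using c by (intro tendsto_add_zero; real_asymp)
  show ?thesis
  proof (rule tendsto_sandwich[OF _ _ tendsto_const lim])
    show "eventually (\<lambda>n. 0 \<le> ?E n (\<lambda>p. \<not> hurwitz_typical \<epsilon> n (l n) p) / ?E n (\<lambda>_. True)) sequentially"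
      by (simp add: event_weight_nonneg)
    show "eventually (\<lambda>n. ?E n (\<lambda>p. \<not> hurwitz_typical \<epsilon> n (l n) p) / ?E n (\<lambda>_. True) \<le>
        exp (- sqrt (real n)) + exp (- c * sqrt (real n))) sequentially"
      using bound regime
    proof eventually_elim
      case (elim n)
      show ?case
      proof (cases "?E n (\<lambda>_. True) = 0")
        case False
        then have "0 < ?E n (\<lambda>_. True)" using event_weight_nonneg[of n "l n" "\<lambda>_. True"] by simp
        then show ?thesis using elim by (simp add: pos_divide_le_eq)
      qed (simp add: add_nonneg_nonneg)
    qed
  qed
qed

lemma tendsto_in_prob_if_hurwitz_typical:
  assumes "\<And>\<epsilon>. 0 < \<epsilon> \<Longrightarrow> \<epsilon> \<le> 1 / 64 \<Longrightarrow> eventually (\<lambda>n. \<forall>\<mu>\<in>partitions n.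
    hurwitz_typical \<epsilon> n (l n) (part_seq \<mu>) \<longrightarrow> \<bar>X n \<mu> - c\<bar> \<le> 3 * \<epsilon>) sequentially"
  shows "tendsto_in_prob (\<lambda>n. plancherel_hurwitz_pos n (l n)) X c"
  unfolding tendsto_in_prob_def
proof (intro allI impI)
  fix e :: real assume "0 < e"
  define \<epsilon> where "\<epsilon> = min (1 / 64) (e / 3)"
  have \<epsilon>: "0 < \<epsilon>" "\<epsilon> \<le> 1 / 64" "3 * \<epsilon> \<le> e" using \<open>0 < e\<close> by (auto simp: \<epsilon>_def)
  let ?P = "\<lambda>n. measure (plancherel_hurwitz_pos n (l n)) {\<omega> \<in> space (plancherel_hurwitz_pos n (l n)). e < \<bar>X n \<omega> - c\<bar>}"
  show "?P \<longlonglongrightarrow> 0"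
  proof (rule tendsto_sandwich[OF _ _ tendsto_const not_hurwitz_typical_tendsto_0[OF \<epsilon>(1,2)]])
    show "eventually (\<lambda>n. ?P n \<le> event_weight n (l n) (\<lambda>p. \<not> hurwitz_typical \<epsilon> n (l n) p) /
        event_weight n (l n) (\<lambda>_. True)) sequentially"
      using assms[OF \<epsilon>(1,2)]
    proof eventually_elim
      case (elim n)
      show ?case by (rule measure_plancherel_hurwitz_pos_le) (use elim \<epsilon>(3) in force)
    qed
  qed simp
qed

lemma hurwitz_typical_tail_size:
  assumes \<epsilon>: "0 < \<epsilon>" "\<epsilon> \<le> 1 / 64"
  shows "eventually (\<lambda>n. \<forall>p. hurwitz_typical \<epsilon> n (l n) p \<longrightarrow>
    0 < n - p 0 \<and> n \<le> 2 * (n - p 0) \<and> (1 - \<epsilon> / 4) * real n \<le> real (n - p 0)) sequentially"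
proof -
  have "eventually (\<lambda>n. 12 * \<theta> / ln (real n) \<le> \<epsilon> / 4) sequentially" using \<theta> \<epsilon> by real_asymp
  then show ?thesis using eventually_large_size[OF \<theta>] regime
  proof eventually_elim
    case (elim n)
    show ?case
    proof (intro allI impI)
      fix p assume "hurwitz_typical \<epsilon> n (l n) p"
      then have "real (p 0) / first_row_scale n (l n) \<le> 2"
        using \<epsilon> unfolding hurwitz_typical_def by linarith
      then have "real (p 0) \<le> 2 * first_row_scale n (l n)"
        using first_row_scale_ge_8[OF elim(2,3)] by (simp add: field_simps)
      also have "\<dots> \<le> 12 * \<theta> / ln (real n) * real n"
        using first_row_scale_bounds(2)[OF elim(2,3)] by (simp add: regime_unit_def)
      also have "\<dots> \<le> \<epsilon> / 4 * real n" using elim(1) by (intro mult_right_mono) auto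
      finally have first_row: "real (p 0) \<le> \<epsilon> / 4 * real n" .
      also have "\<dots> \<le> 1 / 2 * real n" using \<epsilon> by (intro mult_right_mono) auto
      finally have "2 * p 0 \<le> n" by linarith
      then show "0 < n - p 0 \<and> n \<le> 2 * (n - p 0) \<and> (1 - \<epsilon> / 4) * real n \<le> real (n - p 0)"
        using first_row large_size_pos[OF elim(2)] by (simp add: of_nat_diff left_diff_distrib)
    qed
  qed
qed

lemma tendsto_in_prob_div_sqrt:
  fixes F :: "nat list \<Rightarrow> nat"
  assumes "\<And>\<epsilon>. 0 < \<epsilon> \<Longrightarrow> \<epsilon> \<le> 1 / 64 \<Longrightarrow> eventually (\<lambda>n. \<forall>\<mu>\<in>partitions n.
    hurwitz_typical \<epsilon> n (l n) (part_seq \<mu>) \<longrightarrow> \<bar>real (F \<mu>) / sqrt (real (n - part_seq \<mu> 0)) - 2\<bar> \<le> 2 *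
        \<epsilon>) sequentially"
  shows "tendsto_in_prob (\<lambda>n. plancherel_hurwitz_pos n (l n)) (\<lambda>n \<mu>. real (F \<mu>) / sqrt (real n)) 2"
proof (rule tendsto_in_prob_if_hurwitz_typical)
  fix \<epsilon> :: real assume \<epsilon>: "0 < \<epsilon>" "\<epsilon> \<le> 1 / 64"
  show "eventually (\<lambda>n. \<forall>\<mu>\<in>partitions n. hurwitz_typical \<epsilon> n (l n) (part_seq \<mu>) \<longrightarrow>
      \<bar>real (F \<mu>) / sqrt (real n) - 2\<bar> \<le> 3 * \<epsilon>) sequentially"
    using assms[OF \<epsilon>] hurwitz_typical_tail_size[OF \<epsilon>]
  proof eventually_elim
    case (elim n)
    have "\<bar>real (F \<mu>) / sqrt (real n) - 2\<bar> \<le> 2 * \<epsilon> + 2 * (\<epsilon> / 4)"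
      if "\<mu> \<in> partitions n" "hurwitz_typical \<epsilon> n (l n) (part_seq \<mu>)" for \<mu>
      using elim that \<epsilon> by (intro rescale_div_sqrt[of "n - part_seq \<mu> 0"]) auto
    then show ?case using \<epsilon> by fastforce
  qed
qed

lemma tendsto_in_prob_first_row:
  "tendsto_in_prob (\<lambda>n. plancherel_hurwitz_pos n (l n))
     (\<lambda>n \<mu>. real (nth_part \<mu> 1) * inverse (2 * real (l n) / ln (real n))) 1"
proof (rule tendsto_in_prob_if_hurwitz_typical, intro always_eventually allI ballI impI)
  fix \<epsilon> :: real and n \<mu> assume "0 < \<epsilon>" "hurwitz_typical \<epsilon> n (l n) (part_seq \<mu>)"
  then show "\<bar>real (nth_part \<mu> 1) * inverse (2 * real (l n) / ln (real n)) - 1\<bar> \<le> 3 * \<epsilon>"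
    by (simp add: hurwitz_typical_def first_row_scale_def nth_part_def part_seq_def)
qed

lemma tendsto_in_prob_tail_profile:
  "tendsto_in_prob (\<lambda>n. plancherel_hurwitz_pos n (l n)) (\<lambda>n \<mu>. SUP x. \<bar>profile (tl \<mu>) x - limit_shape x\<bar>) 0"
proof (rule tendsto_in_prob_if_hurwitz_typical)
  fix \<epsilon> :: real assume \<epsilon>: "0 < \<epsilon>" "\<epsilon> \<le> 1 / 64"
  show "eventually (\<lambda>n. \<forall>\<mu>\<in>partitions n. hurwitz_typical \<epsilon> n (l n) (part_seq \<mu>) \<longrightarrow>
      \<bar>(SUP x. \<bar>profile (tl \<mu>) x - limit_shape x\<bar>) - 0\<bar> \<le> 3 * \<epsilon>) sequentially"
    using hurwitz_typical_tail_size[OF \<epsilon>]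
  proof (eventually_elim, intro ballI impI)
    fix n \<mu>
    assume size: "\<forall>p. hurwitz_typical \<epsilon> n (l n) p \<longrightarrow>
        0 < n - p 0 \<and> n \<le> 2 * (n - p 0) \<and> (1 - \<epsilon> / 4) * real n \<le> real (n - p 0)"
      and \<mu>: "\<mu> \<in> partitions n" and typical: "hurwitz_typical \<epsilon> n (l n) (part_seq \<mu>)"
    let ?d = "\<lambda>x. \<bar>profile (tl \<mu>) x - limit_shape x\<bar>"
    have close: "?d x \<le> \<epsilon>" for x
      using typical size profile_eq_scaled_profile[OF tl_partitions[OF \<mu>], of x]
      by (simp add: hurwitz_typical_def near_limit_shape_def part_seq_tl)
    have "(SUP x. ?d x) \<le> \<epsilon>" by (rule cSUP_least) (use close in auto)
    moreover have "?d 0 \<le> (SUP x. ?d x)"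
      by (rule cSUP_upper) (use close in \<open>auto intro!: bdd_aboveI[of _ \<epsilon>]\<close>)
    ultimately show "\<bar>(SUP x. ?d x) - 0\<bar> \<le> 3 * \<epsilon>" using \<epsilon> by linarith
  qed
qed

lemma tendsto_in_prob_second_row:
  "tendsto_in_prob (\<lambda>n. plancherel_hurwitz_pos n (l n)) (\<lambda>n \<mu>. real (nth_part \<mu> 2) / sqrt (real n)) 2"
proof (rule tendsto_in_prob_div_sqrt, intro always_eventually allI ballI impI)
  fix \<epsilon> :: real and n \<mu> assume "0 < \<epsilon>" "hurwitz_typical \<epsilon> n (l n) (part_seq \<mu>)"
  then show "\<bar>real (nth_part \<mu> 2) / sqrt (real (n - part_seq \<mu> 0)) - 2\<bar> \<le> 2 * \<epsilon>"
    by (simp add: hurwitz_typical_def near_limit_shape_def nth_part_def part_seq_def)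
qed

lemma tendsto_in_prob_length:
  "tendsto_in_prob (\<lambda>n. plancherel_hurwitz_pos n (l n)) (\<lambda>n \<mu>. real (length \<mu>) / sqrt (real n)) 2"
proof (rule tendsto_in_prob_div_sqrt)
  fix \<epsilon> :: real assume \<epsilon>: "0 < \<epsilon>" "\<epsilon> \<le> 1 / 64"
  have "eventually (\<lambda>n. 1 / sqrt (real n / 2) \<le> \<epsilon>) sequentially" using \<epsilon> by real_asymp
  then show "eventually (\<lambda>n. \<forall>\<mu>\<in>partitions n. hurwitz_typical \<epsilon> n (l n) (part_seq \<mu>) \<longrightarrow>
      \<bar>real (length \<mu>) / sqrt (real (n - part_seq \<mu> 0)) - 2\<bar> \<le> 2 * \<epsilon>) sequentially"
    using hurwitz_typical_tail_size[OF \<epsilon>] eventually_gt_at_top[of 0]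
  proof eventually_elim
    case (elim n)
    show ?case
    proof (intro ballI impI)
      fix \<mu> assume \<mu>: "\<mu> \<in> partitions n" and typical: "hurwitz_typical \<epsilon> n (l n) (part_seq \<mu>)"
      let ?m = "n - part_seq \<mu> 0"
      have m: "0 < ?m" "n \<le> 2 * ?m" using elim(2) typical by blast+
      have "1 / sqrt (real ?m) \<le> 1 / sqrt (real n / 2)"
        using m elim(3) by (intro divide_left_mono real_sqrt_le_mono mult_pos_pos) auto
      then have small: "1 / sqrt (real ?m) \<le> \<epsilon>" using elim(1) by linarith
      have "length \<mu> = length (tl \<mu>) + 1" using \<mu> elim(3) by (cases \<mu>) (auto simp: partitions_def)
      then have "real (length \<mu>) / sqrt (real ?m) =
          real (column_length (part_seq (tl \<mu>)) 0) / sqrt (real ?m) + 1 / sqrt (real ?m)"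
        by (simp add: column_length_part_seq[OF tl_partitions[OF \<mu>]] add_divide_distrib[symmetric]
            del: length_tl)
      moreover have "\<bar>real (column_length (part_seq (tl \<mu>)) 0) / sqrt (real ?m) - 2\<bar> \<le> \<epsilon>"
        using typical by (simp add: hurwitz_typical_def near_limit_shape_def part_seq_tl)
      moreover have "0 \<le> 1 / sqrt (real ?m)" by simp
      ultimately show "\<bar>real (length \<mu>) / sqrt (real ?m) - 2\<bar> \<le> 2 * \<epsilon>" using small \<epsilon> by linarith
    qed
  qed
qed

end

lemma linear_regime_if_asymp_equiv:
  assumes \<theta>: "0 < \<theta>" and l: "(\<lambda>n. real (l n)) \<sim>[at_top] (\<lambda>n. 2 * \<theta> * real n)"
  shows "eventually (\<lambda>n. linear_regime \<theta> n (l n)) sequentially"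
proof -
  have "((\<lambda>n. real (l n) / (2 * \<theta> * real n)) \<longlongrightarrow> 1) at_top"
    using l
    by (rule asymp_equivD_strong)
      (use \<theta> in \<open>auto simp: eventually_at_top_linorder intro!: exI[of _ 1]\<close>)
  from order_tendstoD(1)[OF this, of "1 / 2"] order_tendstoD(2)[OF this, of "3 / 2"]
  have "eventually (\<lambda>n. 1 / 2 < real (l n) / (2 * \<theta> * real n)) sequentially"
    "eventually (\<lambda>n. real (l n) / (2 * \<theta> * real n) < 3 / 2) sequentially" by simp_all
  then show ?thesis
    using eventually_gt_at_top[of 0]
    by eventually_elim (use \<theta> in \<open>simp add: linear_regime_def field_simps\<close>)
qed

theorem theorem1p2:
  fixes \<theta> :: real and l :: "nat \<Rightarrow> nat"
  assumes "\<theta> > 0"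
    and "\<And>n. n \<ge> 1 \<Longrightarrow> even (l n)"
    and "(\<lambda>n. real (l n)) \<sim>[at_top] (\<lambda>n. 2 * \<theta> * real n)"
  shows
    "tendsto_in_prob (\<lambda>n. plancherel_hurwitz_pos n (l n))
       (\<lambda>n \<mu>. real (nth_part \<mu> 1) * inverse (2 * real (l n) / ln (real n))) 1
     \<and> tendsto_in_prob (\<lambda>n. plancherel_hurwitz_pos n (l n))
       (\<lambda>n \<mu>. SUP x. \<bar>profile (tl \<mu>) x - limit_shape x\<bar>) 0
     \<and> tendsto_in_prob (\<lambda>n. plancherel_hurwitz_pos n (l n))
       (\<lambda>n \<mu>. real (nth_part \<mu> 2) / sqrt (real n)) 2
     \<and> tendsto_in_prob (\<lambda>n. plancherel_hurwitz_pos n (l n))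
       (\<lambda>n \<mu>. real (length \<mu>) / sqrt (real n)) 2"
proof -
  note regime = assms(1) linear_regime_if_asymp_equiv[OF assms(1,3)]
  show ?thesis
    using tendsto_in_prob_first_row[OF regime] tendsto_in_prob_tail_profile[OF regime]
      tendsto_in_prob_second_row[OF regime] tendsto_in_prob_length[OF regime] by blast
qed

end
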